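(* Let $k$ be a field, $V$ a finite-dimensional $k$-vector space and $H\subset G$ two nested finite subgroups of $GL(V)$. Assume $k[V]^G$ is a polynomial algebra, and let $C=\langle c\rangle$ be the cyclic subgroup generated by a regular element $c$ in $G$, with eigenvalue $\zeta\in k^\times$ on some regular vector in $V$, and let $\hat\zeta\in\mathbb{C}$ be a complex lift of $\zeta$. Let $\Gamma:=N_G(H)/H$, where $N_G(H)$ is the normalizer of $H$ in $G$. Give $k[V]^H$ the structure of a $(k(\Gamma),k(C))$-bimodule in which $c$ scales the variables $x_1,\dots,x_n$ in $V^*$ by $\zeta$, and $\Gamma$ acts by linear substitutions. Let $k(H\backslash G)$ be the $k$-vector space with basis the right cosets of $H$ in $G$, regarded as a $(k(\Gamma),k(C))$-bimodule where $$\gamma\cdot Hg\cdot c:=\gamma Hgc=H\gamma gc.$$ Then in $\mathbf{R}(k(\Gamma\times C))$ one has the equality $$\sum_{i\geq 0}(-1)^i\sum_{j\geq 0}\left[\operatorname{Tor}_i^{k[V]^G}(k[V]^H,k)_j\right]=\left[k(H\backslash G)\right].$$ Ignoring the $\Gamma$-action, this implies that the quotient of Hilbert series $$X(t):=\frac{[k[V]^H](t)}{[k[V]^G](t)}$$ is a polynomial in $t$ and, together with the $C$-action on the set $X=H\backslash G$, gives a triple $(X,X(t),C)$ that exhibits the cyclic sieving phenomenon: for each element $c^j$ in $C$, the cardinality of the fixed point set $X^{c^j}\subset X$ is given by evaluating $X(t)$ at the complex root of unity $\hat\zeta^j$, of the same multiplicative order as $c^j$, i.e. $$|X^{c^j}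|=\left[X(t)\right]_{t=\hat\zeta^j}.$$
   Context: $k(\Gamma)$ denotes the group algebra. $k[V]$ is the graded algebra of polynomial functions on $V$, with $G$ acting by $(gf)(w)=f(g^{-1}w)$; $x_1,\dots,x_n$ is a basis of $V^*$. A vector $v\in V$ is regular if its stabilizer in $G$ is trivial. An element $c\in G$ is regular if it has a regular eigenvector $v\in V$, $c(v)=\zeta v$, after possibly extending $k$ to contain the eigenvalue; here $k$ is assumed already to contain $\zeta$ and $V$ to contain $v$. The complex lift $\hat\zeta$ is a complex root of unity of the same multiplicative order as $\zeta$ (which equals the order of $c$). Bimodules are identified with left $k(\Gamma\times C)$-modules by letting the left action of $c\in C$ be the right action of $c^{-1}$; thus as left modules $c\cdot Hg=Hgc^{-1}$, while $c$ acts on the left on the degree-$d$ component of $k[V]^H$ and of $k[V]^G$ as the scalar $\zeta^d$. The group $\Gamma$ acts trivially on $k[V]^G$. $k=k[V]^G/k[V]^G_+$ is the trivial $k[V]^G$-module; $\operatorname{Tor}_i^{k[V]^G}(k[V]^H,k)$ carries an internal grading $j$ and the induced action of $\Gamma\times C$ (the sum is finite because $k[V]^G$ is polynomial). $\mathbf{R}(k(\Gamma\times C))$ is the Grothendieck ring of finite-dimensional $k(\Gamma\times C)$-modules (relations from all short exact sequences). For a graded vector space $N$ with finite-dimensional components, the Hilbert series is $[N](t)=\sum_d\dim_k(N_d)t^d$. $C$ acts on the set $X=H\backslash G$ by right translation. *)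

theory Defs
  imports
    Complex_Main
    "HOL-Algebra.Module"
    "HOL-Algebra.Algebraic_Closure_Type"
    "HOL-Algebra.Group_Action"
    "HOL-Algebra.Multiplicative_Group"
    "HOL-Algebra.Free_Abelian_Groups"
    "HOL-Computational_Algebra.Polynomial_FPS"
begin

section \<open>Multivariate polynomials\<close>

type_synonym ('x, 'k) mpol = "('x \<Rightarrow>\<^sub>0 nat) \<Rightarrow>\<^sub>0 'k"

definition mconst :: "'k::field \<Rightarrow> ('x, 'k) mpol" where
  "mconst a = Poly_Mapping.single 0 a"

definition mvar :: "'x \<Rightarrow> ('x, 'k::field) mpol" where
  "mvar x = Poly_Mapping.single (Poly_Mapping.single x 1) 1"

definition msubst :: "('x \<Rightarrow> ('y, 'k::field) mpol) \<Rightarrow> ('x, 'k) mpol \<Rightarrow> ('y, 'k) mpol" where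
  "msubst s p = (\<Sum>m\<in>Poly_Mapping.keys p. mconst (Poly_Mapping.lookup p m) *
     (\<Prod>x\<in>Poly_Mapping.keys m. s x ^ Poly_Mapping.lookup m x))"

definition mpol_ring :: "'x set \<Rightarrow> ('x, 'k::field) mpol set" where
  "mpol_ring I = {p. \<forall>m\<in>Poly_Mapping.keys p. Poly_Mapping.keys m \<subseteq> I}"

definition homogeneous :: "nat \<Rightarrow> ('x, 'k::field) mpol \<Rightarrow> bool" where
  "homogeneous d p \<longleftrightarrow>
     (\<forall>m\<in>Poly_Mapping.keys p. (\<Sum>x\<in>Poly_Mapping.keys m. Poly_Mapping.lookup m x) = d)"

text \<open>Polynomial in finitely many variables, up to isomorphism of \<open>k\<close>-algebras: \<open>msubst f\<close> is
  the algebra homomorphism sending the \<open>i\<close>-th variable to \<open>f i\<close>.\<close>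

definition polynomial_algebra :: "('x, 'k::field) mpol set \<Rightarrow> bool" where
  "polynomial_algebra A \<longleftrightarrow>
     (\<exists>(m::nat) f. bij_betw (msubst f :: (nat, 'k) mpol \<Rightarrow> _) (mpol_ring {..<m}) A)"

definition hilbert_series :: "('x, 'k::field) mpol set \<Rightarrow> complex fps" where
  "hilbert_series N = Abs_fps (\<lambda>d.
     of_nat (vector_space.dim (\<lambda>a p. mconst a * p) {p \<in> N. homogeneous d p}))"

section \<open>Linear groups and invariants\<close>

definition GL :: "('k::field \<Rightarrow> 'v::ab_group_add \<Rightarrow> 'v) \<Rightarrow> ('v \<Rightarrow> 'v) monoid" where
  "GL scale = \<lparr>carrier = {g. Vector_Spaces.linear scale scale g \<and> bij g},
     monoid.mult = (\<circ>), one = id\<rparr>"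

text \<open>The ring \<open>k[V]\<close> is \<open>mpol_ring basis\<close> for a basis of \<open>V\<close>: the variable indexed by \<open>b\<close> is the
  coordinate function \<open>x\<^sub>b\<close>, an element of the dual basis.  The action \<open>(g f)(w) = f(g\<^sup>-\<^sup>1 w)\<close> sends
  \<open>x\<^sub>b\<close> to the linear form \<open>\<Sum>\<^sub>b\<^sub>' x\<^sub>b(g\<^sup>-\<^sup>1 b') x\<^sub>b\<^sub>'\<close>.\<close>

definition pol_act ::
  "('k::field \<Rightarrow> 'v::ab_group_add \<Rightarrow> 'v) \<Rightarrow> 'v set \<Rightarrow> ('v \<Rightarrow> 'v) \<Rightarrow> ('v, 'k) mpol \<Rightarrow> ('v, 'k) mpol"
where
  "pol_act scale basis g = msubst (\<lambda>b. \<Sum>b'\<in>basis.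
     mconst (module.representation scale basis ((inv\<^bsub>GL scale\<^esub> g) b') b) * mvar b')"

definition pol_invariants ::
  "('k::field \<Rightarrow> 'v::ab_group_add \<Rightarrow> 'v) \<Rightarrow> 'v set \<Rightarrow> ('v \<Rightarrow> 'v) set \<Rightarrow> ('v, 'k) mpol set"
where
  "pol_invariants scale basis G = {p \<in> mpol_ring basis. \<forall>g\<in>G. pol_act scale basis g p = p}"

definition regular_vector :: "('v \<Rightarrow> 'v) set \<Rightarrow> 'v \<Rightarrow> bool" where
  "regular_vector G v \<longleftrightarrow> {g \<in> G. g v = v} = {id}"

definition mult_order :: "'a::monoid_mult \<Rightarrow> nat" where
  "mult_order x = (LEAST d. 0 < d \<and> x ^ d = 1)"

definition complex_lift :: "'k::field \<Rightarrow> complex \<Rightarrow> bool" where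
  "complex_lift \<zeta> z \<longleftrightarrow> (\<exists>d>0. z ^ d = 1) \<and> mult_order z = mult_order \<zeta>"

section \<open>Representations and the Grothendieck group\<close>

text \<open>A \<open>k(Q)\<close>-module is a \<open>k\<close>-vector space with a linear action of \<open>Q\<close>.  As for any \<open>module\<close>
  record, the multiplicative fields of the ring part are meaningless.\<close>

record ('q, 'k, 'm) rep = "('k, 'm) module" +
  act :: "'q \<Rightarrow> 'm \<Rightarrow> 'm"

definition linear_on ::
  "('k::field, 'm, 'x) module_scheme \<Rightarrow> ('k, 'n, 'y) module_scheme \<Rightarrow> ('m \<Rightarrow> 'n) \<Rightarrow> bool" where
  "linear_on M N f \<longleftrightarrow> f \<in> carrier M \<rightarrow> carrier N \<and>
     (\<forall>x\<in>carrier M. \<forall>y\<in>carrier M. f (x \<oplus>\<^bsub>M\<^esub> y) = f x \<oplus>\<^bsub>N\<^esub> f y) \<and>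
     (\<forall>a. \<forall>x\<in>carrier M. f (a \<odot>\<^bsub>M\<^esub> x) = a \<odot>\<^bsub>N\<^esub> f x)"

definition is_rep :: "'q monoid \<Rightarrow> ('q, 'k::field, 'm) rep \<Rightarrow> bool" where
  "is_rep Q M \<longleftrightarrow> Module.module ring_of_type_algebra M \<and>
     (\<forall>q\<in>carrier Q. linear_on M M (act M q)) \<and>
     (\<forall>x\<in>carrier M. act M \<one>\<^bsub>Q\<^esub> x = x) \<and>
     (\<forall>q\<in>carrier Q. \<forall>r\<in>carrier Q. \<forall>x\<in>carrier M. act M (q \<otimes>\<^bsub>Q\<^esub> r) x = act M q (act M r x))"

definition fin_dim_rep :: "'q monoid \<Rightarrow> ('q, 'k::field, 'm) rep \<Rightarrow> bool" where
  "fin_dim_rep Q M \<longleftrightarrow> is_rep Q M \<and>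
     (\<exists>S. finite S \<and> S \<subseteq> carrier M \<and>
       (\<forall>x\<in>carrier M. \<exists>a. x = (\<Oplus>\<^bsub>M\<^esub>s\<in>S. a s \<odot>\<^bsub>M\<^esub> s)))"

definition rep_hom ::
  "'q monoid \<Rightarrow> ('q, 'k::field, 'm) rep \<Rightarrow> ('q, 'k, 'n) rep \<Rightarrow> ('m \<Rightarrow> 'n) \<Rightarrow> bool" where
  "rep_hom Q M N f \<longleftrightarrow> linear_on M N f \<and>
     (\<forall>q\<in>carrier Q. \<forall>x\<in>carrier M. f (act M q x) = act N q (f x))"

definition rep_iso :: "'q monoid \<Rightarrow> ('q, 'k::field, 'm) rep \<Rightarrow> ('q, 'k, 'n) rep \<Rightarrow> bool" where
  "rep_iso Q M N \<longleftrightarrow> (\<exists>f. rep_hom Q M N f \<and> bij_betw f (carrier M) (carrier N))"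

definition short_exact ::
  "'q monoid \<Rightarrow> ('q, 'k::field, 'l) rep \<Rightarrow> ('q, 'k, 'm) rep \<Rightarrow> ('q, 'k, 'n) rep \<Rightarrow> bool" where
  "short_exact Q L M N \<longleftrightarrow> (\<exists>f g. rep_hom Q L M f \<and> rep_hom Q M N g \<and>
     inj_on f (carrier L) \<and> g ` carrier M = carrier N \<and>
     f ` carrier L = {x \<in> carrier M. g x = \<zero>\<^bsub>N\<^esub>})"

text \<open>The carrier type \<open>nat \<Rightarrow>\<^sub>0 'k\<close> contains an isomorphic copy of every finite-dimensional module,
  so the modules living on it suffice as generators of the Grothendieck group.  Only the additive
  structure of the Grothendieck ring is needed; as for \<open>free_Abelian_group\<close>, it is written
  multiplicatively.  Isomorphic modules are identified by the short exact sequences with a zero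
  term.\<close>

type_synonym ('q, 'k) urep = "('q, 'k, nat \<Rightarrow>\<^sub>0 'k) rep"

definition fd_reps :: "'q monoid \<Rightarrow> ('q, 'k::field) urep set" where
  "fd_reps Q = {M. fin_dim_rep Q M}"

definition ses_relations :: "'q monoid \<Rightarrow> (('q, 'k::field) urep \<Rightarrow>\<^sub>0 int) set" where
  "ses_relations Q = {frag_of M - frag_of L - frag_of N | L M N.
     L \<in> fd_reps Q \<and> M \<in> fd_reps Q \<and> N \<in> fd_reps Q \<and> short_exact Q L M N}"

definition relation_group :: "'q monoid \<Rightarrow> (('q, 'k::field) urep \<Rightarrow>\<^sub>0 int) set" where
  "relation_group Q = generate (free_Abelian_group (fd_reps Q)) (ses_relations Q)"

definition grothendieck_group :: "'q monoid \<Rightarrow> (('q, 'k::field) urep \<Rightarrow>\<^sub>0 int) set monoid" where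
  "grothendieck_group Q = free_Abelian_group (fd_reps Q) Mod relation_group Q"

definition rep_class ::
  "'q monoid \<Rightarrow> ('q, 'k::field, 'm) rep \<Rightarrow> (('q, 'k) urep \<Rightarrow>\<^sub>0 int) set" where
  "rep_class Q M = relation_group Q #>\<^bsub>free_Abelian_group (fd_reps Q)\<^esub>
     frag_of (SOME U. U \<in> fd_reps Q \<and> rep_iso Q M U)"

definition quotient_rep ::
  "('k \<Rightarrow> 'm::ab_group_add \<Rightarrow> 'm) \<Rightarrow> ('q \<Rightarrow> 'm \<Rightarrow> 'm) \<Rightarrow> 'm set \<Rightarrow> 'm set \<Rightarrow> ('q, 'k, 'm set) rep"
where
  "quotient_rep sc ac Z B =
     \<lparr>carrier = (\<lambda>z. (\<lambda>b. z + b) ` B) ` Z,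
      monoid.mult = undefined, one = undefined,
      ring.zero = B,
      add = (\<lambda>U W. {x + y | x y. x \<in> U \<and> y \<in> W}),
      module.smult = (\<lambda>a U. {sc a x + b | x b. x \<in> U \<and> b \<in> B}),
      act = (\<lambda>q U. {ac q x + b | x b. x \<in> U \<and> b \<in> B})\<rparr>"

section \<open>Graded free resolutions and Tor\<close>

text \<open>For a graded subalgebra \<open>A\<close> of a polynomial ring, a complex of graded free \<open>A\<close>-modules
  \<open>P\<^sub>0 \<leftarrow> P\<^sub>1 \<leftarrow> \<dots>\<close> augmented to the trivial module \<open>k\<close>: \<open>P\<^sub>i\<close> has basis \<open>gens P i\<close> with the generator
  \<open>b\<close> in degree \<open>gdeg P i b\<close>, \<open>bd P i b \<in> P\<^sub>i\<close> is the image of the generator \<open>b\<close> of \<open>P\<^bsub>i+1\<^esub>\<close>, and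
  \<open>aug P b \<in> k\<close> the image of the generator \<open>b\<close> of \<open>P\<^sub>0\<close>.\<close>

record ('f, 'k) free_cplx =
  gens :: "nat \<Rightarrow> nat set"
  gdeg :: "nat \<Rightarrow> nat \<Rightarrow> nat"
  bd   :: "nat \<Rightarrow> nat \<Rightarrow> 'f"
  aug  :: "nat \<Rightarrow> 'k"

type_synonym ('x, 'k) free_complex = "(nat \<Rightarrow>\<^sub>0 ('x, 'k) mpol, 'k) free_cplx"

text \<open>\<open>N \<otimes>\<^sub>A P\<^sub>i\<close>, for \<open>P\<^sub>i\<close> free with basis \<open>B\<close>, is the direct sum of copies of \<open>N\<close> indexed by
  \<open>B\<close>; its degree-\<open>j\<close> component is the sum of the \<open>N\<^bsub>j - deg b\<^esub>\<close>.\<close>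

definition free_tensor ::
  "('x, 'k::field) mpol set \<Rightarrow> nat set \<Rightarrow> (nat \<Rightarrow>\<^sub>0 ('x, 'k) mpol) set" where
  "free_tensor N B = {u. Poly_Mapping.keys u \<subseteq> B \<and> (\<forall>b\<in>B. Poly_Mapping.lookup u b \<in> N)}"

definition free_tensor_deg ::
  "('x, 'k::field) mpol set \<Rightarrow> nat set \<Rightarrow> (nat \<Rightarrow> nat) \<Rightarrow> nat \<Rightarrow> (nat \<Rightarrow>\<^sub>0 ('x, 'k) mpol) set" where
  "free_tensor_deg N B dg j = {u \<in> free_tensor N B. \<forall>b\<in>Poly_Mapping.keys u.
     \<exists>d. d + dg b = j \<and> homogeneous d (Poly_Mapping.lookup u b)}"

definition bd_map ::
  "(nat \<Rightarrow> (nat \<Rightarrow>\<^sub>0 ('x, 'k::field) mpol)) \<Rightarrow> (nat \<Rightarrow>\<^sub>0 ('x, 'k) mpol) \<Rightarrow> (nat \<Rightarrow>\<^sub>0 ('x, 'k) mpol)"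
where
  "bd_map D u = (\<Sum>b\<in>Poly_Mapping.keys u.
     Poly_Mapping.map (\<lambda>p. Poly_Mapping.lookup u b * p) (D b))"

text \<open>A polynomial acts on \<open>k = A/A\<^sub>+\<close> by its constant term.\<close>

definition aug_map :: "(nat \<Rightarrow> 'k::field) \<Rightarrow> (nat \<Rightarrow>\<^sub>0 ('x, 'k) mpol) \<Rightarrow> 'k" where
  "aug_map e u = (\<Sum>b\<in>Poly_Mapping.keys u.
     Poly_Mapping.lookup (Poly_Mapping.lookup u b) 0 * e b)"

definition graded_free_resolution ::
  "('x, 'k::field) mpol set \<Rightarrow> ('x, 'k) free_complex \<Rightarrow> bool" where
  "graded_free_resolution A P \<longleftrightarrow>
     (\<forall>i. \<forall>b\<in>gens P (Suc i).
        bd P i b \<in> free_tensor_deg A (gens P i) (gdeg P i) (gdeg P (Suc i) b)) \<and>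
     (\<forall>b\<in>gens P 0. aug P b \<noteq> 0 \<longrightarrow> gdeg P 0 b = 0) \<and>
     aug_map (aug P) ` free_tensor A (gens P 0) = UNIV \<and>
     {u \<in> free_tensor A (gens P 0). aug_map (aug P) u = 0} =
       bd_map (bd P 0) ` free_tensor A (gens P 1) \<and>
     (\<forall>i. {u \<in> free_tensor A (gens P (Suc i)). bd_map (bd P i) u = 0} =
       bd_map (bd P (Suc i)) ` free_tensor A (gens P (Suc (Suc i))))"

definition tor_cycles ::
  "('x, 'k::field) mpol set \<Rightarrow> ('x, 'k) free_complex \<Rightarrow> nat \<Rightarrow> nat \<Rightarrow> (nat \<Rightarrow>\<^sub>0 ('x, 'k) mpol) set"
where
  "tor_cycles N P i j = {u \<in> free_tensor_deg N (gens P i) (gdeg P i) j.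
     case i of 0 \<Rightarrow> True | Suc l \<Rightarrow> bd_map (bd P l) u = 0}"

definition tor_boundaries ::
  "('x, 'k::field) mpol set \<Rightarrow> ('x, 'k) free_complex \<Rightarrow> nat \<Rightarrow> nat \<Rightarrow> (nat \<Rightarrow>\<^sub>0 ('x, 'k) mpol) set"
where
  "tor_boundaries N P i j =
     bd_map (bd P i) ` free_tensor_deg N (gens P (Suc i)) (gdeg P (Suc i)) j"

text \<open>\<open>Tor\<^sub>i\<^sup>A(N,k)\<^sub>j\<close>, the homology of \<open>N \<otimes>\<^sub>A P\<close>.  The group \<open>Q\<close> acts on \<open>N\<close> by \<open>ac\<close>; it acts on \<open>A\<close> and
  on the resolution \<open>P\<close> of \<open>k\<close> by scaling degree \<open>d\<close> by \<open>\<chi>(q)\<^sup>d\<close>, so that on \<open>N \<otimes>\<^sub>A P\<close> one has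
  \<open>q(m \<otimes> b) = qm \<otimes> \<chi>(q)\<^bsup>deg b\<^esup> b\<close>.\<close>

definition tor_rep ::
  "('q \<Rightarrow> 'k::field) \<Rightarrow> ('q \<Rightarrow> ('x, 'k) mpol \<Rightarrow> ('x, 'k) mpol) \<Rightarrow> ('x, 'k) mpol set \<Rightarrow>
   ('x, 'k) free_complex \<Rightarrow> nat \<Rightarrow> nat \<Rightarrow> ('q, 'k, (nat \<Rightarrow>\<^sub>0 ('x, 'k) mpol) set) rep" where
  "tor_rep \<chi> ac N P i j = quotient_rep
     (\<lambda>a. Poly_Mapping.map (\<lambda>p. mconst a * p))
     (\<lambda>q. Poly_Mapping.mapp (\<lambda>b p. mconst (\<chi> q ^ gdeg P i b) * ac q p))
     (tor_cycles N P i j) (tor_boundaries N P i j)"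

section \<open>The groups and bimodules at hand\<close>

definition quot_normalizer ::
  "('k::field \<Rightarrow> 'v::ab_group_add \<Rightarrow> 'v) \<Rightarrow> ('v \<Rightarrow> 'v) set \<Rightarrow> ('v \<Rightarrow> 'v) set \<Rightarrow> ('v \<Rightarrow> 'v) set monoid"
where
  "quot_normalizer scale G H =
     (GL scale)\<lparr>carrier := normalizer ((GL scale)\<lparr>carrier := G\<rparr>) H\<rparr> Mod H"

definition cyclic_group ::
  "('k::field \<Rightarrow> 'v::ab_group_add \<Rightarrow> 'v) \<Rightarrow> ('v \<Rightarrow> 'v) \<Rightarrow> ('v \<Rightarrow> 'v) monoid" where
  "cyclic_group scale c = (GL scale)\<lparr>carrier := generate (GL scale) {c}\<rparr>"

definition Gamma_C ::
  "('k::field \<Rightarrow> 'v::ab_group_add \<Rightarrow> 'v) \<Rightarrow> ('v \<Rightarrow> 'v) set \<Rightarrow> ('v \<Rightarrow> 'v) set \<Rightarrow> ('v \<Rightarrow> 'v) \<Rightarrow>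
   (('v \<Rightarrow> 'v) set \<times> ('v \<Rightarrow> 'v)) monoid" where
  "Gamma_C scale G H c = quot_normalizer scale G H \<times>\<times> cyclic_group scale c"

text \<open>The character of \<open>C\<close> with \<open>c \<mapsto> \<zeta>\<close>; it is well defined because \<open>\<zeta>\<close> and \<open>c\<close> have the same
  order.\<close>

definition cyc_char ::
  "('k::field \<Rightarrow> 'v::ab_group_add \<Rightarrow> 'v) \<Rightarrow> ('v \<Rightarrow> 'v) \<Rightarrow> 'k \<Rightarrow> ('v \<Rightarrow> 'v) \<Rightarrow> 'k" where
  "cyc_char scale c \<zeta> h = \<zeta> ^ (LEAST a::nat. c [^]\<^bsub>GL scale\<^esub> a = h)"

text \<open>A coset in \<open>N\<^sub>G(H)/H\<close> acts on \<open>k[V]\<^sup>H\<close> through any of its representatives.\<close>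

definition inv_act ::
  "('k::field \<Rightarrow> 'v::ab_group_add \<Rightarrow> 'v) \<Rightarrow> 'v set \<Rightarrow> ('v \<Rightarrow> 'v) \<Rightarrow> 'k \<Rightarrow>
   ('v \<Rightarrow> 'v) set \<times> ('v \<Rightarrow> 'v) \<Rightarrow> ('v, 'k) mpol \<Rightarrow> ('v, 'k) mpol" where
  "inv_act scale basis c \<zeta> = (\<lambda>(K, h) p.
     msubst (\<lambda>b. mconst (cyc_char scale c \<zeta> h) * mvar b)
       (pol_act scale basis (SOME \<gamma>. \<gamma> \<in> K) p))"

definition Tor_inv ::
  "('k::field \<Rightarrow> 'v::ab_group_add \<Rightarrow> 'v) \<Rightarrow> 'v set \<Rightarrow> ('v \<Rightarrow> 'v) set \<Rightarrow> ('v \<Rightarrow> 'v) \<Rightarrow> 'k \<Rightarrow>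
   ('v, 'k) free_complex \<Rightarrow> nat \<Rightarrow> nat \<Rightarrow>
   (('v \<Rightarrow> 'v) set \<times> ('v \<Rightarrow> 'v), 'k, (nat \<Rightarrow>\<^sub>0 ('v, 'k) mpol) set) rep" where
  "Tor_inv scale basis H c \<zeta> = tor_rep (\<lambda>(K, h). cyc_char scale c \<zeta> h)
     (inv_act scale basis c \<zeta>) (pol_invariants scale basis H)"

definition right_cosets ::
  "('k::field \<Rightarrow> 'v::ab_group_add \<Rightarrow> 'v) \<Rightarrow> ('v \<Rightarrow> 'v) set \<Rightarrow> ('v \<Rightarrow> 'v) set \<Rightarrow> ('v \<Rightarrow> 'v) set set"
where
  "right_cosets scale G H = rcosets\<^bsub>(GL scale)\<lparr>carrier := G\<rparr>\<^esub> H"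

text \<open>\<open>k(H\G)\<close> as a left module, \<open>(H\<gamma>, h) \<cdot> Hg = H\<gamma> Hg h\<^sup>-\<^sup>1 = H\<gamma>gh\<^sup>-\<^sup>1\<close>.\<close>

definition coset_rep ::
  "('k::field \<Rightarrow> 'v::ab_group_add \<Rightarrow> 'v) \<Rightarrow> ('v \<Rightarrow> 'v) set \<Rightarrow> ('v \<Rightarrow> 'v) set \<Rightarrow>
   (('v \<Rightarrow> 'v) set \<times> ('v \<Rightarrow> 'v), 'k, ('v \<Rightarrow> 'v) set \<Rightarrow>\<^sub>0 'k) rep" where
  "coset_rep scale G H =
     \<lparr>carrier = {f. Poly_Mapping.keys f \<subseteq> right_cosets scale G H},
      monoid.mult = undefined, one = undefined,
      ring.zero = 0, add = (+),
      module.smult = (\<lambda>a. Poly_Mapping.map (\<lambda>x. a * x)),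
      act = (\<lambda>(K, h) f. \<Sum>Y\<in>Poly_Mapping.keys f.
        Poly_Mapping.single ((K <#>\<^bsub>GL scale\<^esub> Y) #>\<^bsub>GL scale\<^esub> (inv\<^bsub>GL scale\<^esub> h))
          (Poly_Mapping.lookup f Y))\<rparr>"

end

theory Submission
  imports Defs
begin

text \<open>Since \<open>k[V]\<^sup>G\<close> is polynomial on homogeneous generators \<open>h\<^sub>s\<close>, the Koszul complex resolves
  \<open>k\<close>, and the alternating sum of the graded pieces of \<open>Tor\<close> is that of the graded pieces of
  \<open>k[V]\<^sup>H\<close> tensored with the Koszul complex, cut off in a degree beyond which the homology vanishes.
  Replacing \<open>h\<^sub>s\<close> by \<open>h\<^sub>s - h\<^sub>s(v)\<close> changes the differential only by terms of lower degree and
  keeps it equivariant, because \<open>h\<^sub>s(v) \<noteq> 0\<close> forces \<open>\<zeta>\<close> to the power \<open>deg h\<^sub>s\<close> to be \<open>1\<close>.  The orbit of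
  the regular vector \<open>v\<close> is free, so the deformed complex resolves the functions on \<open>H\<close>-orbits of
  \<open>Gv\<close>, which form \<open>k(X)\<close>.  Cyclic sieving follows by taking dimensions of eigenspaces of \<open>c\<close>.\<close>

text \<open>The characteristic of \<open>k\<close> is arbitrary: the orders of \<open>G\<close> and
  \<open>H\<close> may vanish in \<open>k\<close>, and passing to \<open>H\<close>-invariants is not
  exact. Averaging over \<open>H\<close> is replaced by a transfer. A polynomial \<open>pp\<close>
  equal to 1 at \<open>v\<close> and to 0 on the rest of the orbit yields \<open>ff\<close> with
  \<open>transfer H (ff * n) = transfer G pp * n\<close> for every \<open>H\<close>-invariant
  \<open>n\<close>, and \<open>transfer G pp\<close> is congruent to 1 modulo the deformed
  relations. This carries exactness from \<open>k[V]\<close> down to \<open>k[V]^H\<close>.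

  The deformed differential respects only a filtration by degree, while the Grothendieck group knows
  only finite-dimensional modules; hence a uniform bound on the degrees of Koszul homology is
  needed, and it comes from a Noetherian argument.

  Eigenspaces of \<open>c\<close> are exact because the order of \<open>\<zeta>\<close> is
  invertible in \<open>k\<close>. Their dimensions are integers, so the count can be compared with
  complex roots of unity without lifting modules to characteristic 0.\<close>

type_synonym ('x, 'k) fvec = "nat \<Rightarrow>\<^sub>0 ('x, 'k) mpol"

abbreviation "hmg \<equiv> homogeneous"
abbreviation "ft \<equiv> free_tensor"
abbreviation "ftd \<equiv> free_tensor_deg"
abbreviation "tcyc \<equiv> tor_cycles"
abbreviation "tbnd \<equiv> tor_boundaries"
type_synonym ('x, 'k) fcplx = "('x, 'k) free_complex"

abbreviation lk :: "('a \<Rightarrow>\<^sub>0 'b::zero) => 'a => 'b" where "lk \<equiv> Poly_Mapping.lookup"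
abbreviation ky :: "('a \<Rightarrow>\<^sub>0 'b::zero) => 'a set" where "ky \<equiv> Poly_Mapping.keys"
abbreviation sg :: "'a => 'b::zero => ('a \<Rightarrow>\<^sub>0 'b)" where "sg \<equiv> Poly_Mapping.single"

section \<open>Finitely supported functions, monomials and evaluation homomorphisms\<close>

lemma sum_monomials: "(p :: 'a \<Rightarrow>\<^sub>0 'b::comm_monoid_add) = (\<Sum>m\<in>ky p. sg m (lk p m))"
 by (rule poly_mapping_eqI)
  (auto simp: lookup_sum lookup_single when_def in_keys_iff sum.delta' sum.If_cases)

text \<open>Singles need to be treated only at keys of the given \<open>p\<close>, so that a
  condition on the support of \<open>p\<close> remains usable in that case.\<close>

lemma poly_mapping_induct [case_names zero single add]:
 fixes p :: "'a \<Rightarrow>\<^sub>0 'b::comm_monoid_add"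
 assumes "P 0" "!!m a. m : ky p ==> P (sg m a)" "!!p q. P p ==> P q ==> P (p + q)"
 shows "P p"
proof -
 have "P (\<Sum>m\<in>M. sg m (lk p m))" if "M \<subseteq> ky p" for M
  using finite_subset[OF that finite_keys] that
  by (induction M rule: finite_induct) (auto intro: assms)
 from this[OF order_refl] show ?thesis by (simp flip: sum_monomials)
qed

definition mon :: "('x => 'a::comm_monoid_mult) => ('x \<Rightarrow>\<^sub>0 nat) => 'a" where
 "mon s m = (\<Prod>x\<in>ky m. s x ^ lk m x)"

lemma mon_superset: "finite Y ==> ky m \<subseteq> Y ==> mon s m = (\<Prod>x\<in>Y. s x ^ lk m x)"
 unfolding mon_def by (rule prod.mono_neutral_left) (auto simp: in_keys_iff)

lemma mon_0 [simp]: "mon s 0 = 1"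
 by (simp add: mon_def)

lemma mon_add: "mon s (m + m') = mon s m * mon s m'"
proof -
 let ?Y = "ky m \<union> ky m'"
 have "mon s (m + m') = (\<Prod>x\<in>?Y. s x ^ lk (m + m') x)"
  by (rule mon_superset) (use keys_add[of m m'] in auto)
 then show ?thesis
  by (simp add: mon_superset[of ?Y m] mon_superset[of ?Y m'] lookup_add power_add prod.distrib)
qed

lemma mon_single [simp]: "mon s (sg x n) = s x ^ n"
 by (simp add: mon_def)

definition rhom :: "('a::comm_ring_1 => 'b::comm_ring_1) => bool" where
 "rhom f \<longleftrightarrow> f 1 = 1 & (ALL x y. f (x + y) = f x + f y) & (ALL x y. f (x * y) = f x * f y)"

lemma rhomD:
 assumes "rhom f"
 shows "f 1 = 1" "f (x + y) = f x + f y" "f (x * y) = f x * f y" "f 0 = 0" "f (- x) = - f x"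
  "f (x - y) = f x - f y" "f (x ^ n) = f x ^ n" "f (sum g Y) = (\<Sum>x\<in>Y. f (g x))"
  "f (prod g Y) = (\<Prod>x\<in>Y. f (g x))"
proof -
 show *: "f 1 = 1" "f (x + y) = f x + f y" "f (x * y) = f x * f y" for x y
  using assms by (auto simp: rhom_def)
 show 0: "f 0 = 0" using *(2)[of 0 0] by simp
 show u: "f (- x) = - f x" for x using *(2)[of x "-x"] 0 by (simp add: eq_neg_iff_add_eq_0 add.commute)
 show "f (x - y) = f x - f y" using *(2)[of x "-y"] u by simp
 show "f (x ^ n) = f x ^ n" by (induction n) (simp_all add: *)
 show "f (sum g Y) = (\<Sum>x\<in>Y. f (g x))"
  by (induction Y rule: infinite_finite_induct) (simp_all add: * 0)
 show "f (prod g Y) = (\<Prod>x\<in>Y. f (g x))"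
  by (induction Y rule: infinite_finite_induct) (simp_all add: * 0)
qed

lemma rhom_id [simp]: "rhom (%x. x)"
 by (simp add: rhom_def)

lemma rhom_mon: "rhom f ==> f (mon s m) = mon (%x. f (s x)) m"
 by (simp add: mon_def rhomD)

text \<open>Common generalization of substitution (\<open>f\<close> is \<open>mconst\<close>) and of
  evaluation at a point (\<open>f\<close> is the identity of the field), so that multiplicativity
  and the behaviour under composition are proved once.\<close>

definition ins :: "('k::comm_ring_1 => 'a::comm_ring_1) => ('x => 'a) => (('x \<Rightarrow>\<^sub>0 nat) \<Rightarrow>\<^sub>0 'k) => 'a" where
 "ins f s p = (\<Sum>m\<in>ky p. f (lk p m) * mon s m)"

lemma ins_superset: "rhom f ==> finite Y ==> ky p \<subseteq> Y ==> ins f s p = (\<Sum>m\<in>Y. f (lk p m) * mon s m)"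
 unfolding ins_def by (rule sum.mono_neutral_left) (auto simp: in_keys_iff rhomD)

lemma ins_single: "rhom f ==> ins f s (sg m a) = f a * mon s m"
 by (auto simp: ins_def rhomD)

lemma ins_add:
 assumes "rhom f" shows "ins f s (p + q) = ins f s p + ins f s q"
proof -
 let ?Y = "ky p \<union> ky q"
 have "ins f s (p + q) = (\<Sum>m\<in>?Y. f (lk (p + q) m) * mon s m)"
  by (rule ins_superset[OF assms]) (use keys_add[of p q] in auto)
 then show ?thesis
  by (simp add: ins_superset[OF assms, of ?Y p] ins_superset[OF assms, of ?Y q] lookup_add
   rhomD[OF assms] distrib_right sum.distrib)
qed

lemma ins_0 [simp]: "ins f s 0 = 0"
 by (simp add: ins_def)

lemma ins_mult:
 assumes "rhom f" shows "ins f s (p * q) = ins f s p * ins f s q"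
proof (induction p rule: poly_mapping_induct)
 case (single m a)
 show ?case
 proof (induction q rule: poly_mapping_induct)
  case (single m' a')
  then show ?case by (simp add: mult_single ins_single[OF assms] rhomD[OF assms] mon_add)
 qed (simp_all add: distrib_left ins_add[OF assms])
qed (simp_all add: distrib_right ins_add[OF assms])

lemma rhom_ins: "rhom f ==> rhom (ins f s)"
 unfolding rhom_def[of "ins f s"]
 by (metis ins_add ins_mult ins_single mon_0 mult.right_neutral rhomD(1) single_one)

lemma rhom_mconst: "rhom mconst"
 by (simp add: rhom_def mconst_def single_add mult_single)

lemmas mconst_simps = rhomD[OF rhom_mconst]

lemma lookup_mconst_mult: "lk (mconst a * p) m = a * lk p m"
proof (induction p rule: poly_mapping_induct)
 case (single m' b)
 then show ?case by (simp add: mconst_def mult_single lookup_single when_def)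
qed (simp_all add: distrib_left lookup_add)

lemma sg_eq: "sg m a = mconst a * sg m (1::'k::field)"
 by (simp add: mconst_def mult_single)

lemma mon_mvar: "mon mvar m = sg m (1::'k::field)"
proof (induction m rule: poly_mapping_induct)
 case (single x n)
 have "mvar x ^ n = sg (sg x n) (1::'k)"
  by (induction n) (simp_all add: mvar_def mult_single flip: single_add)
 then show ?case by simp
next
 case (add p q)
 then show ?case by (simp add: mon_add mult_single)
qed simp

lemma sg_mon: "sg m a = mconst a * mon mvar (m :: 'x \<Rightarrow>\<^sub>0 nat)"
 using sg_eq by (simp add: mon_mvar)

lemma msubst_ins: "msubst s = ins mconst s"
 by (rule ext) (simp add: msubst_def ins_def mon_def)

lemma rhom_msubst: "rhom (msubst s)"
 by (simp add: msubst_ins rhom_ins rhom_mconst)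

lemmas msubst_simps = rhomD[OF rhom_msubst]

lemma ins_mconst [simp]: "rhom f ==> ins f s (mconst a) = f a"
 by (simp add: mconst_def ins_single)

lemma ins_mvar [simp]: "rhom f ==> ins f s (mvar x) = s x"
 by (simp add: mvar_def ins_single rhomD)

lemma msubst_mconst [simp]: "msubst s (mconst a) = mconst a"
 and msubst_mvar [simp]: "msubst s (mvar x) = s x"
 by (simp_all add: msubst_ins rhom_mconst)

lemma msubst_single: "msubst s (sg m a) = mconst a * mon s m"
 by (simp add: msubst_ins ins_single rhom_mconst)

lemma msubst_mconst_mult [simp]: "msubst s (mconst a * p) = mconst a * msubst s p"
 by (simp add: msubst_simps)

subsection \<open>The ring on a set of variables\<close>

lemma mpol_ring_zero [simp]: "0 : mpol_ring I"
 by (simp add: mpol_ring_def)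

lemma mpol_ring_mconst [simp]: "mconst a : mpol_ring I"
 by (simp add: mpol_ring_def mconst_def)

lemma mpol_ring_one [simp]: "1 : mpol_ring I"
 by (simp add: mpol_ring_def)

lemma mpol_ring_mvar: "x : I ==> mvar x : mpol_ring I"
 by (simp add: mpol_ring_def mvar_def)

lemma mpol_ring_add: "p : mpol_ring I ==> q : mpol_ring I ==> p + q : mpol_ring I"
 using keys_add[of p q] by (auto simp: mpol_ring_def)

lemma keys_add_nat: "ky (m + m') = ky m \<union> ky (m' :: 'x \<Rightarrow>\<^sub>0 nat)"
 by (auto simp: in_keys_iff lookup_add)

lemma mpol_ring_mult: "p : mpol_ring I ==> q : mpol_ring I ==> p * q : mpol_ring I"
 using keys_mult[of p q] by (fastforce simp: mpol_ring_def keys_add_nat)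

lemma mpol_ring_uminus: "p : mpol_ring I ==> - p : mpol_ring I"
 by (simp add: mpol_ring_def keys_def uminus_poly_mapping.rep_eq)

lemma mpol_ring_single: "ky m \<subseteq> I ==> sg m a : mpol_ring I"
 by (simp add: mpol_ring_def)

lemma mpol_ring_induct [consumes 1, case_names const var add mult]:
 fixes P :: "('x,'k::field) mpol => bool"
 assumes p: "p : mpol_ring I"
  and const: "!!a. P (mconst a)" and var: "!!x. x : I ==> P (mvar x)"
  and add: "!!p q. p : mpol_ring I ==> q : mpol_ring I ==> P p ==> P q ==> P (p + q)"
  and mult: "!!p q. p : mpol_ring I ==> q : mpol_ring I ==> P p ==> P q ==> P (p * q)"
 shows "P p"
proof -
 have one: "P 1" using const[of 1] by (simp add: mconst_simps)
 have pw: "P (mvar x ^ n) & (mvar x ^ n :: ('x,'k) mpol) : mpol_ring I" if "x : I" for x n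
  proof (induction n)
  case (Suc n)
  have v: "(mvar x :: ('x,'k) mpol) : mpol_ring I" by (rule mpol_ring_mvar[OF that])
  have "P (mvar x * mvar x ^ n)" by (rule mult[OF v _ var[OF that]]) (use Suc in auto)
  then show ?case using Suc v mpol_ring_mult[OF v, of "mvar x ^ n"] by simp
 qed (simp add: one)
 have mon: "P (mon mvar m) & (mon mvar m :: ('x,'k) mpol) : mpol_ring I" if "ky m \<subseteq> I" for m
 proof -
  have "P (\<Prod>x\<in>Y. mvar x ^ lk m x) & (\<Prod>x\<in>Y. mvar x ^ lk m x :: ('x,'k) mpol) : mpol_ring I"
   if "Y \<subseteq> I" "finite Y" for Y
   using that(2,1) by (induction Y rule: finite_induct) (auto intro: one mult pw mpol_ring_mult simp: pw)
  then show ?thesis unfolding mon_def using that by simp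
 qed
 have "P (\<Sum>m\<in>M. sg m (lk p m)) & (\<Sum>m\<in>M. sg m (lk p m)) : mpol_ring I" if "M \<subseteq> ky p" for M
  using finite_subset[OF that finite_keys] that
 proof (induction M rule: finite_induct)
  case empty
  then show ?case using const[of 0] by (simp add: mconst_simps)
 next
  case (insert m M)
  have m: "ky m \<subseteq> I" using insert p by (auto simp: mpol_ring_def)
  have "P (sg m (lk p m))" unfolding sg_mon by (intro mult const) (use mon[OF m] in auto)
  moreover have "sg m (lk p m) : mpol_ring I" by (rule mpol_ring_single[OF m])
  ultimately show ?case using insert by (auto intro: add mpol_ring_add)
 qed
 from this[OF order_refl] show ?thesis by (simp flip: sum_monomials)
qed

lemma ins_cong: "p : mpol_ring I ==> (!!x. x : I ==> s x = s' x) ==> ins f s p = ins f s' p"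
 unfolding ins_def mon_def by (intro sum.cong arg_cong2[of _ _ _ _ "(*)"] prod.cong refl)
  (auto simp: mpol_ring_def subset_iff)

lemma rhom_ins_comp:
 assumes f: "rhom f" and F: "rhom F" shows "F (ins f s p) = ins (%a. F (f a)) (%x. F (s x)) p"
 by (simp add: ins_def rhomD[OF F] rhom_mon[OF F])

lemma msubst_msubst: "msubst t (msubst s p) = msubst (%x. msubst t (s x)) p"
 using rhom_ins_comp[OF rhom_mconst rhom_msubst] by (simp add: msubst_ins[of s] msubst_ins[of "%x. msubst t (s x)"])

lemma ins_msubst: "rhom f ==> ins f t (msubst s p) = ins f (%x. ins f t (s x)) p"
 using rhom_ins_comp[OF rhom_mconst rhom_ins[of f t], of s p] by (simp add: msubst_ins)

lemma msubst_mvar_id: "msubst mvar p = p"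
 by (simp add: msubst_def flip: mon_def sg_mon sum_monomials)

lemma msubst_closed:
 assumes "p : mpol_ring I" "!!x. x : I ==> s x : Y" "!!a. mconst a : Y"
  "!!p q. p : Y ==> q : Y ==> p + q : Y" "!!p q. p : Y ==> q : Y ==> p * q : Y"
 shows "msubst s p : Y"
 using assms(1) by (induction rule: mpol_ring_induct) (simp_all add: assms msubst_simps)

lemma mpol_ring_sum: "(!!x. x : Y ==> f x : mpol_ring I) ==> sum f Y : mpol_ring I"
 by (induction Y rule: infinite_finite_induct) (auto intro: mpol_ring_add)

lemma mpol_ring_power: "p : mpol_ring I ==> p ^ n : mpol_ring I"
 by (induction n) (auto intro: mpol_ring_mult)

lemma mpol_ring_diff: "p : mpol_ring I ==> q : mpol_ring I ==> p - q : mpol_ring I"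
 using mpol_ring_add[of p I "-q"] by (simp add: mpol_ring_uminus)

subsection \<open>Degrees\<close>

definition wdeg :: "('x => nat) => ('x \<Rightarrow>\<^sub>0 nat) => nat" where
 "wdeg w m = (\<Sum>x\<in>ky m. lk m x * w x)"

abbreviation mdeg :: "('x \<Rightarrow>\<^sub>0 nat) => nat" where "mdeg \<equiv> wdeg (%_. Suc 0)"

lemma wdeg_superset: "finite Y ==> ky m \<subseteq> Y ==> wdeg w m = (\<Sum>x\<in>Y. lk m x * w x)"
 unfolding wdeg_def by (rule sum.mono_neutral_left) (auto simp: in_keys_iff)

lemma wdeg_0 [simp]: "wdeg w 0 = 0"
 by (simp add: wdeg_def)

lemma wdeg_single [simp]: "wdeg w (sg x n) = n * w x"
 by (simp add: wdeg_def)

lemma wdeg_add: "wdeg w (m + m') = wdeg w m + wdeg w m'"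
 by (simp add: wdeg_superset[of "ky m \<union> ky m'"] keys_add_nat lookup_add add_mult_distrib sum.distrib)

lemma homogeneous_iff: "hmg d p \<longleftrightarrow> (\<forall>m\<in>ky p. mdeg m = d)"
 by (simp add: homogeneous_def wdeg_def)

lemma homogeneousD: "hmg d p ==> mdeg m ~= d ==> lk p m = 0"
 by (auto simp: homogeneous_iff in_keys_iff)

lemma homogeneous_0 [simp]: "hmg d 0"
 by (simp add: homogeneous_iff)

lemma homogeneous_add: "hmg d p ==> hmg d q ==> hmg d (p + q)"
 using keys_add[of p q] by (auto simp: homogeneous_iff)

lemma homogeneous_mult: "hmg d p ==> hmg e q ==> hmg (d + e) (p * q)"
 using keys_mult[of p q] by (auto simp: homogeneous_iff wdeg_add dest!: subsetD)

lemma homogeneous_mconst [simp]: "hmg 0 (mconst a)"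
 by (simp add: homogeneous_iff mconst_def)

lemma homogeneous_mconst_mult: "hmg d p ==> hmg d (mconst a * p)"
 using homogeneous_mult[OF homogeneous_mconst, of d p a] by simp

lemma homogeneous_sum: "(!!x. x : Y ==> hmg d (f x)) ==> hmg d (sum f Y)"
 by (induction Y rule: infinite_finite_induct) (auto intro: homogeneous_add)

lemma homogeneous_mvar: "hmg 1 (mvar x)"
 by (simp add: homogeneous_iff mvar_def)

lemma homogeneous_power: "hmg d p ==> hmg (n * d) (p ^ n)"
proof (induction n)
 case 0
 then show ?case using homogeneous_mconst[of 1] by (simp add: mconst_simps)
next
 case (Suc n)
 then show ?case using homogeneous_mult[of d p "n * d" "p ^ n"] by simp
qed

lemma homogeneous_prod:
 "(!!x. x : Y ==> hmg (d x) (f x)) ==> hmg (sum d Y) (prod f Y)"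
proof (induction Y rule: infinite_finite_induct)
 case (insert x Y)
 then show ?case by (auto intro!: homogeneous_mult)
qed (use homogeneous_mconst[of 1] in \<open>simp_all add: mconst_simps\<close>)

lemma homogeneous_mon: "(!!x. x : ky m ==> hmg (w x) (s x)) ==> hmg (wdeg w m) (mon s m)"
 unfolding mon_def wdeg_def by (intro homogeneous_prod homogeneous_power)

definition hcomp :: "nat => ('x,'k::field) mpol => ('x,'k) mpol" where
 "hcomp d p = (\<Sum>m\<in>{m\<in>ky p. mdeg m = d}. sg m (lk p m))"

lemma lookup_hcomp: "lk (hcomp d p) m = (lk p m when mdeg m = d)"
proof -
 have "lk (hcomp d p) m = (\<Sum>m'\<in>{m\<in>ky p. mdeg m = d}. if m = m' then lk p m' else 0)"
  unfolding hcomp_def lookup_sum by (intro sum.cong) (auto simp: lookup_single when_def)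
 then show ?thesis by (auto simp: when_def in_keys_iff)
qed

lemma keys_hcomp: "ky (hcomp d p) = {m\<in>ky p. mdeg m = d}"
 by (auto simp: in_keys_iff lookup_hcomp when_def split: if_splits)

lemma homogeneous_hcomp [simp]: "hmg d (hcomp d p)"
 by (simp add: homogeneous_iff keys_hcomp)

lemma hcomp_add: "hcomp d (p + q) = hcomp d p + hcomp d q"
 by (rule poly_mapping_eqI) (simp add: lookup_hcomp lookup_add when_def)

lemma hcomp_0 [simp]: "hcomp d 0 = 0"
 by (simp add: hcomp_def)

lemma hcomp_diff: "hcomp d (p - q) = hcomp d p - hcomp d q"
 by (rule poly_mapping_eqI) (simp add: lookup_hcomp lookup_minus when_def)

lemma hcomp_sum: "hcomp d (sum f Y) = (\<Sum>x\<in>Y. hcomp d (f x))"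
 by (induction Y rule: infinite_finite_induct) (simp_all add: hcomp_add)

lemma hcomp_mconst_mult: "hcomp d (mconst a * p) = mconst a * hcomp d p"
 by (rule poly_mapping_eqI) (simp add: lookup_hcomp lookup_mconst_mult when_def)

lemma hcomp_homogeneous: "hmg e p ==> hcomp d p = (if d = e then p else 0)"
 by (rule poly_mapping_eqI) (auto simp: lookup_hcomp when_def homogeneousD)

lemma hcomp_decomp: "(!!m. m : ky p ==> mdeg m < D) ==> p = (\<Sum>d<D. hcomp d p)"
 by (rule poly_mapping_eqI) (auto simp: lookup_sum lookup_hcomp when_def in_keys_iff)

lemma hcomp_bound: "EX D. \<forall>m\<in>ky p. mdeg m < D"
 using finite_nat_set_iff_bounded[of "mdeg ` ky p"] by auto

lemma hcomp_eqI:
 assumes "!!d. hcomp d p = hcomp d q" shows "p = q"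
proof (rule poly_mapping_eqI)
 fix m
 show "lk p m = lk q m"
  using arg_cong[OF assms[of "mdeg m"], of "%p. lk p m"] by (simp add: lookup_hcomp)
qed

lemma hcomp_mult:
 assumes q: "hmg e q"
 shows "hcomp d (p * q) = (if e \<le> d then hcomp (d - e) p * q else 0)"
proof -
 obtain D where D: "p = (\<Sum>d<D. hcomp d p)" using hcomp_bound hcomp_decomp by metis
 have "hcomp d (p * q) = (\<Sum>i<D. hcomp d (hcomp i p * q))"
  by (subst D) (simp add: sum_distrib_right hcomp_sum)
 also have "... = (\<Sum>i<D. if i + e = d then hcomp i p * q else 0)"
  by (intro sum.cong refl) (simp add: hcomp_homogeneous[OF homogeneous_mult[OF homogeneous_hcomp q]] eq_commute)
 also have "... = (\<Sum>i<D. if e \<le> d then hcomp (d - e) (hcomp i p) * q else 0)"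
  by (intro sum.cong refl) (auto simp: hcomp_homogeneous[OF homogeneous_hcomp])
 also have "... = (if e \<le> d then hcomp (d - e) p * q else 0)"
  by (simp add: flip: sum_distrib_right hcomp_sum D)
 finally show ?thesis .
qed

text \<open>A polynomial is the finite sum of its components, and an additive map that preserves
  degrees can be applied to each of them. This serves for every group action below.\<close>

lemma hcomp_linear:
 assumes add: "!!p q. F (p + q) = F p + F q" and hom: "!!d p. hmg d p ==> hmg d (F p)"
 shows "hcomp d (F p) = F (hcomp d p)"
proof -
 obtain D where D: "p = (\<Sum>d<D. hcomp d p)" using hcomp_bound hcomp_decomp by metis
 have 0: "F 0 = 0" using add[of 0 0] by simp
 have s: "F (sum f Y) = (\<Sum>x\<in>Y. F (f x))" for f and Y :: "nat set"
  by (induction Y rule: infinite_finite_induct) (simp_all add: add 0)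
 have "hcomp d (F p) = (\<Sum>i<D. hcomp d (F (hcomp i p)))"
  by (subst D) (simp add: s hcomp_sum)
 also have "... = (\<Sum>i<D. F (hcomp d (hcomp i p)))"
  by (intro sum.cong refl) (simp add: hcomp_homogeneous[OF homogeneous_hcomp] 0 hcomp_homogeneous[OF hom[OF homogeneous_hcomp]])
 also have "... = F (hcomp d p)" by (subst (2) D) (simp add: s hcomp_sum)
 finally show ?thesis .
qed

lemma mpol_ring_hcomp: "p : mpol_ring I ==> hcomp d p : mpol_ring I"
 by (auto simp: mpol_ring_def keys_hcomp)

lemma homogeneous_msubst:
 assumes "!!x. hmg 1 (s x)" "hmg d p" shows "hmg d (msubst s p)"
proof -
 have "hmg d (mconst (lk p m) * mon s m)" if "m : ky p" for m
  using homogeneous_mon[of m "%_. Suc 0" s] assms that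
  by (intro homogeneous_mconst_mult) (auto simp: homogeneous_iff)
 then show ?thesis by (auto simp: msubst_ins ins_def intro: homogeneous_sum)
qed

lemma homogeneous_0_mconst: "hmg 0 (p :: ('x,'k::field) mpol) ==> p = mconst (lk p 0)"
proof (rule poly_mapping_eqI)
 fix m :: "'x \<Rightarrow>\<^sub>0 nat" assume h: "hmg 0 p"
 have "mdeg m = 0 ==> m = 0" by (auto simp: wdeg_def in_keys_iff intro!: poly_mapping_eqI)
 then show "lk p m = lk (mconst (lk p 0)) m"
  using homogeneousD[OF h, of m] by (cases "m = 0") (auto simp: mconst_def lookup_single)
qed

lemma lookup_0_homogeneous: "hmg d p ==> d > 0 ==> lk p 0 = 0"
 by (rule homogeneousD) auto

text \<open>The constant term is evaluation at the origin. This is how it is seen to be a ring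
  homomorphism, and it makes the augmentation of an algebra a special case of a point
  evaluation.\<close>

lemma ins_zero_lookup: "ins (%x. x) (%_. 0) p = lk (p :: ('x,'k::field) mpol) 0"
proof (induction p rule: poly_mapping_induct)
 case (single m a)
 have "mon (%_. 0 :: 'k) m = (if m = 0 then 1 else 0)"
 proof (cases "m = 0")
  case False
  then obtain x where "x : ky m" by (metis in_keys_iff lookup_zero poly_mapping_eqI)
  then have "mon (%_. 0 :: 'k) m = 0"
   unfolding mon_def by (intro prod_zero bexI[of _ x]) (auto simp: in_keys_iff power_0_left)
  then show ?thesis using False by simp
 qed simp
 then show ?case by (simp add: ins_single lookup_single when_def)
qed (simp_all add: ins_add lookup_add)

lemma rhom_lookup_0: "rhom (%p :: ('x,'k::field) mpol. lk p 0)"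
 using rhom_ins[OF rhom_id, of "%_::'x. 0::'k"] by (simp add: rhom_def ins_zero_lookup)

lemmas lookup_0_simps = rhomD[OF rhom_lookup_0]

lemma vector_space_mpol: "vector_space (%a p. mconst a * (p :: ('x,'k::field) mpol))"
 by unfold_locales (simp_all add: distrib_left distrib_right mconst_simps mult.assoc)

section \<open>The Koszul complex\<close>

definition ksgn :: "nat => nat set => 'a::comm_ring_1" where
 "ksgn s T = (- 1) ^ card {t\<in>T. t < s}"

text \<open>An element of the exterior algebra on \<open>m\<close> generators is given by its
  coefficients \<open>u T\<close> at the basis elements indexed by subsets \<open>T\<close>. In
  these terms \<open>kdiff\<close> is contraction with the functional that sends the generator
  \<open>s\<close> to \<open>a s\<close>, and \<open>kwedge s\<close> is exterior multiplication by
  the generator \<open>s\<close>.\<close>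

definition kdiff :: "nat => (nat => 'a::comm_ring_1) => (nat set => 'a) => nat set => 'a" where
 "kdiff m a u T = (\<Sum>s\<in>{..<m} - T. ksgn s T * a s * u (insert s T))"

definition kwedge :: "nat => (nat set => 'a::comm_ring_1) => nat set => 'a" where
 "kwedge s u T = (if s : T then ksgn s (T - {s}) * u (T - {s}) else 0)"

lemma ksgn_square [simp]: "ksgn s T * ksgn s T = (1::'a::comm_ring_1)"
 by (simp add: ksgn_def flip: power_add mult_2)

lemma ksgn_insert:
 assumes "finite T" "t \<notin> T"
 shows "ksgn s (insert t T) = (if t < s then - ksgn s T else (ksgn s T :: 'a::comm_ring_1))"
proof (cases "t < s")
 case True
 then have "{x : insert t T. x < s} = insert t {x\<in>T. x < s}" by auto
 then show ?thesis using assms True by (simp add: ksgn_def)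
next
 case False
 then have "{x : insert t T. x < s} = {x\<in>T. x < s}" by auto
 then show ?thesis using assms False by (simp add: ksgn_def)
qed

lemma ksgn_swap:
 assumes "finite T" "s \<notin> T" "t \<notin> T" "s ~= t"
 shows "ksgn s T * ksgn t (insert s T) = - (ksgn t T * ksgn s (insert t T) :: 'a::comm_ring_1)"
 using assms by (auto simp: ksgn_insert)

lemma ksgn_remove:
 assumes "finite T" "s : T" "t \<notin> T"
 shows "ksgn t T * ksgn s (insert t T - {s}) = - (ksgn s (T - {s}) * ksgn t (T - {s}) :: 'a::comm_ring_1)"
proof -
 let ?U = "T - {s}"
 have U: "finite ?U" "s \<notin> ?U" "t \<notin> ?U" "s ~= t" using assms by auto
 have *: "insert s ?U = T" "insert t T - {s} = insert t ?U" using assms by auto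
 have "ksgn t (insert s ?U) * ksgn s (insert t ?U) = - (ksgn s ?U * ksgn t ?U :: 'a)"
  unfolding ksgn_insert[OF U(1,2), of t] ksgn_insert[OF U(1,3), of s] using U(4)
  by (cases s t rule: linorder_cases) (simp_all add: mult.commute)
 then show ?thesis by (simp only: *)
qed

lemma kdiff_cong: "(!!s. s < m ==> s \<notin> T ==> u (insert s T) = w (insert s T)) ==> kdiff m a u T = kdiff m a w T"
 by (simp add: kdiff_def)

lemma kdiff_add: "kdiff m a (%T. u T + w T) T = kdiff m a u T + kdiff m a w T"
 by (simp add: kdiff_def algebra_simps sum.distrib)

lemma kdiff_diff: "kdiff m a (%T. u T - w T) T = kdiff m a u T - kdiff m a w T"
 by (simp add: kdiff_def algebra_simps sum_subtractf)

lemma kdiff_cmult: "kdiff m a (%T. b * u T) T = b * kdiff m a u T"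
 by (simp add: kdiff_def sum_distrib_left algebra_simps)

lemma kdiff_sum: "kdiff m a (%T. \<Sum>s\<in>Y. u s T) T = (\<Sum>s\<in>Y. kdiff m a (u s) T)"
 by (simp add: kdiff_def sum_distrib_left) (rule sum.swap)

lemma kdiff_kdiff:
 assumes "finite T" shows "kdiff m a (kdiff m a u) T = 0"
proof -
 define f where "f s t = ksgn s T * a s * (ksgn t (insert s T) * a t * u (insert t (insert s T)))" for s t
 let ?D = "{..<m} - T"
 have anti: "f s t = - f t s" if "s : ?D" "t : ?D" "s ~= t" for s t
 proof -
  have "f s t = (ksgn s T * ksgn t (insert s T)) * (a s * a t * u (insert t (insert s T)))"
   by (simp add: f_def algebra_simps)
  also have "... = - (ksgn t T * ksgn s (insert t T)) * (a s * a t * u (insert t (insert s T)))"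
   using that assms by (subst ksgn_swap) auto
  also have "... = - f t s" by (simp add: f_def algebra_simps insert_commute)
  finally show ?thesis .
 qed
 have "kdiff m a (kdiff m a u) T = (\<Sum>s\<in>?D. \<Sum>t\<in>?D - {s}. f s t)"
  unfolding kdiff_def f_def sum_distrib_left by (intro sum.cong refl) auto
 \<comment> \<open>The pairs are split by order because antisymmetry of the double sum alone would
   only show that twice the sum is 0, which is no information in characteristic 2.\<close>
 also have "... = (\<Sum>s\<in>?D. (\<Sum>t\<in>{t\<in>?D. t < s}. f s t) + (\<Sum>t\<in>{t\<in>?D. s < t}. f s t))"
 proof (intro sum.cong refl)
  fix s
  have *: "?D - {s} = {t\<in>?D. t < s} \<union> {t\<in>?D. s < t}" by auto
  show "(\<Sum>t\<in>?D - {s}. f s t) = (\<Sum>t\<in>{t\<in>?D. t < s}. f s t) + (\<Sum>t\<in>{t\<in>?D. s < t}. f s t)"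
   unfolding * by (rule sum.union_disjoint) auto
 qed
 also have "... = (\<Sum>s\<in>?D. \<Sum>t\<in>{t\<in>?D. t < s}. f s t) + (\<Sum>s\<in>?D. \<Sum>t\<in>{t\<in>?D. s < t}. f s t)"
  by (rule sum.distrib)
 also have "(\<Sum>s\<in>?D. \<Sum>t\<in>{t\<in>?D. t < s}. f s t) = (\<Sum>t\<in>?D. \<Sum>s\<in>{s\<in>?D. t < s}. f s t)"
  by (rule sum.swap_restrict) auto
 also have "... = (\<Sum>t\<in>?D. \<Sum>s\<in>{s\<in>?D. t < s}. - f t s)"
  by (intro sum.cong refl anti) auto
 finally show ?thesis by (simp add: sum_negf)
qed

text \<open>Contraction is an antiderivation. Consequently exterior multiplication by a generator is
  a homotopy between multiplication by \<open>a s\<close> and zero, and every \<open>a s\<close>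
  annihilates Koszul homology.\<close>

lemma kdiff_kwedge:
 assumes "finite T" "s < m"
 shows "kdiff m a (kwedge s u) T + kwedge s (kdiff m a u) T = a s * u T"
proof (cases "s : T")
 case False
 have "kdiff m a (kwedge s u) T = (\<Sum>t\<in>{..<m} - T. if t = s then a s * u T else 0)"
  unfolding kdiff_def
 proof (intro sum.cong refl)
  fix t assume t: "t : {..<m} - T"
  show "ksgn t T * a t * kwedge s u (insert t T) = (if t = s then a s * u T else 0)"
  proof (cases "t = s")
   case True
   have "ksgn s T * a s * (ksgn s T * u T) = (ksgn s T * ksgn s T) * (a s * u T)" by (simp only: ac_simps)
   then show ?thesis using True False by (simp add: kwedge_def)
  qed (use False in \<open>auto simp: kwedge_def\<close>)
 qed
 then show ?thesis using False assms by (simp add: kwedge_def)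
next
 case True
 let ?D = "{..<m} - T"
 let ?U = "T - {s}"
 have 1: "kwedge s (kdiff m a u) T = a s * u T + (\<Sum>t\<in>?D. ksgn s ?U * (ksgn t ?U * a t * u (insert t ?U)))"
 proof -
  have "{..<m} - ?U = insert s ?D" using True assms by auto
  then have "kdiff m a u ?U = ksgn s ?U * a s * u (insert s ?U) + (\<Sum>t\<in>?D. ksgn t ?U * a t * u (insert t ?U))"
   using True by (simp add: kdiff_def)
  moreover have "insert s ?U = T" using True by auto
  ultimately have "kwedge s (kdiff m a u) T =
   ksgn s ?U * (ksgn s ?U * a s * u T) + (\<Sum>t\<in>?D. ksgn s ?U * (ksgn t ?U * a t * u (insert t ?U)))"
   using True by (simp add: kwedge_def distrib_left sum_distrib_left)
  moreover have "ksgn s ?U * (ksgn s ?U * a s * u T) = (ksgn s ?U * ksgn s ?U) * (a s * u T)"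
   by (simp only: ac_simps)
  ultimately show ?thesis by simp
 qed
 have "kdiff m a (kwedge s u) T = (\<Sum>t\<in>?D. - (ksgn s ?U * (ksgn t ?U * a t * u (insert t ?U))))"
  unfolding kdiff_def
 proof (intro sum.cong refl)
  fix t assume t: "t : ?D"
  have *: "insert t T - {s} = insert t ?U" using t True by auto
  have "ksgn t T * a t * kwedge s u (insert t T)
   = (ksgn t T * ksgn s (insert t T - {s})) * (a t * u (insert t ?U))"
   using True t by (simp add: kwedge_def * ac_simps)
  also have "... = - (ksgn s ?U * (ksgn t ?U * a t * u (insert t ?U)))"
   using True t assms(1) by (subst ksgn_remove) (auto simp: ac_simps)
  finally show "ksgn t T * a t * kwedge s u (insert t T) = - (ksgn s ?U * (ksgn t ?U * a t * u (insert t ?U)))" .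
 qed
 then show ?thesis using 1 by (simp add: sum_negf)
qed

section \<open>Acyclicity of the Koszul complex of an ideal that contains a regular sequence\<close>

definition ksub :: "nat => nat => nat set set" where
 "ksub m i = {T. T \<subseteq> {..<m} & card T = i}"

lemma ksub_finite: "T : ksub m i ==> finite T"
 by (auto simp: ksub_def finite_subset)

lemma ksub_insert: "T : ksub m i ==> s < m ==> s \<notin> T ==> insert s T : ksub m (Suc i)"
 using ksub_finite[of T m i] by (auto simp: ksub_def)

lemma ksub_remove: "T : ksub m (Suc i) ==> s : T ==> T - {s} : ksub m i"
 using ksub_finite[of T m "Suc i"] by (auto simp: ksub_def)

lemma ksub_empty: "m < i ==> ksub m i = {}"
 by (auto simp: ksub_def dest!: card_mono[OF finite_lessThan])

locale subring =
 fixes R :: "'a::comm_ring_1 set"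
 assumes one: "1 : R" and add: "p : R ==> q : R ==> p + q : R"
  and mult: "p : R ==> q : R ==> p * q : R" and uminus: "p : R ==> - p : R"
begin

lemma zero: "0 : R"
 using add[OF one uminus[OF one]] by simp

lemma diff: "p : R ==> q : R ==> p - q : R"
 using add[of p "-q"] uminus[of q] by simp

lemma sum: "(!!x. x : Y ==> f x : R) ==> sum f Y : R"
 by (induction Y rule: infinite_finite_induct) (auto intro: add zero)

lemma power: "p : R ==> p ^ n : R"
 by (induction n) (auto intro: mult one)

lemma prod: "(!!x. x : Y ==> f x : R) ==> prod f Y : R"
 by (induction Y rule: infinite_finite_induct) (auto intro: mult one)

lemma ksgn: "ksgn s T : R"
 unfolding ksgn_def by (intro power uminus one)

lemma kdiff_ideal:
 assumes J: "0 : J" "!!p q. p : J ==> q : J ==> p + q : J" "!!p q. p : R ==> q : J ==> p * q : J"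
  and a: "!!s. s < m ==> a s : R" and u: "!!T. T : ksub m (Suc i) ==> u T : J" and T: "T : ksub m i"
 shows "kdiff m a u T : J"
proof -
 have *: "sum f Y : J" if "!!x. x : Y ==> f x : J" for f and Y :: "nat set"
  using that by (induction Y rule: infinite_finite_induct) (auto intro: J)
 show ?thesis unfolding kdiff_def
  by (intro * J(3) mult ksgn a u ksub_insert[OF T]) auto
qed

text \<open>Depth sensitivity: an ideal \<open>(a\<^sub>0,\<dots>)\<close> containing a regular sequence \<open>y\<^sub>0,...,y\<^bsub>n-1\<^esub>\<close> of length at least
 the number of the \<open>a\<^sub>s\<close> has an acyclic Koszul complex.  The induction goes down from \<open>l = n\<close> and
 compares homology modulo \<open>J\<^bsub>l+1\<^esub> = J\<^sub>l + (y\<^sub>l)\<close> with homology modulo \<open>J\<^sub>l\<close>, using that \<open>y\<^sub>l\<close> kills the latter.\<close>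

lemma koszul_acyclic_mod:
 assumes a: "!!s. s < m ==> a s : R" and mn: "m \<le> n"
  and y: "!!l. l < n ==> EX c. (\<forall>s<m. c s : R) & y l = (\<Sum>s<m. c s * a s)"
  and J_R: "!!l. J l \<subseteq> R" and J0: "!!l. 0 : J l" and J_add: "!!l p q. p : J l ==> q : J l ==> p + q : J l"
  and J_mult: "!!l p q. p : R ==> q : J l ==> p * q : J l"
  and J_Suc: "!!l p. l < n ==> p : J (Suc l) \<longleftrightarrow> (\<exists>p1\<in>J l. \<exists>p2\<in>R. p = p1 + y l * p2)"
  and reg: "!!l p. l < n ==> p : R ==> y l * p : J l ==> p : J l"
  and l: "l \<le> n" and i: "l \<le> i"
  and u: "!!T. T : ksub m (Suc i) ==> u T : R" and du: "!!T. T : ksub m i ==> kdiff m a u T : J l"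
 shows "EX w. (\<forall>T\<in>ksub m (Suc (Suc i)). w T : R) & (\<forall>T\<in>ksub m (Suc i). u T - kdiff m a w T : J l)"
 using l i u du
proof (induction l arbitrary: i u rule: inc_induct)
 \<comment> \<open>At \<open>l = n\<close> one has \<open>m \<le> n \<le> i\<close>, so there are no
   subsets of size \<open>Suc i\<close> and nothing has to be shown.\<close>
 case base
 then show ?case using ksub_empty[of m "Suc i"] ksub_empty[of m "Suc (Suc i)"] mn by auto
next
 case (step l)
 note ideal = kdiff_ideal[where J = "J l", OF J0 J_add J_mult a]
 obtain c where c: "!!s. s < m ==> c s : R" "y l = (\<Sum>s<m. c s * a s)" using y[OF step.hyps(2)] by auto
 have J_sum: "sum f Y : J l" if "!!x. x : Y ==> f x : J l" for f and Y :: "nat set"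
  using that by (induction Y rule: infinite_finite_induct) (auto intro: J0 J_add)
 have J_diff: "p - q : J l" if "p : J l" "q : J l" for p q
  using J_add[OF that(1) J_mult[OF uminus[OF one] that(2)]] by simp
 \<comment> \<open>Exterior multiplication by the element with coefficients \<open>c\<close> is a
   homotopy from multiplication by \<open>y l\<close> to zero, because \<open>y l\<close> is the
   combination of the \<open>a s\<close> with these coefficients. Since the boundary of
   \<open>u\<close> lies in \<open>J l\<close>, the boundary of \<open>v\<close> is
   \<open>y l * u\<close> modulo \<open>J l\<close>.\<close>
 define v where "v T = (\<Sum>s<m. c s * kwedge s u T)" for T
 have wedge: "kwedge s w T : K" if "!!T. T : ksub m j ==> w T : K" "T : ksub m (Suc j)" "0 : K"
  "!!p. p : K ==> ksgn s (T - {s}) * p : K" for w T K s j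
  using that ksub_remove[OF that(2)] by (auto simp: kwedge_def)
 have vR: "v T : R" if "T : ksub m (Suc (Suc i))" for T
  unfolding v_def using that by (intro sum mult c wedge[of "Suc i" u] step.prems zero ksgn) auto
 have kv: "y l * u T - kdiff m a v T : J l" if T: "T : ksub m (Suc i)" for T
 proof -
  have "y l * u T - kdiff m a v T = (\<Sum>s<m. c s * (a s * u T - kdiff m a (kwedge s u) T))"
  proof -
   have "kdiff m a v T = (\<Sum>s<m. c s * kdiff m a (kwedge s u) T)"
   by (simp add: v_def[abs_def] kdiff_sum kdiff_cmult)
   then show ?thesis by (simp add: c(2) sum_distrib_right mult.assoc right_diff_distrib sum_subtractf)
  qed
  also have "... = (\<Sum>s<m. c s * kwedge s (kdiff m a u) T)"
   using kdiff_kwedge[OF ksub_finite[OF T], where a = a and u = u]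
   by (intro sum.cong refl arg_cong2[where f = "(*)"]) (simp add: diff_eq_eq add.commute)
  also have "... : J l"
   using T by (intro J_sum J_mult c wedge[of i "kdiff m a u"] step.prems J0 ksgn) auto
  finally show ?thesis .
 qed
 \<comment> \<open>Modulo \<open>J (Suc l)\<close> the multiple \<open>y l * u\<close> vanishes, so
   \<open>v\<close> is a cycle one level higher; raising the level together with \<open>l\<close>
   keeps the condition \<open>l \<le> i\<close>.\<close>
 have "kdiff m a v T : J (Suc l)" if T: "T : ksub m (Suc i)" for T
  unfolding J_Suc[OF step.hyps(2)]
  using J_mult[OF uminus[OF one] kv[OF T]] step.prems(2)[OF T]
  by (intro bexI[of _ "- (y l * u T - kdiff m a v T)"] bexI[of _ "u T"]) auto
 from step.IH[of "Suc i" v, OF _ vR this] step.prems(1)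
 obtain w where w: "!!T. T : ksub m (Suc (Suc (Suc i))) ==> w T : R"
  "!!T. T : ksub m (Suc (Suc i)) ==> v T - kdiff m a w T : J (Suc l)" by auto
 then have "EX j z. T : ksub m (Suc (Suc i)) --> j : J l & z : R & v T - kdiff m a w T = j + y l * z" for T
  using J_Suc[OF step.hyps(2)] by meson
 then obtain j z where jz: "!!T. T : ksub m (Suc (Suc i)) ==>
   j T : J l & z T : R & v T - kdiff m a w T = j T + y l * z T"
  by metis
 \<comment> \<open>The coefficient \<open>z\<close> of \<open>y l\<close> in
   \<open>v - kdiff m a w\<close> is the primitive sought: applying the differential and comparing
   with the boundary of \<open>v\<close> gives the claim multiplied by \<open>y l\<close>, which
   regularity cancels.\<close>
 have "u T - kdiff m a z T : J l" if T: "T : ksub m (Suc i)" for T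
 proof (rule reg[OF step.hyps(2)])
  have "kdiff m a z T : R"
   by (rule kdiff_ideal[where J = R and i = "Suc i", OF zero add mult a _ T]) (use jz in auto)
  then show "u T - kdiff m a z T : R" using step.prems(2)[OF T] by (rule diff[rotated])
  have "kdiff m a (%T. v T - kdiff m a w T) T = kdiff m a (%T. j T + y l * z T) T"
   by (rule kdiff_cong) (use jz ksub_insert[OF T] in auto)
  then have "kdiff m a v T = kdiff m a j T + y l * kdiff m a z T"
   by (simp add: kdiff_diff kdiff_add kdiff_cmult kdiff_kdiff[OF ksub_finite[OF T]])
  then have "y l * (u T - kdiff m a z T) = (y l * u T - kdiff m a v T) + kdiff m a j T"
   by (simp add: algebra_simps)
  moreover have "kdiff m a j T : J l"
   by (rule ideal[where i = "Suc i"]) (use jz T in auto)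
  ultimately show "y l * (u T - kdiff m a z T) : J l" using kv[OF T] J_add by simp
 qed
 then show ?case using jz by blast
qed

end

lemma subring_mpol_ring: "subring (mpol_ring I)"
 by unfold_locales (auto intro: mpol_ring_add mpol_ring_mult mpol_ring_uminus)

lemma lookup_single_mult: "lk (sg m a * p) (m + m') = a * lk p (m' :: 'x \<Rightarrow>\<^sub>0 nat)"
proof (induction p rule: poly_mapping_induct)
 case (single m'' b)
 then show ?case by (simp add: mult_single lookup_single when_def)
qed (simp_all add: distrib_left lookup_add)

lemma keys_single_mult: "ky (sg m (1::'k::field) * p) = (+) m ` ky (p :: ('x,'k) mpol)"
proof
 show "ky (sg m 1 * p) \<subseteq> (+) m ` ky p" using keys_mult[of "sg m 1" p] by auto
 show "(+) m ` ky p \<subseteq> ky (sg m 1 * p)" by (auto simp: in_keys_iff lookup_single_mult)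
qed

text \<open>The regular sequence consists of the \<open>r\<close>-th powers of all variables, and
  \<open>J l\<close> is the monomial ideal generated by the first \<open>l\<close> of them.
  Membership and regularity can then be tested on single monomials, and \<open>J 0\<close> is the
  zero ideal.\<close>

lemma koszul_acyclic_mpol:
 fixes a :: "nat => ('x,'k::field) mpol"
 assumes x: "bij_betw x {..<n} I" and m: "m \<le> n" and a: "!!s. s < m ==> a s : mpol_ring I"
  and y: "!!j. j < n ==> EX c. (\<forall>s<m. c s : mpol_ring I) & mvar (x j) ^ r = (\<Sum>s<m. c s * a s)"
  and u: "!!T. T : ksub m (Suc i) ==> u T : mpol_ring I" and du: "!!T. T : ksub m i ==> kdiff m a u T = 0"
 shows "EX w. (\<forall>T\<in>ksub m (Suc (Suc i)). w T : mpol_ring I) & (\<forall>T\<in>ksub m (Suc i). u T = kdiff m a w T)"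
proof -
 interpret subring "mpol_ring I :: ('x,'k) mpol set" by (rule subring_mpol_ring)
 define J :: "nat => ('x,'k) mpol set" where
  "J l = {p : mpol_ring I. \<forall>\<mu>\<in>ky p. \<exists>j<l. r \<le> lk \<mu> (x j)}" for l
 have inj: "x i = x j \<longleftrightarrow> i = j" if "i < n" "j < n" for i j
  using that x by (auto simp: bij_betw_def inj_on_def)
 have xI: "x i : I" if "i < n" for i using that x by (auto simp: bij_betw_def)
 have yl: "mvar (x l) ^ r = (sg (sg (x l) r) 1 :: ('x,'k) mpol)" for l
  using mon_mvar[of "sg (x l) r"] by simp
 have "EX w. (\<forall>T\<in>ksub m (Suc (Suc i)). w T : mpol_ring I) & (\<forall>T\<in>ksub m (Suc i). u T - kdiff m a w T : J 0)"
 proof (rule koszul_acyclic_mod[where y = "%l. mvar (x l) ^ r" and J = J, OF a m y _ _ _ _ _ _ _ _ u])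
  show "J l \<subseteq> mpol_ring I" for l by (auto simp: J_def)
  show 0: "0 : J l" for l by (simp add: J_def)
  show add': "p + q : J l" if "p : J l" "q : J l" for p q l
   using that keys_add[of p q] by (auto simp: J_def intro: add)
  show mult': "p * q : J l" if "p : mpol_ring I" "q : J l" for p q l
  proof -
   have "\<exists>j<l. r \<le> lk (\<mu> + \<nu>) (x j)" if "\<mu> : ky p" "\<nu> : ky q" for \<mu> \<nu>
   using that \<open>q : J l\<close> unfolding J_def lookup_add by (auto intro: trans_le_add2)
   then have "\<forall>\<mu>\<in>ky (p * q). \<exists>j<l. r \<le> lk \<mu> (x j)" using keys_mult[of p q] by blast
   then show ?thesis using that by (auto simp: J_def intro!: mult)
  qed
  show "p : J (Suc l) \<longleftrightarrow> (\<exists>p1\<in>J l. \<exists>p2\<in>mpol_ring I. p = p1 + mvar (x l) ^ r * p2)" if l: "l < n" for l p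
  proof
   assume p: "p : J (Suc l)"
   \<comment> \<open>The monomials already divisible by one of the earlier powers go into
     \<open>p1\<close>; every other one is divisible by the \<open>r\<close>-th power of the
     variable \<open>x l\<close>.\<close>
   define p1 where "p1 = (\<Sum>\<mu>\<in>{\<mu>\<in>ky p. \<exists>j<l. r \<le> lk \<mu> (x j)}. sg \<mu> (lk p \<mu>))"
   define M2 where "M2 = {\<mu>\<in>ky p. \<not> (\<exists>j<l. r \<le> lk \<mu> (x j))}"
   define p2 where "p2 = (\<Sum>\<mu>\<in>M2. sg (\<mu> - sg (x l) r) (lk p \<mu>))"
   have M2: "sg (x l) r + (\<mu> - sg (x l) r) = \<mu>" "\<mu> : ky p" if "\<mu> : M2" for \<mu>
   proof -
   have "\<exists>j<Suc l. r \<le> lk \<mu> (x j)" "\<not> (\<exists>j<l. r \<le> lk \<mu> (x j))" using that p by (auto simp: M2_def J_def)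
   then have "r \<le> lk \<mu> (x l)" using less_Suc_eq by auto
   then show "sg (x l) r + (\<mu> - sg (x l) r) = \<mu>"
   by (intro poly_mapping_eqI) (auto simp: lookup_add lookup_minus lookup_single when_def)
   show "\<mu> : ky p" using that by (simp add: M2_def)
   qed
   have kI: "ky \<mu> \<subseteq> I" if "\<mu> : ky p" for \<mu> using that p by (auto simp: J_def mpol_ring_def)
   have "p1 : J l"
   proof -
   have "sum f Y : J l" if "!!x. x : Y ==> f x : J l" for f and Y :: "('x \<Rightarrow>\<^sub>0 nat) set"
   using that by (induction Y rule: infinite_finite_induct) (auto intro: 0 add')
   note Js = this
   show ?thesis unfolding p1_def
   by (rule Js) (use kI in \<open>auto simp: J_def intro!: mpol_ring_single\<close>)
   qed
   moreover have "p2 : mpol_ring I"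
   unfolding p2_def
   proof (intro sum mpol_ring_single)
   fix \<mu> assume "\<mu> : M2"
   have "ky (\<mu> - sg (x l) r) \<subseteq> ky \<mu>" by (auto simp: in_keys_iff lookup_minus)
   then show "ky (\<mu> - sg (x l) r) \<subseteq> I" using kI M2(2)[OF \<open>\<mu> : M2\<close>] by auto
   qed
   moreover have "p = p1 + mvar (x l) ^ r * p2"
   proof -
   have "mvar (x l) ^ r * p2 = (\<Sum>\<mu>\<in>M2. sg \<mu> (lk p \<mu>))"
   unfolding p2_def yl sum_distrib_left mult_single by (intro sum.cong) (auto simp: M2)
   moreover have "ky p = {\<mu>\<in>ky p. \<exists>j<l. r \<le> lk \<mu> (x j)} \<union> M2" by (auto simp: M2_def)
   then have "(\<Sum>\<mu>\<in>ky p. sg \<mu> (lk p \<mu>)) = p1 + (\<Sum>\<mu>\<in>M2. sg \<mu> (lk p \<mu>))"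
   unfolding p1_def by (subst sum.union_disjoint[symmetric]) (auto simp: M2_def)
   ultimately show ?thesis by (simp flip: sum_monomials)
   qed
   ultimately show "\<exists>p1\<in>J l. \<exists>p2\<in>mpol_ring I. p = p1 + mvar (x l) ^ r * p2" by auto
  next
   assume "\<exists>p1\<in>J l. \<exists>p2\<in>mpol_ring I. p = p1 + mvar (x l) ^ r * p2"
   then obtain p1 p2 where p: "p1 : J l" "p2 : mpol_ring I" "p = p1 + mvar (x l) ^ r * p2" by auto
   have "p1 : J (Suc l)" using p(1) by (auto simp: J_def less_Suc_eq)
   moreover have "mvar (x l) ^ r : J (Suc l)"
   unfolding yl using xI[OF l] by (auto simp: J_def intro!: mpol_ring_single split: if_splits)
   ultimately show "p : J (Suc l)" using mult'[OF p(2), of "mvar (x l) ^ r"] by (auto simp: p(3) mult.commute intro: add')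
  qed
  show "p : J l" if l: "l < n" "p : mpol_ring I" "mvar (x l) ^ r * p : J l" for l p
   unfolding J_def
  proof safe
   fix \<mu> assume "\<mu> : ky p"
   then have "sg (x l) r + \<mu> : ky (mvar (x l) ^ r * p)" by (simp add: yl keys_single_mult)
   then obtain j where j: "j < l" "r \<le> lk (sg (x l) r + \<mu>) (x j)" using l by (auto simp: J_def)
   then have "x j ~= x l" using inj[of j l] l(1) by simp
   then show "\<exists>j<l. r \<le> lk \<mu> (x j)" using j by (auto simp: lookup_add lookup_single when_def)
  qed (use that in auto)
  show "kdiff m a u T : J 0" if "T : ksub m i" for T using du[OF that] 0 by simp
 qed auto
 moreover have "J 0 = {0}" by (auto simp: J_def)
 ultimately show ?thesis by (auto simp: algebra_simps)
qed

section \<open>Homogeneous generators of a graded polynomial subalgebra\<close>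

interpretation mvs: vector_space "%a p. mconst a * (p :: ('x,'k::field) mpol)"
 by (rule vector_space_mpol)

section \<open>Lowest-degree forms and substitutions tangent to the identity\<close>

definition ordge :: "nat => ('x,'k::field) mpol => bool" where
 "ordge d p \<longleftrightarrow> (\<forall>\<mu>\<in>ky p. d \<le> mdeg \<mu>)"

lemma ordge_iff: "ordge d p \<longleftrightarrow> (\<forall>e<d. hcomp e p = 0)"
proof
 assume p: "ordge d p"
 show "\<forall>e<d. hcomp e p = 0"
 proof (intro allI impI poly_mapping_eqI)
  fix e \<mu> assume "e < d"
  then show "lk (hcomp e p) \<mu> = lk 0 \<mu>"
   using p by (cases "\<mu> : ky p") (auto simp: ordge_def lookup_hcomp when_def not_in_keys_iff_lookup_eq_zero)
 qed
next
 assume p: "\<forall>e<d. hcomp e p = 0"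
 show "ordge d p" unfolding ordge_def
 proof (rule ballI, rule ccontr)
  fix \<mu> assume "\<mu> : ky p" "\<not> d \<le> mdeg \<mu>"
  then have "lk (hcomp (mdeg \<mu>) p) \<mu> = 0" using p by simp
  then show False using \<open>\<mu> : ky p\<close> by (simp add: lookup_hcomp in_keys_iff)
 qed
qed

lemma ordge_add: "ordge d p ==> ordge d q ==> ordge d (p + q)"
 using keys_add[of p q] by (auto simp: ordge_def)

lemma ordge_mult: "ordge d p ==> ordge e q ==> ordge (d + e) (p * q)"
 unfolding ordge_def using keys_mult[of p q] by (fastforce simp: wdeg_add intro: add_mono)

lemma ordge_mono: "ordge d p ==> e \<le> d ==> ordge e p"
 by (auto simp: ordge_def)

definition same_lead :: "nat => ('x,'k::field) mpol => ('x,'k) mpol => bool" where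
 "same_lead d p q \<longleftrightarrow> ordge d p & ordge d q & ordge (Suc d) (p - q)"

lemma same_lead_mult:
 assumes "same_lead d p q" "same_lead e p' q'" shows "same_lead (d + e) (p * p') (q * q')"
proof -
 have "p * p' - q * q' = (p - q) * p' + q * (p' - q')" by (simp add: algebra_simps)
 moreover have "ordge (Suc (d + e)) ((p - q) * p')" "ordge (Suc (d + e)) (q * (p' - q'))"
  using ordge_mult[of "Suc d" "p - q" e p'] ordge_mult[of d q "Suc e" "p' - q'"] assms
  by (auto simp: same_lead_def)
 ultimately show ?thesis using assms by (auto simp: same_lead_def intro: ordge_mult ordge_add)
qed

lemma same_lead_1: "same_lead 0 1 1"
 by (simp add: same_lead_def ordge_def)

lemma same_lead_mon:
 assumes "!!x. x : ky \<mu> ==> same_lead 1 (s x) (t x)" shows "same_lead (mdeg \<mu>) (mon s \<mu>) (mon t \<mu>)"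
proof -
 have pw: "same_lead n (s x ^ n) (t x ^ n)" if "x : ky \<mu>" for x n
  by (induction n) (use same_lead_1 same_lead_mult[OF assms[OF that]] in auto)
 have "same_lead (\<Sum>x\<in>Y. lk \<mu> x) (\<Prod>x\<in>Y. s x ^ lk \<mu> x) (\<Prod>x\<in>Y. t x ^ lk \<mu> x)" if "finite Y" "Y \<subseteq> ky \<mu>" for Y
  using that by (induction Y rule: finite_induct) (auto intro!: same_lead_mult same_lead_1 pw)
 then show ?thesis by (simp add: mon_def wdeg_def)
qed

text \<open>A substitution tangent to the identity is injective, since it preserves lowest-degree forms.\<close>

lemma msubst_tangent_inj:
 fixes s :: "'x => ('x,'k::field) mpol"
 assumes s: "!!x. x : I ==> same_lead 1 (s x) (mvar x)" and q: "q : mpol_ring I" and 0: "msubst s q = 0"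
 shows "q = 0"
proof (rule ccontr)
 assume "q ~= 0"
 then have "EX d. hcomp d q ~= 0" using hcomp_eqI[of q 0] by auto
 define D where "D = (LEAST d. hcomp d q ~= 0)"
 have D: "hcomp D q ~= 0" unfolding D_def by (rule LeastI_ex) fact
 have less: "hcomp d q = 0" if "d < D" for d using not_less_Least that unfolding D_def by auto
 have "hcomp D (msubst s q) = (\<Sum>\<mu>\<in>ky q. hcomp D (mconst (lk q \<mu>) * mon s \<mu>))"
  by (simp add: msubst_ins ins_def hcomp_sum)
 also have "... = (\<Sum>\<mu>\<in>ky q. hcomp D (sg \<mu> (lk q \<mu>)))"
 proof (intro sum.cong refl)
  fix \<mu> assume \<mu>: "\<mu> : ky q"
  have "D \<le> mdeg \<mu>"
  proof (rule ccontr)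
   assume "\<not> D \<le> mdeg \<mu>"
   then have "lk (hcomp (mdeg \<mu>) q) \<mu> = 0" by (simp add: less)
   then show False using \<mu> by (simp add: lookup_hcomp in_keys_iff)
  qed
  have "same_lead (mdeg \<mu>) (mon s \<mu>) (mon mvar \<mu>)"
   by (rule same_lead_mon, rule s) (use q \<mu> in \<open>auto simp: mpol_ring_def\<close>)
  then have "ordge (Suc D) (mon s \<mu> - mon mvar \<mu>)"
   using \<open>D \<le> mdeg \<mu>\<close> by (auto simp: same_lead_def intro: ordge_mono)
  then have "hcomp D (mon s \<mu> - mon mvar \<mu>) = 0"
   by (simp add: ordge_iff)
  then have "hcomp D (mon s \<mu>) = hcomp D (mon mvar \<mu>)" by (simp add: hcomp_diff)
  then show "hcomp D (mconst (lk q \<mu>) * mon s \<mu>) = hcomp D (sg \<mu> (lk q \<mu>))"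
   by (simp add: hcomp_mconst_mult sg_mon)
 qed
 also have "... = hcomp D q" by (simp flip: hcomp_sum sum_monomials)
 finally show False using 0 D by simp
qed

text \<open>Describes the square of the ideal of polynomials without constant term. The cofactors
  again have no constant term; this is what later lets a product in a graded algebra be broken into
  factors of smaller degree.\<close>

lemma mpol_order_two_decomp:
 fixes q :: "(nat,'k::field) mpol"
 assumes q: "q : mpol_ring {..<m}" "hcomp 0 q = 0" "hcomp 1 q = 0"
 shows "EX r. (ALL j. r j : mpol_ring {..<m} & lk (r j) 0 = 0) & q = (\<Sum>j<m. mvar j * r j)"
proof -
 let ?P = "%q :: (nat,'k) mpol. EX r. (ALL j. r j : mpol_ring {..<m} & lk (r j) 0 = 0) & q = (\<Sum>j<m. mvar j * r j)"
 have add: "?P (p + p')" if "?P p" "?P p'" for p p'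
 proof -
  from that obtain r r' where "ALL j. r j : mpol_ring {..<m} & lk (r j) 0 = 0" "p = (\<Sum>j<m. mvar j * r j)"
   "ALL j. r' j : mpol_ring {..<m} & lk (r' j) 0 = 0" "p' = (\<Sum>j<m. mvar j * r' j)" by auto
  then show ?thesis
   by (intro exI[of _ "%j. r j + r' j"]) (auto simp: distrib_left sum.distrib lookup_add intro: mpol_ring_add)
 qed
 have zero: "?P 0" by (rule exI[of _ "%_. 0"]) simp
 have mono: "?P (sg \<mu> a)" if \<mu>: "\<mu> : ky q" for \<mu> a
 proof -
  have "mdeg \<mu> ~= 0" "mdeg \<mu> ~= 1"
  proof -
   have "mdeg \<mu> ~= d" if "hcomp d q = 0" for d
   using \<mu> arg_cong[OF that, of "%p. lk p \<mu>"] by (auto simp: lookup_hcomp in_keys_iff when_def split: if_splits)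
   then show "mdeg \<mu> ~= 0" "mdeg \<mu> ~= 1" using q by auto
  qed
  then have "ky \<mu> ~= {}" by (auto simp: wdeg_def)
  then obtain j where j: "j : ky \<mu>" by blast
  define \<nu> where "\<nu> = \<mu> - sg j 1"
  have \<mu>\<nu>: "\<mu> = sg j 1 + \<nu>"
   using j by (intro poly_mapping_eqI) (auto simp: \<nu>_def lookup_add lookup_minus lookup_single when_def in_keys_iff)
  have "\<nu> ~= 0" using \<open>mdeg \<mu> ~= 1\<close> by (auto simp: \<mu>\<nu>)
  have kI: "ky \<mu> \<subseteq> {..<m}" using q(1) \<mu> by (auto simp: mpol_ring_def)
  have "j < m" using j kI by auto
  have "sg \<mu> a = mvar j * sg \<nu> a" by (simp add: mvar_def mult_single \<mu>\<nu>)
  then have "sg \<mu> a = (\<Sum>i<m. mvar i * (if i = j then sg \<nu> a else 0))"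
   using \<open>j < m\<close> by (simp add: if_distrib[of "(*) _"] cong: if_cong)
  moreover have "ky \<nu> \<subseteq> {..<m}" using kI by (auto simp: \<mu>\<nu> keys_add_nat)
  ultimately show ?thesis using \<open>\<nu> ~= 0\<close>
   by (intro exI[of _ "%i. if i = j then sg \<nu> a else 0"]) (auto simp: lookup_single intro: mpol_ring_single)
 qed
 show ?thesis by (rule poly_mapping_induct[of ?P q]) (use zero mono add in auto)
qed

lemma lookup_mvar: "lk (mvar x) \<mu> = (1 when sg x 1 = \<mu>)"
 by (simp add: mvar_def lookup_single)

lemma lookup_0_mvar [simp]: "lk (mvar x) 0 = 0"
 by (metis homogeneous_mvar lookup_0_homogeneous zero_less_one)

lemma lookup_0_mconst [simp]: "lk (mconst a) 0 = a"
 by (simp add: mconst_def)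

text \<open>Matrix multiplication in terms of substitutions. It is used for the change of generators
  and for the action of a composite of linear maps.\<close>

lemma msubst_linear:
 "msubst (%i. \<Sum>t\<in>T. mconst (N i t) * mvar t) (\<Sum>i\<in>S. mconst (c i) * mvar i)
  = (\<Sum>t\<in>T. mconst (\<Sum>i\<in>S. c i * N i t) * mvar t)"
proof -
 have "msubst (%i. \<Sum>t\<in>T. mconst (N i t) * mvar t) (\<Sum>i\<in>S. mconst (c i) * mvar i)
  = (\<Sum>i\<in>S. \<Sum>t\<in>T. mconst (c i * N i t) * mvar t)"
  by (simp only: msubst_simps(8) msubst_mconst_mult msubst_mvar sum_distrib_left mconst_simps(3) mult.assoc)
 then show ?thesis
  by (subst (asm) sum.swap) (simp only: mconst_simps(8) sum_distrib_right)
qed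

lemma sg_1_eq: "sg i (Suc 0) = sg j (Suc 0) \<longleftrightarrow> i = j"
 by (metis lookup_single_eq lookup_single_not_eq nat.distinct(1))

lemma homogeneous_1_decomp:
 fixes q :: "(nat,'k::field) mpol"
 assumes q: "q : mpol_ring {..<m}" "hmg 1 q"
 shows "q = (\<Sum>i<m. mconst (lk q (sg i 1)) * mvar i)"
proof (rule poly_mapping_eqI)
 fix \<mu> :: "nat \<Rightarrow>\<^sub>0 nat"
 have R: "lk (\<Sum>i<m. mconst (lk q (sg i 1)) * mvar i) \<mu> = (\<Sum>i<m. lk q (sg i 1) when sg i 1 = \<mu>)"
  by (auto simp: lookup_sum lookup_mconst_mult lookup_mvar when_def intro!: sum.cong)
 show "lk q \<mu> = lk (\<Sum>i<m. mconst (lk q (sg i 1)) * mvar i) \<mu>"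
 proof (cases "\<exists>i<m. \<mu> = sg i 1")
  case True
  then obtain i where "i < m" "\<mu> = sg i 1" by auto
  then show ?thesis unfolding R by (simp add: sg_1_eq when_def)
 next
  case False
  have "\<mu> \<notin> ky q"
  proof
   assume \<mu>: "\<mu> : ky q"
   then have d: "mdeg \<mu> = 1" and k: "ky \<mu> \<subseteq> {..<m}" using q by (auto simp: homogeneous_iff mpol_ring_def)
   from d have "ky \<mu> ~= {}" by (auto simp: wdeg_def)
   then obtain j where j: "j : ky \<mu>" by blast
   have "mdeg \<mu> = lk \<mu> j + (\<Sum>x\<in>ky \<mu> - {j}. lk \<mu> x)"
   using j by (simp add: wdeg_def sum.remove)
   moreover have "lk \<mu> j \<ge> 1" using j by (simp add: in_keys_iff)
   ultimately have 1: "lk \<mu> j = 1" "(\<Sum>x\<in>ky \<mu> - {j}. lk \<mu> x) = 0" using d by auto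
   then have "lk \<mu> x = 0" if "x ~= j" for x using that 1(2) by (cases "x : ky \<mu>") (auto simp: not_in_keys_iff_lookup_eq_zero)
   then have "\<mu> = sg j 1" using 1 by (intro poly_mapping_eqI) (auto simp: lookup_single when_def)
   then show False using False j k by auto
  qed
  moreover have "(\<Sum>i<m. lk q (sg i 1) when sg i 1 = \<mu>) = 0"
   using False by (intro sum.neutral) (auto simp: when_def)
  ultimately show ?thesis unfolding R by (simp add: in_keys_iff)
 qed
qed

text \<open>The hypothesis provides generators without any relation to the grading. The augmentation
  ideal modulo its square is a graded space of dimension \<open>m\<close>; lifting a homogeneous
  basis of it gives generators by induction on the degree, as in the graded form of Nakayama's
  lemma. Algebraic independence holds because, after a linear change, the new generators are tangent
  to the old ones.\<close>

lemma homogeneous_generators: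
 fixes A :: "('x,'k::field) mpol set"
 assumes A: "subring A" and const: "!!a. mconst a : A" and graded: "!!p d. p : A ==> hcomp d p : A"
  and poly: "polynomial_algebra A"
 obtains m h dg where "!!s. s < m ==> h s : A" "!!s. s < m ==> hmg (dg s) (h s)"
  "!!s. s < m ==> 0 < dg s" "bij_betw (msubst h) (mpol_ring {..<m :: nat}) A"
proof -
 interpret A: subring A by fact
 obtain m :: nat and f0 where f0: "bij_betw (msubst f0) (mpol_ring {..<m}) A"
  using poly by (auto simp: polynomial_algebra_def)
 let ?Y = "mpol_ring {..<m} :: (nat,'k) mpol set"
 interpret Y: subring ?Y by (rule subring_mpol_ring)
 define c0 where "c0 i = lk (f0 i) 0" for i
 define f where "f i = f0 i - mconst (c0 i)" for i
 have f0A: "f0 i : A" if "i < m" for i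
  using bij_betwE[OF f0] mpol_ring_mvar[of i "{..<m}"] that by (metis lessThan_iff msubst_mvar)
 have fA: "f i : A" if "i < m" for i unfolding f_def using f0A[OF that] const by (rule A.diff)
 have f_const: "lk (f i) 0 = 0" for i by (simp add: f_def c0_def lookup_minus mconst_def)
 \<comment> \<open>Translating the variables is an automorphism of the polynomial ring, so the given
   generators may be replaced by generators without constant term.\<close>
 have f_bij: "bij_betw (msubst f) ?Y A"
 proof -
  define \<sigma> where "\<sigma> = (msubst (%i. mvar i - mconst (c0 i)) :: (nat,'k) mpol => _)"
  define \<tau> where "\<tau> = (msubst (%i. mvar i + mconst (c0 i)) :: (nat,'k) mpol => _)"
  have "\<sigma> (\<tau> p) = p" "\<tau> (\<sigma> p) = p" for p
   by (simp_all add: \<sigma>_def \<tau>_def msubst_msubst msubst_simps msubst_mvar_id)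
  moreover have "\<sigma> p : ?Y" "\<tau> p : ?Y" if "p : ?Y" for p
   unfolding \<sigma>_def \<tau>_def using that
   by (auto intro!: msubst_closed[OF that] Y.add Y.diff Y.mult mpol_ring_mvar)
  ultimately have "bij_betw \<sigma> ?Y ?Y" by (intro bij_betwI[where g = \<tau>]) auto
  then have "bij_betw (msubst f0 o \<sigma>) ?Y A" using f0 by (rule bij_betw_trans)
  moreover have "msubst f0 o \<sigma> = msubst f"
   by (rule ext) (simp add: \<sigma>_def f_def[abs_def] msubst_msubst msubst_simps)
  ultimately show ?thesis by simp
 qed
 define \<psi> where "\<psi> = inv_into ?Y (msubst f)"
 have \<psi>Y: "\<psi> a : ?Y" and f\<psi>: "msubst f (\<psi> a) = a" if "a : A" for a
  using bij_betw_inv_into_right[OF f_bij that] inv_into_into[of a "msubst f" ?Y] f_bij that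
  by (auto simp: \<psi>_def bij_betw_def)
 have \<psi>f: "\<psi> (msubst f q) = q" if "q : ?Y" for q
  using bij_betw_inv_into_left[OF f_bij that] by (simp add: \<psi>_def)
 have mfA: "msubst f q : A" if "q : ?Y" for q using bij_betwE[OF f_bij] that by auto
 have \<psi>I: "\<psi> a = q" if "q : ?Y" "msubst f q = a" for a q using \<psi>f that by auto
 have \<psi>_add: "\<psi> (a + b) = \<psi> a + \<psi> b" if "a : A" "b : A" for a b
  by (rule \<psi>I) (auto simp: that \<psi>Y f\<psi> msubst_simps intro: Y.add)
 have \<psi>_diff: "\<psi> (a - b) = \<psi> a - \<psi> b" if "a : A" "b : A" for a b
  by (rule \<psi>I) (auto simp: that \<psi>Y f\<psi> msubst_simps intro: Y.diff)
 have \<psi>_scale: "\<psi> (mconst c * a) = mconst c * \<psi> a" if "a : A" for a c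
  by (rule \<psi>I) (auto simp: that \<psi>Y f\<psi> msubst_simps intro: Y.mult)
 have \<psi>_0: "\<psi> 0 = 0" by (rule \<psi>I) (auto simp: msubst_simps)
 have \<psi>_sum: "\<psi> (sum g Z) = (\<Sum>z\<in>Z. \<psi> (g z))" if "!!z. z : Z ==> g z : A" for g and Z :: "'z set"
  using that by (induction Z rule: infinite_finite_induct) (auto simp: \<psi>_0 \<psi>_add A.sum)
 have const_f: "lk (msubst f q) 0 = lk q 0" if "q : ?Y" for q
  using that by (induction rule: mpol_ring_induct)
   (simp_all add: msubst_simps lookup_0_simps f_const lookup_0_mvar lookup_0_mconst)
 \<comment> \<open>On elements without constant term, \<open>\<Lambda>\<close> computes the class
   modulo the square of the augmentation ideal, as a linear form in the coordinates given by the
   generators \<open>f\<close>.\<close>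
 define \<Lambda> where "\<Lambda> a = hcomp 1 (\<psi> a)" for a
 have \<Lambda>_f: "\<Lambda> (f i) = mvar i" if "i < m" for i
  using \<psi>f[of "mvar i"] that by (simp add: \<Lambda>_def mpol_ring_mvar hcomp_homogeneous[OF homogeneous_mvar])
 obtain D where D: "!!i \<mu>. i < m ==> \<mu> : ky (f i) ==> mdeg \<mu> < D"
 proof -
  have "ALL i. EX D. \<forall>\<mu>\<in>ky (f i). mdeg \<mu> < D" using hcomp_bound by blast
  then obtain Di where Di: "!!i. \<forall>\<mu>\<in>ky (f i). mdeg \<mu> < Di i" by (auto dest!: choice)
  have "mdeg \<mu> < (\<Sum>i<m. Di i)" if "i < m" "\<mu> : ky (f i)" for i \<mu>
  proof -
   have "mdeg \<mu> < Di i" using Di that by blast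
   also have "Di i \<le> (\<Sum>i<m. Di i)" using that by (intro member_le_sum) auto
   finally show ?thesis .
  qed
  then show ?thesis using that by blast
 qed
 \<comment> \<open>The homogeneous components of the \<open>f i\<close>. Their images under
   \<open>\<Lambda>\<close> span all linear forms, since the components of \<open>f i\<close> add up
   to \<open>f i\<close>, which \<open>\<Lambda>\<close> sends to the \<open>i\<close>-th
   variable.\<close>
 define T where "T = (%(i,d). hcomp d (f i)) ` ({..<m} \<times> {..<D})"
 have TA: "T \<subseteq> A" unfolding T_def using graded fA by auto
 have f_T: "f i = (\<Sum>d<D. hcomp d (f i))" if "i < m" for i
  by (rule hcomp_decomp) (use D that in auto)
 let ?W = "mvar ` {..<m} :: (nat,'k) mpol set"
 obtain B where B: "B \<subseteq> \<Lambda> ` T" "mvs.independent B" "\<Lambda> ` T \<subseteq> mvs.span B"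
  using mvs.maximal_independent_subset by blast
 have W_span: "mvar i : mvs.span B" if "i < m" for i
 proof -
  have "mvar i = (\<Sum>d<D. \<Lambda> (hcomp d (f i)))"
   using \<Lambda>_f[OF that] f_T[OF that] \<psi>_sum[of "{..<D}" "%d. hcomp d (f i)"] graded[OF fA[OF that]]
   by (simp add: \<Lambda>_def hcomp_sum)
  moreover have "\<Lambda> (hcomp d (f i)) : mvs.span B" if "d < D" for d
   using B(3) that \<open>i < m\<close> by (auto simp: T_def)
  ultimately show ?thesis by (auto intro: mvs.span_sum)
 qed
 have B_span: "B \<subseteq> mvs.span ?W"
 proof
  fix b assume "b : B"
  then obtain t where t: "t : A" "b = \<Lambda> t" using B(1) TA by auto
  have "b = (\<Sum>i<m. mconst (lk b (sg i 1)) * mvar i)"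
   unfolding t(2) \<Lambda>_def by (intro homogeneous_1_decomp mpol_ring_hcomp \<psi>Y t(1) homogeneous_hcomp)
  moreover have "(\<Sum>i<m. mconst (lk b (sg i 1)) * mvar i) : mvs.span ?W"
   by (intro mvs.span_sum mvs.span_scale mvs.span_base) auto
  ultimately show "b : mvs.span ?W" by (rule ssubst)
 qed
 have mvar_inj: "inj (mvar :: nat => (nat,'k) mpol)"
 proof (rule injI)
  fix i j assume "(mvar i :: (nat,'k) mpol) = mvar j"
  from arg_cong[OF this, of "%p. lk p (sg i 1)"] show "i = j"
   by (auto simp: lookup_mvar sg_1_eq when_def split: if_splits)
 qed
 have W_indep: "mvs.independent ?W"
 proof (rule mvs.independent_if_scalars_zero)
  fix g w assume g: "(\<Sum>w\<in>?W. mconst (g w) * w) = 0" and "w : ?W"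
  then obtain i where i: "i < m" "w = mvar i" by auto
  have "(\<Sum>w\<in>?W. mconst (g w) * w) = (\<Sum>j<m. mconst (g (mvar j)) * mvar j)"
   by (rule sum.reindex_cong[OF inj_on_subset[OF mvar_inj]]) auto
  then have "lk (\<Sum>j<m. mconst (g (mvar j)) * mvar j) (sg i 1) = 0" using g by simp
  then show "g w = 0" using i
   by (simp add: lookup_sum lookup_mconst_mult lookup_mvar sg_1_eq when_def if_distrib[of "(*) _"] cong: if_cong)
 qed simp
 have finB: "finite B" using B(1) by (rule finite_subset) (simp add: T_def)
 \<comment> \<open>\<open>B\<close> and the variables are bases of the same space, so exactly
   \<open>m\<close> homogeneous elements get selected.\<close>
 have "card B = card ?W"
 proof -
  have "mvs.span B = mvs.span ?W"
   using W_span B_span by (intro equalityI mvs.span_minimal) auto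
  then show ?thesis using mvs.dim_eq_card[OF _ B(2), of ?W] mvs.dim_eq_card[OF _ W_indep, of ?W] by simp
 qed
 also have "card ?W = m" using mvar_inj by (simp add: card_image inj_on_subset)
 finally obtain b where b: "bij_betw b {..<m} B" using finB by (metis bij_betw_from_nat_into_finite ex_bij_betw_nat_finite atLeast0LessThan)
 have "EX t. s < m --> t : T & \<Lambda> t = b s" for s using b B(1) by (fastforce simp: bij_betw_def)
 then obtain h where h: "!!s. s < m ==> h s : T & \<Lambda> (h s) = b s" by metis
 have hA: "h s : A" if "s < m" for s using h[OF that] TA by auto
 have "EX d. s < m --> hmg d (h s) & (\<exists>i<m. h s = hcomp d (f i))" for s
 proof (cases "s < m")
  case True
  then obtain i d where "i < m" "h s = hcomp d (f i)" using h[OF True] by (auto simp: T_def)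
  then show ?thesis by (intro exI[of _ d]) auto
 qed simp
 then obtain dg where dg: "!!s. s < m ==> hmg (dg s) (h s) & (\<exists>i<m. h s = hcomp (dg s) (f i))" by metis
 have h_const: "lk (h s) 0 = 0" if s: "s < m" for s
  using dg[OF s] f_const by (auto simp: lookup_hcomp when_def)
 have dg_pos: "0 < dg s" if s: "s < m" for s
 proof (rule ccontr)
  assume "\<not> 0 < dg s"
  then have "h s = 0" using dg[OF s] homogeneous_0_mconst[of "h s"] h_const[OF s] by (simp add: mconst_simps)
  then have "b s = 0" using h[OF s] by (simp add: \<Lambda>_def \<psi>_0)
  then show False using b B(2) s mvs.dependent_zero by (metis bij_betwE lessThan_iff)
 qed
 have "EX u. i < m --> mvar i = (\<Sum>s<m. mconst (u s) * b s)" for i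
 proof (cases "i < m")
  case True
  obtain u where "mvar i = (\<Sum>v\<in>B. mconst (u v) * v)"
   using W_span[OF True] by (auto simp: mvs.span_finite[OF finB])
  also have "... = (\<Sum>s<m. mconst (u (b s)) * b s)"
   by (rule sum.reindex_bij_betw[OF b, symmetric])
  finally show ?thesis by auto
 qed simp
 then obtain M' where M': "!!i. i < m ==> mvar i = (\<Sum>s<m. mconst (M' i s) * b s)" by metis
 define M where "M s i = lk (b s) (sg i 1)" for s i
 have M: "b s = (\<Sum>i<m. mconst (M s i) * mvar i)" if "s < m" for s
 proof -
  have "b s = hcomp 1 (\<psi> (h s))" using h[OF that] by (simp add: \<Lambda>_def)
  then show ?thesis
   unfolding M_def by (simp only:) (intro homogeneous_1_decomp mpol_ring_hcomp \<psi>Y hA that homogeneous_hcomp)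
 qed
 have MM': "(\<Sum>i<m. M s i * M' i t) = (if s = t then 1 else 0)" if s: "s < m" and t: "t < m" for s t
 proof -
  define c where "c t = (\<Sum>i<m. M s i * M' i t) - (if s = t then 1 else 0)" for t
  define u where "u v = c (inv_into {..<m} b v)" for v
  have ub: "u (b t) = c t" if "t < m" for t
   using b that by (simp add: u_def bij_betw_inv_into_left)
  have "b s = (\<Sum>i<m. mconst (M s i) * (\<Sum>t<m. mconst (M' i t) * b t))"
   unfolding M[OF s] by (intro sum.cong refl arg_cong2[where f = "(*)"]) (simp add: M')
  also have "... = (\<Sum>i<m. \<Sum>t<m. mconst (M s i * M' i t) * b t)"
   by (simp only: sum_distrib_left mconst_simps(3) mult.assoc)
  also have "... = (\<Sum>t<m. mconst (\<Sum>i<m. M s i * M' i t) * b t)"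
   by (subst sum.swap) (simp add: mconst_simps sum_distrib_right)
  finally have 1: "b s = (\<Sum>t<m. mconst (\<Sum>i<m. M s i * M' i t) * b t)" .
  have 2: "b s = (\<Sum>t<m. mconst (if s = t then 1 else 0) * b t)"
   using s by (simp add: if_distrib[of mconst] if_distrib[of "%x. x * _"] mconst_simps cong: if_cong)
  have "(\<Sum>v\<in>B. mconst (u v) * v) = (\<Sum>t<m. mconst (u (b t)) * b t)"
   by (rule sum.reindex_bij_betw[OF b, symmetric])
  also have "... = (\<Sum>t<m. mconst (c t) * b t)" by (intro sum.cong refl) (simp add: ub)
  also have "... = b s - b s"
   unfolding c_def mconst_simps(6) left_diff_distrib sum_subtractf 1[symmetric] 2[symmetric] ..
  finally have "(\<Sum>v\<in>B. mconst (u v) * v) = 0" by simp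
  from mvs.independentD[OF B(2) finB order_refl this] have "u (b t) = 0"
   using b t by (auto simp: bij_betw_def)
  then show ?thesis by (simp add: ub[OF t] c_def)
 qed
 \<comment> \<open>The combination of the homogeneous elements \<open>h\<close> whose linear part in
   the coordinates \<open>f\<close> is the \<open>i\<close>-th variable; this makes the substitution
   tangent to the identity.\<close>
 define h' where "h' i = (\<Sum>s<m. mconst (M' i s) * h s)" for i
 have h'A: "h' i : A" for i unfolding h'_def by (intro A.sum A.mult const hA) auto
 have \<psi>h': "\<psi> (h' i) = (\<Sum>s<m. mconst (M' i s) * \<psi> (h s))" for i
  unfolding h'_def by (subst \<psi>_sum) (auto simp: \<psi>_scale hA intro!: A.mult const hA)
 have \<psi>h'1: "hcomp 1 (\<psi> (h' i)) = mvar i" if "i < m" for i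
  using h by (simp add: \<psi>h' hcomp_sum hcomp_mconst_mult M'[OF that] \<Lambda>_def)
 have \<psi>0: "hcomp 0 (\<psi> a) = 0" if "a : A" "lk a 0 = 0" for a
  using homogeneous_0_mconst[OF homogeneous_hcomp, of "\<psi> a"] const_f[OF \<psi>Y[OF that(1)]] that
  by (simp add: lookup_hcomp f\<psi> mconst_simps)
 have h'0: "lk (h' i) 0 = 0" for i
  by (simp add: h'_def lookup_sum lookup_mconst_mult h_const)
 have lead: "same_lead 1 (\<psi> (h' i)) (mvar i)" if i: "i < m" for i
  using \<psi>0[OF h'A h'0] \<psi>h'1[OF i]
  by (auto simp: same_lead_def ordge_iff less_Suc_eq hcomp_diff hcomp_homogeneous[OF homogeneous_mvar])
 have inj': "q = 0" if q: "q : ?Y" "msubst h' q = 0" for q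
 proof (rule msubst_tangent_inj[OF lead q(1)])
  have "msubst (%i. \<psi> (h' i)) q : ?Y" by (rule msubst_closed[OF q(1)]) (auto intro: \<psi>Y h'A Y.add Y.mult)
  moreover have "msubst f (msubst (%i. \<psi> (h' i)) q) = 0"
   using q(2) by (simp add: msubst_msubst f\<psi>[OF h'A])
  ultimately show "msubst (%i. \<psi> (h' i)) q = 0" using \<psi>f \<psi>_0 by fastforce
 qed auto
 have inj: "q = 0" if q: "q : ?Y" "msubst h q = 0" for q
 proof -
  define q' where "q' = msubst (%s. \<Sum>i<m. mconst (M s i) * mvar i) q"
  have q'Y: "q' : ?Y" unfolding q'_def
   by (rule msubst_closed[OF q(1)]) (auto intro!: Y.add Y.mult Y.sum mpol_ring_mvar)
  have "msubst (%i. \<Sum>s<m. mconst (M' i s) * mvar s) q' = msubst mvar q"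
   unfolding q'_def msubst_msubst unfolding msubst_ins
  proof (rule ins_cong[OF q(1)])
   fix s assume "s : {..<m}"
   then have s: "s < m" by simp
   have "ins mconst (%i. \<Sum>s<m. mconst (M' i s) * mvar s) (\<Sum>i<m. mconst (M s i) * mvar i)
   = (\<Sum>t<m. mconst (\<Sum>i<m. M s i * M' i t) * mvar t)"
   unfolding msubst_ins[symmetric] by (rule msubst_linear)
   also have "... = (\<Sum>t<m. if s = t then mvar t else 0)"
   by (intro sum.cong refl) (simp add: MM'[OF s] mconst_simps)
   also have "... = mvar s" using s by simp
   finally show "ins mconst (%i. \<Sum>s<m. mconst (M' i s) * mvar s) (\<Sum>i<m. mconst (M s i) * mvar i) = mvar s" .
  qed
  then have q_eq: "msubst (%i. \<Sum>s<m. mconst (M' i s) * mvar s) q' = q" by (simp add: msubst_mvar_id)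
  have "msubst h' q' = msubst h (msubst (%i. \<Sum>s<m. mconst (M' i s) * mvar s) q')"
   by (simp add: msubst_msubst msubst_simps h'_def[abs_def])
  then have "msubst h' q' = 0" using q(2) q_eq by simp
  then have "q' = 0" by (rule inj'[OF q'Y])
  then show ?thesis using q_eq by (simp add: msubst_simps)
 qed
 let ?B = "msubst h ` ?Y"
 have B_add: "a + b : ?B" and B_mult: "a * b : ?B" if "a : ?B" "b : ?B" for a b
 proof -
  from that obtain p q where "p : ?Y" "q : ?Y" "a = msubst h p" "b = msubst h q" by auto
  then show "a + b : ?B" "a * b : ?B"
   by (auto simp flip: msubst_simps(2,3) intro!: Y.add Y.mult imageI)
 qed
 have B_const: "mconst a : ?B" for a by (rule image_eqI[of _ _ "mconst a"]) auto
 have B_h: "h s : ?B" if "s < m" for s by (rule image_eqI[of _ _ "mvar s"]) (auto simp: that mpol_ring_mvar)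
 have B_sum: "sum g Z : ?B" if "!!z. z : Z ==> g z : ?B" for g and Z :: "nat set"
  using that B_const[of 0] by (induction Z rule: infinite_finite_induct) (auto simp: mconst_simps intro: B_add)
 have gen: "p : ?B" if "p : A" "hmg d p" for p d
  using that
 proof (induction d arbitrary: p rule: less_induct)
  case (less d)
  show ?case
  proof (cases "d = 0")
   case True
   then show ?thesis using homogeneous_0_mconst[of p] less.prems B_const by metis
  next
   case False
   define ci where "ci i = lk (\<psi> p) (sg i 1)" for i
   \<comment> \<open>After subtracting the part of \<open>p\<close> that is linear modulo the square
     of the augmentation ideal, no terms of degree 0 or 1 in the coordinates \<open>f\<close>
     remain, so the rest is a sum of products of elements without constant term.\<close>
   define q where "q = \<psi> p - (\<Sum>i<m. mconst (ci i) * \<psi> (h' i))"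
   have qY: "q : ?Y" unfolding q_def by (intro Y.diff Y.sum Y.mult \<psi>Y h'A less.prems) auto
   have p0: "lk p 0 = 0" using less.prems False lookup_0_homogeneous by blast
   have q0: "hcomp 0 q = 0"
   by (simp add: q_def hcomp_diff hcomp_sum hcomp_mconst_mult \<psi>0[OF less.prems(1) p0] \<psi>0[OF h'A h'0])
   have q1: "hcomp 1 q = 0"
   proof -
   have "hcomp 1 (\<psi> p) = (\<Sum>i<m. mconst (lk (hcomp 1 (\<psi> p)) (sg i 1)) * mvar i)"
   by (rule homogeneous_1_decomp) (auto intro: mpol_ring_hcomp \<psi>Y less.prems)
   then show ?thesis
   using \<psi>h'1 by (simp add: q_def hcomp_diff hcomp_sum hcomp_mconst_mult ci_def lookup_hcomp)
   qed
   from mpol_order_two_decomp[OF qY q0 q1] obtain r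
   where r: "ALL j. r j : ?Y & lk (r j) 0 = 0" and r3: "q = (\<Sum>j<m. mvar j * r j)" by (elim exE conjE)
   have "p = msubst f (\<Sum>i<m. mconst (ci i) * \<psi> (h' i)) + msubst f q"
   by (simp add: q_def f\<psi> less.prems flip: msubst_simps(2))
   also have "... = (\<Sum>i<m. mconst (ci i) * h' i) + (\<Sum>j<m. f j * msubst f (r j))"
   by (simp add: msubst_simps f\<psi> h'A r3)
   finally have p: "p = (\<Sum>i<m. mconst (ci i) * h' i) + (\<Sum>j<m. f j * msubst f (r j))" .
   have "p = hcomp d p" using less.prems(2) by (simp add: hcomp_homogeneous)
   also have "... = (\<Sum>i<m. mconst (ci i) * hcomp d (h' i)) + (\<Sum>j<m. hcomp d (f j * msubst f (r j)))"
   by (subst p) (simp add: hcomp_add hcomp_sum hcomp_mconst_mult)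
   also have "... : ?B"
   proof (intro B_add B_sum B_mult B_const)
   fix i
   have "hcomp d (h' i) = (\<Sum>s<m. mconst (M' i s) * (if d = dg s then h s else 0))"
   using dg by (auto simp: h'_def hcomp_sum hcomp_mconst_mult hcomp_homogeneous intro!: sum.cong)
   then show "hcomp d (h' i) : ?B"
   using B_const[of 0] by (auto simp: mconst_simps intro!: B_sum B_mult B_const B_h)
   next
   fix j assume "j : {..<m}"
   then have j: "j < m" by simp
   let ?g = "msubst f (r j)"
   have gA: "?g : A" and g0: "lk ?g 0 = 0" using mfA const_f r by auto
   have c0: "hcomp 0 ?g = 0" "hcomp 0 (f j) = 0"
   using homogeneous_0_mconst[OF homogeneous_hcomp, of ?g] homogeneous_0_mconst[OF homogeneous_hcomp, of "f j"]
   by (simp_all add: lookup_hcomp g0 f_const mconst_simps)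
   have "hcomp d (f j * ?g) = hcomp d (\<Sum>e<D. ?g * hcomp e (f j))"
   by (subst f_T[OF j], subst mult.commute) (simp only: sum_distrib_left)
   also have "... = (\<Sum>e<D. if e \<le> d then hcomp (d - e) ?g * hcomp e (f j) else 0)"
   by (simp add: hcomp_sum hcomp_mult[OF homogeneous_hcomp])
   also have "... : ?B"
   proof (rule B_sum)
   fix e
   \<comment> \<open>Both factors lack a constant term, so the first three cases contribute 0; in
     the last one both factors have degree strictly between 0 and \<open>d\<close>, and the
     induction hypothesis applies.\<close>
   consider "e = 0" | "e = d" | "d < e" | "0 < e" "e < d" by linarith
   then show "(if e \<le> d then hcomp (d - e) ?g * hcomp e (f j) else 0) : ?B"
   proof cases
   case 4
   then have "hcomp (d - e) ?g : ?B" "hcomp e (f j) : ?B"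
   by (auto intro!: less.IH[OF _ graded[OF gA] homogeneous_hcomp] less.IH[OF _ graded[OF fA[OF j]] homogeneous_hcomp])
   then show ?thesis using 4 B_mult by auto
   qed (use B_const[of 0] c0 in \<open>auto simp: mconst_simps\<close>)
   qed
   finally show "hcomp d (f j * ?g) : ?B" .
   qed
   finally show ?thesis .
  qed
 qed
 have "A \<subseteq> ?B"
 proof
  fix p assume p: "p : A"
  obtain E where "p = (\<Sum>d<E. hcomp d p)" using hcomp_bound hcomp_decomp by metis
  moreover have "(\<Sum>d<E. hcomp d p) : ?B" by (intro B_sum gen[OF graded[OF p] homogeneous_hcomp])
  ultimately show "p : ?B" by simp
 qed
 moreover have "?B \<subseteq> A" by (auto intro!: msubst_closed[where Y = A] hA const A.add A.mult)
 moreover have "inj_on (msubst h) ?Y"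
 proof (rule inj_onI)
  fix p q assume "p : ?Y" "q : ?Y" "msubst h p = msubst h q"
  then show "p = q" using inj[of "p - q"] by (simp add: msubst_simps Y.diff)
 qed
 ultimately have "bij_betw (msubst h) ?Y A" by (auto simp: bij_betw_def)
 then show ?thesis using that[of m h dg] hA dg dg_pos by blast
qed

section \<open>Noetherianity\<close>

text \<open>A monotone subsequence exists in any case; if it is non-increasing, it becomes constant
  once it has reached its least value.\<close>

lemma mono_subsequence_nat:
 fixes s :: "nat => nat"
 shows "\<exists>\<phi> :: nat => nat. strict_mono \<phi> & mono (%n. s (\<phi> n))"
proof -
 obtain f where f: "strict_mono f" "monoseq (%n. s (f n))" using seq_monosub by blast
 from f(2) consider "!!m n. m \<le> n ==> s (f m) \<le> s (f n)" | "!!m n. m \<le> n ==> s (f n) \<le> s (f m)"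
  unfolding monoseq_def by blast
 then show ?thesis
 proof cases
  case 1
  then show ?thesis using f(1) by (intro exI[of _ f]) (auto simp: mono_def)
 next
  case 2
  define v where "v = (LEAST v. EX n. v = s (f n))"
  have "EX n. v = s (f n)" unfolding v_def by (rule LeastI_ex) auto
  then obtain N where N: "v = s (f N)" by auto
  have min: "v \<le> s (f n)" for n unfolding v_def by (rule Least_le) auto
  have "s (f (N + n)) = v" for n using 2[of N "N + n"] min[of "N + n"] N by simp
  moreover have "strict_mono (%n. f (N + n))" using f(1) by (auto simp: strict_mono_def)
  ultimately show ?thesis by (intro exI[of _ "%n. f (N + n)"]) (auto simp: mono_def)
 qed
qed

text \<open>Passing to a subsequence once per coordinate makes all \<open>n\<close> coordinates
  non-decreasing at the same time.\<close>

lemma dickson: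
 fixes f :: "nat => nat => nat"
 shows "\<exists>r r'. r < r' & (\<forall>i<n. f r i \<le> f r' i)"
proof -
 have "\<exists>\<phi> :: nat => nat. strict_mono \<phi> & (\<forall>i<n. mono (%k. f (\<phi> k) i))"
 proof (induction n)
  case 0
  show ?case by (intro exI[of _ "%k. k"]) (simp add: strict_mono_def)
 next
  case (Suc n)
  then obtain \<phi> :: "nat => nat" where \<phi>: "strict_mono \<phi>" "\<forall>i<n. mono (%k. f (\<phi> k) i)" by blast
  obtain \<theta> :: "nat => nat" where \<theta>: "strict_mono \<theta>" "mono (%k. f (\<phi> (\<theta> k)) n)"
   using mono_subsequence_nat[of "%k. f (\<phi> k) n"] by blast
  have "strict_mono (%k. \<phi> (\<theta> k))" using \<phi>(1) \<theta>(1) by (auto simp: strict_mono_def)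
  moreover have "mono (%k. f (\<phi> (\<theta> k)) i)" if "i < Suc n" for i
  proof (cases "i = n")
   case False
   then have "mono (%k. f (\<phi> k) i)" using \<phi>(2) that by auto
   moreover have "mono \<theta>" using \<theta>(1) by (rule strict_mono_mono)
   ultimately show ?thesis by (auto simp: mono_def)
  qed (use \<theta> in simp)
  ultimately show ?case by blast
 qed
 then obtain \<phi> :: "nat => nat" where \<phi>: "strict_mono \<phi>" "!!i. i < n ==> mono (%k. f (\<phi> k) i)" by blast
 have "f (\<phi> 0) i \<le> f (\<phi> 1) i" if "i < n" for i using \<phi>(2)[OF that] by (auto simp: mono_def)
 moreover have "\<phi> 0 < \<phi> 1" using \<phi>(1) by (auto simp: strict_mono_def)
 ultimately show ?thesis by blast
qed

text \<open>Suppose \<open>Z\<^sub>j\<close> is not contained in \<open>Y\<^sub>j\<close> for infinitely many \<open>j\<close>, and choose an element of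
 \<open>Z\<^sub>j - Y\<^sub>j\<close> with minimal leading monomial for each of these \<open>j\<close>.  By Dickson's lemma one of the leading
 monomials divides another one, which can be cancelled without leaving \<open>Z\<^sub>j - Y\<^sub>j\<close>.\<close>

lemma graded_noetherian:
 fixes sc :: "'k::field => 'u::ab_group_add => 'u" and OP :: "(nat \<Rightarrow>\<^sub>0 nat) => 'u => 'u"
  and \<omega> :: "(nat \<Rightarrow>\<^sub>0 nat) => nat => 'u" and Z Y :: "nat => 'u set"
  and m q :: nat and dg dw :: "nat => nat"
 defines "Idx \<equiv> %j. {(\<mu>, t). ky \<mu> \<subseteq> {..<m} & t < q & wdeg dg \<mu> + dw t = j}"
 assumes vs: "vector_space sc" and fin: "!!j. finite (Idx j)"
  and OP_add: "!!e u v. OP e (u + v) = OP e u + OP e v" and OP_sc: "!!e a u. OP e (sc a u) = sc a (OP e u)"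
  and OP_\<omega>: "!!e \<mu> t. OP e (\<omega> \<mu> t) = \<omega> (e + \<mu>) t"
  and Z_add: "!!j u v. u : Z j ==> v : Z j ==> u + v : Z j" and Z_sc: "!!j a u. u : Z j ==> sc a u : Z j"
  and Z_OP: "!!j e u. ky e \<subseteq> {..<m} ==> u : Z j ==> OP e u : Z (j + wdeg dg e)"
  and Y_0: "!!j. 0 : Y j" and Y_add: "!!j u v. u : Y j ==> v : Y j ==> u + v : Y j"
  and Y_sc: "!!j a u. u : Y j ==> sc a u : Y j"
  and Y_OP: "!!j e u. ky e \<subseteq> {..<m} ==> e ~= 0 ==> u : Z j ==> OP e u : Y (j + wdeg dg e)"
  and span: "!!j u. u : Z j ==> u : module.span sc ((%(\<mu>, t). \<omega> \<mu> t) ` Idx j)"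
 shows "finite {j. \<not> Z j \<subseteq> Y j}"
proof (rule ccontr)
 interpret vs: vector_space sc by fact
 define J where "J = {j. \<not> Z j \<subseteq> Y j}"
 assume "infinite {j. \<not> Z j \<subseteq> Y j}"
 then have J: "infinite J" by (simp add: J_def)
 \<comment> \<open>A pair of an exponent vector and a generator index becomes one exponent vector,
   with the generator recorded as an extra variable \<open>m + t\<close>. Divisibility of such
   vectors forces equal generators, and the linear order on them is compatible with
   addition.\<close>
 define \<kappa> where "\<kappa> = (%(\<mu>, t). \<mu> + sg (m + t) (1::nat))"
 define Sp where "Sp j \<nu> = vs.span ((%(\<mu>, t). \<omega> \<mu> t) ` {i\<in>Idx j. \<kappa> i < \<nu>})" for j \<nu>
 define Spe where "Spe j \<nu> = vs.span ((%(\<mu>, t). \<omega> \<mu> t) ` {i\<in>Idx j. \<kappa> i \<le> \<nu>})" for j \<nu>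
 \<comment> \<open>Possible leading positions of elements of \<open>Z j\<close> outside
   \<open>Y j\<close>. The family \<open>\<omega>\<close> may have linear relations, so leading
   positions are defined through spans rather than through coefficients.\<close>
 define C where "C j = {\<nu>\<in>\<kappa> ` Idx j. \<exists>z\<in>Z j - Y j. z : Spe j \<nu>}" for j
 define L where "L j = Min (C j)" for j
 have finC: "finite (C j)" for j using fin by (simp add: C_def)
 have neC: "C j ~= {}" if "j : J" for j
 proof -
  obtain z where z: "z : Z j" "z \<notin> Y j" using \<open>j : J\<close> by (auto simp: J_def)
  have ne: "Idx j ~= {}"
  proof
   assume "Idx j = {}"
   then show False using span[OF z(1)] z(2) Y_0 by simp
  qed
  have "{i\<in>Idx j. \<kappa> i \<le> Max (\<kappa> ` Idx j)} = Idx j" using fin by auto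
  then have "z : Spe j (Max (\<kappa> ` Idx j))" using span[OF z(1)] by (simp only: Spe_def)
  moreover have "Max (\<kappa> ` Idx j) : \<kappa> ` Idx j" using ne fin by (intro Max_in) auto
  ultimately have "Max (\<kappa> ` Idx j) : C j" using z unfolding C_def by blast
  then show ?thesis by blast
 qed
 \<comment> \<open>Minimality of \<open>L j\<close>: an element of \<open>Z j\<close> outside
   \<open>Y j\<close> in the span of positions strictly below \<open>L j\<close> would give a
   smaller member of \<open>C j\<close>.\<close>
 have low: "z : Y j" if z: "z : Z j" "z : Sp j (L j)" for j z
 proof (rule ccontr)
  assume "z \<notin> Y j"
  let ?F = "{i\<in>Idx j. \<kappa> i < L j}"
  have "?F ~= {}"
  proof
   assume "?F = {}"
   then have "z = 0" using z(2) unfolding Sp_def by (simp only: image_empty vs.span_empty singleton_iff)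
   then show False using \<open>z \<notin> Y j\<close> Y_0 by simp
  qed
  define \<nu> where "\<nu> = Max (\<kappa> ` ?F)"
  have finF: "finite ?F" using fin by auto
  have "\<nu> : \<kappa> ` ?F" unfolding \<nu>_def using \<open>?F ~= {}\<close> finF by (intro Max_in) auto
  then have \<nu>: "\<nu> : \<kappa> ` Idx j" "\<nu> < L j" by auto
  have "?F \<subseteq> {i\<in>Idx j. \<kappa> i \<le> \<nu>}" unfolding \<nu>_def using finF by (auto intro!: Max_ge)
  then have "Sp j (L j) \<subseteq> Spe j \<nu>" unfolding Sp_def Spe_def by (intro vs.span_mono image_mono)
  then have "\<nu> : C j" using \<nu> z \<open>z \<notin> Y j\<close> by (auto simp: C_def)
  then have "L j \<le> \<nu>" unfolding L_def using finC by simp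
  then show False using \<nu>(2) by simp
 qed
 have "\<exists>z k \<mu> t. j : J --> z : Z j & z \<notin> Y j & (\<mu>, t) : Idx j & \<kappa> (\<mu>, t) = L j & k ~= 0 & z - sc k (\<omega> \<mu> t) : Sp j (L j)" for j
 proof (cases "j : J")
  case True
  have "L j : C j" unfolding L_def using finC neC[OF True] by simp
  then obtain z \<mu> t where z: "z : Z j" "z \<notin> Y j" "z : Spe j (L j)" "(\<mu>, t) : Idx j" "\<kappa> (\<mu>, t) = L j"
   by (fastforce simp: C_def)
  have inj: "i = (\<mu>, t)" if "i : Idx j" "\<kappa> i = L j" for i
  proof -
   obtain \<mu>' t' where i: "i = (\<mu>', t')" by (cases i)
   have eq: "\<mu>' + sg (m + t') 1 = \<mu> + sg (m + t) 1" using that z(5) by (simp add: \<kappa>_def i)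
   have "lk \<mu> (m + t') = 0" "lk \<mu>' (m + t') = 0"
   using that z(4) by (auto simp: Idx_def i not_in_keys_iff_lookup_eq_zero[symmetric])
   then have "lk (sg (m + t) (1::nat)) (m + t') = 1"
   using arg_cong[OF eq, of "%\<mu>. lk \<mu> (m + t')"] by (simp add: lookup_add)
   then have "t' = t" by (simp add: lookup_single when_def split: if_splits)
   then show ?thesis using eq i by simp
  qed
  have "i : insert (\<mu>, t) {i\<in>Idx j. \<kappa> i < L j}" if "i : Idx j" "\<kappa> i \<le> L j" for i
   using inj[OF that(1)] that by (cases "\<kappa> i = L j") auto
  then have "{i\<in>Idx j. \<kappa> i \<le> L j} \<subseteq> insert (\<mu>, t) {i\<in>Idx j. \<kappa> i < L j}" by (intro subsetI) simp
  moreover have "(\<mu>, t) : {i\<in>Idx j. \<kappa> i \<le> L j}" using z(4) by (simp only: mem_Collect_eq z(5) order_refl simp_thms)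
  moreover have "{i\<in>Idx j. \<kappa> i < L j} \<subseteq> {i\<in>Idx j. \<kappa> i \<le> L j}" by (auto intro: less_imp_le)
  ultimately have "{i\<in>Idx j. \<kappa> i \<le> L j} = insert (\<mu>, t) {i\<in>Idx j. \<kappa> i < L j}"
   by (intro equalityI insert_subsetI)
  then have "z : vs.span (insert (\<omega> \<mu> t) ((%(\<mu>, t). \<omega> \<mu> t) ` {i\<in>Idx j. \<kappa> i < L j}))"
   using z(3) by (simp add: Spe_def)
  then obtain k where k: "z - sc k (\<omega> \<mu> t) : Sp j (L j)"
   unfolding Sp_def by (auto simp: vs.span_breakdown_eq)
  have "k ~= 0"
  proof
   assume "k = 0"
   then show False using low[OF z(1)] k z(2) by simp
  qed
  then show ?thesis using z k by blast
 qed simp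
 then obtain z k \<mu> t where z: "!!j. j : J ==> z j : Z j & z j \<notin> Y j & (\<mu> j, t j) : Idx j & \<kappa> (\<mu> j, t j) = L j & k j ~= 0
   & z j - sc (k j) (\<omega> (\<mu> j) (t j)) : Sp j (L j)" by metis
 \<comment> \<open>Degrees are enumerated in increasing order, so that the two members found by
   Dickson's lemma have different degrees and the quotient monomial \<open>e\<close> is
   nontrivial.\<close>
 define en where "en = enumerate J"
 have en: "en r : J" for r using enumerate_in_set[OF J] by (simp add: en_def)
 obtain r r' where r: "r < r'" "!!i. i < m + q ==> lk (\<kappa> (\<mu> (en r), t (en r))) i \<le> lk (\<kappa> (\<mu> (en r'), t (en r'))) i"
  using dickson[of "m + q" "%r i. lk (\<kappa> (\<mu> (en r), t (en r))) i"] by auto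
 define j j' where "j = en r" and "j' = en r'"
 have jj: "j < j'" unfolding j_def j'_def en_def using r(1) J by (simp add: enumerate_mono)
 have jJ: "j : J" "j' : J" using en by (auto simp: j_def j'_def)
 have Ix: "ky (\<mu> j) \<subseteq> {..<m}" "t j < q" "wdeg dg (\<mu> j) + dw (t j) = j"
  "ky (\<mu> j') \<subseteq> {..<m}" "t j' < q" "wdeg dg (\<mu> j') + dw (t j') = j'"
  using z[OF jJ(1)] z[OF jJ(2)] by (auto simp: Idx_def)
 have out: "lk (\<mu> j) i = 0" "lk (\<mu> j') i = 0" if "\<not> i < m" for i
  using Ix that by (auto simp: not_in_keys_iff_lookup_eq_zero[symmetric])
 have t: "t j = t j'"
  using r(2)[of "m + t j"] Ix(2) out[of "m + t j"]
  by (auto simp: \<kappa>_def lookup_add lookup_single when_def split: if_splits simp flip: j_def j'_def)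
 define e where "e = \<mu> j' - \<mu> j"
 have e\<mu>: "e + \<mu> j = \<mu> j'"
 proof (rule poly_mapping_eqI)
  fix i
  have "lk (\<mu> j) i \<le> lk (\<mu> j') i"
  proof (cases "i < m")
   case True
   then show ?thesis using r(2)[of i] by (auto simp: \<kappa>_def lookup_add lookup_single when_def simp flip: j_def j'_def)
  qed (use out in simp)
  then show "lk (e + \<mu> j) i = lk (\<mu> j') i" by (simp add: e_def lookup_add lookup_minus)
 qed
 have ke: "ky e \<subseteq> {..<m}" using Ix(4) unfolding e\<mu>[symmetric] keys_add_nat by simp
 have "e ~= 0" using e\<mu> Ix(3,6) t jj by auto
 have j': "j + wdeg dg e = j'" using Ix(3,6) t unfolding e\<mu>[symmetric] wdeg_add by simp
 have OP0: "OP e 0 = 0" using OP_add[of e 0 0] by simp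
 have L: "e + L j = L j'"
  using z[OF jJ(1)] z[OF jJ(2)] t by (simp add: \<kappa>_def add.assoc flip: e\<mu>)
 have OP_Sp: "OP e u : Sp j' (L j')" if "u : Sp j (L j)" for u
  using that unfolding Sp_def
 proof (induction rule: vs.span_induct_alt)
  case base
  then show ?case by (simp add: OP0 vs.span_zero)
 next
  case (step c x y)
  then obtain \<nu> s where x: "x = \<omega> \<nu> s" "(\<nu>, s) : Idx j" "\<kappa> (\<nu>, s) < L j" by auto
  have "\<kappa> (e + \<nu>, s) < L j'" using x(3) unfolding L[symmetric] by (simp add: \<kappa>_def add.assoc)
  moreover have "(e + \<nu>, s) : Idx j'" using x(2) ke j' by (auto simp: Idx_def keys_add_nat wdeg_add)
  ultimately have "OP e x : vs.span ((%(\<mu>, t). \<omega> \<mu> t) ` {i\<in>Idx j'. \<kappa> i < L j'})"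
   by (intro vs.span_base) (auto simp: x OP_\<omega> intro!: image_eqI[of _ _ "(e + \<nu>, s)"])
  then show ?case using step by (simp add: OP_add OP_sc vs.span_add vs.span_scale)
 qed
 \<comment> \<open>The factor that cancels the leading terms. What remains lies below
   \<open>L j'\<close>, hence in \<open>Y j'\<close>, while the subtracted multiple lies in
   \<open>Y j'\<close> by the assumption on nontrivial monomials.\<close>
 let ?c = "k j' / k j"
 have 1: "OP e (z j) : Z j'" "OP e (z j) : Y j'"
  using Z_OP[OF ke] Y_OP[OF ke \<open>e ~= 0\<close>] z[OF jJ(1)] j' by auto
 have "z j' - sc ?c (OP e (z j)) = (z j' - sc (k j') (\<omega> (\<mu> j') (t j'))) - sc ?c (OP e (z j - sc (k j) (\<omega> (\<mu> j) (t j))))"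
 proof -
  have "OP e (- u) = - OP e u" for u using OP_add[of e u "-u"] OP0 by (simp add: eq_neg_iff_add_eq_0 add.commute)
  then have "OP e (z j - sc (k j) (\<omega> (\<mu> j) (t j))) = OP e (z j) - sc (k j) (\<omega> (\<mu> j') (t j'))"
   using OP_add[of e "z j" "- sc (k j) (\<omega> (\<mu> j) (t j))"] by (simp add: OP_sc OP_\<omega> e\<mu> t)
  then show ?thesis using z[OF jJ(1)] by (simp add: vs.scale_right_diff_distrib)
 qed
 also have "... : Sp j' (L j')"
 proof -
  have "z j' - sc (k j') (\<omega> (\<mu> j') (t j')) : Sp j' (L j')" using z[OF jJ(2)] by blast
  moreover have "OP e (z j - sc (k j) (\<omega> (\<mu> j) (t j))) : Sp j' (L j')" using OP_Sp z[OF jJ(1)] by blast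
  ultimately show ?thesis unfolding Sp_def by (rule vs.span_diff[OF _ vs.span_scale])
 qed
 finally have "z j' - sc ?c (OP e (z j)) : Sp j' (L j')" .
 moreover have "z j' - sc ?c (OP e (z j)) : Z j'"
 proof -
  have "- sc ?c (OP e (z j)) : Z j'" using Z_sc[OF 1(1), of "- ?c"] by (simp only: vs.scale_minus_left)
  from Z_add[OF _ this] show ?thesis using z[OF jJ(2)] by simp
 qed
 ultimately have "z j' - sc ?c (OP e (z j)) : Y j'" by (rule low[rotated])
 from Y_add[OF this Y_sc[OF 1(2), of ?c]] show False using z[OF jJ(2)] by simp
qed

lemma finite_monomials_wdeg:
 assumes "!!s. s < m ==> 0 < dg s"
 shows "finite {\<mu>. ky \<mu> \<subseteq> {..<m::nat} & wdeg dg \<mu> \<le> d}"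
proof -
 let ?M = "{\<mu>. ky \<mu> \<subseteq> {..<m} & wdeg dg \<mu> \<le> d}"
 have le: "lk \<mu> i \<le> d" if "\<mu> : ?M" for \<mu> i
 proof (cases "i : ky \<mu>")
  case True
  then have "i < m" using that by auto
  have "lk \<mu> i \<le> lk \<mu> i * dg i" using assms[OF \<open>i < m\<close>] by simp
  also have "... \<le> wdeg dg \<mu>" unfolding wdeg_def using True by (intro member_le_sum) auto
  finally show ?thesis using that by simp
 qed (simp add: not_in_keys_iff_lookup_eq_zero)
 have "finite (lk ` ?M)"
 proof (rule finite_subset)
  show "lk ` ?M \<subseteq> {f. ALL i. (i : {..<m} --> f i : {..d}) & (i \<notin> {..<m} --> f i = 0)}"
   using le by (auto simp: not_in_keys_iff_lookup_eq_zero[symmetric])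
  show "finite {f. ALL i. (i : {..<m} --> f i : {..d}) & (i \<notin> {..<m} --> f i = (0::nat))}"
   by (rule finite_set_of_finite_funs) auto
 qed
 then show ?thesis by (rule finite_imageD) (rule inj_onI, simp only: poly_mapping.lookup_inject)
qed

text \<open>Taylor expansion of order one at \<open>a\<close>. For products it rests on writing
  \<open>p * q\<close> minus its value as \<open>(p - p(a)) * q + p(a) * (q - q(a))\<close>.\<close>

lemma mpol_point_ideal:
 fixes q :: "(nat,'k::field) mpol"
 assumes "q : mpol_ring {..<m}"
 shows "EX r. (ALL j. r j : mpol_ring {..<m}) & q - mconst (ins (%x. x) a q) = (\<Sum>j<m. (mvar j - mconst (a j)) * r j)"
 using assms
proof (induction rule: mpol_ring_induct)
 case (const b)
 then show ?case by (intro exI[of _ "%_. 0"]) simp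
next
 case (var i)
 then have "mvar i - mconst (a i) = (\<Sum>j<m. (mvar j - mconst (a j)) * (if j = i then 1 else 0 :: (nat,'k) mpol))"
  by (simp add: if_distrib[of "(*) _"] cong: if_cong)
 then show ?case by (intro exI[of _ "%j. if j = i then 1 else 0"]) auto
next
 case (add p q)
 then obtain r r' where "ALL j. r j : mpol_ring {..<m}" "p - mconst (ins (%x. x) a p) = (\<Sum>j<m. (mvar j - mconst (a j)) * r j)"
  "ALL j. r' j : mpol_ring {..<m}" "q - mconst (ins (%x. x) a q) = (\<Sum>j<m. (mvar j - mconst (a j)) * r' j)" by blast
 moreover have "p + q - mconst (ins (%x. x) a (p + q)) = (p - mconst (ins (%x. x) a p)) + (q - mconst (ins (%x. x) a q))"
  by (simp add: ins_add mconst_simps)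
 ultimately show ?case
  by (intro exI[of _ "%j. r j + r' j"]) (simp add: distrib_left sum.distrib mpol_ring_add)
next
 case (mult p q)
 then obtain r r' where r: "ALL j. r j : mpol_ring {..<m}" "p - mconst (ins (%x. x) a p) = (\<Sum>j<m. (mvar j - mconst (a j)) * r j)"
  "ALL j. r' j : mpol_ring {..<m}" "q - mconst (ins (%x. x) a q) = (\<Sum>j<m. (mvar j - mconst (a j)) * r' j)" by blast
 let ?a = "mconst (ins (%x. x) a p)"
 have "p * q - mconst (ins (%x. x) a (p * q)) = (p - ?a) * q + ?a * (q - mconst (ins (%x. x) a q))"
  by (simp add: ins_mult mconst_simps algebra_simps)
 also have "... = (\<Sum>j<m. (mvar j - mconst (a j)) * (r j * q + ?a * r' j))"
  unfolding r(2,4) by (simp add: sum_distrib_right sum_distrib_left distrib_left sum.distrib ac_simps)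
 finally show ?case using r mult
  by (intro exI[of _ "%j. r j * q + ?a * r' j"]) (auto intro!: mpol_ring_add mpol_ring_mult)
qed

section \<open>Graded polynomial subalgebras\<close>

lemma kdiff_hom: "rhom F ==> F (kdiff m a u T) = kdiff m (%s. F (a s)) (%T. F (u T)) T"
proof -
 assume F: "rhom F"
 have "F (ksgn s T) = ksgn s T" for s by (simp add: ksgn_def rhomD[OF F])
 then show ?thesis by (simp add: kdiff_def rhomD[OF F])
qed

lemma rhom_msubst_eval:
 assumes "rhom ev" "!!c. ev (mconst c) = c" shows "ev (msubst s p) = ins (%x. x) (%x. ev (s x)) p"
 using rhom_ins_comp[OF rhom_mconst assms(1), of s p] assms(2) by (simp add: msubst_ins)

lemma card_bounded_monomials:
 assumes "finite F"
 shows "card {\<mu> :: 'x \<Rightarrow>\<^sub>0 nat. ky \<mu> \<subseteq> F & (ALL x. lk \<mu> x \<le> q)} = (q + 1) ^ card F"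
  and "finite {\<mu> :: 'x \<Rightarrow>\<^sub>0 nat. ky \<mu> \<subseteq> F & (ALL x. lk \<mu> x \<le> q)}"
proof -
 let ?M = "{\<mu> :: 'x \<Rightarrow>\<^sub>0 nat. ky \<mu> \<subseteq> F & (ALL x. lk \<mu> x \<le> q)}"
 define poly :: "('x => nat) => ('x \<Rightarrow>\<^sub>0 nat)" where "poly f = (\<Sum>x\<in>F. sg x (f x))" for f
 have lk_poly: "lk (poly f) x = (if x : F then f x else 0)" for f x
  using assms by (simp add: poly_def lookup_sum lookup_single when_def)
 have "bij_betw (%\<mu>. restrict (lk \<mu>) F) ?M (PiE F (%_. {..q}))"
 proof (rule bij_betwI[where g = poly])
  show "(%\<mu>. restrict (lk \<mu>) F) : ?M \<rightarrow> PiE F (%_. {..q})" by auto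
  show "poly : PiE F (%_. {..q}) \<rightarrow> ?M"
   by (auto simp: lk_poly in_keys_iff PiE_def Pi_def split: if_splits)
  show "poly (restrict (lk \<mu>) F) = \<mu>" if "\<mu> : ?M" for \<mu>
   using that by (intro poly_mapping_eqI) (auto simp: lk_poly not_in_keys_iff_lookup_eq_zero[symmetric])
  show "restrict (lk (poly f)) F = f" if "f : PiE F (%_. {..q})" for f
   using that by (intro ext) (auto simp: lk_poly PiE_def extensional_def)
 qed
 moreover have "card (PiE F (%_. {..q})) = (q + 1) ^ card F" "finite (PiE F (%_. {..q}))"
  using assms by (auto simp: card_PiE intro: finite_PiE)
 ultimately show "card ?M = (q + 1) ^ card F" "finite ?M"
  by (auto dest: bij_betw_same_card bij_betw_finite)
qed

text \<open>The features of \<open>k[V]^G\<close> inside \<open>k[V]\<close> on which the Koszul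
  argument rests. The common degree \<open>r\<close> of the integral equations will be the order of
  \<open>G\<close>. Integrality yields both that \<open>k[V]\<close> is finitely generated over
  \<open>A\<close> and that the \<open>h s\<close> have no common zero besides the origin.\<close>

locale graded_subalgebra =
 fixes I :: "'x set" and A :: "('x,'k::field) mpol set" and m :: nat
  and h :: "nat => ('x,'k) mpol" and dg :: "nat => nat" and r :: nat
 assumes finI: "finite I" and A_sub: "subring A" and A_const: "mconst a : A"
  and A_hcomp: "p : A ==> hcomp d p : A" and A_ring: "A \<subseteq> mpol_ring I"
  and h_A: "s < m ==> h s : A" and h_hom: "s < m ==> hmg (dg s) (h s)"
  and dg_pos: "s < m ==> 0 < dg s" and h_bij: "bij_betw (msubst h) (mpol_ring {..<m}) A"
  and integral: "x : I ==> EX a. (\<forall>l<r. a l : A) & mvar x ^ r = (\<Sum>l<r. a l * mvar x ^ l)"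
begin

sublocale A: subring A by (rule A_sub)

lemma h_ring: "s < m ==> h s : mpol_ring I"
 using h_A A_ring by auto

lemma h_inj: "p : mpol_ring {..<m} ==> msubst h p = 0 ==> p = 0"
 using h_bij inj_onD[of "msubst h" "mpol_ring {..<m}" p 0] by (auto simp: bij_betw_def msubst_simps)

lemma h_onto: "p : A ==> \<exists>q\<in>mpol_ring {..<m}. p = msubst h q"
 using h_bij by (auto simp: bij_betw_def)

lemma h_maps: "q : mpol_ring {..<m} ==> msubst h q : A"
 using h_bij by (auto simp: bij_betw_def)

lemma h_0: "s < m ==> lk (h s) 0 = 0"
 using lookup_0_homogeneous h_hom dg_pos by blast

lemma mon_h_homogeneous: "ky \<mu> \<subseteq> {..<m} ==> hmg (wdeg dg \<mu>) (mon h \<mu>)"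
 by (rule homogeneous_mon) (auto intro: h_hom)

lemma mon_h_A: "ky \<mu> \<subseteq> {..<m} ==> mon h \<mu> : A"
 unfolding mon_def by (intro A.prod A.power h_A) auto

text \<open>The algebra is a polynomial ring on the \<open>h s\<close>, so the kernel of a point
  evaluation restricted to it is generated by the shifted generators. This is used at the origin and
  at the regular vector.\<close>

lemma A_ideal:
 assumes "rhom ev" "!!c. ev (mconst c) = c" "p : A"
 shows "EX c. (ALL s. c s : A) & p - mconst (ev p) = (\<Sum>s<m. c s * (h s - mconst (ev (h s))))"
proof -
 obtain q where q: "q : mpol_ring {..<m}" "p = msubst h q" using h_onto assms by blast
 obtain c where c: "ALL j. c j : mpol_ring {..<m}"
  "q - mconst (ins (%x. x) (%s. ev (h s)) q) = (\<Sum>j<m. (mvar j - mconst (ev (h j))) * c j)"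
  using mpol_point_ideal[OF q(1)] by blast
 have "p - mconst (ev p) = msubst h (q - mconst (ins (%x. x) (%s. ev (h s)) q))"
  by (simp add: q msubst_simps rhom_msubst_eval[OF assms(1,2)])
 also have "... = (\<Sum>s<m. msubst h (c s) * (h s - mconst (ev (h s))))"
  unfolding c(2) by (simp add: msubst_simps mult.commute)
 finally show ?thesis using c(1) h_maps by (intro exI[of _ "%s. msubst h (c s)"]) simp
qed

lemma A_plus_ideal:
 assumes "p : A" "lk p 0 = 0" shows "EX c. (ALL s. c s : A) & p = (\<Sum>s<m. c s * h s)"
proof -
 obtain c where c: "ALL s. c s : A" "p - mconst (lk p 0) = (\<Sum>s<m. c s * (h s - mconst (lk (h s) 0)))"
  using A_ideal[OF rhom_lookup_0 _ assms(1)] by auto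
 then have "p = (\<Sum>s<m. c s * h s)" using assms(2) by (simp add: mconst_simps h_0)
 then show ?thesis using c(1) by blast
qed

text \<open>In the degree \<open>r\<close> part of the integral equation of a variable the
  coefficients are homogeneous of positive degree in \<open>A\<close>, hence lie in the ideal of the
  \<open>h s\<close>.\<close>

lemma var_power_ideal:
 assumes x: "x : I"
 shows "EX c. (\<forall>s<m. c s : mpol_ring I) & mvar x ^ r = (\<Sum>s<m. c s * h s)"
proof -
 interpret S: subring "mpol_ring I :: ('x,'k) mpol set" by (rule subring_mpol_ring)
 obtain a where a: "\<forall>l<r. a l : A" "mvar x ^ r = (\<Sum>l<r. a l * mvar x ^ l)" using integral[OF x] by blast
 have hx: "hmg l (mvar x ^ l :: ('x,'k) mpol)" for l
  using homogeneous_power[OF homogeneous_mvar, of l] by simp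
 have "mvar x ^ r = hcomp r (mvar x ^ r :: ('x,'k) mpol)" by (simp add: hcomp_homogeneous[OF hx])
 also have "... = (\<Sum>l<r. hcomp (r - l) (a l) * mvar x ^ l)"
  unfolding a(2) by (simp add: hcomp_sum hcomp_mult[OF hx])
 finally have 1: "mvar x ^ r = (\<Sum>l<r. hcomp (r - l) (a l) * mvar x ^ l)" .
 have "EX c. l < r --> (ALL s. c s : A) & hcomp (r - l) (a l) = (\<Sum>s<m. c s * h s)" for l
 proof (cases "l < r")
  case True
  then have "hcomp (r - l) (a l) : A" "lk (hcomp (r - l) (a l)) 0 = 0"
   using a(1) by (auto intro: A_hcomp simp: lookup_hcomp when_def)
  then show ?thesis using A_plus_ideal by blast
 qed simp
 then obtain c where c: "!!l. l < r ==> (ALL s. c l s : A) & hcomp (r - l) (a l) = (\<Sum>s<m. c l s * h s)" by metis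
 have "mvar x ^ r = (\<Sum>l<r. \<Sum>s<m. c l s * h s * mvar x ^ l)"
  unfolding 1 by (intro sum.cong refl) (simp add: c sum_distrib_right)
 also have "... = (\<Sum>s<m. (\<Sum>l<r. c l s * mvar x ^ l) * h s)"
  by (subst sum.swap) (simp add: sum_distrib_left sum_distrib_right mult_ac)
 finally have "mvar x ^ r = (\<Sum>s<m. (\<Sum>l<r. c l s * mvar x ^ l) * h s)" .
 moreover have "(\<Sum>l<r. c l s * mvar x ^ l) : mpol_ring I" for s
  using c A_ring x by (intro S.sum S.mult S.power mpol_ring_mvar) auto
 ultimately show ?thesis by (intro exI[of _ "%s. \<Sum>l<r. c l s * mvar x ^ l"]) auto
qed

text \<open>Algebraic independence bounds the number of generators: monomials in the \<open>h\<^sub>s\<close> with exponents at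
 most \<open>q\<close> live in a space of dimension \<open>O(q\<^bsup>card I\<^esup>)\<close>.\<close>

lemma m_le_card: "m \<le> card I"
proof (rule ccontr)
 assume "\<not> m \<le> card I"
 then have m: "Suc (card I) \<le> m" by simp
 define D where "D = (\<Sum>s<m. dg s)"
 have key: "(q + 1) ^ m \<le> (q * D + 1) ^ card I" for q
 proof -
  let ?M = "{\<mu> :: nat \<Rightarrow>\<^sub>0 nat. ky \<mu> \<subseteq> {..<m} & (ALL x. lk \<mu> x \<le> q)}"
  let ?V = "{\<nu> :: 'x \<Rightarrow>\<^sub>0 nat. ky \<nu> \<subseteq> I & (ALL x. lk \<nu> x \<le> q * D)}"
  have finM: "finite ?M" and cardM: "card ?M = (q + 1) ^ m"
   using card_bounded_monomials[of "{..<m}" q] by auto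
  have finV: "finite ?V" and cardV: "card ?V = (q * D + 1) ^ card I"
   using card_bounded_monomials[OF finI, of "q * D"] by auto
  have msub: "msubst h (sg \<mu> a) = mconst a * mon h \<mu>" for \<mu> a by (rule msubst_single)
  have inj: "inj_on (mon h) ?M"
  proof (rule inj_onI)
   fix \<mu> \<nu> assume *: "\<mu> : ?M" "\<nu> : ?M" "mon h \<mu> = mon h \<nu>"
   then have "msubst h (sg \<mu> 1 - sg \<nu> 1) = 0" by (simp add: msubst_simps msub)
   moreover have "sg \<mu> 1 - sg \<nu> 1 : (mpol_ring {..<m} :: (nat,'k) mpol set)"
   using * by (intro mpol_ring_diff mpol_ring_single) auto
   ultimately have "sg \<mu> (1::'k) = sg \<nu> 1" using h_inj by fastforce
   then show "\<mu> = \<nu>" by (metis lookup_single_eq lookup_single_not_eq one_neq_zero)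
  qed
  have "mvs.independent (mon h ` ?M)"
  proof (rule mvs.independent_if_scalars_zero)
   fix u v assume u: "(\<Sum>v\<in>mon h ` ?M. mconst (u v) * v) = 0" and v: "v : mon h ` ?M"
   define p where "p = (\<Sum>\<mu>\<in>?M. sg \<mu> (u (mon h \<mu>)))"
   have "msubst h p = 0" using u by (simp add: p_def msubst_simps(8) msub sum.reindex[OF inj])
   moreover have "p : mpol_ring {..<m}" unfolding p_def by (intro mpol_ring_sum mpol_ring_single) auto
   ultimately have "p = 0" by (rule h_inj[rotated])
   obtain \<mu> where \<mu>: "\<mu> : ?M" "v = mon h \<mu>" using v by auto
   have "lk p \<mu> = u v" using \<mu> finM by (simp add: p_def lookup_sum lookup_single when_def)
   then show "u v = 0" using \<open>p = 0\<close> by simp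
  qed (use finM in simp)
  moreover have "mon h ` ?M \<subseteq> mvs.span ((%\<nu>. sg \<nu> 1) ` ?V)"
  proof
   fix v assume "v : mon h ` ?M"
   then obtain \<mu> where \<mu>: "ky \<mu> \<subseteq> {..<m}" "!!x. lk \<mu> x \<le> q" "v = mon h \<mu>" by auto
   have "v : mpol_ring I" using mon_h_A[OF \<mu>(1)] A_ring \<mu>(3) by auto
   have "wdeg dg \<mu> \<le> (\<Sum>s<m. q * dg s)"
   unfolding wdeg_superset[OF finite_lessThan \<mu>(1)] by (intro sum_mono mult_right_mono \<mu>(2)) simp
   then have wd: "wdeg dg \<mu> \<le> q * D" by (simp add: D_def sum_distrib_left)
   have "\<nu> : ?V" if "\<nu> : ky v" for \<nu>
   proof -
   have "mdeg \<nu> = wdeg dg \<mu>"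
   using mon_h_homogeneous[OF \<mu>(1)] that by (auto simp: \<mu>(3) homogeneous_iff)
   have "lk \<nu> x \<le> q * D" for x
   proof (cases "x : ky \<nu>")
   case True
   have "lk \<nu> x \<le> mdeg \<nu>" unfolding wdeg_def using True member_le_sum[of x "ky \<nu>" "lk \<nu>"] by simp
   then show ?thesis using wd \<open>mdeg \<nu> = wdeg dg \<mu>\<close> by simp
   qed (simp add: not_in_keys_iff_lookup_eq_zero)
   then show ?thesis using \<open>v : mpol_ring I\<close> that by (auto simp: mpol_ring_def)
   qed
   then have "(\<Sum>\<nu>\<in>ky v. mconst (lk v \<nu>) * sg \<nu> 1) : mvs.span ((%\<nu>. sg \<nu> 1) ` ?V)"
   by (intro mvs.span_sum mvs.span_scale mvs.span_base) auto
   then show "v : mvs.span ((%\<nu>. sg \<nu> 1) ` ?V)" by (simp flip: sg_eq sum_monomials)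
  qed
  ultimately have "card (mon h ` ?M) \<le> card ((%\<nu>. sg \<nu> (1::'k)) ` ?V)"
   using mvs.independent_span_bound[of "(%\<nu>. sg \<nu> (1::'k)) ` ?V" "mon h ` ?M"] finV by simp
  also have "... \<le> card ?V" using finV by (rule card_image_le)
  finally show ?thesis by (simp add: card_image[OF inj] cardM cardV)
 qed
 define n where "n = card I"
 \<comment> \<open>The growth comparison reads
   \<open>(q + 1)^(n + 1) \<le> (q + 1)^n * (D + 1)^n\<close>; this value of \<open>q\<close> turns
   it into \<open>q + 1 \<le> q\<close>.\<close>
 define q where "q = (D + 1) ^ n"
 have "(q + 1) ^ Suc n \<le> (q + 1) ^ m" using m by (intro power_increasing) (auto simp: n_def)
 also have "... \<le> (q * D + 1) ^ n" using key by (simp add: n_def)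
 also have "... \<le> ((q + 1) * (D + 1)) ^ n" by (intro power_mono) auto
 also have "... = (q + 1) ^ n * q" by (simp only: power_mult_distrib q_def)
 finally have "q + 1 \<le> q" by simp
 then show False by simp
qed

text \<open>Over the full polynomial ring the \<open>h s\<close> generate an ideal that contains
  powers of all variables, and there are at most as many of them as variables; this is what depth
  sensitivity asks for.\<close>

lemma koszul_ring:
 assumes u: "!!T. T : ksub m (Suc i) ==> u T : mpol_ring I" and du: "!!T. T : ksub m i ==> kdiff m h u T = 0"
 shows "EX w. (\<forall>T\<in>ksub m (Suc (Suc i)). w T : mpol_ring I) & (\<forall>T\<in>ksub m (Suc i). u T = kdiff m h w T)"
proof -
 obtain x where x: "bij_betw x {..<card I} I" using ex_bij_betw_nat_finite[OF finI] by (auto simp: atLeast0LessThan)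
 have "x j : I" if "j < card I" for j using x that by (auto simp: bij_betw_def)
 then show ?thesis using koszul_acyclic_mpol[OF x m_le_card h_ring var_power_ideal u du] by blast
qed

text \<open>Pulled back along the isomorphism \<open>msubst h\<close>, the \<open>h s\<close> become
  the variables of a polynomial ring, so the criterion applies with exponent 1.\<close>

lemma koszul_A:
 assumes u: "!!T. T : ksub m (Suc i) ==> u T : A" and du: "!!T. T : ksub m i ==> kdiff m h u T = 0"
 shows "EX w. (\<forall>T\<in>ksub m (Suc (Suc i)). w T : A) & (\<forall>T\<in>ksub m (Suc i). u T = kdiff m h w T)"
proof -
 interpret Y: subring "mpol_ring {..<m} :: (nat,'k) mpol set" by (rule subring_mpol_ring)
 have "EX q. T : ksub m (Suc i) --> q : mpol_ring {..<m} & u T = msubst h q" for T using u h_onto by blast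
 then obtain u' where u': "!!T. T : ksub m (Suc i) ==> u' T : mpol_ring {..<m} & u T = msubst h (u' T)" by metis
 have hom: "msubst h (kdiff m mvar w T) = kdiff m h (%T. msubst h (w T)) T" for w T
  by (simp add: kdiff_hom[OF rhom_msubst])
 have d0: "kdiff m mvar u' T = 0" if T: "T : ksub m i" for T
 proof (rule h_inj)
  show "kdiff m mvar u' T : mpol_ring {..<m}"
   by (rule Y.kdiff_ideal[where i = i]) (use u' T in \<open>auto intro: Y.add Y.mult mpol_ring_mvar\<close>)
  have "kdiff m h (%T. msubst h (u' T)) T = kdiff m h u T"
   by (rule kdiff_cong) (use u' ksub_insert[OF T] in auto)
  then show "msubst h (kdiff m mvar u' T) = 0" using du[OF T] by (simp add: hom)
 qed
 have "EX w. (\<forall>T\<in>ksub m (Suc (Suc i)). w T : mpol_ring {..<m}) & (\<forall>T\<in>ksub m (Suc i). u' T = kdiff m mvar w T)"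
 proof (rule koszul_acyclic_mpol[where n = m and x = "%i. i" and r = 1])
  show "EX c. (\<forall>s<m. c s : mpol_ring {..<m}) & mvar j ^ 1 = (\<Sum>s<m. c s * (mvar s :: (nat,'k) mpol))" if "j < m" for j
   using that by (intro exI[of _ "%s. if s = j then 1 else 0"])
   (auto simp: if_distrib[of "%x. x * _"] cong: if_cong)
 qed (use u' d0 in \<open>auto simp: bij_betw_def mpol_ring_mvar\<close>)
 then obtain w where w: "!!T. T : ksub m (Suc (Suc i)) ==> w T : mpol_ring {..<m}"
  "!!T. T : ksub m (Suc i) ==> u' T = kdiff m mvar w T" by blast
 have "u T = kdiff m h (%T. msubst h (w T)) T" if "T : ksub m (Suc i)" for T
  using u'[OF that] w(2)[OF that] by (simp flip: hom)
 then show ?thesis using w(1) h_maps by (intro exI[of _ "%T. msubst h (w T)"]) auto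
qed

section \<open>The polynomial ring as a finitely generated module over the subalgebra\<close>

definition red_mons :: "('x \<Rightarrow>\<^sub>0 nat) set" where
 "red_mons = {\<beta>. ky \<beta> \<subseteq> I & (ALL x. lk \<beta> x \<le> r - 1)}"

lemma finite_red_mons: "finite red_mons"
 unfolding red_mons_def by (rule card_bounded_monomials(2)[OF finI])

lemma A_span: "a : A ==> a : mvs.span (mon h ` {\<mu>. ky \<mu> \<subseteq> {..<m}})"
proof -
 assume "a : A"
 then obtain q where q: "q : mpol_ring {..<m}" "a = msubst h q" using h_onto by blast
 have "(\<Sum>\<mu>\<in>ky q. mconst (lk q \<mu>) * mon h \<mu>) : mvs.span (mon h ` {\<mu>. ky \<mu> \<subseteq> {..<m}})"
  using q(1) by (intro mvs.span_sum mvs.span_scale mvs.span_base) (auto simp: mpol_ring_def)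
 then show ?thesis by (simp add: q(2) msubst_ins ins_def)
qed

text \<open>The span of the products is stable under multiplication by \<open>A\<close> and, by
  means of the integral equations, by variables; it contains 1 and is therefore everything. Taking
  components of degree \<open>d\<close> at the end keeps only the products of that degree.\<close>

lemma ring_span:
 assumes p: "p : mpol_ring I" "hmg d p"
 shows "p : mvs.span ((%(\<mu>, \<beta>). mon h \<mu> * mon mvar \<beta>) `
  {(\<mu>, \<beta>). ky \<mu> \<subseteq> {..<m} & \<beta> : red_mons & wdeg dg \<mu> + mdeg \<beta> = d})"
proof -
 define g where "g = (%(\<mu>, \<beta>). mon h \<mu> * mon mvar \<beta> :: ('x,'k) mpol)"
 let ?E = "mvs.span (g ` {(\<mu>, \<beta>). ky \<mu> \<subseteq> {..<m} & \<beta> : red_mons})"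
 have base: "mon h \<mu> * mon mvar \<beta> : ?E" if "ky \<mu> \<subseteq> {..<m}" "\<beta> : red_mons" for \<mu> \<beta>
  using that by (intro mvs.span_base) (auto simp: g_def intro!: image_eqI[of _ _ "(\<mu>, \<beta>)"])
 have A_mult: "a * s : ?E" if "a : A" "s : ?E" for a s
  using that(2)
 proof (induction rule: mvs.span_induct_alt)
  case (step c x y)
  then obtain \<mu> \<beta> where x: "x = mon h \<mu> * mon mvar \<beta>" "ky \<mu> \<subseteq> {..<m}" "\<beta> : red_mons" by (auto simp: g_def)
  have "a * x : ?E" using A_span[OF that(1)]
  proof (induction rule: mvs.span_induct_alt)
   case (step c' x' y')
   then obtain \<nu> where \<nu>: "x' = mon h \<nu>" "ky \<nu> \<subseteq> {..<m}" by auto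
   have "x' * x : ?E" using base[of "\<nu> + \<mu>" \<beta>] \<nu> x by (simp add: keys_add_nat mon_add mult.assoc)
   moreover have "(mconst c' * x' + y') * x = mconst c' * (x' * x) + y' * x" by (simp add: algebra_simps)
   ultimately show ?case using step by (simp add: mvs.span_add mvs.span_scale)
  qed (simp add: mvs.span_zero)
  moreover have "a * (mconst c * x + y) = mconst c * (a * x) + a * y" by (simp add: algebra_simps)
  ultimately show ?case using step by (simp add: mvs.span_add mvs.span_scale)
 qed (simp add: mvs.span_zero)
 have x_mult: "mvar x * s : ?E" if "x : I" "s : ?E" for x s
  using that(2)
 proof (induction rule: mvs.span_induct_alt)
  case (step c b y)
  then obtain \<mu> \<beta> where b: "b = mon h \<mu> * mon mvar \<beta>" "ky \<mu> \<subseteq> {..<m}" "\<beta> : red_mons" by (auto simp: g_def)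
  have "mvar x * mon mvar \<beta> : ?E"
  proof (cases "lk \<beta> x + 1 \<le> r - 1")
   case True
   then have "\<beta> + sg x 1 : red_mons" using b(3) \<open>x : I\<close>
   by (auto simp: red_mons_def keys_add_nat lookup_add lookup_single when_def)
   then show ?thesis using base[of 0 "\<beta> + sg x 1"] by (simp add: mon_add mult.commute)
  next
   \<comment> \<open>Here the exponent of \<open>x\<close> in \<open>\<beta>\<close> has reached
     \<open>r - 1\<close>; multiplying by \<open>x\<close> produces the \<open>r\<close>-th power,
     which the integral equation lowers. For \<open>r = 0\<close> that equation would read
     \<open>1 = 0\<close>.\<close>
   case False
   define \<beta>' where "\<beta>' = \<beta> - sg x (lk \<beta> x)"
   have \<beta>: "\<beta> = \<beta>' + sg x (lk \<beta> x)" and x0: "lk \<beta>' x = 0"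
   by (auto intro!: poly_mapping_eqI simp: \<beta>'_def lookup_add lookup_minus lookup_single when_def)
   have red: "\<beta>' + sg x l : red_mons" if "l < r" for l
   using b(3) \<open>x : I\<close> that x0
   by (auto simp: red_mons_def keys_add_nat lookup_add lookup_single when_def \<beta>'_def lookup_minus in_keys_iff
   subset_iff split: if_splits)
   obtain a where a: "\<forall>l<r. a l : A" "mvar x ^ r = (\<Sum>l<r. a l * mvar x ^ l)" using integral[OF \<open>x : I\<close>] by blast
   have "lk \<beta> x \<le> r - 1" using b(3) by (auto simp: red_mons_def)
   then consider "r = 0" | "r = Suc (lk \<beta> x)" using False by linarith
   then show ?thesis
   proof cases
   case 1
   then have "(1 :: ('x,'k) mpol) = 0" using a(2) by simp
   then show ?thesis by simp
   next
   case 2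
   have "mvar x * mon mvar \<beta> = mvar x ^ r * mon mvar \<beta>'"
   by (subst \<beta>) (simp add: mon_add 2 mult_ac)
   also have "... = (\<Sum>l<r. a l * (mon h 0 * mon mvar (\<beta>' + sg x l)))"
   unfolding a(2) sum_distrib_right by (simp add: mon_add mult_ac)
   also have "... : ?E" using a(1) red by (intro mvs.span_sum A_mult base) auto
   finally show ?thesis .
   qed
  qed
  then have "mon h \<mu> * (mvar x * mon mvar \<beta>) : ?E" using A_mult mon_h_A[OF b(2)] by blast
  moreover have "mvar x * (mconst c * b + y) = mconst c * (mon h \<mu> * (mvar x * mon mvar \<beta>)) + mvar x * y"
   by (simp add: b(1) algebra_simps)
  ultimately show ?case using step by (simp add: mvs.span_add mvs.span_scale)
 qed (simp add: mvs.span_zero)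
 have "\<forall>s\<in>?E. p * s : ?E" using p(1)
 proof (induction rule: mpol_ring_induct)
  case (const a)
  show ?case by (intro ballI mvs.span_scale)
 next
  case (var x)
  then show ?case by (intro ballI x_mult)
 next
  case (add p q)
  then show ?case by (intro ballI) (simp only: distrib_right, intro mvs.span_add, blast+)
 next
  case (mult p q)
  then show ?case by (intro ballI) (simp only: mult.assoc)
 qed
 moreover have "1 : ?E" using base[of 0 0] by (simp add: red_mons_def)
 ultimately have "p : ?E" by fastforce
 then have "hcomp d p : mvs.span (g ` {(\<mu>, \<beta>). ky \<mu> \<subseteq> {..<m} & \<beta> : red_mons & wdeg dg \<mu> + mdeg \<beta> = d})"
 proof (induction rule: mvs.span_induct_alt)
  case (step c b y)
  then obtain \<mu> \<beta> where b: "b = mon h \<mu> * mon mvar \<beta>" "ky \<mu> \<subseteq> {..<m}" "\<beta> : red_mons" by (auto simp: g_def)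
  have "hmg (wdeg dg \<mu> + mdeg \<beta>) b"
   unfolding b(1) by (intro homogeneous_mult mon_h_homogeneous b(2) homogeneous_mon) (simp add: homogeneous_mvar[simplified])
  then have "hcomp d b : mvs.span (g ` {(\<mu>, \<beta>). ky \<mu> \<subseteq> {..<m} & \<beta> : red_mons & wdeg dg \<mu> + mdeg \<beta> = d})"
   using b by (auto simp: hcomp_homogeneous g_def intro!: mvs.span_zero mvs.span_base image_eqI[of _ _ "(\<mu>, \<beta>)"])
  then show ?case using step by (simp add: hcomp_add hcomp_mconst_mult mvs.span_add mvs.span_scale)
 qed (simp add: mvs.span_zero)
 then show ?thesis using p(2) by (simp add: hcomp_homogeneous g_def)
qed

end

section \<open>Representations presented by spaces with an action\<close>

text \<open>The laws of an action are demanded on \<open>Z\<close> only: the formulas for the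
  actions below need not define an action of \<open>Q\<close> on the whole ambient type.\<close>

definition subrep ::
 "'q monoid => ('k::field => 'm::ab_group_add => 'm) => ('q => 'm => 'm) => 'm set => bool" where
 "subrep Q sc ac Z \<longleftrightarrow> 0 : Z & (\<forall>x\<in>Z. \<forall>y\<in>Z. x + y : Z) & (ALL a. \<forall>x\<in>Z. sc a x : Z) \<and>
  (\<forall>q\<in>carrier Q. \<forall>x\<in>Z. ac q x : Z & (\<forall>y\<in>Z. ac q (x + y) = ac q x + ac q y) & (ALL a. ac q (sc a x) = sc a (ac q x))) \<and>
  (\<forall>x\<in>Z. ac \<one>\<^bsub>Q\<^esub> x = x) \<and>
  (\<forall>q\<in>carrier Q. \<forall>r\<in>carrier Q. \<forall>x\<in>Z. ac (q \<otimes>\<^bsub>Q\<^esub> r) x = ac q (ac r x))"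

lemma subrepD:
 assumes "subrep Q sc ac Z"
 shows "0 : Z" "x : Z ==> y : Z ==> x + y : Z" "x : Z ==> sc a x : Z"
  "q : carrier Q ==> x : Z ==> ac q x : Z"
  "q : carrier Q ==> x : Z ==> y : Z ==> ac q (x + y) = ac q x + ac q y"
  "q : carrier Q ==> x : Z ==> ac q (sc a x) = sc a (ac q x)"
  "x : Z ==> ac \<one>\<^bsub>Q\<^esub> x = x"
  "q : carrier Q ==> p : carrier Q ==> x : Z ==> ac (q \<otimes>\<^bsub>Q\<^esub> p) x = ac q (ac p x)"
 using assms unfolding subrep_def by simp_all

text \<open>\<open>M\<close> is only assumed to be the image of \<open>Z\<close> under a map
  compatible with the operations. Its module laws are then consequences, so they need not be checked
  directly on cosets.\<close>

definition presents ::
 "'q monoid => ('k::field => 'm::ab_group_add => 'm) => ('q => 'm => 'm) => 'm set => ('q, 'k, 'n) rep => ('m => 'n) => bool" where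
 "presents Q sc ac Z M \<pi> \<longleftrightarrow> \<pi> ` Z = carrier M & (\<forall>x\<in>Z. \<forall>y\<in>Z. \<pi> (x + y) = \<pi> x \<oplus>\<^bsub>M\<^esub> \<pi> y) \<and>
  (ALL a. \<forall>x\<in>Z. \<pi> (sc a x) = a \<odot>\<^bsub>M\<^esub> \<pi> x) & \<pi> 0 = \<zero>\<^bsub>M\<^esub> \<and>
  (\<forall>q\<in>carrier Q. \<forall>x\<in>Z. \<pi> (ac q x) = act M q (\<pi> x))"

definition fdim :: "('k::field => 'm::ab_group_add => 'm) => 'm set => bool" where
 "fdim sc Z \<longleftrightarrow> (EX S. finite S & S \<subseteq> Z & Z \<subseteq> module.span sc S)"

definition srep :: "('k::field => 'm::ab_group_add => 'm) => ('q => 'm => 'm) => 'm set => ('q, 'k, 'm) rep" where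
 "srep sc ac Z = \<lparr>carrier = Z, monoid.mult = undefined, one = undefined, ring.zero = 0, add = (+),
  module.smult = sc, act = ac\<rparr>"

lemma presents_srep: "presents Q sc ac Z (srep sc ac Z) (%x. x)"
 by (simp add: presents_def srep_def)

lemma subrep_subspace: "vector_space sc ==> subrep Q sc ac Z ==> module.subspace sc Z"
proof -
 assume "vector_space sc" "subrep Q sc ac Z"
 then interpret vector_space sc by simp
 show ?thesis using subrepD[OF \<open>subrep Q sc ac Z\<close>] by (auto simp: subspace_def)
qed

lemma fdim_subset:
 assumes "vector_space sc" "fdim sc Z" "module.subspace sc B" "B \<subseteq> Z" shows "fdim sc B"
proof -
 interpret vector_space sc by fact
 obtain S where S: "finite S" "Z \<subseteq> span S" using assms(2) by (auto simp: fdim_def)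
 obtain C where C: "C \<subseteq> B" "independent C" "B \<subseteq> span C" using maximal_independent_subset by blast
 have "finite C" using independent_span_bound[OF S(1) C(2)] C(1) assms(4) S(2) by blast
 then show ?thesis using C unfolding fdim_def by blast
qed

lemma ring_of_type_simps:
 "carrier ring_of_type_algebra = (UNIV :: 'a::comm_ring_1 set)"
 "x \<oplus>\<^bsub>ring_of_type_algebra\<^esub> y = (x + y :: 'a)" "x \<otimes>\<^bsub>ring_of_type_algebra\<^esub> y = x * y"
 "\<one>\<^bsub>ring_of_type_algebra\<^esub> = (1::'a)" "\<zero>\<^bsub>ring_of_type_algebra\<^esub> = (0::'a)"
 by (simp_all add: ring_of_type_algebra_def)

locale presented_rep =
 fixes Q :: "'q monoid" and sc :: "'k::field => 'm::ab_group_add => 'm" and ac Z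
  and M :: "('q, 'k, 'n) rep" and \<pi> :: "'m => 'n"
 assumes Q: "group Q" and vs: "vector_space sc" and subrep: "subrep Q sc ac Z"
  and presents: "presents Q sc ac Z M \<pi>" and fdim: "fdim sc Z"
begin

sublocale vs: vector_space sc by (rule vs)
sublocale Q: group Q by (rule Q)

lemma pi:
 "\<pi> ` Z = carrier M" "x : Z ==> y : Z ==> \<pi> (x + y) = \<pi> x \<oplus>\<^bsub>M\<^esub> \<pi> y"
 "x : Z ==> \<pi> (sc a x) = a \<odot>\<^bsub>M\<^esub> \<pi> x" "\<pi> 0 = \<zero>\<^bsub>M\<^esub>" "q : carrier Q ==> x : Z ==> \<pi> (ac q x) = act M q (\<pi> x)"
 "x : Z ==> \<pi> x : carrier M"
 using presents by (auto simp: presents_def)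

lemma carrierE:
 assumes "y : carrier M" obtains x where "x : Z" "y = \<pi> x"
 using assms pi(1) by blast

lemmas sub = subrepD[OF subrep]

lemma neg: "x : Z ==> - x : Z"
 using sub(3)[of x "-1"] by simp

lemma diff: "x : Z ==> y : Z ==> x - y : Z"
 using sub(2)[of x "-y"] neg by simp

lemma abelian_group: "abelian_group M"
proof (rule abelian_groupI)
 fix x y z assume "x : carrier M" "y : carrier M" "z : carrier M"
 then obtain a b c where *: "a : Z" "x = \<pi> a" "b : Z" "y = \<pi> b" "c : Z" "z = \<pi> c" by (metis carrierE)
 have e: "x \<oplus>\<^bsub>M\<^esub> y = \<pi> (a + b)" "y \<oplus>\<^bsub>M\<^esub> x = \<pi> (b + a)" "y \<oplus>\<^bsub>M\<^esub> z = \<pi> (b + c)" using * by (simp_all add: pi(2))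
 show "x \<oplus>\<^bsub>M\<^esub> y \<oplus>\<^bsub>M\<^esub> z = x \<oplus>\<^bsub>M\<^esub> (y \<oplus>\<^bsub>M\<^esub> z)"
  unfolding e unfolding * using * by (simp add: pi(2)[symmetric] sub(2) add.assoc)
next
 fix x y assume "x : carrier M" "y : carrier M"
 then obtain a b where *: "a : Z" "x = \<pi> a" "b : Z" "y = \<pi> b" by (metis carrierE)
 have e: "x \<oplus>\<^bsub>M\<^esub> y = \<pi> (a + b)" "y \<oplus>\<^bsub>M\<^esub> x = \<pi> (b + a)" using * by (simp_all add: pi(2))
 show "x \<oplus>\<^bsub>M\<^esub> y : carrier M" unfolding e using * by (simp add: pi(6) sub(2))
 show "x \<oplus>\<^bsub>M\<^esub> y = y \<oplus>\<^bsub>M\<^esub> x" unfolding e by (simp add: add.commute)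
next
 show "\<zero>\<^bsub>M\<^esub> : carrier M" using pi(4,6) sub(1) by metis
next
 fix x assume "x : carrier M"
 then obtain a where *: "a : Z" "x = \<pi> a" by (metis carrierE)
 show "\<zero>\<^bsub>M\<^esub> \<oplus>\<^bsub>M\<^esub> x = x" using * pi(2)[of 0 a] sub(1) by (simp add: pi(4))
 show "\<exists>y\<in>carrier M. y \<oplus>\<^bsub>M\<^esub> x = \<zero>\<^bsub>M\<^esub>"
  using * pi(2)[of "-a" a] neg[of a] by (intro bexI[of _ "\<pi> (-a)"]) (simp_all add: pi(4,6))
qed

lemma module: "Module.module ring_of_type_algebra M"
proof (rule moduleI[OF cring_from_type_algebra abelian_group])
 fix a :: 'k and x assume "x : carrier M"
 then obtain u where u: "u : Z" "x = \<pi> u" by (metis carrierE)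
 show "a \<odot>\<^bsub>M\<^esub> x : carrier M" using u by (simp add: pi(3)[symmetric] pi(6) sub(3))
 show "\<one>\<^bsub>ring_of_type_algebra\<^esub> \<odot>\<^bsub>M\<^esub> x = x" using u by (simp add: ring_of_type_simps pi(3)[symmetric])
 fix b :: 'k
 show "(a \<oplus>\<^bsub>ring_of_type_algebra\<^esub> b) \<odot>\<^bsub>M\<^esub> x = a \<odot>\<^bsub>M\<^esub> x \<oplus>\<^bsub>M\<^esub> b \<odot>\<^bsub>M\<^esub> x"
  using u by (simp add: ring_of_type_simps pi(3)[symmetric] pi(2)[symmetric] sub(3) vs.scale_left_distrib)
 show "(a \<otimes>\<^bsub>ring_of_type_algebra\<^esub> b) \<odot>\<^bsub>M\<^esub> x = a \<odot>\<^bsub>M\<^esub> (b \<odot>\<^bsub>M\<^esub> x)"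
  using u by (simp add: ring_of_type_simps pi(3)[symmetric] sub(3))
next
 fix a :: 'k and x y assume "x : carrier M" "y : carrier M"
 then obtain u w where "u : Z" "x = \<pi> u" "w : Z" "y = \<pi> w" by (metis carrierE)
 then show "a \<odot>\<^bsub>M\<^esub> (x \<oplus>\<^bsub>M\<^esub> y) = a \<odot>\<^bsub>M\<^esub> x \<oplus>\<^bsub>M\<^esub> a \<odot>\<^bsub>M\<^esub> y"
  by (simp add: pi(3)[symmetric] pi(2)[symmetric] sub(2,3) vs.scale_right_distrib)
qed

lemma is_rep: "is_rep Q M"
 unfolding is_rep_def
proof (intro conjI ballI module)
 fix q assume q: "q : carrier Q"
 show "linear_on M M (act M q)"
  unfolding linear_on_def
 proof (intro conjI ballI allI funcsetI)
  fix x assume "x : carrier M"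
  then obtain u where u: "u : Z" "x = \<pi> u" by (metis carrierE)
  show "act M q x : carrier M" using u q by (simp add: pi(5)[symmetric] pi(6) sub(4))
  show "act M q (a \<odot>\<^bsub>M\<^esub> x) = a \<odot>\<^bsub>M\<^esub> act M q x" for a
   using u q by (simp add: pi(5)[symmetric] pi(3)[symmetric] sub(3,4,6))
  fix y assume "y : carrier M"
  then obtain w where w: "w : Z" "y = \<pi> w" by (metis carrierE)
  show "act M q (x \<oplus>\<^bsub>M\<^esub> y) = act M q x \<oplus>\<^bsub>M\<^esub> act M q y"
   using u w q by (simp add: pi(5)[symmetric] pi(2)[symmetric] sub(2,4,5))
 qed
next
 fix x assume "x : carrier M"
 then obtain u where u: "u : Z" "x = \<pi> u" by (metis carrierE)
 show "act M \<one>\<^bsub>Q\<^esub> x = x" using u by (simp add: pi(5)[symmetric] sub(7))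
next
 fix q p x assume q: "q : carrier Q" "p : carrier Q" and "x : carrier M"
 then obtain u where u: "u : Z" "x = \<pi> u" by (metis carrierE)
 show "act M (q \<otimes>\<^bsub>Q\<^esub> p) x = act M q (act M p x)"
  using u q by (simp add: pi(5)[symmetric] sub(4,8))
qed

lemma fin_dim_rep: "fin_dim_rep Q M"
 unfolding fin_dim_rep_def
proof (intro conjI is_rep)
 interpret M: Module.module ring_of_type_algebra M by (rule module)
 obtain S where S: "finite S" "S \<subseteq> Z" "Z \<subseteq> vs.span S" using fdim by (auto simp: fdim_def)
 have SM: "\<pi> ` S \<subseteq> carrier M" using S(2) pi(6) by auto
 define L where "L = {x. EX a. x = (\<Oplus>\<^bsub>M\<^esub>s\<in>\<pi> ` S. a s \<odot>\<^bsub>M\<^esub> s)}"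
 have cl: "a \<odot>\<^bsub>M\<^esub> s : carrier M" if "s : \<pi> ` S" for a s
  using M.smult_closed[of a s] that SM by (auto simp: ring_of_type_simps)
 have "\<pi> z : L & z : Z" if "z : vs.span S" for z
  using that
 proof (induction rule: vs.span_induct_alt)
  case base
  have "\<pi> 0 = (\<Oplus>\<^bsub>M\<^esub>s\<in>\<pi> ` S. 0 \<odot>\<^bsub>M\<^esub> s)"
  proof -
   have "(\<Oplus>\<^bsub>M\<^esub>s\<in>\<pi> ` S. 0 \<odot>\<^bsub>M\<^esub> s) = (\<Oplus>\<^bsub>M\<^esub>s\<in>\<pi> ` S. \<zero>\<^bsub>M\<^esub>)"
   using SM M.smult_l_null by (intro M.finsum_cong'[OF refl]) (auto simp: ring_of_type_simps)
   then show ?thesis by (simp add: pi(4))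
  qed
  then show ?case using sub(1) by (auto simp: L_def)
 next
  case (step c x y)
  then obtain a where a: "\<pi> y = (\<Oplus>\<^bsub>M\<^esub>s\<in>\<pi> ` S. a s \<odot>\<^bsub>M\<^esub> s)" "y : Z" by (auto simp: L_def)
  have x: "x : Z" "\<pi> x : \<pi> ` S" using step(1) S(2) by auto
  define b where "b s = (if \<pi> x = s then c else 0)" for s
  have "(\<Oplus>\<^bsub>M\<^esub>s\<in>\<pi> ` S. b s \<odot>\<^bsub>M\<^esub> s) = (\<Oplus>\<^bsub>M\<^esub>s\<in>\<pi> ` S. if \<pi> x = s then c \<odot>\<^bsub>M\<^esub> s else \<zero>\<^bsub>M\<^esub>)"
  proof (rule M.finsum_cong'[OF refl])
   show "(%s. if \<pi> x = s then c \<odot>\<^bsub>M\<^esub> s else \<zero>\<^bsub>M\<^esub>) : \<pi> ` S \<rightarrow> carrier M" using cl by auto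
   fix s assume "s : \<pi> ` S"
   then show "b s \<odot>\<^bsub>M\<^esub> s = (if \<pi> x = s then c \<odot>\<^bsub>M\<^esub> s else \<zero>\<^bsub>M\<^esub>)"
   using SM M.smult_l_null[of s] by (auto simp: b_def ring_of_type_simps)
  qed
  also have "... = c \<odot>\<^bsub>M\<^esub> \<pi> x"
   using M.finsum_singleton[OF x(2), of "%s. c \<odot>\<^bsub>M\<^esub> s"] S(1) cl by auto
  finally have bx: "c \<odot>\<^bsub>M\<^esub> \<pi> x = (\<Oplus>\<^bsub>M\<^esub>s\<in>\<pi> ` S. b s \<odot>\<^bsub>M\<^esub> s)" by simp
  have "\<pi> (sc c x + y) = (\<Oplus>\<^bsub>M\<^esub>s\<in>\<pi> ` S. b s \<odot>\<^bsub>M\<^esub> s \<oplus>\<^bsub>M\<^esub> a s \<odot>\<^bsub>M\<^esub> s)"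
   using x a cl by (simp add: pi(2,3) sub(3) bx M.finsum_addf Pi_def)
  also have "... = (\<Oplus>\<^bsub>M\<^esub>s\<in>\<pi> ` S. (b s + a s) \<odot>\<^bsub>M\<^esub> s)"
   using SM M.smult_l_distr cl by (intro M.finsum_cong'[OF refl]) (auto simp: ring_of_type_simps)
  finally have "\<pi> (sc c x + y) : L" unfolding L_def by (intro CollectI exI[of _ "%s. b s + a s"])
  then show ?case using x(1) a(2) by (simp add: sub(2,3))
 qed
 then have "\<forall>x\<in>carrier M. x : L" using S(3) by (metis carrierE subsetD)
 then show "EX S. finite S & S \<subseteq> carrier M & (\<forall>x\<in>carrier M. EX a. x = (\<Oplus>\<^bsub>M\<^esub>s\<in>S. a s \<odot>\<^bsub>M\<^esub> s))"
  using S(1) SM by (intro exI[of _ "\<pi> ` S"]) (auto simp: L_def)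
qed

definition ker where "ker = {x\<in>Z. \<pi> x = \<zero>\<^bsub>M\<^esub>}"

lemma ker_subrep: "subrep Q sc ac ker"
proof -
 interpret M: Module.module ring_of_type_algebra M by (rule module)
 have z: "a \<odot>\<^bsub>M\<^esub> \<zero>\<^bsub>M\<^esub> = \<zero>\<^bsub>M\<^esub>" for a using M.smult_r_null[of a] by (simp add: ring_of_type_simps)
 have "act M q \<zero>\<^bsub>M\<^esub> = \<zero>\<^bsub>M\<^esub>" if q: "q : carrier Q" for q
  using pi(5)[OF q sub(1)] sub(6)[OF q sub(1), of 0] by (simp add: pi(4))
 then show ?thesis unfolding subrep_def ker_def
  using sub by (auto simp: pi(2,3,4,5) z)
qed

lemma eq_iff: "x : Z ==> y : Z ==> \<pi> x = \<pi> y \<longleftrightarrow> x - y : ker"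
proof
 interpret M: Module.module ring_of_type_algebra M by (rule module)
 assume x: "x : Z" and y: "y : Z"
 have s: "\<pi> (x - y) \<oplus>\<^bsub>M\<^esub> \<pi> y = \<pi> x" using pi(2)[OF diff[OF x y] y] by simp
 { assume "\<pi> x = \<pi> y"
  then have "\<pi> (x - y) \<oplus>\<^bsub>M\<^esub> \<pi> y = \<zero>\<^bsub>M\<^esub> \<oplus>\<^bsub>M\<^esub> \<pi> y" using s pi(6)[OF y] by simp
  then have "\<pi> (x - y) = \<zero>\<^bsub>M\<^esub>" using pi(6)[OF y] pi(6)[OF diff[OF x y]] M.zero_closed M.add.r_cancel by metis
  then show "x - y : ker" using diff[OF x y] by (simp add: ker_def) }
 { assume "x - y : ker"
  then show "\<pi> x = \<pi> y" using s pi(6)[OF y] by (simp add: ker_def) }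
qed

end

text \<open>Both are quotients of the same \<open>Z\<close>; equal kernels make the choice of a
  preimage in \<open>f\<close> irrelevant.\<close>

lemma rep_iso_same_kernel:
 assumes M: "presented_rep Q sc ac Z M \<pi>" and N: "presented_rep Q sc ac Z N \<rho>"
  and ker: "!!x. x : Z ==> \<pi> x = \<zero>\<^bsub>M\<^esub> \<longleftrightarrow> \<rho> x = \<zero>\<^bsub>N\<^esub>"
 shows "rep_iso Q M N"
proof -
 interpret M: presented_rep Q sc ac Z M \<pi> by fact
 interpret N: presented_rep Q sc ac Z N \<rho> by fact
 have k: "M.ker = N.ker" using ker by (auto simp: M.ker_def N.ker_def)
 define f where "f y = \<rho> (SOME z. z : Z & \<pi> z = y)" for y
 have f: "f (\<pi> z) = \<rho> z" if z: "z : Z" for z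
 proof -
  have "(SOME z'. z' : Z & \<pi> z' = \<pi> z) : Z & \<pi> (SOME z'. z' : Z & \<pi> z' = \<pi> z) = \<pi> z"
   by (rule someI[of _ z]) (use z in simp)
  then show ?thesis unfolding f_def using M.eq_iff N.eq_iff k z by blast
 qed
 have "rep_hom Q M N f" unfolding rep_hom_def linear_on_def
 proof (intro conjI ballI allI funcsetI)
  fix x assume "x : carrier M"
  then obtain u where u: "u : Z" "x = \<pi> u" by (metis M.carrierE)
  show "f x : carrier N" using u f N.pi(6) by simp
  show "f (a \<odot>\<^bsub>M\<^esub> x) = a \<odot>\<^bsub>N\<^esub> f x" for a
   using u f M.sub(3) by (simp add: M.pi(3)[symmetric] N.pi(3))
  show "f (act M q x) = act N q (f x)" if "q : carrier Q" for q
   using u f that M.sub(4) by (simp add: M.pi(5)[symmetric] N.pi(5))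
  fix y assume "y : carrier M"
  then obtain w where w: "w : Z" "y = \<pi> w" by (metis M.carrierE)
  show "f (x \<oplus>\<^bsub>M\<^esub> y) = f x \<oplus>\<^bsub>N\<^esub> f y"
   using u w f M.sub(2) by (simp add: M.pi(2)[symmetric] N.pi(2))
 qed
 moreover have "bij_betw f (carrier M) (carrier N)"
 proof -
  have "inj_on f (carrier M)"
  proof (rule inj_onI)
   fix x y assume "x : carrier M" "y : carrier M" "f x = f y"
   then show "x = y" by (metis M.carrierE f M.eq_iff N.eq_iff k)
  qed
  moreover have "f ` carrier M = carrier N"
   unfolding M.pi(1)[symmetric] N.pi(1)[symmetric] using f by (auto simp: image_iff)
  ultimately show ?thesis by (simp add: bij_betw_def)
 qed
 ultimately show ?thesis by (auto simp: rep_iso_def)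
qed

context presented_rep
begin

text \<open>A linear map to \<open>nat \<Rightarrow>\<^sub>0 'k\<close> with the same kernel as \<open>\<pi>\<close> transports the structure to the universal carrier type.\<close>

lemma urep_exists: "\<exists>U :: ('q, 'k) urep. U : fd_reps Q & rep_iso Q M U"
proof -
 have ksub: "vs.subspace ker" by (rule subrep_subspace[OF vs ker_subrep])
 obtain S where S: "finite S" "Z \<subseteq> vs.span S" using fdim by (auto simp: fdim_def)
 obtain B0 where B0: "B0 \<subseteq> ker" "vs.independent B0" "ker \<subseteq> vs.span B0" using vs.maximal_independent_subset by blast
 have B0Z: "B0 \<subseteq> Z" using B0(1) by (auto simp: ker_def)
 obtain C where C: "B0 \<subseteq> C" "C \<subseteq> Z" "vs.independent C" "Z \<subseteq> vs.span C"
  using vs.maximal_independent_subset_extend[OF B0Z B0(2)] by blast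
 have finC: "finite C" using vs.independent_span_bound[OF S(1) C(3)] C(2) S(2) by blast
 obtain e :: "'m => nat" where e: "inj_on e (C - B0)" using finite_imp_inj_to_nat_seg[of "C - B0"] finC by auto
 \<comment> \<open>\<open>C\<close> extends a basis \<open>B0\<close> of the kernel, and
   \<open>\<phi>\<close> keeps the coordinates outside \<open>B0\<close>, numbered by
   \<open>e\<close>. Hence on \<open>Z\<close> it vanishes exactly on the kernel.\<close>
 define \<phi> where "\<phi> x = (\<Sum>d\<in>C - B0. sg (e d) (vs.representation C x d))" for x
 have \<phi>_add: "\<phi> (x + y) = \<phi> x + \<phi> y" if "x : Z" "y : Z" for x y
  using that C(4) by (simp add: \<phi>_def vs.representation_add[OF C(3)] subset_iff single_add sum.distrib)
 have \<phi>_sc: "\<phi> (sc a x) = sg 0 a * \<phi> x" if "x : Z" for a x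
  using that C(4) by (simp add: \<phi>_def vs.representation_scale[OF C(3)] subset_iff sum_distrib_left mult_single)
 have \<phi>_0: "\<phi> 0 = 0" using \<phi>_sc[OF sub(1), of 0] by simp
 have \<phi>_ker: "\<phi> x = 0 \<longleftrightarrow> \<pi> x = \<zero>\<^bsub>M\<^esub>" if x: "x : Z" for x
 proof
  have xC: "x : vs.span C" using x C(4) by auto
  { assume "\<phi> x = 0"
   have "vs.representation C x d = 0" if d: "d : C - B0" for d
   proof -
   have "lk (\<phi> x) (e d) = (\<Sum>d'\<in>C - B0. if d' = d then vs.representation C x d' else 0)"
   unfolding \<phi>_def lookup_sum by (intro sum.cong refl) (use e d in \<open>auto simp: lookup_single when_def inj_on_def\<close>)
   then show ?thesis using d finC \<open>\<phi> x = 0\<close> by simp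
   qed
   then have sub: "{b. vs.representation C x b ~= 0} \<subseteq> B0" using vs.representation_ne_zero by blast
   have "x = (\<Sum>b | vs.representation C x b ~= 0. sc (vs.representation C x b) b)"
   using vs.sum_nonzero_representation_eq[OF C(3) xC] by simp
   moreover have "(\<Sum>b | vs.representation C x b ~= 0. sc (vs.representation C x b) b) : ker"
   by (intro vs.subspace_sum[OF ksub] vs.subspace_scale[OF ksub]) (use B0(1) sub in blast)
   ultimately have "x : ker" by (rule ssubst)
   then show "\<pi> x = \<zero>\<^bsub>M\<^esub>" by (simp add: ker_def) }
  { assume "\<pi> x = \<zero>\<^bsub>M\<^esub>"
   then have "x : vs.span B0" using x B0(3) by (auto simp: ker_def)
   then have "vs.representation C x = vs.representation B0 x" using vs.representation_extend[OF C(3) _ C(1)] by blast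
   then have "vs.representation C x d = 0" if "d : C - B0" for d using that vs.representation_ne_zero by fastforce
   then show "\<phi> x = 0" by (simp add: \<phi>_def) }
 qed
 have \<phi>_eq: "\<phi> x = \<phi> y \<longleftrightarrow> \<pi> x = \<pi> y" if "x : Z" "y : Z" for x y
 proof -
  have "\<phi> (x - y) + \<phi> y = \<phi> x" using \<phi>_add[OF diff[OF that] that(2)] by simp
  then show ?thesis using \<phi>_ker[OF diff[OF that]] eq_iff[OF that] diff[OF that] by (auto simp: ker_def)
 qed
 define U :: "('q, 'k) urep" where "U = \<lparr>carrier = \<phi> ` Z, monoid.mult = undefined, one = undefined, ring.zero = 0, add = (+),
  module.smult = (%a y. sg 0 a * y), act = (%q y. \<phi> (ac q (SOME z. z : Z & \<phi> z = y)))\<rparr>"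
 have "presents Q sc ac Z U \<phi>"
  unfolding presents_def
 proof (intro conjI ballI allI)
  fix q x assume q: "q : carrier Q" and x: "x : Z"
  define z where "z = (SOME z. z : Z & \<phi> z = \<phi> x)"
  have z: "z : Z" "\<phi> z = \<phi> x" using someI[of "%z. z : Z & \<phi> z = \<phi> x" x] x by (auto simp: z_def)
  then have "\<pi> (ac q z) = \<pi> (ac q x)" using \<phi>_eq[OF z(1) x] q x by (simp add: pi(5))
  then have "\<phi> (ac q z) = \<phi> (ac q x)" using \<phi>_eq z x q sub(4) by blast
  then show "\<phi> (ac q x) = act U q (\<phi> x)" by (simp add: U_def z_def)
 qed (simp_all add: U_def \<phi>_add \<phi>_sc \<phi>_0)
 then have U: "presented_rep Q sc ac Z U \<phi>"
  using Q vs subrep fdim by (simp add: presented_rep_def)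
 then have "U : fd_reps Q" by (simp add: fd_reps_def presented_rep.fin_dim_rep)
 moreover have "rep_iso Q M U"
  by (rule rep_iso_same_kernel[OF _ U]) (use \<phi>_ker presented_rep_axioms in \<open>auto simp: U_def\<close>)
 ultimately show ?thesis by blast
qed

end

text \<open>Representative, in the free abelian group, of the coset \<open>rep_class\<close>.
  Computations are done additively with these representatives modulo \<open>relation_group\<close>
  and turned into cosets only at the end.\<close>

definition cls :: "'q monoid => ('q, 'k::field, 'm) rep => (('q, 'k) urep \<Rightarrow>\<^sub>0 int)" where
 "cls Q M = frag_of (SOME U. U : fd_reps Q & rep_iso Q M U)"

lemma rep_class_cls: "rep_class Q M = relation_group Q #>\<^bsub>free_Abelian_group (fd_reps Q)\<^esub> cls Q M"
 by (simp add: rep_class_def cls_def)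

lemma rep_hom_comp: "rep_hom Q L M f ==> rep_hom Q M N g ==> rep_hom Q L N (%x. g (f x))"
 unfolding rep_hom_def linear_on_def by (auto simp: Pi_def)

lemma rep_hom_inv:
 assumes f: "rep_hom Q M N f" "bij_betw f (carrier M) (carrier N)" and M: "is_rep Q M"
 shows "rep_hom Q N M (inv_into (carrier M) f)"
proof -
 interpret M: Module.module ring_of_type_algebra M using M by (simp add: is_rep_def)
 let ?g = "inv_into (carrier M) f"
 have g: "?g y : carrier M" "f (?g y) = y" if "y : carrier N" for y
  using f(2) that by (auto simp: bij_betw_def inv_into_into f_inv_into_f)
 have gf: "?g (f x) = x" if "x : carrier M" for x
  using f(2) that by (simp add: bij_betw_def)
 have fh: "f (x \<oplus>\<^bsub>M\<^esub> y) = f x \<oplus>\<^bsub>N\<^esub> f y" "f (a \<odot>\<^bsub>M\<^esub> x) = a \<odot>\<^bsub>N\<^esub> f x" "q : carrier Q ==> f (act M q x) = act N q (f x)"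
  if "x : carrier M" "y : carrier M" for x y a q
  using f(1) that by (auto simp: rep_hom_def linear_on_def)
 have act: "act M q x : carrier M" if "q : carrier Q" "x : carrier M" for q x
  using M that by (auto simp: is_rep_def linear_on_def)
 show ?thesis unfolding rep_hom_def linear_on_def
 proof (intro conjI ballI allI funcsetI)
  fix x assume x: "x : carrier N"
  show "?g x : carrier M" using g x by blast
  show "?g (a \<odot>\<^bsub>N\<^esub> x) = a \<odot>\<^bsub>M\<^esub> ?g x" for a
   using fh(2)[OF g(1)[OF x] g(1)[OF x], of a] g[OF x] gf[of "a \<odot>\<^bsub>M\<^esub> ?g x"] M.smult_closed[of a "?g x"]
   by (simp add: ring_of_type_simps)
  show "?g (act N q x) = act M q (?g x)" if q: "q : carrier Q" for q
   using fh(3)[OF g(1)[OF x] g(1)[OF x] q] g[OF x] gf[OF act[OF q g(1)[OF x]]] by simp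
  fix y assume y: "y : carrier N"
  show "?g (x \<oplus>\<^bsub>N\<^esub> y) = ?g x \<oplus>\<^bsub>M\<^esub> ?g y"
   using fh(1)[OF g(1)[OF x] g(1)[OF y]] g[OF x] g[OF y] gf[of "?g x \<oplus>\<^bsub>M\<^esub> ?g y"] by simp
 qed
qed

context presented_rep
begin

lemma cls_ex: "EX U. U : fd_reps Q & rep_iso Q M U & cls Q M = frag_of U"
 unfolding cls_def using someI_ex[OF urep_exists] by blast

lemma ker_presented: "presented_rep Q sc ac ker (srep sc ac ker) (%x. x)"
 using Q vs ker_subrep presents_srep[of Q sc ac ker] fdim_subset[OF vs fdim subrep_subspace[OF vs ker_subrep]]
 by (auto simp: presented_rep_def ker_def)

lemma Z_presented: "presented_rep Q sc ac Z (srep sc ac Z) (%x. x)"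
 using Q vs subrep presents_srep fdim by (simp add: presented_rep_def)

text \<open>The short exact sequence is formed by the kernel, \<open>Z\<close> and \<open>M\<close>.
  Each term is replaced by the copy that \<open>cls\<close> has chosen, and the maps are composed
  with the chosen isomorphisms.\<close>

lemma cls_relation: "cls Q (srep sc ac Z) - cls Q (srep sc ac ker) - cls Q M : ses_relations Q"
proof -
 let ?Z = "srep sc ac Z" and ?B = "srep sc ac ker"
 interpret Z: presented_rep Q sc ac Z ?Z "%x. x" by (rule Z_presented)
 interpret B: presented_rep Q sc ac ker ?B "%x. x" by (rule ker_presented)
 obtain UZ iZ where Z: "UZ : fd_reps Q" "cls Q ?Z = frag_of UZ" "rep_hom Q ?Z UZ iZ" "bij_betw iZ (carrier ?Z) (carrier UZ)"
  using Z.cls_ex by (auto simp: rep_iso_def)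
 obtain UB iB where B: "UB : fd_reps Q" "cls Q ?B = frag_of UB" "rep_hom Q ?B UB iB" "bij_betw iB (carrier ?B) (carrier UB)"
  using B.cls_ex by (auto simp: rep_iso_def)
 obtain UM iM where M: "UM : fd_reps Q" "cls Q M = frag_of UM" "rep_hom Q M UM iM" "bij_betw iM (carrier M) (carrier UM)"
  using cls_ex by (auto simp: rep_iso_def)
 let ?jB = "inv_into (carrier ?B) iB" and ?jZ = "inv_into (carrier ?Z) iZ"
 have jB: "rep_hom Q UB ?B ?jB" by (rule rep_hom_inv[OF B(3,4) B.is_rep])
 have jZ: "rep_hom Q UZ ?Z ?jZ" by (rule rep_hom_inv[OF Z(3,4) Z.is_rep])
 have inc: "rep_hom Q ?B ?Z (%x. x)" by (auto simp: rep_hom_def linear_on_def srep_def ker_def)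
 have pr: "rep_hom Q ?Z M \<pi>" using pi by (auto simp: rep_hom_def linear_on_def srep_def)
 have c[simp]: "carrier ?B = ker" "carrier ?Z = Z" by (simp_all add: srep_def)
 have kZ: "ker \<subseteq> Z" by (auto simp: ker_def)
 have jBb: "bij_betw ?jB (carrier UB) ker" using bij_betw_inv_into[OF B(4)] by simp
 have jZb: "bij_betw ?jZ (carrier UZ) Z" using bij_betw_inv_into[OF Z(4)] by simp
 have iZ_inj: "inj_on iZ Z" and iZ_im: "iZ ` Z = carrier UZ" using Z(4) by (auto simp: bij_betw_def)
 have jiZ: "?jZ (iZ z) = z" if "z : Z" for z using that iZ_inj by simp
 have ijZ: "iZ (?jZ y) = y" if "y : carrier UZ" for y using that iZ_im by (simp add: f_inv_into_f)
 have zero: "iM y = \<zero>\<^bsub>UM\<^esub> \<longleftrightarrow> y = \<zero>\<^bsub>M\<^esub>" if y: "y : carrier M" for y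
 proof -
  interpret Mm: Module.module ring_of_type_algebra M by (rule module)
  interpret Um: Module.module ring_of_type_algebra UM using M(1) by (simp add: fd_reps_def fin_dim_rep_def is_rep_def)
  have "iM (\<zero>\<^bsub>M\<^esub> \<oplus>\<^bsub>M\<^esub> \<zero>\<^bsub>M\<^esub>) = iM \<zero>\<^bsub>M\<^esub> \<oplus>\<^bsub>UM\<^esub> iM \<zero>\<^bsub>M\<^esub>" and iM0: "iM \<zero>\<^bsub>M\<^esub> : carrier UM"
   using M(3) Mm.zero_closed unfolding rep_hom_def linear_on_def by blast+
  then have "iM \<zero>\<^bsub>M\<^esub> = \<zero>\<^bsub>UM\<^esub>" using Um.add.l_cancel_one' by (simp add: Mm.zero_closed)
  then show ?thesis using M(4) y Mm.zero_closed unfolding bij_betw_def inj_on_def by metis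
 qed
 have "short_exact Q UB UZ UM"
  unfolding short_exact_def
 proof (intro exI conjI)
  show "rep_hom Q UB UZ (%x. iZ (?jB x))"
   using rep_hom_comp[OF rep_hom_comp[OF jB inc] Z(3)] .
  show "rep_hom Q UZ UM (%x. iM (\<pi> (?jZ x)))"
   using rep_hom_comp[OF rep_hom_comp[OF jZ pr] M(3)] .
  show "inj_on (%x. iZ (?jB x)) (carrier UB)"
   using jBb iZ_inj kZ comp_inj_on[of ?jB "carrier UB" iZ] by (auto simp: bij_betw_def comp_def intro: inj_on_subset)
  have "(%x. iM (\<pi> (?jZ x))) ` carrier UZ = iM ` \<pi> ` ?jZ ` carrier UZ" by (simp add: image_image)
  also have "?jZ ` carrier UZ = Z" using jZb by (simp add: bij_betw_def)
  finally show "(%x. iM (\<pi> (?jZ x))) ` carrier UZ = carrier UM" using M(4) by (simp add: pi(1) bij_betw_def)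
  have "(%x. iZ (?jB x)) ` carrier UB = iZ ` ?jB ` carrier UB" by (simp add: image_image)
  also have "?jB ` carrier UB = ker" using jBb by (simp add: bij_betw_def)
  also have "iZ ` ker = {x : carrier UZ. iM (\<pi> (?jZ x)) = \<zero>\<^bsub>UM\<^esub>}"
  proof (intro equalityI subsetI)
   fix y assume "y : iZ ` ker"
   then obtain z where z: "z : ker" "y = iZ z" by auto
   then show "y : {x : carrier UZ. iM (\<pi> (?jZ x)) = \<zero>\<^bsub>UM\<^esub>}"
   using iZ_im jiZ zero[of "\<pi> z"] pi(6)[of z] unfolding ker_def by auto
  next
   fix y assume y: "y : {x : carrier UZ. iM (\<pi> (?jZ x)) = \<zero>\<^bsub>UM\<^esub>}"
   have "?jZ y : Z" using jZb y by (auto simp: bij_betw_def)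
   then have "?jZ y : ker" using zero[of "\<pi> (?jZ y)"] pi(6) y by (auto simp: ker_def)
   then show "y : iZ ` ker" using ijZ y by (intro image_eqI[of _ _ "?jZ y"]) auto
  qed
  finally show "(%x. iZ (?jB x)) ` carrier UB = {x : carrier UZ. iM (\<pi> (?jZ x)) = \<zero>\<^bsub>UM\<^esub>}" .
 qed
 then show ?thesis unfolding ses_relations_def Z(2) B(2) M(2) using Z(1) B(1) M(1) by blast
qed

end

section \<open>The Grothendieck group\<close>

lemma ses_relations_carrier: "ses_relations Q \<subseteq> carrier (free_Abelian_group (fd_reps Q))"
proof
 fix x assume "x : ses_relations Q"
 then obtain L M N where *: "x = frag_of M - frag_of L - frag_of N" "L : fd_reps Q" "M : fd_reps Q" "N : fd_reps Q"
  by (auto simp: ses_relations_def)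
 have "ky x \<subseteq> {L, M, N}" unfolding *(1) by (rule order_trans[OF keys_diff]) (use keys_diff[of "frag_of M" "frag_of L"] in auto)
 then show "x : carrier (free_Abelian_group (fd_reps Q))" using * by auto
qed

lemma relation_group_subgroup: "subgroup (relation_group Q) (free_Abelian_group (fd_reps Q))"
 unfolding relation_group_def
 by (rule group.generate_is_subgroup[OF group_free_Abelian_group ses_relations_carrier])

lemma relation_group_closed:
 "0 : relation_group Q" "x : relation_group Q ==> y : relation_group Q ==> x + y : relation_group Q"
 "x : relation_group Q ==> - x : relation_group Q"
proof -
 interpret subgroup "relation_group Q" "free_Abelian_group (fd_reps Q)" by (rule relation_group_subgroup)
 show "0 : relation_group Q" using one_closed by simp
 show "x : relation_group Q ==> y : relation_group Q ==> x + y : relation_group Q" using m_closed by simp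
 assume x: "x : relation_group Q"
 from subsetD[OF subset x] have "ky x \<subseteq> fd_reps Q" by simp
 then show "- x : relation_group Q" using m_inv_closed[OF x] by simp
qed

lemma grothendieck_coset_eq:
 assumes "x - y : relation_group Q"
 shows "relation_group Q #>\<^bsub>free_Abelian_group (fd_reps Q)\<^esub> x = relation_group Q #>\<^bsub>free_Abelian_group (fd_reps Q)\<^esub> y"
proof -
 have "\<exists>r'\<in>relation_group Q. r + x = r' + y" if "r : relation_group Q" "x - y : relation_group Q" for r x y
  by (rule bexI[of _ "r + (x - y)"]) (auto intro: relation_group_closed that)
 moreover have "y - x : relation_group Q" using relation_group_closed(3)[OF assms] by simp
 ultimately show ?thesis using assms by (auto simp: r_coset_def)
qed

text \<open>Translates the multiplicatively written alternating sum into the coset of an additive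
  one; the exponents \<open>1\<close> and \<open>-1\<close> become signs.\<close>

lemma grothendieck_finprod:
 fixes M :: "'s => ('q, 'k::field, 'm) rep" and n :: "'s => int"
 assumes fin: "finite S" and n: "!!s. s : S ==> n s = 1 \<or> n s = - 1"
  and M: "!!s. s : S ==> ky (cls Q (M s)) \<subseteq> fd_reps Q"
 shows "finprod (grothendieck_group Q) (%s. rep_class Q (M s) [^]\<^bsub>grothendieck_group Q\<^esub> n s) S
  = relation_group Q #>\<^bsub>free_Abelian_group (fd_reps Q)\<^esub> (\<Sum>s\<in>S. if n s = 1 then cls Q (M s) else - cls Q (M s))"
proof -
 let ?F = "free_Abelian_group (fd_reps Q) :: (('q, 'k) urep \<Rightarrow>\<^sub>0 int) monoid"
 let ?R = "grothendieck_group Q :: (('q, 'k) urep \<Rightarrow>\<^sub>0 int) set monoid"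
 interpret F: comm_group ?F by (rule abelian_free_Abelian_group)
 interpret R: comm_group ?R unfolding grothendieck_group_def
  by (rule F.abelian_FactGroup[OF relation_group_subgroup])
 let ?c = "%x. relation_group Q #>\<^bsub>?F\<^esub> x"
 have nrm: "normal (relation_group Q) ?F" by (rule F.subgroup_imp_normal[OF relation_group_subgroup])
 have hom: "?c : hom ?F ?R" unfolding grothendieck_group_def by (rule normal.r_coset_hom_Mod[OF nrm])
 have c_carrier: "?c x : carrier ?R" if "ky x \<subseteq> fd_reps Q" for x
  using hom that by (auto simp: hom_def)
 have c_add: "?c (x + y) = ?c x \<otimes>\<^bsub>?R\<^esub> ?c y" if "ky x \<subseteq> fd_reps Q" "ky y \<subseteq> fd_reps Q" for x y
  using hom_mult[OF hom, of x y] that by simp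
 define v where "v s = (if n s = 1 then cls Q (M s) else - cls Q (M s))" for s
 have v: "ky (v s) \<subseteq> fd_reps Q" if "s : S" for s
  using M[OF that] by (simp add: v_def)
 have pw: "rep_class Q (M s) [^]\<^bsub>?R\<^esub> n s = ?c (v s)" if s: "s : S" for s
 proof -
  have "ky (cls Q (M s)) \<subseteq> fd_reps Q" using M[OF s] .
  then have "?c (cls Q (M s) [^]\<^bsub>?F\<^esub> n s) = ?c (cls Q (M s)) [^]\<^bsub>?R\<^esub> n s"
   using hom_int_pow[OF hom] F.is_group R.is_group by simp
  then show ?thesis using n[OF s] M[OF s] by (auto simp: rep_class_cls v_def)
 qed
 have "finprod ?R (%s. ?c (v s)) T = ?c (\<Sum>s\<in>T. v s) & ky (\<Sum>s\<in>T. v s) \<subseteq> fd_reps Q" if "T \<subseteq> S" for T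
  using finite_subset[OF that fin] that
 proof (induction T rule: finite_induct)
  case empty
  have "?c 0 = \<one>\<^bsub>?R\<^esub>" using hom_one[OF hom F.is_group R.is_group] by simp
  then show ?case by simp
 next
  case (insert s T)
  then have "finprod ?R (%s. ?c (v s)) (insert s T) = ?c (v s) \<otimes>\<^bsub>?R\<^esub> finprod ?R (%s. ?c (v s)) T"
   by (intro R.finprod_insert) (auto intro!: c_carrier v)
  moreover have "ky (v s + (\<Sum>s\<in>T. v s)) \<subseteq> fd_reps Q" using keys_add[of "v s" "\<Sum>s\<in>T. v s"] insert v by blast
  ultimately show ?case using insert v by (simp add: c_add)
 qed
 from this[OF order_refl] have "finprod ?R (%s. ?c (v s)) S = ?c (\<Sum>s\<in>S. v s)" by blast
 moreover have "finprod ?R (%s. rep_class Q (M s) [^]\<^bsub>?R\<^esub> n s) S = finprod ?R (%s. ?c (v s)) S"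
  by (rule R.finprod_cong') (auto simp: pw intro!: c_carrier v)
 ultimately show ?thesis by (simp add: v_def)
qed

section \<open>Maps between free modules\<close>

definition smul :: "('x,'k::field) mpol => (('x,'k) fvec) => (('x,'k) fvec)" where
 "smul p = Poly_Mapping.map (%q. p * q)"

lemma lookup_smul: "lk (smul p u) b = p * lk u b"
 by (simp add: smul_def Poly_Mapping.map.rep_eq when_def)

lemma keys_smul: "ky (smul p u) \<subseteq> ky u"
proof
 fix b assume "b : ky (smul p u)"
 then show "b : ky u" by (cases "b : ky u") (auto simp: in_keys_iff lookup_smul)
qed

lemma bd_map_alt: "bd_map D u = (\<Sum>b\<in>ky u. smul (lk u b) (D b))"
 by (simp add: bd_map_def smul_def)

lemma smul_add: "smul p (u + v) = smul p u + smul p v"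
 by (rule poly_mapping_eqI) (simp add: lookup_smul lookup_add distrib_left)

lemma smul_add_left: "smul (p + q) u = smul p u + smul q u"
 by (rule poly_mapping_eqI) (simp add: lookup_smul lookup_add distrib_right)

lemma smul_smul: "smul p (smul q u) = smul (p * q) u"
 by (rule poly_mapping_eqI) (simp add: lookup_smul mult.assoc)

lemma smul_0 [simp]: "smul p 0 = 0" "smul 0 u = 0" "smul 1 u = u"
 by (rule poly_mapping_eqI, simp add: lookup_smul)+

lemma smul_uminus: "smul p (- u) = - smul p u" "smul (- p) u = - smul p u"
 by (rule poly_mapping_eqI, simp add: lookup_smul)+

lemma smul_diff: "smul p (u - v) = smul p u - smul p v" "smul (p - q) u = smul p u - smul q u"
 by (rule poly_mapping_eqI, simp add: lookup_smul lookup_minus algebra_simps)+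

lemma smul_sum: "smul (sum f Y) u = (\<Sum>y\<in>Y. smul (f y) u)" "smul p (sum g Y) = (\<Sum>y\<in>Y. smul p (g y))"
 by (rule poly_mapping_eqI, simp add: lookup_smul lookup_sum sum_distrib_left sum_distrib_right)+

lemma smul_single: "smul p (sg b q) = sg b (p * q)"
 by (rule poly_mapping_eqI) (simp add: lookup_smul lookup_single when_def)

lemma vector_space_smul: "vector_space (%a. smul (mconst a))"
 by unfold_locales (simp_all add: smul_add smul_add_left mconst_simps smul_smul)

interpretation svs: vector_space "%a. smul (mconst a) :: (('x,'k::field) fvec) => _"
 by (rule vector_space_smul)

lemma bd_map_superset: "finite Y ==> ky u \<subseteq> Y ==> bd_map D u = (\<Sum>b\<in>Y. smul (lk u b) (D b))"
 unfolding bd_map_alt by (rule sum.mono_neutral_left) (auto simp: in_keys_iff)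

lemma bd_map_add: "bd_map D (u + v) = bd_map D u + bd_map D v"
proof -
 let ?Y = "ky u \<union> ky v"
 have "bd_map D (u + v) = (\<Sum>b\<in>?Y. smul (lk (u + v) b) (D b))"
  by (rule bd_map_superset) (use keys_add[of u v] in auto)
 then show ?thesis
  by (simp add: bd_map_superset[of ?Y u] bd_map_superset[of ?Y v] lookup_add smul_add_left sum.distrib)
qed

lemma bd_map_0 [simp]: "bd_map D 0 = 0"
 by (simp add: bd_map_alt)

lemma bd_map_smul: "bd_map D (smul p u) = smul p (bd_map D u)"
proof -
 have "bd_map D (smul p u) = (\<Sum>b\<in>ky u. smul (lk (smul p u) b) (D b))"
  by (rule bd_map_superset) (auto simp: in_keys_iff lookup_smul)
 then show ?thesis by (simp add: bd_map_alt smul_sum smul_smul lookup_smul)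
qed

lemma bd_map_uminus: "bd_map D (- u) = - bd_map D u"
 using bd_map_smul[of D "- 1" u] by (simp add: smul_uminus)

lemma bd_map_diff: "bd_map D (u - v) = bd_map D u - bd_map D v"
 using bd_map_add[of D u "- v"] by (simp add: bd_map_uminus)

lemma bd_map_sum: "bd_map D (sum f Y) = (\<Sum>y\<in>Y. bd_map D (f y))"
 by (induction Y rule: infinite_finite_induct) (simp_all add: bd_map_add)

lemma bd_map_single: "bd_map D (sg b p) = smul p (D b)"
 by (simp add: bd_map_alt)

lemma bd_map_cong: "(!!b. b : ky u ==> D b = E b) ==> bd_map D u = bd_map E u"
 by (simp add: bd_map_alt)

lemma bd_map_bd_map: "bd_map D (bd_map E u) = bd_map (%b. bd_map D (E b)) u"
 by (simp add: bd_map_alt[of E] bd_map_alt[of "%b. bd_map D (E b)"] bd_map_sum bd_map_smul)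

lemma bd_map_plus_left: "bd_map (%b. D b + E b) u = bd_map D u + bd_map E u"
 by (simp add: bd_map_alt smul_add sum.distrib)

lemma bd_map_minus_left: "bd_map (%b. D b - E b) u = bd_map D u - bd_map E u"
 by (simp add: bd_map_alt smul_diff sum_subtractf)

lemma bd_map_id: "bd_map (%b. sg b 1) u = u"
 by (simp add: bd_map_alt smul_single flip: sum_monomials)

section \<open>Graded pieces of tensor products with free modules\<close>

locale graded_ring =
 fixes N :: "('x,'k::field) mpol set"
 assumes N_sub: "subring N" and N_const: "mconst a : N" and N_hcomp: "p : N ==> hcomp d p : N"
begin

sublocale N: subring N by (rule N_sub)

lemma ft_lookup: "u : ft N B ==> lk u b : N"
 using N.zero by (cases "b : B") (auto simp: free_tensor_def not_in_keys_iff_lookup_eq_zero subset_iff, metis in_keys_iff)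

lemma ft_iff: "u : ft N B \<longleftrightarrow> ky u \<subseteq> B & (ALL b. lk u b : N)"
 using ft_lookup by (auto simp: free_tensor_def)

lemma ft_0 [simp]: "0 : ft N B"
 using N.zero by (simp add: ft_iff)

lemma ft_add: "u : ft N B ==> v : ft N B ==> u + v : ft N B"
 using keys_add[of u v] by (auto simp: ft_iff lookup_add intro: N.add)

lemma ft_smul: "p : N ==> u : ft N B ==> smul p u : ft N B"
 using keys_smul[of p u] by (auto simp: ft_iff lookup_smul intro: N.mult)

lemma ft_uminus: "u : ft N B ==> - u : ft N B"
 using ft_smul[OF N.uminus[OF N.one], of u B] by (simp add: smul_uminus)

lemma ft_diff: "u : ft N B ==> v : ft N B ==> u - v : ft N B"
 using ft_add[of u B "-v"] ft_uminus by simp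

lemma ft_sum: "(!!y. y : Y ==> f y : ft N B) ==> sum f Y : ft N B"
 by (induction Y rule: infinite_finite_induct) (auto intro: ft_add)

lemma ft_single: "b : B ==> p : N ==> sg b p : ft N B"
 using N.zero by (auto simp: ft_iff lookup_single when_def)

lemma ft_bd_map:
 assumes "u : ft N B" "!!b. b : B ==> D b : ft N B'" shows "bd_map D u : ft N B'"
 unfolding bd_map_alt using assms by (intro ft_sum ft_smul ft_lookup[OF assms(1)] assms(2)) (auto simp: ft_iff)

lemma ftd_iff: "u : ftd N B dg j \<longleftrightarrow> u : ft N B \<and>
  (\<forall>b\<in>ky u. dg b \<le> j & hmg (j - dg b) (lk u b))"
proof -
 have "(EX d. d + dg b = j & hmg d p) \<longleftrightarrow> dg b \<le> j & hmg (j - dg b) p" for b and p :: "('x,'k) mpol"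
  by (auto intro: exI[of _ "j - dg b"])
 then show ?thesis by (auto simp: free_tensor_deg_def)
qed

lemma ftd_ft: "u : ftd N B dg j ==> u : ft N B"
 by (simp add: ftd_iff)

lemma ftd_0 [simp]: "0 : ftd N B dg j"
 by (simp add: ftd_iff)

text \<open>Component of total degree \<open>j\<close> when the generator \<open>b\<close> sits in
  degree \<open>dg b\<close>. The case distinction keeps truncated subtraction from producing a
  degree 0 part for generators of too large degree.\<close>

definition tcomp :: "(nat => nat) => nat => (('x,'k) fvec) => (('x,'k) fvec)" where
 "tcomp dg j = Poly_Mapping.mapp (%b p. if dg b \<le> j then hcomp (j - dg b) p else 0)"

lemma lookup_tcomp: "lk (tcomp dg j u) b = (if dg b \<le> j then hcomp (j - dg b) (lk u b) else 0)"
 by (simp add: tcomp_def lookup_mapp when_def in_keys_iff)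

lemma keys_tcomp: "ky (tcomp dg j u) \<subseteq> ky u"
proof
 fix b assume "b : ky (tcomp dg j u)"
 then show "b : ky u" by (cases "b : ky u") (auto simp: in_keys_iff lookup_tcomp split: if_splits)
qed

lemma tcomp_add: "tcomp dg j (u + v) = tcomp dg j u + tcomp dg j v"
 by (rule poly_mapping_eqI) (simp add: lookup_tcomp lookup_add hcomp_add)

lemma tcomp_0 [simp]: "tcomp dg j 0 = 0"
 by (rule poly_mapping_eqI) (simp add: lookup_tcomp)

lemma tcomp_smul: "tcomp dg j (smul (mconst a) u) = smul (mconst a) (tcomp dg j u)"
 by (rule poly_mapping_eqI) (simp add: lookup_tcomp lookup_smul hcomp_mconst_mult)

lemma tcomp_diff: "tcomp dg j (u - v) = tcomp dg j u - tcomp dg j v"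
 by (rule poly_mapping_eqI) (simp add: lookup_tcomp lookup_minus hcomp_diff)

lemma tcomp_sum: "tcomp dg j (sum f Y) = (\<Sum>y\<in>Y. tcomp dg j (f y))"
 by (induction Y rule: infinite_finite_induct) (simp_all add: tcomp_add)

lemma tcomp_ft: "u : ft N B ==> tcomp dg j u : ft N B"
 using keys_tcomp[of dg j u] N.zero by (auto simp: ft_iff lookup_tcomp intro: N_hcomp)

lemma tcomp_ftd: "u : ft N B ==> tcomp dg j u : ftd N B dg j"
 using tcomp_ft[of u B dg j] by (auto simp: ftd_iff lookup_tcomp in_keys_iff split: if_splits)

lemma tcomp_eq: "u : ftd N B dg i ==> tcomp dg j u = (if j = i then u else 0)"
proof (rule poly_mapping_eqI)
 fix b assume u: "u : ftd N B dg i"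
 show "lk (tcomp dg j u) b = lk (if j = i then u else 0) b"
 proof (cases "b : ky u")
  case True
  then have "dg b \<le> i" "hmg (i - dg b) (lk u b)" using u by (auto simp: ftd_iff)
  then show ?thesis by (auto simp: lookup_tcomp hcomp_homogeneous)
 qed (auto simp: lookup_tcomp not_in_keys_iff_lookup_eq_zero)
qed

lemma ftd_iff_tcomp: "u : ftd N B dg j \<longleftrightarrow> u : ft N B & tcomp dg j u = u"
 using tcomp_ftd[of u B dg j] tcomp_eq[of u B dg j j] ftd_ft by metis

lemma ftd_add: "u : ftd N B dg j ==> v : ftd N B dg j ==> u + v : ftd N B dg j"
 by (simp add: ftd_iff_tcomp tcomp_add ft_add)

lemma ftd_sum: "(!!y. y : Y ==> f y : ftd N B dg j) ==> sum f Y : ftd N B dg j"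
 by (induction Y rule: infinite_finite_induct) (auto intro: ftd_add)

lemma ftd_smul: "hmg d p ==> p : N ==> u : ftd N B dg j ==> smul p u : ftd N B dg (d + j)"
proof -
 assume *: "hmg d p" "p : N" "u : ftd N B dg j"
 have "dg b \<le> d + j & hmg (d + j - dg b) (p * lk u b)" if "b : ky u" for b
 proof -
  have b: "dg b \<le> j" "hmg (j - dg b) (lk u b)" using * that by (auto simp: ftd_iff)
  then show ?thesis using homogeneous_mult[OF *(1) b(2)] by simp
 qed
 moreover have "ky (smul p u) \<subseteq> ky u" by (rule keys_smul)
 ultimately show ?thesis using * ft_smul[of p u B] by (auto simp: ftd_iff lookup_smul)
qed

lemma ftd_sc: "u : ftd N B dg j ==> smul (mconst a) u : ftd N B dg j"
 using ftd_smul[OF homogeneous_mconst N_const, of u B dg j a] by simp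

lemma ftd_diff: "u : ftd N B dg j ==> v : ftd N B dg j ==> u - v : ftd N B dg j"
 by (simp add: ftd_iff_tcomp tcomp_diff ft_diff)

lemma ftd_single: "b : B ==> p : N ==> hmg d p ==> sg b p : ftd N B dg (d + dg b)"
 using ft_single[of b B p] by (auto simp: ftd_iff)

lemma ftd_bd_map:
 assumes u: "u : ftd N B dg j" and D: "!!b. b : B ==> D b : ftd N B' dg' (dg b)"
 shows "bd_map D u : ftd N B' dg' j"
 unfolding bd_map_alt
proof (rule ftd_sum)
 fix b assume "b : ky u"
 then have b: "b : B" "dg b \<le> j" "hmg (j - dg b) (lk u b)" "lk u b : N"
  using u by (auto simp: ftd_iff ft_iff)
 show "smul (lk u b) (D b) : ftd N B' dg' j"
  using ftd_smul[OF b(3,4) D[OF b(1)]] b(2) by simp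
qed

lemma ft_decomp: "EX E. u = (\<Sum>j<E. tcomp dg j u)"
proof -
 have "EX E. \<forall>b\<in>ky u. \<forall>\<mu>\<in>ky (lk u b). dg b + mdeg \<mu> < E"
 proof -
  let ?M = "\<Union>b\<in>ky u. (%\<mu>. dg b + mdeg \<mu>) ` ky (lk u b)"
  have "finite ?M" by auto
  then obtain E where "\<forall>x\<in>?M. x < E" using finite_nat_set_iff_bounded by auto
  then show ?thesis by auto
 qed
 then obtain E where E: "!!b \<mu>. b : ky u ==> \<mu> : ky (lk u b) ==> dg b + mdeg \<mu> < E" by blast
 have "u = (\<Sum>j<E. tcomp dg j u)"
 proof (rule poly_mapping_eqI, rule poly_mapping_eqI)
  fix b \<mu>
  have "lk (lk (\<Sum>j<E. tcomp dg j u) b) \<mu> = (\<Sum>j<E. if j = dg b + mdeg \<mu> then lk (lk u b) \<mu> else 0)"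
   unfolding lookup_sum by (intro sum.cong refl) (auto simp: lookup_tcomp lookup_hcomp when_def)
  also have "... = lk (lk u b) \<mu>"
  proof (cases "b : ky u & \<mu> : ky (lk u b)")
   case True
   then show ?thesis using E by simp
  next
   case False
   then have "lk (lk u b) \<mu> = 0" by (metis in_keys_iff lookup_zero)
   then show ?thesis by simp
  qed
  finally show "lk (lk u b) \<mu> = lk (lk (\<Sum>j<E. tcomp dg j u) b) \<mu>" by simp
 qed
 then show ?thesis by blast
qed

lemma tcomp_bd_map:
 assumes u: "u : ft N B" and D: "!!b. b : B ==> D b : ftd N B' dg' (dg b)"
 shows "tcomp dg' j (bd_map D u) = bd_map D (tcomp dg j u)"
proof -
 obtain E where E: "u = (\<Sum>i<E. tcomp dg i u)" using ft_decomp by blast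
 have "tcomp dg' j (bd_map D u) = (\<Sum>i<E. tcomp dg' j (bd_map D (tcomp dg i u)))"
  by (subst E) (simp add: bd_map_sum tcomp_sum)
 also have "... = (\<Sum>i<E. bd_map D (tcomp dg j (tcomp dg i u)))"
 proof (intro sum.cong refl)
  fix i
  have t: "tcomp dg i u : ftd N B dg i" by (rule tcomp_ftd[OF u])
  show "tcomp dg' j (bd_map D (tcomp dg i u)) = bd_map D (tcomp dg j (tcomp dg i u))"
   by (simp add: tcomp_eq[OF t] tcomp_eq[OF ftd_bd_map[OF t D]])
 qed
 also have "... = bd_map D (tcomp dg j u)" by (subst (2) E) (simp add: tcomp_sum bd_map_sum)
 finally show ?thesis .
qed

end

section \<open>The Koszul complex as a complex of free modules\<close>

text \<open>Free complexes have generators indexed by natural numbers, so a subset is stored through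
  its binary code. \<open>kfun\<close> and \<open>kmap\<close> translate between elements of the
  free module and functions on subsets.\<close>

definition kgens :: "nat => nat => nat set" where "kgens m i = set_encode ` ksub m i"

definition kwt :: "(nat => nat) => nat => nat" where "kwt dg b = sum dg (set_decode b)"

definition kbd :: "(nat => ('x,'k::field) mpol) => nat => (('x,'k) fvec)" where
 "kbd a b = (\<Sum>s\<in>set_decode b. sg (set_encode (set_decode b - {s})) (ksgn s (set_decode b - {s}) * a s))"

definition kfun :: "(('x,'k::field) fvec) => nat set => ('x,'k) mpol" where
 "kfun u T = lk u (set_encode T)"

definition kmap :: "nat => nat => (nat set => ('x,'k::field) mpol) => (('x,'k) fvec)" where
 "kmap m i w = (\<Sum>T\<in>ksub m i. sg (set_encode T) (w T))"

lemma finite_ksub: "finite (ksub m i)"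
 by (rule finite_subset[of _ "Pow {..<m}"]) (auto simp: ksub_def)

lemma finite_kgens: "finite (kgens m i)"
 by (simp add: kgens_def finite_ksub)

lemma kgens_empty: "m < i ==> kgens m i = {}"
 by (simp add: kgens_def ksub_empty)

lemma encode_eq: "T : ksub m i ==> finite U ==> set_encode U = set_encode T \<longleftrightarrow> U = T"
 using ksub_finite set_encode_eq by blast

lemma kfun_kmap: "T : ksub m i ==> kfun (kmap m i w) T = w T"
proof -
 assume T: "T : ksub m i"
 have "kfun (kmap m i w) T = (\<Sum>U\<in>ksub m i. if U = T then w U else 0)"
  unfolding kfun_def kmap_def lookup_sum
  by (intro sum.cong refl) (auto simp: lookup_single when_def encode_eq[OF T] dest: ksub_finite)
 then show ?thesis using T by (simp add: finite_ksub)
qed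

lemma keys_kmap: "ky (kmap m i w) \<subseteq> kgens m i"
proof -
 have "ky (\<Sum>T\<in>Y. sg (set_encode T) (w T)) \<subseteq> set_encode ` Y" if "finite Y" for Y
  using that
 proof (induction Y rule: finite_induct)
  case (insert T Y)
  then show ?case using keys_add[of "sg (set_encode T) (w T)" "\<Sum>T\<in>Y. sg (set_encode T) (w T)"] by (auto split: if_splits)
 qed simp
 then show ?thesis by (simp add: kmap_def kgens_def finite_ksub)
qed

lemma kfun_eqI:
 assumes "ky u \<subseteq> kgens m i" "ky v \<subseteq> kgens m i" "!!T. T : ksub m i ==> kfun u T = kfun v T" shows "u = v"
proof (rule poly_mapping_eqI)
 fix b
 show "lk u b = lk v b"
 proof (cases "b : kgens m i")
  case True
  then show ?thesis using assms(3) by (auto simp: kgens_def kfun_def)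
 next
  case False
  then have "b \<notin> ky u" "b \<notin> ky v" using assms by auto
  then show ?thesis by (simp add: not_in_keys_iff_lookup_eq_zero)
 qed
qed

text \<open>Links the two descriptions of the Koszul differential, so that identities and exactness
  proved for functions on subsets pass to the free modules.\<close>

lemma kfun_bd_map:
 assumes u: "ky u \<subseteq> kgens m (Suc i)" and T: "T : ksub m i"
 shows "kfun (bd_map (kbd a) u) T = kdiff m a (kfun u) T"
proof (rule poly_mapping_induct[of "%u. kfun (bd_map (kbd a) u) T = kdiff m a (kfun u) T" u])
 show "kfun (bd_map (kbd a) 0) T = kdiff m a (kfun 0) T" by (simp add: kfun_def kdiff_def)
 fix p q assume "kfun (bd_map (kbd a) p) T = kdiff m a (kfun p) T" "kfun (bd_map (kbd a) q) T = kdiff m a (kfun q) T"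
 then show "kfun (bd_map (kbd a) (p + q)) T = kdiff m a (kfun (p + q)) T"
  using kdiff_add[of m a "kfun p" "kfun q" T] by (simp add: bd_map_add kfun_def[abs_def] lookup_add)
next
 fix b p assume "b : ky u"
 then obtain U where U: "U : ksub m (Suc i)" "b = set_encode U" using u by (auto simp: kgens_def)
 have finU: "finite U" using ksub_finite[OF U(1)] .
 have finT: "finite T" using ksub_finite[OF T] .
 have Um: "U \<subseteq> {..<m}" using U(1) by (auto simp: ksub_def)
 have "kfun (bd_map (kbd a) (sg b p)) T = p * (\<Sum>s\<in>U. (ksgn s (U - {s}) * a s when U - {s} = T))"
  using finU by (simp add: kfun_def bd_map_single lookup_smul kbd_def U(2) set_encode_inverse lookup_sum lookup_single
   encode_eq[OF T])
 also have "... = p * (\<Sum>s<m. (ksgn s T * a s when s : U & U - {s} = T))"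
  using Um by (intro arg_cong2[where f = "(*)"] refl sum.mono_neutral_cong_left) (auto simp: when_def)
 also have "... = p * (\<Sum>s\<in>{..<m} - T. (ksgn s T * a s when U = insert s T))"
  by (intro arg_cong2[where f = "(*)"] refl sum.mono_neutral_cong_right) (auto simp: when_def)
 also have "... = kdiff m a (kfun (sg b p)) T"
  unfolding kdiff_def sum_distrib_left
 proof (intro sum.cong refl)
  fix s
  have "set_encode U = set_encode (insert s T) \<longleftrightarrow> U = insert s T" using finT finU by (simp add: set_encode_eq del: set_encode_insert)
  then show "p * (ksgn s T * a s when U = insert s T) = ksgn s T * a s * kfun (sg b p) (insert s T)"
   unfolding kfun_def lookup_single U(2) by (simp add: when_def)
 qed
 finally show "kfun (bd_map (kbd a) (sg b p)) T = kdiff m a (kfun (sg b p)) T" .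
qed

lemma keys_kbd: "b : kgens m (Suc i) ==> ky (kbd a b) \<subseteq> kgens m i"
proof -
 assume "b : kgens m (Suc i)"
 then obtain U where U: "U : ksub m (Suc i)" "b = set_encode U" by (auto simp: kgens_def)
 have "ky (\<Sum>s\<in>Y. sg (set_encode (U - {s})) (c s)) \<subseteq> kgens m i" if "finite Y" "Y \<subseteq> U" for Y and c :: "nat => ('a,'b) mpol"
  using that
 proof (induction Y rule: finite_induct)
  case (insert s Y)
  then have "set_encode (U - {s}) : kgens m i" using ksub_remove[OF U(1)] by (auto simp: kgens_def)
  then show ?case using insert keys_add[of "sg (set_encode (U - {s})) (c s)" "\<Sum>s\<in>Y. sg (set_encode (U - {s})) (c s)"]
   by (auto split: if_splits)
 qed simp
 from this[of U "%s. ksgn s (U - {s}) * a s"] show ?thesis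
  using ksub_finite[OF U(1)] by (simp add: kbd_def U(2) set_encode_inverse)
qed

lemma keys_bd_map: "ky u \<subseteq> B ==> (!!b. b : B ==> ky (D b) \<subseteq> B') ==> ky (bd_map D u) \<subseteq> B'"
proof -
 assume u: "ky u \<subseteq> B" and D: "!!b. b : B ==> ky (D b) \<subseteq> B'"
 have "lk (bd_map D u) b = 0" if "b \<notin> B'" for b
  unfolding bd_map_alt lookup_sum
 proof (rule sum.neutral, rule ballI)
  fix x assume "x : ky u"
  then have "b \<notin> ky (D x)" using u D that by blast
  then show "lk (smul (lk u x) (D x)) b = 0" by (simp add: lookup_smul not_in_keys_iff_lookup_eq_zero)
 qed
 then show ?thesis by (auto simp: in_keys_iff)
qed

lemma bd_kbd_kbd: "ky u \<subseteq> kgens m (Suc (Suc i)) ==> bd_map (kbd a) (bd_map (kbd a) u) = 0"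
proof -
 assume u: "ky u \<subseteq> kgens m (Suc (Suc i))"
 have k1: "ky (bd_map (kbd a) u) \<subseteq> kgens m (Suc i)" by (rule keys_bd_map[OF u keys_kbd])
 have k2: "ky (bd_map (kbd a) (bd_map (kbd a) u)) \<subseteq> kgens m i" by (rule keys_bd_map[OF k1 keys_kbd])
 show ?thesis
 proof (rule kfun_eqI[OF k2])
  fix T assume T: "T : ksub m i"
  have "kfun (bd_map (kbd a) (bd_map (kbd a) u)) T = kdiff m a (kdiff m a (kfun u)) T"
   unfolding kfun_bd_map[OF k1 T] by (rule kdiff_cong) (rule kfun_bd_map[OF u ksub_insert[OF T]])
  then show "kfun (bd_map (kbd a) (bd_map (kbd a) u)) T = kfun 0 T"
   by (simp add: kdiff_kdiff[OF ksub_finite[OF T]] kfun_def)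
 qed simp
qed

context graded_ring
begin

lemma kmap_ft: "(!!T. T : ksub m i ==> w T : N) ==> kmap m i w : ft N (kgens m i)"
 unfolding kmap_def by (intro ft_sum ft_single) (auto simp: kgens_def)

lemma kbd_ft: "(!!s. s < m ==> a s : N) ==> b : kgens m (Suc i) ==> kbd a b : ft N (kgens m i)"
proof -
 assume a: "!!s. s < m ==> a s : N" and "b : kgens m (Suc i)"
 then obtain U where U: "U : ksub m (Suc i)" "b = set_encode U" by (auto simp: kgens_def)
 have "U \<subseteq> {..<m}" "set_decode b = U" using U ksub_finite[OF U(1)] by (auto simp: ksub_def set_encode_inverse)
 then show ?thesis unfolding kbd_def using a ksub_remove[OF U(1)]
  by (intro ft_sum ft_single N.mult N.ksgn) (auto simp: kgens_def)
qed

lemma kbd_ftd: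
 assumes a: "!!s. s < m ==> a s : N" "!!s. s < m ==> hmg (dg s) (a s)" and b: "b : kgens m (Suc i)"
 shows "kbd a b : ftd N (kgens m i) (kwt dg) (kwt dg b)"
proof -
 obtain U where U: "U : ksub m (Suc i)" "b = set_encode U" using b by (auto simp: kgens_def)
 have U': "U \<subseteq> {..<m}" "set_decode b = U" "finite U" using U ksub_finite[OF U(1)] by (auto simp: ksub_def set_encode_inverse)
 show ?thesis unfolding kbd_def U'(2)
 proof (rule ftd_sum)
  fix s assume s: "s : U"
  then have "s < m" using U' by auto
  have "hmg (0 * 0 + dg s) (ksgn s (U - {s}) * a s)"
   unfolding ksgn_def using a(2)[OF \<open>s < m\<close>] homogeneous_power[of 0 "-1::('x,'k) mpol" "card {t : U - {s}. t < s}"]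
   homogeneous_mconst[of "-1"] by (intro homogeneous_mult) (simp_all add: mconst_simps)
  moreover have "dg s + kwt dg (set_encode (U - {s})) = kwt dg b"
   using U' s by (simp add: kwt_def U(2) set_encode_inverse sum.remove)
  ultimately show "sg (set_encode (U - {s})) (ksgn s (U - {s}) * a s) : ftd N (kgens m i) (kwt dg) (kwt dg b)"
   using ftd_single[of "set_encode (U - {s})" "kgens m i" "ksgn s (U - {s}) * a s" "dg s" "kwt dg"]
   ksub_remove[OF U(1) s] N.mult[OF N.ksgn a(1)[OF \<open>s < m\<close>]] by (auto simp: kgens_def)
 qed
qed

lemma kos_acyclic:
 assumes ac: "!!u. (!!T. T : ksub m (Suc i) ==> u T : N) ==> (!!T. T : ksub m i ==> kdiff m a u T = 0) ==>
   EX w. (\<forall>T\<in>ksub m (Suc (Suc i)). w T : N) & (\<forall>T\<in>ksub m (Suc i). u T = kdiff m a w T)"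
  and u: "u : ft N (kgens m (Suc i))" "bd_map (kbd a) u = 0"
 shows "\<exists>w\<in>ft N (kgens m (Suc (Suc i))). u = bd_map (kbd a) w"
proof -
 have uk: "ky u \<subseteq> kgens m (Suc i)" using u(1) by (simp add: ft_iff)
 have "kfun u T : N" for T using u(1) by (simp add: ft_iff kfun_def)
 moreover have "kdiff m a (kfun u) T = 0" if "T : ksub m i" for T
  using kfun_bd_map[OF uk that, of a] u(2) by (simp add: kfun_def)
 ultimately obtain w where w: "\<forall>T\<in>ksub m (Suc (Suc i)). w T : N" "\<forall>T\<in>ksub m (Suc i). kfun u T = kdiff m a w T"
  using ac by blast
 let ?w = "kmap m (Suc (Suc i)) w"
 have "u = bd_map (kbd a) ?w"
 proof (rule kfun_eqI[OF uk keys_bd_map[OF keys_kmap keys_kbd]])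
  fix T assume T: "T : ksub m (Suc i)"
  have "kdiff m a (kfun ?w) T = kdiff m a w T"
   by (rule kdiff_cong) (rule kfun_kmap[OF ksub_insert[OF T]])
  then show "kfun u T = kfun (bd_map (kbd a) ?w) T" using w(2) T by (simp add: kfun_bd_map[OF keys_kmap T])
 qed
 then show ?thesis using kmap_ft[of m "Suc (Suc i)" w] w(1) by blast
qed

text \<open>The primitive is the exterior product of the generator \<open>s\<close> with
  \<open>u\<close>, by the homotopy formula. Level 0 comes without a cycle condition: the correction
  term involves subsets containing \<open>s\<close>, and the empty set is not one.\<close>

lemma kos_kills:
 assumes s: "s < m" and u: "u : ft N (kgens m i)" "i > 0 ==> bd_map (kbd a) u = 0"
 shows "\<exists>w\<in>ft N (kgens m (Suc i)). smul (a s) u = bd_map (kbd a) w"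
proof -
 have uk: "ky u \<subseteq> kgens m i" using u(1) by (simp add: ft_iff)
 let ?w = "kmap m (Suc i) (kwedge s (kfun u))"
 have wN: "?w : ft N (kgens m (Suc i))"
  by (rule kmap_ft) (use u(1) N.zero N.ksgn in \<open>auto simp: kwedge_def kfun_def ft_iff intro!: N.mult\<close>)
 moreover have "smul (a s) u = bd_map (kbd a) ?w"
 proof (rule kfun_eqI[where m = m and i = i])
  show "ky (smul (a s) u) \<subseteq> kgens m i" using uk keys_smul by blast
  show "ky (bd_map (kbd a) ?w) \<subseteq> kgens m i" by (rule keys_bd_map[OF keys_kmap keys_kbd])
  fix T assume T: "T : ksub m i"
  have "kwedge s (kdiff m a (kfun u)) T = 0"
  proof (cases "s : T")
   case True
   then obtain l where i: "i = Suc l" using T ksub_finite[OF T] by (cases i) (auto simp: ksub_def)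
   have "T - {s} : ksub m l" using ksub_remove[of T m l s] T True i by simp
   then have "kdiff m a (kfun u) (T - {s}) = 0"
   using kfun_bd_map[of u m l "T - {s}" a] uk u(2) i by (simp add: kfun_def)
   then show ?thesis by (simp add: kwedge_def)
  qed (simp add: kwedge_def)
  then have "kdiff m a (kwedge s (kfun u)) T = a s * kfun u T"
   using kdiff_kwedge[OF ksub_finite[OF T] s, of a "kfun u"] by simp
  moreover have "kfun (bd_map (kbd a) ?w) T = kdiff m a (kwedge s (kfun u)) T"
   unfolding kfun_bd_map[OF keys_kmap T] by (rule kdiff_cong) (rule kfun_kmap[OF ksub_insert[OF T]])
  ultimately show "kfun (smul (a s) u) T = kfun (bd_map (kbd a) ?w) T" by (simp add: kfun_def lookup_smul)
 qed
 ultimately show ?thesis by blast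
qed

end

lemma kgens_0: "kgens m 0 = {0}"
proof -
 have "ksub m 0 = {{}}" by (auto simp: ksub_def finite_subset)
 then show ?thesis by (simp add: kgens_def)
qed

definition kos :: "nat => (nat => ('x,'k::field) mpol) => (nat => nat) => ('x,'k) fcplx" where
 "kos m a dg = \<lparr>gens = kgens m, gdeg = (%i. kwt dg), bd = (%i. kbd a), aug = (%_. 1)\<rparr>"

sublocale graded_subalgebra \<subseteq> AA: graded_ring A
 by (rule graded_ring.intro[OF A_sub A_const A_hcomp])

lemma kbd_1: "kfun (bd_map (kbd a) u) {} = (\<Sum>s<m. a s * lk u (set_encode {s}))" if "ky u \<subseteq> kgens m 1"
 using kfun_bd_map[of u m 0 "{}" a] that by (simp add: ksub_def kdiff_def kfun_def ksgn_def)

text \<open>Above level 0 exactness is \<open>koszul_A\<close>; at level 0 it says that the elements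
  of \<open>A\<close> without constant term form the ideal generated by the
  \<open>h s\<close>.\<close>

lemma (in graded_subalgebra) kos_resolution: "graded_free_resolution A (kos m h dg)"
 unfolding graded_free_resolution_def
proof (intro conjI allI ballI impI)
 let ?K = "kos m h dg"
 show "bd ?K i b : ftd A (gens ?K i) (gdeg ?K i) (gdeg ?K (Suc i) b)" if "b : gens ?K (Suc i)" for i b
  using AA.kbd_ftd[OF h_A h_hom] that by (simp add: kos_def)
 show "gdeg ?K 0 b = 0" if "b : gens ?K 0" for b using that by (simp add: kos_def kgens_0 kwt_def)
 have aug: "aug_map (aug ?K) u = lk (lk u 0) 0" if "ky u \<subseteq> {0}" for u
 proof -
  have "aug_map (aug ?K) u = (\<Sum>b\<in>{0}. lk (lk u b) 0 * aug ?K b)"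
   unfolding aug_map_def by (rule sum.mono_neutral_left) (use that in \<open>auto simp: not_in_keys_iff_lookup_eq_zero\<close>)
  then show ?thesis by (simp add: kos_def)
 qed
 show "aug_map (aug ?K) ` ft A (gens ?K 0) = UNIV"
 proof -
  have "aug_map (aug ?K) (sg 0 (mconst a)) = a" for a by (subst aug) auto
  moreover have "sg 0 (mconst a) : ft A (gens ?K 0)" for a
   by (rule AA.ft_single) (auto simp: kos_def kgens_0 A_const)
  ultimately have "a : aug_map (aug ?K) ` ft A (gens ?K 0)" for a by (metis imageI)
  then show ?thesis by blast
 qed
 show "{u : ft A (gens ?K 0). aug_map (aug ?K) u = 0} = bd_map (bd ?K 0) ` ft A (gens ?K 1)"
 proof (intro equalityI subsetI)
  fix u assume "u : {u : ft A (gens ?K 0). aug_map (aug ?K) u = 0}"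
  then have u: "ky u \<subseteq> {0}" "lk u 0 : A" "lk (lk u 0) 0 = 0" using aug[of u]
   by (auto simp: kos_def kgens_0 AA.ft_iff)
  obtain c where c: "!!s. c s : A" "lk u 0 = (\<Sum>s<m. c s * h s)" using A_plus_ideal[OF u(2,3)] by blast
  let ?w = "kmap m 1 (%T. c (the_elem T))"
  have wA: "?w : ft A (kgens m 1)" by (rule AA.kmap_ft) (rule c(1))
  have "u = bd_map (kbd h) ?w"
  proof (rule kfun_eqI[where m = m and i = 0])
   show "ky u \<subseteq> kgens m 0" using u(1) by (simp add: kgens_0)
   show "ky (bd_map (kbd h) ?w) \<subseteq> kgens m 0"
   by (rule keys_bd_map[OF keys_kmap]) (use keys_kbd[of _ m 0] in simp)
   fix T assume "T : ksub m 0"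
   then have T: "T = {}" by (auto simp: ksub_def finite_subset)
   have "lk ?w (set_encode {s}) = c s" if "s < m" for s
   using kfun_kmap[of "{s}" m 1 "%T. c (the_elem T)"] that by (simp add: kfun_def ksub_def)
   then show "kfun u T = kfun (bd_map (kbd h) ?w) T"
   unfolding T kbd_1[OF keys_kmap] using c(2) by (simp add: kfun_def mult.commute)
  qed
  then show "u : bd_map (bd ?K 0) ` ft A (gens ?K 1)" using wA by (simp add: kos_def)
 next
  fix u assume "u : bd_map (bd ?K 0) ` ft A (gens ?K 1)"
  then obtain w where w: "w : ft A (kgens m 1)" "u = bd_map (kbd h) w" by (auto simp: kos_def)
  have "u : ft A (kgens m 0)"
   unfolding w(2) using w(1) AA.kbd_ft[OF h_A, where i = 0] by (intro AA.ft_bd_map[OF w(1)]) auto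
  moreover have "lk u 0 = (\<Sum>s<m. h s * lk w (set_encode {s}))"
   using kbd_1[of w m h] w by (auto simp: kfun_def AA.ft_iff)
  then have "lk (lk u 0) 0 = 0" by (simp add: lookup_0_simps h_0)
  ultimately show "u : {u : ft A (gens ?K 0). aug_map (aug ?K) u = 0}"
   using aug[of u] by (auto simp: kos_def kgens_0 AA.ft_iff)
 qed
 show "{u : ft A (gens ?K (Suc i)). bd_map (bd ?K i) u = 0} = bd_map (bd ?K (Suc i)) ` ft A (gens ?K (Suc (Suc i)))" for i
 proof (intro equalityI subsetI)
  fix u assume "u : {u : ft A (gens ?K (Suc i)). bd_map (bd ?K i) u = 0}"
  then show "u : bd_map (bd ?K (Suc i)) ` ft A (gens ?K (Suc (Suc i)))"
   using AA.kos_acyclic[OF koszul_A, of i u] by (auto simp: kos_def)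
 next
  fix u assume "u : bd_map (bd ?K (Suc i)) ` ft A (gens ?K (Suc (Suc i)))"
  then obtain w where w: "w : ft A (kgens m (Suc (Suc i)))" "u = bd_map (kbd h) w" by (auto simp: kos_def)
  then show "u : {u : ft A (gens ?K (Suc i)). bd_map (bd ?K i) u = 0}"
   using AA.ft_bd_map[OF w(1) AA.kbd_ft[OF h_A]] bd_kbd_kbd[of w m i h] by (auto simp: kos_def AA.ft_iff)
 qed
qed

section \<open>Comparison of graded free resolutions\<close>

lemma aug_map_superset: "finite Y ==> ky u \<subseteq> Y ==> aug_map e u = (\<Sum>b\<in>Y. lk (lk u b) 0 * e b)"
 unfolding aug_map_def by (rule sum.mono_neutral_left) (auto simp: not_in_keys_iff_lookup_eq_zero)

lemma aug_map_add: "aug_map e (u + v) = aug_map e u + aug_map e v"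
proof -
 let ?Y = "ky u \<union> ky v"
 have "aug_map e (u + v) = (\<Sum>b\<in>?Y. lk (lk (u + v) b) 0 * e b)"
  by (rule aug_map_superset) (use keys_add[of u v] in auto)
 then show ?thesis
  by (simp add: aug_map_superset[of ?Y u] aug_map_superset[of ?Y v] lookup_add distrib_right sum.distrib)
qed

lemma aug_map_smul: "aug_map e (smul p u) = lk p 0 * aug_map e u"
proof -
 have "aug_map e (smul p u) = (\<Sum>b\<in>ky u. lk (lk (smul p u) b) 0 * e b)"
  by (rule aug_map_superset) (auto simp: keys_smul)
 then show ?thesis by (simp add: aug_map_def lookup_smul lookup_0_simps sum_distrib_left mult.assoc)
qed

lemma aug_map_bd_map:
 fixes u :: "('x,'k::field) fvec"
 shows "aug_map e (bd_map F u) = aug_map (%b. aug_map e (F b)) u"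
proof -
 have z: "aug_map e (0 :: ('x,'k) fvec) = 0" by (simp add: aug_map_def)
 have "aug_map e (sum f Y) = (\<Sum>y\<in>Y. aug_map e (f y))" for f :: "nat => ('x,'k) fvec" and Y
  by (induction Y rule: infinite_finite_induct) (simp_all add: aug_map_add z)
 then have "aug_map e (bd_map F u) = (\<Sum>b\<in>ky u. lk (lk u b) 0 * aug_map e (F b))"
  by (simp add: bd_map_alt aug_map_smul)
 then show ?thesis by (simp only: aug_map_def)
qed

lemma aug_map_cong: "(!!b. b : ky u ==> e b = e' b) ==> aug_map e u = aug_map e' u"
 by (simp add: aug_map_def)

context graded_ring
begin

definition res_cycles :: "('x,'k) fcplx => nat => (('x,'k) fvec) set" where
 "res_cycles P i = {u : ft N (gens P i). case i of 0 => aug_map (aug P) u = 0 | Suc l => bd_map (bd P l) u = 0}"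

abbreviation gmap :: "('x,'k) fcplx => nat => ('x,'k) fcplx => nat => (nat => (('x,'k) fvec)) => bool" where
 "gmap P i K l F \<equiv> \<forall>b\<in>gens P i. F b : ftd N (gens K l) (gdeg K l) (gdeg P i b)"

context
 fixes P :: "('x,'k) fcplx"
 assumes P: "graded_free_resolution N P"
begin

lemma res_bd: "b : gens P (Suc i) ==> bd P i b : ftd N (gens P i) (gdeg P i) (gdeg P (Suc i) b)"
 using P by (simp add: graded_free_resolution_def)

lemma res_exact: "res_cycles P i = bd_map (bd P i) ` ft N (gens P (Suc i))"
 using P by (cases i) (auto simp: graded_free_resolution_def res_cycles_def)

lemma res_bd_cycle: "b : gens P (Suc i) ==> bd P i b : res_cycles P i"
 unfolding res_exact using ft_single[of b "gens P (Suc i)" 1] N.one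
 by (intro image_eqI[of _ _ "sg b 1"]) (simp_all add: bd_map_single)

lemma res_graded_exact:
 assumes u: "u : res_cycles P i" "u : ftd N (gens P i) (gdeg P i) j"
 shows "\<exists>w\<in>ftd N (gens P (Suc i)) (gdeg P (Suc i)) j. u = bd_map (bd P i) w"
proof -
 obtain w where w: "w : ft N (gens P (Suc i))" "u = bd_map (bd P i) w" using u(1) res_exact by auto
 have "u = tcomp (gdeg P i) j u" using tcomp_eq[OF u(2), of j] by simp
 also have "... = bd_map (bd P i) (tcomp (gdeg P (Suc i)) j w)"
  unfolding w(2) by (rule tcomp_bd_map[OF w(1) res_bd])
 finally show ?thesis using tcomp_ftd[OF w(1)] by blast
qed

text \<open>Only generators of degree 0 have nonzero augmentation, so the degree 0 component of a
  preimage is again a preimage.\<close>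

lemma res_aug_onto:
 assumes "e ~= 0 ==> d = 0"
 shows "\<exists>u\<in>ftd N (gens P 0) (gdeg P 0) d. aug_map (aug P) u = e"
proof (cases "e = 0")
 case True
 then show ?thesis by (intro bexI[of _ 0]) (auto simp: aug_map_def)
next
 case False
 then have d: "d = 0" using assms by simp
 have "e : aug_map (aug P) ` ft N (gens P 0)" using P by (simp add: graded_free_resolution_def)
 then obtain u where u: "u : ft N (gens P 0)" "aug_map (aug P) u = e" by auto
 have dg: "gdeg P 0 b = 0" if "b : gens P 0" "aug P b ~= 0" for b
  using P that by (simp add: graded_free_resolution_def)
 have "aug_map (aug P) (tcomp (gdeg P 0) 0 u) = (\<Sum>b\<in>ky u. lk (lk (tcomp (gdeg P 0) 0 u) b) 0 * aug P b)"
  by (rule aug_map_superset[OF finite_keys keys_tcomp])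
 also have "... = aug_map (aug P) u"
  unfolding aug_map_def
 proof (intro sum.cong refl)
  fix b assume "b : ky u"
  then have "b : gens P 0" using u(1) by (auto simp: ft_iff)
  then show "lk (lk (tcomp (gdeg P 0) 0 u) b) 0 * aug P b = lk (lk u b) 0 * aug P b"
   using dg by (cases "aug P b = 0") (auto simp: lookup_tcomp lookup_hcomp)
 qed
 finally show ?thesis using u tcomp_ftd[OF u(1)] d by auto
qed

end

text \<open>The comparison theorem for free resolutions, level by level. The invariant
  \<open>ok\<close> also records that cycles go to cycles, which makes the image of each boundary
  liftable; \<open>res_graded_exact\<close> chooses the lift in the right degree.\<close>

lemma lift_exists:
 assumes P: "graded_free_resolution N P" and K: "graded_free_resolution N K"
 shows "EX F. (ALL i. gmap P i K i (F i)) & (\<forall>b\<in>gens P 0. aug_map (aug K) (F 0 b) = aug P b) \<and>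
  (ALL i. \<forall>b\<in>gens P (Suc i). bd_map (bd K i) (F (Suc i) b) = bd_map (F i) (bd P i b))"
proof -
 define ok where "ok i F \<longleftrightarrow> gmap P i K i F & (\<forall>u\<in>res_cycles P i. bd_map F u : res_cycles K i) \<and>
  (i = 0 --> (\<forall>b\<in>gens P 0. aug_map (aug K) (F b) = aug P b))" for i F
 define lnk where "lnk i F F' \<longleftrightarrow> (\<forall>b\<in>gens P (Suc i). bd_map (bd K i) (F' b) = bd_map F (bd P i b))"
  for i and F F' :: "nat => (('x,'k) fvec)"
 have ft: "bd_map F u : ft N (gens K i)" if "gmap P i K i F" "u : ft N (gens P i)" for F u i
  using ft_bd_map[OF that(2)] that(1) ftd_ft by blast
 have "EX F. ok 0 F"
 proof -
  have "EX v. b : gens P 0 --> v : ftd N (gens K 0) (gdeg K 0) (gdeg P 0 b) & aug_map (aug K) v = aug P b" for b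
  proof (cases "b : gens P 0")
   case True
   have "aug P b ~= 0 ==> gdeg P 0 b = 0" using P True by (simp add: graded_free_resolution_def)
   from res_aug_onto[OF K this] show ?thesis by blast
  qed simp
  then obtain F where F: "!!b. b : gens P 0 ==> F b : ftd N (gens K 0) (gdeg K 0) (gdeg P 0 b) & aug_map (aug K) (F b) = aug P b"
   by metis
  have "bd_map F u : res_cycles K 0" if u: "u : res_cycles P 0" for u
  proof -
   have u': "u : ft N (gens P 0)" "aug_map (aug P) u = 0" using u by (auto simp: res_cycles_def)
   have "aug_map (aug K) (bd_map F u) = aug_map (aug P) u"
   unfolding aug_map_bd_map by (rule aug_map_cong) (use F u'(1) in \<open>auto simp: ft_iff\<close>)
   then show ?thesis using ft[of 0 F u] F u' by (simp add: res_cycles_def)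
  qed
  then show ?thesis using F by (auto simp: ok_def)
 qed
 moreover have "\<exists>F'. ok (Suc i) F' & lnk i F F'" if F: "ok i F" for i F
 proof -
  have "EX v. b : gens P (Suc i) --> v : ftd N (gens K (Suc i)) (gdeg K (Suc i)) (gdeg P (Suc i) b) \<and>
   bd_map (bd K i) v = bd_map F (bd P i b)" for b
  proof (cases "b : gens P (Suc i)")
   case True
   have "bd_map F (bd P i b) : res_cycles K i" using F res_bd_cycle[OF P True] by (simp add: ok_def)
   moreover have "bd_map F (bd P i b) : ftd N (gens K i) (gdeg K i) (gdeg P (Suc i) b)"
   using F by (intro ftd_bd_map[OF res_bd[OF P True]]) (auto simp: ok_def)
   ultimately obtain v where "v : ftd N (gens K (Suc i)) (gdeg K (Suc i)) (gdeg P (Suc i) b)"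
   "bd_map F (bd P i b) = bd_map (bd K i) v" using res_graded_exact[OF K] by blast
   then show ?thesis by (intro exI[of _ v]) simp
  qed simp
  then obtain F' where F': "!!b. b : gens P (Suc i) ==>
   F' b : ftd N (gens K (Suc i)) (gdeg K (Suc i)) (gdeg P (Suc i) b) \<and>
   bd_map (bd K i) (F' b) = bd_map F (bd P i b)" by metis
  have "bd_map F' u : res_cycles K (Suc i)" if u: "u : res_cycles P (Suc i)" for u
  proof -
   have u': "u : ft N (gens P (Suc i))" "bd_map (bd P i) u = 0" using u by (auto simp: res_cycles_def)
   have "bd_map (bd K i) (bd_map F' u) = bd_map (%b. bd_map F (bd P i b)) u"
   unfolding bd_map_bd_map by (rule bd_map_cong) (use F' u'(1) in \<open>auto simp: ft_iff\<close>)
   also have "... = 0" by (simp add: u'(2) flip: bd_map_bd_map)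
   finally show ?thesis using ft[of "Suc i" F' u] F' u'(1) by (simp add: res_cycles_def)
  qed
  then show ?thesis using F' by (intro exI[of _ F']) (auto simp: ok_def lnk_def)
 qed
 ultimately obtain F where "!!i. ok i (F i)" "!!i. lnk i (F i) (F (Suc i))"
  using dependent_nat_choice[of ok lnk] by blast
 then show ?thesis unfolding ok_def lnk_def by blast
qed

text \<open>Here \<open>E\<close> stands for the difference of two lifts of the same map, a lift of
  zero. The invariant that on cycles \<open>E i\<close> is the boundary of \<open>s\<close> makes
  the next obstruction a cycle, hence a boundary.\<close>

lemma null_homotopy_exists:
 assumes P: "graded_free_resolution N P" and K: "graded_free_resolution N K"
  and E: "!!i. gmap P i K i (E i)" "!!b. b : gens P 0 ==> aug_map (aug K) (E 0 b) = 0"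
  and chain: "!!i b. b : gens P (Suc i) ==> bd_map (bd K i) (E (Suc i) b) = bd_map (E i) (bd P i b)"
 shows "EX s. (ALL i. gmap P i K (Suc i) (s i)) & (\<forall>b\<in>gens P 0. E 0 b = bd_map (bd K 0) (s 0 b)) \<and>
  (ALL i. \<forall>b\<in>gens P (Suc i). E (Suc i) b = bd_map (bd K (Suc i)) (s (Suc i) b) + bd_map (s i) (bd P i b))"
proof -
 define ok where "ok i s \<longleftrightarrow> gmap P i K (Suc i) s & (\<forall>u\<in>res_cycles P i. bd_map (E i) u = bd_map (bd K i) (bd_map s u)) \<and>
  (i = 0 --> (\<forall>b\<in>gens P 0. E 0 b = bd_map (bd K 0) (s b)))" for i s
 define lnk where "lnk i s s' \<longleftrightarrow> (\<forall>b\<in>gens P (Suc i). E (Suc i) b = bd_map (bd K (Suc i)) (s' b) + bd_map s (bd P i b))"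
  for i s and s' :: "nat => (('x,'k) fvec)"
 have "EX s. ok 0 s"
 proof -
  have "EX v. b : gens P 0 --> v : ftd N (gens K 1) (gdeg K 1) (gdeg P 0 b) & E 0 b = bd_map (bd K 0) v" for b
  proof (cases "b : gens P 0")
   case True
   have d: "E 0 b : ftd N (gens K 0) (gdeg K 0) (gdeg P 0 b)" using E(1) True by blast
   then have "E 0 b : res_cycles K 0" using E(2)[OF True] ftd_ft by (simp add: res_cycles_def)
   from res_graded_exact[OF K this d] show ?thesis by auto
  qed simp
  then obtain s where s: "!!b. b : gens P 0 ==> s b : ftd N (gens K 1) (gdeg K 1) (gdeg P 0 b) & E 0 b = bd_map (bd K 0) (s b)"
   by metis
  have "bd_map (E 0) u = bd_map (bd K 0) (bd_map s u)" if "u : res_cycles P 0" for u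
   unfolding bd_map_bd_map by (rule bd_map_cong) (use s that in \<open>auto simp: res_cycles_def ft_iff\<close>)
  then show ?thesis using s by (auto simp: ok_def)
 qed
 moreover have "\<exists>s'. ok (Suc i) s' & lnk i s s'" if s: "ok i s" for i s
 proof -
  have "EX v. b : gens P (Suc i) --> v : ftd N (gens K (Suc (Suc i))) (gdeg K (Suc (Suc i))) (gdeg P (Suc i) b) \<and>
   bd_map (bd K (Suc i)) v = E (Suc i) b - bd_map s (bd P i b)" for b
  proof (cases "b : gens P (Suc i)")
   case True
   let ?v = "E (Suc i) b - bd_map s (bd P i b)"
   have d: "?v : ftd N (gens K (Suc i)) (gdeg K (Suc i)) (gdeg P (Suc i) b)"
   using E(1) True s by (intro ftd_diff ftd_bd_map[OF res_bd[OF P True]]) (auto simp: ok_def)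
   have "bd_map (bd K i) ?v = 0"
   using s res_bd_cycle[OF P True] by (simp add: bd_map_diff chain[OF True] ok_def)
   then have "?v : res_cycles K (Suc i)" using ftd_ft[OF d] by (simp add: res_cycles_def)
   from res_graded_exact[OF K this d] obtain v where
   "v : ftd N (gens K (Suc (Suc i))) (gdeg K (Suc (Suc i))) (gdeg P (Suc i) b)" "?v = bd_map (bd K (Suc i)) v" by blast
   then show ?thesis by (intro exI[of _ v]) simp
  qed simp
  then obtain s' where s': "!!b. b : gens P (Suc i) ==>
   s' b : ftd N (gens K (Suc (Suc i))) (gdeg K (Suc (Suc i))) (gdeg P (Suc i) b) \<and>
   bd_map (bd K (Suc i)) (s' b) = E (Suc i) b - bd_map s (bd P i b)" by metis
  have "bd_map (E (Suc i)) u = bd_map (bd K (Suc i)) (bd_map s' u)" if u: "u : res_cycles P (Suc i)" for u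
  proof -
   have u': "u : ft N (gens P (Suc i))" "bd_map (bd P i) u = 0" using u by (auto simp: res_cycles_def)
   have "bd_map (bd K (Suc i)) (bd_map s' u) = bd_map (%b. E (Suc i) b - bd_map s (bd P i b)) u"
   unfolding bd_map_bd_map by (rule bd_map_cong) (use s' u'(1) in \<open>auto simp: ft_iff\<close>)
   also have "... = bd_map (E (Suc i)) u" by (simp add: bd_map_minus_left u'(2) flip: bd_map_bd_map)
   finally show ?thesis by simp
  qed
  then show ?thesis using s' by (intro exI[of _ s']) (auto simp: ok_def lnk_def)
 qed
 ultimately obtain s where "!!i. ok i (s i)" "!!i. lnk i (s i) (s (Suc i))"
  using dependent_nat_choice[of ok lnk] by blast
 then show ?thesis unfolding ok_def lnk_def by (intro exI[of _ s]) auto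
qed

end

lemma free_tensor_deg_mono: "A \<subseteq> N ==> ftd A B dg j \<subseteq> ftd N B dg j"
 by (auto simp: free_tensor_deg_def free_tensor_def)

text \<open>Homotopy equivalence of the resolutions \<open>P\<close> and \<open>K\<close>, tensored with the overring \<open>N\<close> of \<open>A\<close>.\<close>

lemma tor_comparison:
 fixes A :: "('x,'k::field) mpol set"
 assumes A: "graded_ring A" and N: "graded_ring N" and AN: "A \<subseteq> N"
  and P: "graded_free_resolution A P" and K: "graded_free_resolution A K"
 shows "EX F G. (ALL i. \<forall>b\<in>gens P i. F i b : ftd A (gens K i) (gdeg K i) (gdeg P i b)) \<and>
  (ALL i. \<forall>b\<in>gens K i. G i b : ftd A (gens P i) (gdeg P i) (gdeg K i b)) \<and>
  (ALL i j. \<forall>z\<in>tcyc N P i j. bd_map (F i) z : tcyc N K i j & bd_map (G i) (bd_map (F i) z) - z : tbnd N P i j) \<and>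
  (ALL i j. \<forall>z\<in>tcyc N K i j. bd_map (G i) z : tcyc N P i j & bd_map (F i) (bd_map (G i) z) - z : tbnd N K i j) \<and>
  (ALL i j. \<forall>z\<in>tbnd N P i j. bd_map (F i) z : tbnd N K i j) \<and>
  (ALL i j. \<forall>z\<in>tbnd N K i j. bd_map (G i) z : tbnd N P i j)"
proof -
 interpret A: graded_ring A by fact
 interpret N: graded_ring N by fact
 note mono = subsetD[OF free_tensor_deg_mono[OF AN]]
 { fix P K F
  assume P: "graded_free_resolution A P" and K: "graded_free_resolution A K"
   and F: "!!i. A.gmap P i K i (F i)" "!!i b. b : gens P (Suc i) ==> bd_map (bd K i) (F (Suc i) b) = bd_map (F i) (bd P i b)"
  have sq: "bd_map (bd K i) (bd_map (F (Suc i)) w) = bd_map (F i) (bd_map (bd P i) w)"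
   if "w : ft N (gens P (Suc i))" for i w
   unfolding bd_map_bd_map by (rule bd_map_cong) (use F(2) that in \<open>auto simp: N.ft_iff\<close>)
  have deg: "bd_map (F i) w : ftd N (gens K i) (gdeg K i) j"
   if "w : ftd N (gens P i) (gdeg P i) j" for i j w
   using that by (rule N.ftd_bd_map) (use F(1) mono in blast)
  have cyc: "bd_map (F i) z : tcyc N K i j" if z: "z : tcyc N P i j" for i j z
  proof (cases i)
   case 0
   then show ?thesis using deg[of z 0 j] z by (auto simp: tor_cycles_def)
  next
   case (Suc l)
   then have z': "z : ftd N (gens P (Suc l)) (gdeg P (Suc l)) j" "bd_map (bd P l) z = 0"
   using z by (auto simp: tor_cycles_def)
   then show ?thesis using deg[OF z'(1)] sq[OF N.ftd_ft[OF z'(1)]] Suc by (simp add: tor_cycles_def)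
  qed
  have bnd: "bd_map (F i) z : tbnd N K i j" if z: "z : tbnd N P i j" for i j z
  proof -
   obtain w where w: "w : ftd N (gens P (Suc i)) (gdeg P (Suc i)) j" "z = bd_map (bd P i) w"
   using z by (auto simp: tor_boundaries_def)
   then show ?thesis using sq[OF N.ftd_ft[OF w(1)]] deg[OF w(1)] by (auto simp: tor_boundaries_def intro!: image_eqI)
  qed
  note cyc bnd
 } note maps = this
 { fix P K F G
  assume P: "graded_free_resolution A P" and K: "graded_free_resolution A K"
   and F: "!!i. A.gmap P i K i (F i)" "!!b. b : gens P 0 ==> aug_map (aug K) (F 0 b) = aug P b"
   "!!i b. b : gens P (Suc i) ==> bd_map (bd K i) (F (Suc i) b) = bd_map (F i) (bd P i b)"
   and G: "!!i. A.gmap K i P i (G i)" "!!b. b : gens K 0 ==> aug_map (aug P) (G 0 b) = aug K b"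
   "!!i b. b : gens K (Suc i) ==> bd_map (bd P i) (G (Suc i) b) = bd_map (G i) (bd K i b)"
  \<comment> \<open>Both the composite of \<open>F\<close> and \<open>G\<close> and the identity
    lift the identity of \<open>k\<close>, so their difference is null-homotopic. All entries of the
    homotopy lie in \<open>A\<close>, so it can be applied with coefficients in
    \<open>N\<close>.\<close>
  define E where "E i b = bd_map (G i) (F i b) - sg b 1" for i b
  have Fk: "b' : gens K i" if "b' : ky (F i b)" "b : gens P i" for b b' i
  proof -
   have "F i b : ft A (gens K i)" by (rule A.ftd_ft) (use F(1) that(2) in blast)
   then show ?thesis using that(1) by (auto simp: A.ft_iff)
  qed
  have "EX s. (ALL i. A.gmap P i P (Suc i) (s i)) & (\<forall>b\<in>gens P 0. E 0 b = bd_map (bd P 0) (s 0 b)) \<and>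
   (ALL i. \<forall>b\<in>gens P (Suc i). E (Suc i) b = bd_map (bd P (Suc i)) (s (Suc i) b) + bd_map (s i) (bd P i b))"
  proof (rule A.null_homotopy_exists[OF P P])
   have one: "hmg 0 (1 :: ('x,'k) mpol)" using homogeneous_mconst[of 1] by (simp add: mconst_simps)
   show "A.gmap P i P i (E i)" for i
   proof
   fix b assume b: "b : gens P i"
   have "sg b 1 : ftd A (gens P i) (gdeg P i) (gdeg P i b)"
   using A.ftd_single[OF b A.N.one one, of "gdeg P i"] by simp
   then show "E i b : ftd A (gens P i) (gdeg P i) (gdeg P i b)"
   unfolding E_def by (intro A.ftd_diff A.ftd_bd_map) (use F(1) G(1) b in blast)+
   qed
   show "aug_map (aug P) (E 0 b) = 0" if b: "b : gens P 0" for b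
   proof -
   have "aug_map (aug P) (bd_map (G 0) (F 0 b)) = aug_map (aug K) (F 0 b)"
   unfolding aug_map_bd_map by (rule aug_map_cong) (use G(2) Fk[OF _ b] in blast)
   moreover have "aug_map (aug P) (sg b (1 :: ('x,'k) mpol)) = aug P b" by (simp add: aug_map_def)
   moreover have "aug_map (aug P) (bd_map (G 0) (F 0 b)) = aug_map (aug P) (E 0 b) + aug_map (aug P) (sg b (1 :: ('x,'k) mpol))"
   by (simp add: E_def flip: aug_map_add)
   ultimately show ?thesis using F(2)[OF b] by simp
   qed
   show "bd_map (bd P i) (E (Suc i) b) = bd_map (E i) (bd P i b)" if b: "b : gens P (Suc i)" for i b
   proof -
   have "bd_map (bd P i) (bd_map (G (Suc i)) (F (Suc i) b)) = bd_map (%b. bd_map (G i) (bd K i b)) (F (Suc i) b)"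
   unfolding bd_map_bd_map by (rule bd_map_cong) (use G(3) Fk[OF _ b] in blast)
   also have "... = bd_map (G i) (bd_map (F i) (bd P i b))" by (simp add: F(3)[OF b] flip: bd_map_bd_map)
   finally show ?thesis
   by (simp add: E_def[abs_def] bd_map_diff bd_map_single bd_map_minus_left bd_map_id bd_map_bd_map)
   qed
  qed
  then obtain s where s: "!!i. A.gmap P i P (Suc i) (s i)" "!!b. b : gens P 0 ==> E 0 b = bd_map (bd P 0) (s 0 b)"
   "!!i b. b : gens P (Suc i) ==> E (Suc i) b = bd_map (bd P (Suc i)) (s (Suc i) b) + bd_map (s i) (bd P i b)" by blast
  have "bd_map (G i) (bd_map (F i) z) - z : tbnd N P i j" if z: "z : tcyc N P i j" for i j z
  proof -
   have zd: "z : ftd N (gens P i) (gdeg P i) j" using z by (auto simp: tor_cycles_def)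
   have zk: "b : gens P i" if "b : ky z" for b using N.ftd_ft[OF zd] that by (auto simp: N.ft_iff)
   have "bd_map (G i) (bd_map (F i) z) - z = bd_map (E i) z"
   by (simp add: E_def[abs_def] bd_map_minus_left bd_map_id bd_map_bd_map)
   also have "... = bd_map (bd P i) (bd_map (s i) z)"
   proof (cases i)
   case 0
   show ?thesis unfolding bd_map_bd_map 0 by (rule bd_map_cong) (use s(2) zk 0 in blast)
   next
   case (Suc l)
   have "bd_map (bd P l) z = 0" using z Suc by (auto simp: tor_cycles_def)
   moreover have "bd_map (E (Suc l)) z = bd_map (%b. bd_map (bd P (Suc l)) (s (Suc l) b) + bd_map (s l) (bd P l b)) z"
   by (rule bd_map_cong) (use s(3) zk Suc in blast)
   ultimately show ?thesis unfolding Suc by (simp add: bd_map_plus_left flip: bd_map_bd_map)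
   qed
   moreover have "bd_map (s i) z : ftd N (gens P (Suc i)) (gdeg P (Suc i)) j"
   using zd by (rule N.ftd_bd_map) (use s(1) mono in blast)
   ultimately show ?thesis by (auto simp: tor_boundaries_def)
  qed
 } note homot = this
 obtain F where F: "!!i. A.gmap P i K i (F i)" "!!b. b : gens P 0 ==> aug_map (aug K) (F 0 b) = aug P b"
   "!!i b. b : gens P (Suc i) ==> bd_map (bd K i) (F (Suc i) b) = bd_map (F i) (bd P i b)"
  using A.lift_exists[OF P K] by blast
 obtain G where G: "!!i. A.gmap K i P i (G i)" "!!b. b : gens K 0 ==> aug_map (aug P) (G 0 b) = aug K b"
   "!!i b. b : gens K (Suc i) ==> bd_map (bd P i) (G (Suc i) b) = bd_map (G i) (bd K i b)"
  using A.lift_exists[OF K P] by blast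
 show ?thesis
 proof (rule exI[of _ F], rule exI[of _ G], intro conjI allI ballI)
  fix i b assume "b : gens P i"
  then show "F i b : ftd A (gens K i) (gdeg K i) (gdeg P i b)" using F(1) by blast
 next
  fix i b assume "b : gens K i"
  then show "G i b : ftd A (gens P i) (gdeg P i) (gdeg K i b)" using G(1) by blast
 next
  fix i j z assume z: "z : tcyc N P i j"
  show "bd_map (F i) z : tcyc N K i j" by (rule maps(1)[OF P K F(1,3) z])
  show "bd_map (G i) (bd_map (F i) z) - z : tbnd N P i j" by (rule homot[OF P K F G z])
 next
  fix i j z assume z: "z : tcyc N K i j"
  show "bd_map (G i) z : tcyc N P i j" by (rule maps(1)[OF K P G(1,3) z])
  show "bd_map (F i) (bd_map (G i) z) - z : tbnd N K i j" by (rule homot[OF K P G F z])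
 next
  fix i j z assume z: "z : tbnd N P i j"
  show "bd_map (F i) z : tbnd N K i j" by (rule maps(2)[OF P K F(1,3) z])
 next
  fix i j z assume z: "z : tbnd N K i j"
  show "bd_map (G i) z : tbnd N P i j" by (rule maps(2)[OF K P G(1,3) z])
 qed
qed

section \<open>The Koszul complex of a ring of invariants over a regular point\<close>

lemma kbd_diff: "kbd (%s. a s - c s) b = kbd a b - kbd c b"
 by (simp add: kbd_def right_diff_distrib single_diff sum_subtractf)

text \<open>In the application \<open>N\<close> is the ring of \<open>H\<close>-invariants,
  \<open>ev\<close> evaluates at the regular vector, \<open>Tr\<close> is the transfer over
  \<open>H\<close>, and \<open>\<Theta>\<close> restricts invariants to the orbit. The pair
  \<open>ff\<close>, \<open>Ff\<close> takes the place of division by the order of \<open>H\<close>.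
  The kernel condition places \<open>ff * n\<close> in an ideal over the full polynomial ring; the
  transfer brings it back to \<open>N\<close>.\<close>

locale koszul_point = graded_subalgebra I A m h dg r + NN: graded_ring N
 for I :: "'x set" and A :: "('x,'k::field) mpol set" and m h dg r and N :: "('x,'k) mpol set" +
 fixes ev :: "('x,'k) mpol => 'k" and Tr :: "('x,'k) mpol => ('x,'k) mpol"
  and ff Ff :: "('x,'k) mpol" and \<Theta> :: "('x,'k) mpol => 'y::ab_group_add"
 assumes AN: "A \<subseteq> N" and NS: "N \<subseteq> mpol_ring I"
  and ev: "rhom ev" "!!c. ev (mconst c) = c"
  and Tr_add: "!!p q. Tr (p + q) = Tr p + Tr q" and Tr_mult: "!!a p. a : A ==> Tr (p * a) = Tr p * a"
  and Tr_N: "!!p. p : mpol_ring I ==> Tr p : N"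
  and ff: "ff : mpol_ring I" "Ff : A" "ev Ff = 1" "!!n. n : N ==> Tr (ff * n) = Ff * n"
  and Theta_add: "!!p q. \<Theta> (p + q) = \<Theta> p + \<Theta> q"
  and Theta_ideal: "!!n s. n : N ==> s < m ==> \<Theta> ((h s - mconst (ev (h s))) * n) = 0"
  and Theta_ker: "!!n. n : N ==> \<Theta> n = 0 ==>
   EX c. (ALL s. c s : mpol_ring I) & ff * n = (\<Sum>s<m. c s * (h s - mconst (ev (h s))))"
begin

abbreviation h' where "h' s \<equiv> h s - mconst (ev (h s))"
abbreviation d where "d \<equiv> bd_map (kbd h)"
abbreviation d' where "d' \<equiv> bd_map (kbd h')"
abbreviation wt where "wt \<equiv> kwt dg"

sublocale SS: graded_ring "mpol_ring I"
 by (rule graded_ring.intro[OF subring_mpol_ring mpol_ring_mconst mpol_ring_hcomp])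

lemma h'_A: "s < m ==> h' s : A"
 by (intro A.diff h_A A_const)

text \<open>\<open>d'\<close> agrees with \<open>d\<close> up to terms of lower degree.\<close>

lemma tcomp_shift:
 assumes M: "graded_ring M" "A \<subseteq> M" and u: "u : ftd M (kgens m (Suc i)) wt j" and E: "j \<le> E"
 shows "NN.tcomp wt E (d' u) = (if E = j then d u else 0)"
proof -
 interpret M: graded_ring M by fact
 let ?v = "bd_map (kbd (%s. mconst (ev (h s)))) u"
 have uk: "ky u \<subseteq> kgens m (Suc i)" using M.ftd_ft[OF u] by (simp add: M.ft_iff)
 have "d' u = d u - ?v" by (simp add: kbd_diff[abs_def] bd_map_minus_left)
 moreover have "NN.tcomp wt E ?v = 0"
 proof (rule kfun_eqI[where m = m and i = i])
  show "ky (NN.tcomp wt E ?v) \<subseteq> kgens m i"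
  proof -
   have "ky ?v \<subseteq> kgens m i" by (rule keys_bd_map[OF uk keys_kbd])
   then show ?thesis using NN.keys_tcomp[of wt E ?v] by blast
  qed
  fix T assume T: "T : ksub m i"
  have fT: "finite T" by (rule ksub_finite[OF T])
  have "hcomp (E - sum dg T) (kfun u (insert s T)) = 0" if s: "s : {..<m} - T" and le: "sum dg T \<le> E" for s
  proof (cases "set_encode (insert s T) : ky u")
   case True
   have "wt (set_encode (insert s T)) = dg s + sum dg T"
   using s fT by (simp add: kwt_def set_encode_inverse del: set_encode_insert)
   then have "dg s + sum dg T \<le> j" "hmg (j - (dg s + sum dg T)) (kfun u (insert s T))"
   using u True by (auto simp: M.ftd_iff kfun_def simp del: set_encode_insert)
   moreover have "0 < dg s" using dg_pos s by simp
   ultimately show ?thesis using E by (simp add: hcomp_homogeneous)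
  next
   case False
   then show ?thesis by (simp add: kfun_def not_in_keys_iff_lookup_eq_zero del: set_encode_insert)
  qed
  moreover have "hcomp e (ksgn s T * mconst a * p) = ksgn s T * mconst a * hcomp e p" for e s a and p :: "('x,'k) mpol"
  proof -
   have "ksgn s T * mconst a = (mconst (ksgn s T * a) :: ('x,'k) mpol)" by (simp add: ksgn_def mconst_simps)
   then show ?thesis by (simp only: hcomp_mconst_mult)
  qed
  ultimately show "kfun (NN.tcomp wt E ?v) T = kfun 0 T"
   using kfun_bd_map[OF uk T, of "%s. mconst (ev (h s))"] fT
   by (simp add: kfun_def NN.lookup_tcomp kwt_def set_encode_inverse kdiff_def hcomp_sum del: set_encode_insert)
 qed simp
 moreover have "d u : ftd M (kgens m i) wt j"
  by (rule M.ftd_bd_map[OF u M.kbd_ftd]) (use h_A h_hom M(2) in auto)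
 then have "M.tcomp wt E (d u) = (if E = j then d u else 0)" by (rule M.tcomp_eq)
 ultimately show ?thesis by (simp add: NN.tcomp_diff)
qed

text \<open>A bound on total degree, in which the weights of the Koszul generators count. For this
  filtration the associated graded complex of \<open>d'\<close> is the homogeneous Koszul
  complex.\<close>

definition Fl :: "('x,'k) mpol set => nat => nat => (('x,'k) fvec) set" where
 "Fl M D i = {u : ft M (kgens m i). \<forall>j\<ge>D. NN.tcomp wt j u = 0}"

lemma Fl_exists:
 assumes M: "graded_ring M" and u: "u : ft M (kgens m i)" shows "EX D. u : Fl M D i"
proof -
 interpret M: graded_ring M by fact
 obtain E where E: "u = (\<Sum>j<E. M.tcomp wt j u)" using M.ft_decomp by blast
 have "M.tcomp wt j u = 0" if "E \<le> j" for j
 proof -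
  have "M.tcomp wt j u = (\<Sum>l<E. M.tcomp wt j (M.tcomp wt l u))" by (subst E) (rule M.tcomp_sum)
  also have "... = 0" using that by (intro sum.neutral) (auto simp: M.tcomp_eq[OF M.tcomp_ftd[OF u]])
  finally show ?thesis .
 qed
 then show ?thesis using u by (auto simp: Fl_def intro!: exI[of _ E])
qed

lemma Fl_0: "graded_ring M ==> Fl M 0 i = {0}"
proof -
 assume M: "graded_ring M"
 interpret M: graded_ring M by fact
 have "u = 0" if "u : Fl M 0 i" for u
 proof -
  obtain E where E: "u = (\<Sum>j<E. M.tcomp wt j u)" using M.ft_decomp by blast
  have "(\<Sum>j<E. M.tcomp wt j u) = 0" using that by (intro sum.neutral) (auto simp: Fl_def)
  then show ?thesis using E by simp
 qed
 then show ?thesis by (auto simp: Fl_def)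
qed

lemma Fl_d':
 assumes M: "graded_ring M" "A \<subseteq> M" and u: "u : Fl M D (Suc i)"
 shows "d' u : Fl M D i" "D = Suc E ==> NN.tcomp wt E (d' u) = d (NN.tcomp wt E u)"
proof -
 interpret M: graded_ring M by fact
 have uf: "u : ft M (kgens m (Suc i))" using u by (simp add: Fl_def)
 have z: "NN.tcomp wt j u = 0" if "D \<le> j" for j using u that by (simp add: Fl_def)
 obtain E' where E': "u = (\<Sum>j<E'. NN.tcomp wt j u)" using NN.ft_decomp by blast
 have t: "NN.tcomp wt j u : ftd M (kgens m (Suc i)) wt j" for j
  using M.tcomp_ftd[OF uf] by simp
 have sum: "NN.tcomp wt e (d' u) = (\<Sum>j<E'. NN.tcomp wt e (d' (NN.tcomp wt j u)))" for e
  by (subst E') (simp add: bd_map_sum NN.tcomp_sum)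
 have 0: "NN.tcomp wt e (d' u) = 0" if "D \<le> e" for e
  unfolding sum
 proof (rule sum.neutral, rule ballI)
  fix j
  show "NN.tcomp wt e (d' (NN.tcomp wt j u)) = 0"
  proof (cases "j < D")
   case True
   then show ?thesis using tcomp_shift[OF M t, of j e] that by simp
  qed (simp add: z)
 qed
 have "d' u : ft M (kgens m i)"
  by (rule M.ft_bd_map[OF uf M.kbd_ft]) (use h'_A M(2) in auto)
 then show "d' u : Fl M D i" using 0 by (simp add: Fl_def)
 assume D: "D = Suc E"
 have "NN.tcomp wt E (d' (NN.tcomp wt j u)) = d (NN.tcomp wt E (NN.tcomp wt j u))" for j
 proof (cases "j \<le> E")
  case True
  have "NN.tcomp wt E (NN.tcomp wt j u) = (if E = j then NN.tcomp wt j u else 0)"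
   using M.tcomp_eq[OF t[of j], of E] by simp
  then show ?thesis using tcomp_shift[OF M t True] by auto
 qed (simp add: z D)
 then have "NN.tcomp wt E (d' u) = d (NN.tcomp wt E (\<Sum>j<E'. NN.tcomp wt j u))"
  unfolding sum by (simp add: NN.tcomp_sum bd_map_sum)
 then show "NN.tcomp wt E (d' u) = d (NN.tcomp wt E u)" using E' by simp
qed

text \<open>The components of \<open>d' y\<close> vanish above degree \<open>E\<close>, and the one
  in degree \<open>E\<close> is \<open>d y\<close>, so the top component of \<open>u\<close> is
  cancelled.\<close>

lemma Fl_subtract:
 assumes M: "graded_ring M" "A \<subseteq> M" and u: "u : Fl M (Suc E) i"
  and y: "y : ftd M (kgens m (Suc i)) wt E" "NN.tcomp wt E u = d y"
 shows "u - d' y : Fl M E i"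
proof -
 interpret M: graded_ring M by fact
 have "d' y : ft M (kgens m i)"
  by (rule M.ft_bd_map[OF M.ftd_ft[OF y(1)] M.kbd_ft]) (use h'_A M(2) in auto)
 moreover have "NN.tcomp wt j (u - d' y) = 0" if "E \<le> j" for j
  using tcomp_shift[OF M y(1) that] y(2) u that by (auto simp: NN.tcomp_diff Fl_def)
 ultimately show ?thesis using u M.ft_diff by (simp add: Fl_def)
qed

text \<open>Induction on a degree bound: the top component of a cycle of \<open>d'\<close> is a
  cycle of \<open>d\<close>, hence a boundary, and subtracting the image under \<open>d'\<close> of
  the same primitive lowers the bound.\<close>

lemma shifted_acyclic_ring:
 assumes u: "u : ft (mpol_ring I) (kgens m (Suc i))" "d' u = 0"
 shows "\<exists>w\<in>ft (mpol_ring I) (kgens m (Suc (Suc i))). u = d' w"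
proof -
 have M: "graded_ring (mpol_ring I :: ('x,'k) mpol set)" by (rule SS.graded_ring_axioms)
 have "\<exists>w\<in>ft (mpol_ring I) (kgens m (Suc (Suc i))). u = d' w" if "u : Fl (mpol_ring I) E (Suc i)" "d' u = 0" for E u
  using that
 proof (induction E arbitrary: u)
  case 0
  then show ?case by (intro bexI[of _ 0]) (auto simp: Fl_0[OF M])
 next
  case (Suc E)
  let ?uE = "NN.tcomp wt E u"
  have uf: "u : ft (mpol_ring I) (kgens m (Suc i))" using Suc.prems by (simp add: Fl_def)
  have "d ?uE = 0" using Fl_d'(2)[OF M A_ring Suc.prems(1) refl] Suc.prems(2) by simp
  moreover have uE: "?uE : ftd (mpol_ring I) (kgens m (Suc i)) wt E"
   using SS.tcomp_ftd[OF uf, of wt E] by simp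
  ultimately obtain w where w: "w : ft (mpol_ring I) (kgens m (Suc (Suc i)))" "?uE = d w"
   using SS.kos_acyclic[OF koszul_ring] SS.ftd_ft by blast
  let ?w = "SS.tcomp wt E w"
  have "d ?w = SS.tcomp wt E (d w)"
   by (rule SS.tcomp_bd_map[OF w(1) SS.kbd_ftd, symmetric]) (use h_ring h_hom in auto)
  also have "... = ?uE" using SS.tcomp_eq[OF uE, of E] w(2) by simp
  finally have dw: "?uE = d ?w" by simp
  have w': "?w : ftd (mpol_ring I) (kgens m (Suc (Suc i))) wt E" by (rule SS.tcomp_ftd[OF w(1)])
  have dd: "d' (d' ?w) = 0" using SS.ftd_ft[OF w'] by (intro bd_kbd_kbd[where m = m and i = i]) (simp add: SS.ft_iff)
  have "u - d' ?w : Fl (mpol_ring I) E (Suc i)" by (rule Fl_subtract[OF M A_ring Suc.prems(1) w' dw])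
  then obtain w1 where w1: "w1 : ft (mpol_ring I) (kgens m (Suc (Suc i)))" "u - d' ?w = d' w1"
   using Suc.IH[of "u - d' ?w"] Suc.prems(2) dd by (auto simp: bd_map_diff)
  then have "u = d' (?w + w1)" by (simp add: bd_map_add algebra_simps)
  then show ?case using SS.ft_add[OF SS.ftd_ft[OF w'] w1(1)] by blast
 qed
 then show ?thesis using Fl_exists[OF M u(1)] u(2) by blast
qed

lemma Ff_ideal: "EX c. (ALL s. c s : A) & Ff - 1 = (\<Sum>s<m. c s * h' s)"
 using A_ideal[OF ev ff(2)] ff(3) by (simp add: mconst_simps)

definition Trm :: "(('x,'k) fvec) => (('x,'k) fvec)" where
 "Trm u = Poly_Mapping.map Tr u"

lemma Tr_0: "Tr 0 = 0"
 using Tr_add[of 0 0] by simp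

lemma Tr_sum: "Tr (sum f Y) = (\<Sum>y\<in>Y. Tr (f y))"
 by (induction Y rule: infinite_finite_induct) (simp_all add: Tr_0 Tr_add)

lemma lookup_Trm: "lk (Trm u) b = Tr (lk u b)"
 by (simp add: Trm_def Poly_Mapping.map.rep_eq when_def Tr_0)

lemma keys_Trm: "ky (Trm u) \<subseteq> ky u"
proof
 fix b assume "b : ky (Trm u)"
 then show "b : ky u" by (cases "b : ky u") (auto simp: in_keys_iff lookup_Trm Tr_0)
qed

lemma Trm_ft: "u : ft (mpol_ring I) B ==> Trm u : ft N B"
 using keys_Trm[of u] by (auto simp: NN.ft_iff SS.ft_iff lookup_Trm intro: Tr_N)

text \<open>The transfer is \<open>A\<close>-linear, and the map has its entries in
  \<open>A\<close>.\<close>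

lemma Trm_bd_map:
 assumes u: "ky u \<subseteq> B" and D: "!!b b'. b : B ==> lk (D b) b' : A"
 shows "Trm (bd_map D u) = bd_map D (Trm u)"
proof (rule poly_mapping_eqI)
 fix b'
 have "lk (Trm (bd_map D u)) b' = (\<Sum>b\<in>ky u. Tr (lk u b * lk (D b) b'))"
  by (simp add: lookup_Trm bd_map_alt lookup_sum lookup_smul Tr_sum)
 also have "... = (\<Sum>b\<in>ky u. Tr (lk u b) * lk (D b) b')"
  using u by (intro sum.cong refl Tr_mult D) auto
 also have "... = lk (bd_map D (Trm u)) b'"
  by (simp add: bd_map_superset[OF finite_keys keys_Trm] lookup_sum lookup_smul lookup_Trm)
 finally show "lk (Trm (bd_map D u)) b' = lk (bd_map D (Trm u)) b'" .
qed

lemma shifted_kills: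
 assumes c: "!!s. c s : A" and u: "u : ft N (kgens m i)" "i > 0 ==> d' u = 0"
 shows "\<exists>w\<in>ft N (kgens m (Suc i)). smul (\<Sum>s<m. c s * h' s) u = d' w"
proof -
 have ex: "EX w. s < m --> w : ft N (kgens m (Suc i)) & smul (h' s) u = d' w" for s
  using NN.kos_kills[of s m u i h'] u by blast
 obtain w where "ALL s. s < m --> w s : ft N (kgens m (Suc i)) & smul (h' s) u = d' (w s)"
  by (rule exE[OF choice[OF allI[OF ex]]])
 then have w: "s < m ==> w s : ft N (kgens m (Suc i)) & smul (h' s) u = d' (w s)" for s by blast
 have "smul (\<Sum>s<m. c s * h' s) u = (\<Sum>s<m. smul (c s) (smul (h' s) u))"
  by (simp add: smul_sum smul_smul)
 also have "... = (\<Sum>s<m. d' (smul (c s) (w s)))"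
  by (intro sum.cong refl) (simp add: w bd_map_smul)
 also have "... = d' (\<Sum>s<m. smul (c s) (w s))" by (simp add: bd_map_sum)
 finally show ?thesis using w c AN by (intro bexI[of _ "\<Sum>s<m. smul (c s) (w s)"] NN.ft_sum NN.ft_smul) auto
qed

text \<open>The element \<open>Ff\<close> acts on the homology of \<open>d'\<close> over \<open>N\<close> as the identity, but factors through the
 homology over the polynomial ring, by the transfer \<open>Tr\<close>.\<close>

lemma shifted_acyclic:
 assumes u: "u : ft N (kgens m (Suc i))" "d' u = 0"
 shows "\<exists>w\<in>ft N (kgens m (Suc (Suc i))). u = d' w"
proof -
 obtain c where c: "!!s. c s : A" "Ff - 1 = (\<Sum>s<m. c s * h' s)" using Ff_ideal by blast
 obtain w1 where w1: "w1 : ft N (kgens m (Suc (Suc i)))" "smul (Ff - 1) u = d' w1"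
  using shifted_kills[of c u "Suc i", OF c(1) u(1)] u(2) unfolding c(2) by blast
 have "smul ff u : ft (mpol_ring I) (kgens m (Suc i))"
  using u(1) NS by (intro SS.ft_smul ff) (auto simp: NN.ft_iff SS.ft_iff)
 from shifted_acyclic_ring[OF this] obtain w
  where w: "w : ft (mpol_ring I) (kgens m (Suc (Suc i)))" "smul ff u = d' w"
  using u(2) by (auto simp: bd_map_smul)
 have "smul Ff u = Trm (smul ff u)"
  using u(1) by (intro poly_mapping_eqI) (simp add: lookup_Trm lookup_smul ff(4) NN.ft_iff)
 also have "... = d' (Trm w)"
  unfolding w(2) by (rule Trm_bd_map[where B = "kgens m (Suc (Suc i))"])
   (use w(1) AA.kbd_ft[of m h' _ "Suc i"] h'_A in \<open>auto simp: SS.ft_iff AA.ft_iff\<close>)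
 finally have "u = d' (Trm w - w1)" using w1(2) by (simp add: bd_map_diff smul_diff algebra_simps)
 then show ?thesis using NN.ft_diff[OF Trm_ft[OF w(1)] w1(1)] by blast
qed

section \<open>Exactness of the deformed complex at level 0\<close>

lemma d'_level_0: "ky w \<subseteq> kgens m 1 ==> lk (d' w) 0 = (\<Sum>s<m. h' s * lk w (set_encode {s}))"
 using kbd_1[of w m h'] by (simp add: kfun_def)

lemma Theta_0: "\<Theta> 0 = 0"
 using Theta_add[of 0 0] by simp

lemma Theta_sum: "\<Theta> (sum f Y) = (\<Sum>y\<in>Y. \<Theta> (f y))"
 by (induction Y rule: infinite_finite_induct) (simp_all add: Theta_0 Theta_add)

lemma Theta_d': "w : ft N (kgens m 1) ==> \<Theta> (lk (d' w) 0) = 0"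
 using d'_level_0[of w] by (simp add: NN.ft_iff Theta_sum Theta_ideal)

text \<open>The same transfer argument one level lower, with \<open>n\<close> the coefficient of
  \<open>u\<close>: \<open>ff * n\<close> lies in the ideal over the polynomial ring, its transfer
  is \<open>Ff * n\<close>, and \<open>Ff - 1\<close> lies in the ideal over \<open>A\<close>.
  Subtracting expresses \<open>n\<close> through the \<open>h' s\<close> with coefficients
  \<open>Tr (c s) - c' s * n\<close> in \<open>N\<close>.\<close>

lemma Theta_exact:
 assumes u: "u : ft N (kgens m 0)" "\<Theta> (lk u 0) = 0"
 shows "\<exists>w\<in>ft N (kgens m 1). u = d' w"
proof -
 let ?n = "lk u 0"
 have n: "?n : N" using u(1) by (simp add: NN.ft_iff)
 obtain c where c: "!!s. c s : mpol_ring I" "ff * ?n = (\<Sum>s<m. c s * h' s)" using Theta_ker[OF n u(2)] by blast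
 obtain c' where c': "!!s. c' s : A" "Ff - 1 = (\<Sum>s<m. c' s * h' s)" using Ff_ideal by blast
 have "Ff * ?n = (\<Sum>s<m. Tr (c s) * h' s)"
  by (simp only: ff(4)[OF n, symmetric] c(2) Tr_sum) (intro sum.cong refl Tr_mult h'_A, simp)
 moreover have "(Ff - 1) * ?n = (\<Sum>s<m. c' s * ?n * h' s)"
  unfolding c'(2) by (simp add: sum_distrib_right sum_distrib_left mult_ac)
 moreover have "(\<Sum>s<m. (Tr (c s) - c' s * ?n) * h' s) = (\<Sum>s<m. Tr (c s) * h' s) - (\<Sum>s<m. c' s * ?n * h' s)"
  by (simp only: left_diff_distrib sum_subtractf)
 moreover have "Ff * ?n - (Ff - 1) * ?n = ?n" by (simp add: algebra_simps)
 ultimately have "?n = (\<Sum>s<m. (Tr (c s) - c' s * ?n) * h' s)" by (simp only:)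
 moreover define e where "e s = Tr (c s) - c' s * ?n" for s
 ultimately have ne: "?n = (\<Sum>s<m. h' s * e s)" by (simp add: mult.commute)
 have eN: "e s : N" for s unfolding e_def using AN by (intro NN.N.diff NN.N.mult Tr_N c n subsetD[OF AN c'(1)])
 let ?w = "kmap m 1 (%T. e (the_elem T))"
 have wN: "?w : ft N (kgens m 1)" by (rule NN.kmap_ft) (rule eN)
 have "u = d' ?w"
 proof (rule kfun_eqI[where m = m and i = 0])
  show "ky u \<subseteq> kgens m 0" using u(1) by (simp add: NN.ft_iff)
  show "ky (d' ?w) \<subseteq> kgens m 0" by (rule keys_bd_map[OF keys_kmap]) (use keys_kbd[of _ m 0] in simp)
  fix T assume "T : ksub m 0"
  then have T: "T = {}" by (auto simp: ksub_def finite_subset)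
  have "lk ?w (set_encode {s}) = e s" if "s < m" for s
   using kfun_kmap[of "{s}" m 1 "%T. e (the_elem T)"] that by (simp add: kfun_def ksub_def)
  then show "kfun u T = kfun (d' ?w) T"
   using d'_level_0[OF keys_kmap, of "%T. e (the_elem T)"] ne by (simp add: T kfun_def)
 qed
 then show ?thesis using wN by blast
qed

subsection \<open>Bounded degree of the Koszul homology\<close>

abbreviation KC where "KC \<equiv> kos m h dg"

lemma KC_simps [simp]: "gens KC = kgens m" "gdeg KC i = wt" "bd KC i = kbd h"
 by (simp_all add: kos_def)

lemma KC_bd: "b : kgens m (Suc i) ==> kbd h b : ftd N (kgens m i) wt (wt b)"
 using AN by (intro NN.kbd_ftd) (auto intro: h_A h_hom)

lemma h_cycles_boundary:
 assumes s: "s < m" and u: "u : tcyc N KC i j"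
 shows "smul (h s) u : tbnd N KC i (dg s + j)"
proof -
 have u': "u : ftd N (kgens m i) wt j" "i > 0 ==> d u = 0"
  using u by (auto simp: tor_cycles_def split: nat.splits)
 obtain w where w: "w : ft N (kgens m (Suc i))" "smul (h s) u = d w"
  using NN.kos_kills[OF s NN.ftd_ft[OF u'(1)] u'(2)] by blast
 have hu: "smul (h s) u : ftd N (kgens m i) wt (dg s + j)"
  using AN s by (intro NN.ftd_smul h_hom u') (auto intro: h_A)
 have "smul (h s) u = NN.tcomp wt (dg s + j) (d w)" using NN.tcomp_eq[OF hu, of "dg s + j"] w(2) by simp
 also have "... = d (NN.tcomp wt (dg s + j) w)" by (rule NN.tcomp_bd_map[OF w(1) KC_bd])
 finally show ?thesis using NN.tcomp_ftd[OF w(1), of wt "dg s + j"] by (auto simp: tor_boundaries_def)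
qed

lemma cycles_smul:
 assumes "a : N" "hmg e a" "u : tcyc N KC i j" shows "smul a u : tcyc N KC i (e + j)"
 using assms by (auto simp: tor_cycles_def bd_map_smul NN.ftd_smul split: nat.splits)

text \<open>Cycles and boundaries sit in a free module of finite rank over the polynomial ring,
  which is finitely generated over \<open>A\<close> by \<open>ring_span\<close>. Every nontrivial
  monomial in the \<open>h s\<close> carries cycles to boundaries. The spanning family of the
  Noetherian lemma may lie outside \<open>N\<close>, so finite generation of \<open>N\<close> over
  \<open>A\<close> does not have to be established.\<close>

lemma homology_bounded_level: "finite {j. \<not> tcyc N KC i j \<subseteq> tbnd N KC i j}"
proof -
 let ?T = "red_mons \<times> kgens m i"
 have finT: "finite ?T" by (simp add: finite_red_mons finite_kgens)
 define q where "q = card ?T"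
 obtain t where t: "bij_betw t {..<q} ?T" using ex_bij_betw_nat_finite[OF finT] by (auto simp: q_def atLeast0LessThan)
 define \<omega> where "\<omega> \<mu> l = (case t l of (\<beta>, b) => sg b (mon h \<mu> * mon mvar \<beta>))" for \<mu> l
 define dw where "dw l = (case t l of (\<beta>, b) => mdeg \<beta> + wt b)" for l
 show ?thesis
 proof (rule graded_noetherian[where m = m and q = q and dg = dg and dw = dw and \<omega> = \<omega>
   and OP = "%e. smul (mon h e)", OF vector_space_smul])
  fix j
  have "{(\<mu>, l). ky \<mu> \<subseteq> {..<m} & l < q & wdeg dg \<mu> + dw l = j} \<subseteq> {\<mu>. ky \<mu> \<subseteq> {..<m} & wdeg dg \<mu> \<le> j} \<times> {..<q}" by auto
  then show "finite {(\<mu>, l). ky \<mu> \<subseteq> {..<m} & l < q & wdeg dg \<mu> + dw l = j}"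
   by (rule finite_subset) (simp add: finite_monomials_wdeg dg_pos)
 next
  fix e \<mu> :: "nat \<Rightarrow>\<^sub>0 nat" and l
  show "smul (mon h e) (\<omega> \<mu> l) = \<omega> (e + \<mu>) l"
   by (simp add: \<omega>_def smul_single mon_add mult.assoc split: prod.splits)
 next
  fix j u v assume "u : tcyc N KC i j" "v : tcyc N KC i j"
  then show "u + v : tcyc N KC i j"
   by (auto simp: tor_cycles_def bd_map_add NN.ftd_add split: nat.splits)
 next
  fix j a u assume "u : tcyc N KC i j"
  then show "smul (mconst a) u : tcyc N KC i j"
   using cycles_smul[OF NN.N_const homogeneous_mconst] by fastforce
 next
  fix j u and e :: "nat \<Rightarrow>\<^sub>0 nat" assume e: "ky e \<subseteq> {..<m}" and u: "u : tcyc N KC i j"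
  show "smul (mon h e) u : tcyc N KC i (j + wdeg dg e)"
   using cycles_smul[OF _ mon_h_homogeneous[OF e] u] mon_h_A[OF e] AN by (auto simp: add.commute)
 next
  fix j
  show "0 : tbnd N KC i j" by (auto simp: tor_boundaries_def intro!: image_eqI[of _ _ 0])
 next
  fix j u v assume "u : tbnd N KC i j" "v : tbnd N KC i j"
  then obtain x y where "x : ftd N (kgens m (Suc i)) wt j" "y : ftd N (kgens m (Suc i)) wt j"
   "u = d x" "v = d y" by (auto simp: tor_boundaries_def)
  then show "u + v : tbnd N KC i j"
   by (auto simp: tor_boundaries_def bd_map_add NN.ftd_add intro!: image_eqI[of _ _ "x + y"])
 next
  fix j a u assume "u : tbnd N KC i j"
  then obtain x where "x : ftd N (kgens m (Suc i)) wt j" "u = d x" by (auto simp: tor_boundaries_def)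
  then show "smul (mconst a) u : tbnd N KC i j"
   by (auto simp: tor_boundaries_def bd_map_smul NN.ftd_sc intro!: image_eqI[of _ _ "smul (mconst a) x"])
 next
  fix j u and e :: "nat \<Rightarrow>\<^sub>0 nat" assume e: "ky e \<subseteq> {..<m}" "e ~= 0" and u: "u : tcyc N KC i j"
  have "ky e ~= {}" using e(2) by simp
  then obtain s where s: "s : ky e" by blast
  \<comment> \<open>One factor \<open>h s\<close> of the monomial suffices to reach the boundaries;
    the remaining factor keeps cycles among cycles.\<close>
  define e' where "e' = e - sg s 1"
  have ee: "e = sg s 1 + e'"
   using s by (intro poly_mapping_eqI) (auto simp: e'_def lookup_add lookup_minus lookup_single when_def in_keys_iff)
  have e': "ky e' \<subseteq> {..<m}" using e(1) by (simp add: ee keys_add_nat)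
  have "s < m" using s e(1) by auto
  have "smul (mon h e') u : tcyc N KC i (wdeg dg e' + j)"
   using cycles_smul[OF _ mon_h_homogeneous[OF e'] u] mon_h_A[OF e'] AN by auto
  from h_cycles_boundary[OF \<open>s < m\<close> this] show "smul (mon h e) u : tbnd N KC i (j + wdeg dg e)"
   by (simp add: smul_smul ee mon_add wdeg_add ac_simps)
 next
  fix j u assume "u : tcyc N KC i j"
  then have u: "u : ftd N (kgens m i) wt j" by (simp add: tor_cycles_def)
  let ?Sp = "svs.span ((%(\<mu>, l). \<omega> \<mu> l) ` {(\<mu>, l). ky \<mu> \<subseteq> {..<m} & l < q & wdeg dg \<mu> + dw l = j})"
  have "sg b (lk u b) : ?Sp" if b: "b : ky u" for b
  proof -
   have b': "b : kgens m i" "wt b \<le> j" "hmg (j - wt b) (lk u b)" "lk u b : mpol_ring I"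
   using u b NS by (auto simp: NN.ftd_iff NN.ft_iff)
   from ring_span[OF b'(4,3)] show ?thesis
   proof (induction rule: mvs.span_induct_alt)
   case (step c x y)
   then obtain \<mu> \<beta> where x: "x = mon h \<mu> * mon mvar \<beta>" "ky \<mu> \<subseteq> {..<m}" "\<beta> : red_mons" "wdeg dg \<mu> + mdeg \<beta> = j - wt b" by auto
   obtain l where l: "l < q" "t l = (\<beta>, b)" using t x(3) b'(1) unfolding bij_betw_def by (metis (no_types, lifting) SigmaI imageE lessThan_iff)
   have "\<omega> \<mu> l : ?Sp"
   using x(2,4) l b'(2) by (intro svs.span_base image_eqI[of _ _ "(\<mu>, l)"]) (auto simp: dw_def)
   then have "sg b x : ?Sp" by (simp add: \<omega>_def l x(1))
   then have "smul (mconst c) (sg b x) + sg b y : ?Sp" using step by (intro svs.span_add svs.span_scale)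
   then show ?case by (simp add: smul_single single_add)
   qed (simp add: svs.span_zero)
  qed
  then have "(\<Sum>b\<in>ky u. sg b (lk u b)) : ?Sp" by (rule svs.span_sum)
  then show "u : ?Sp" by (simp flip: sum_monomials)
 qed (simp_all add: smul_add smul_smul mult.commute)
qed

lemma cycles_empty: "m < i ==> tcyc N KC i j = {0}"
proof -
 assume "m < i"
 then have k: "kgens m i = {}" by (rule kgens_empty)
 have "u = 0" if "u : ftd N {} wt j" for u
  using NN.ftd_ft[OF that] by (simp add: NN.ft_iff)
 moreover obtain l where "i = Suc l" using \<open>m < i\<close> by (cases i) auto
 ultimately show ?thesis using k by (auto simp: tor_cycles_def)
qed

text \<open>Only the levels up to \<open>m\<close> contribute, so the bounds of the single levels
  have a common one.\<close>

lemma homology_bounded: "EX D0. ALL i. \<forall>j\<ge>D0. tcyc N KC i j \<subseteq> tbnd N KC i j"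
proof -
 let ?J = "\<Union>i\<le>m. {j. \<not> tcyc N KC i j \<subseteq> tbnd N KC i j}"
 have "finite ?J" using homology_bounded_level by auto
 then obtain D0 where D0: "\<forall>j\<in>?J. j < D0" using finite_nat_set_iff_bounded by auto
 have "tcyc N KC i j \<subseteq> tbnd N KC i j" if "D0 \<le> j" for i j
 proof (cases "i \<le> m")
  case True
  then show ?thesis using D0 that by fastforce
 next
  case False
  then have "tcyc N KC i j = {0}" by (intro cycles_empty) simp
  then show ?thesis by (auto simp: tor_boundaries_def intro!: image_eqI[of _ _ 0])
 qed
 then show ?thesis by blast
qed

lemma boundaries_cycles: "tbnd N KC i j \<subseteq> tcyc N KC i j"
proof
 fix u assume "u : tbnd N KC i j"
 then obtain w where w: "w : ftd N (kgens m (Suc i)) wt j" "u = d w" by (auto simp: tor_boundaries_def)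
 have "u : ftd N (kgens m i) wt j" unfolding w(2) by (rule NN.ftd_bd_map[OF w(1) KC_bd])
 moreover have "d u = 0" if "i = Suc l" for l
  unfolding w(2) using NN.ftd_ft[OF w(1)] that by (intro bd_kbd_kbd[where i = l and m = m]) (simp add: NN.ft_iff)
 ultimately show "u : tcyc N KC i j" by (auto simp: tor_cycles_def split: nat.splits)
qed

text \<open>Elements of high degree can be pushed down modulo boundaries of \<open>d'\<close>.\<close>

lemma reduce_degree:
 assumes D: "!!i j. D \<le> j ==> tcyc N KC i j \<subseteq> tbnd N KC i j"
  and w: "w : Fl N E i" "D \<le> E" "i > 0 ==> d' w : Fl N D (i - 1)"
 shows "\<exists>w'\<in>Fl N D i. \<exists>y\<in>ft N (kgens m (Suc i)). w = w' + d' y"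
 using w(2,1,3)
proof (induction E arbitrary: w rule: dec_induct)
 case base
 then show ?case by (intro bexI[of _ w] bexI[of _ 0]) auto
next
 case (step E)
 have M: "graded_ring N" by (rule NN.graded_ring_axioms)
 let ?wE = "NN.tcomp wt E w"
 have wf: "w : ft N (kgens m i)" using step.prems by (simp add: Fl_def)
 \<comment> \<open>In degree \<open>E \<ge> D\<close> the element \<open>d' w\<close> has no
   component, so the top component of \<open>w\<close> is a cycle of \<open>d\<close> and, by the
   choice of \<open>D\<close>, a boundary.\<close>
 have "?wE : tcyc N KC i E"
 proof (cases i)
  case 0
  then show ?thesis using NN.tcomp_ftd[OF wf, of wt E] by (simp add: tor_cycles_def)
 next
  case (Suc l)
  have "d ?wE = NN.tcomp wt E (d' w)" using Fl_d'(2)[OF M AN _ refl, of w E l] step.prems(1) Suc by simp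
  also have "... = 0" using step.prems(2) step.hyps Suc by (simp add: Fl_def)
  finally show ?thesis using NN.tcomp_ftd[OF wf, of wt E] Suc by (simp add: tor_cycles_def)
 qed
 then obtain y where y: "y : ftd N (kgens m (Suc i)) wt E" "?wE = d y"
  using D[of E i] step.hyps by (auto simp: tor_boundaries_def)
 have dd: "d' (d' y) = 0" if i: "i > 0"
 proof -
  obtain l where "i = Suc l" using i by (cases i) auto
  then show ?thesis using NN.ftd_ft[OF y(1)] by (intro bd_kbd_kbd[where i = l and m = m]) (simp add: NN.ft_iff)
 qed
 have "w - d' y : Fl N E i" by (rule Fl_subtract[OF M AN step.prems(1) y])
 moreover have "d' (w - d' y) : Fl N D (i - 1)" if "i > 0" using step.prems(2)[OF that] dd[OF that] by (simp add: bd_map_diff)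
 ultimately obtain w' y' where wy: "w' : Fl N D i" "y' : ft N (kgens m (Suc i))" "w - d' y = w' + d' y'"
  using step.IH[of "w - d' y"] by blast
 then have "w = w' + d' (y' + y)" by (simp add: bd_map_add algebra_simps)
 then show ?case using wy NN.ft_add[OF wy(2) NN.ftd_ft[OF y(1)]] by blast
qed

section \<open>The deformed complex truncated below the degree \<open>D\<close>\<close>

context
 fixes D
 assumes D: "!!i j. D \<le> j ==> tcyc N KC i j \<subseteq> tbnd N KC i j"
begin

lemma reduce_any:
 assumes w: "w : ft N (kgens m i)" "i > 0 ==> d' w : Fl N D (i - 1)"
 shows "\<exists>w'\<in>Fl N D i. \<exists>y\<in>ft N (kgens m (Suc i)). w = w' + d' y"
proof -
 obtain E where "w : Fl N E i" using Fl_exists[OF NN.graded_ring_axioms w(1)] by blast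
 then have wE: "w : Fl N (max E D) i" by (auto simp: Fl_def)
 show ?thesis
 proof (rule reduce_degree[OF _ wE])
  show "tcyc N KC i j \<subseteq> tbnd N KC i j" if "D \<le> j" for i j using D that by blast
 qed (use w(2) in auto)
qed

text \<open>A primitive exists, but without any control of its degree. It can be pushed into the
  truncation by subtracting a boundary of \<open>d'\<close>, which does not affect its
  image.\<close>

lemma Fl_acyclic: "{u : Fl N D (Suc i). d' u = 0} = d' ` Fl N D (Suc (Suc i))"
proof (intro equalityI subsetI)
 fix u assume "u : {u : Fl N D (Suc i). d' u = 0}"
 then have u: "u : Fl N D (Suc i)" "d' u = 0" by auto
 from u(1) have "u : ft N (kgens m (Suc i))" by (simp add: Fl_def)
 from shifted_acyclic[OF this u(2)] obtain w where w: "w : ft N (kgens m (Suc (Suc i)))" "u = d' w" by blast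
 then obtain w' y where "w' : Fl N D (Suc (Suc i))" "y : ft N (kgens m (Suc (Suc (Suc i))))" "w = w' + d' y"
  using reduce_any[OF w(1)] u(1) by auto
 moreover from this(2) have "d' (d' y) = 0" by (intro bd_kbd_kbd[where m = m and i = "Suc i"]) (simp add: NN.ft_iff)
 ultimately show "u : d' ` Fl N D (Suc (Suc i))" using w(2) by (auto simp: bd_map_add)
next
 fix u assume "u : d' ` Fl N D (Suc (Suc i))"
 then obtain w where w: "w : Fl N D (Suc (Suc i))" "u = d' w" by auto
 have "d' (d' w) = 0" using w(1) by (intro bd_kbd_kbd[where m = m and i = i]) (auto simp: Fl_def NN.ft_iff)
 then show "u : {u : Fl N D (Suc i). d' u = 0}"
  using Fl_d'(1)[OF NN.graded_ring_axioms AN w(1)] w(2) by simp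
qed

lemma Fl_Theta_ker: "{u : Fl N D 0. \<Theta> (lk u 0) = 0} = d' ` Fl N D 1"
proof (intro equalityI subsetI)
 fix u assume "u : {u : Fl N D 0. \<Theta> (lk u 0) = 0}"
 then have u: "u : Fl N D 0" "\<Theta> (lk u 0) = 0" by auto
 from u(1) have "u : ft N (kgens m 0)" by (simp add: Fl_def)
 from Theta_exact[OF this u(2)] obtain w where w: "w : ft N (kgens m 1)" "u = d' w" by blast
 then obtain w' y where "w' : Fl N D 1" "y : ft N (kgens m (Suc 1))" "w = w' + d' y"
  using reduce_any[OF w(1)] u(1) by auto
 moreover from this(2) have "d' (d' y) = 0" by (intro bd_kbd_kbd[where i = 0 and m = m]) (simp add: NN.ft_iff)
 ultimately show "u : d' ` Fl N D 1" using w(2) by (auto simp: bd_map_add)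
next
 fix u assume "u : d' ` Fl N D 1"
 then obtain w where w: "w : Fl N D 1" "u = d' w" by auto
 then show "u : {u : Fl N D 0. \<Theta> (lk u 0) = 0}"
  using Fl_d'(1)[OF NN.graded_ring_axioms AN, of w D 0] Theta_d'[of w] by (auto simp: Fl_def)
qed

text \<open>Boundaries of \<open>d'\<close> are invisible to \<open>\<Theta>\<close>, so any element
  of \<open>N\<close> may be replaced by one of degree below \<open>D\<close>.\<close>

lemma Fl_Theta_onto: "(%u. \<Theta> (lk u 0)) ` Fl N D 0 = \<Theta> ` N"
proof (intro equalityI subsetI)
 fix x assume "x : \<Theta> ` N"
 then obtain n where n: "n : N" "x = \<Theta> n" by auto
 have "sg 0 n : ft N (kgens m 0)" using n by (intro NN.ft_single) (auto simp: kgens_0)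
 then obtain w' y where wy: "w' : Fl N D 0" "y : ft N (kgens m 1)" "sg 0 n = w' + d' y"
  using reduce_any[of "sg 0 n" 0] by auto
 have "n = lk w' 0 + lk (d' y) 0" using arg_cong[OF wy(3), of "%u. lk u 0"] by (simp add: lookup_add)
 then have "x = \<Theta> (lk w' 0)" using n(2) Theta_d'[OF wy(2)] by (simp add: Theta_add)
 then show "x : (%u. \<Theta> (lk u 0)) ` Fl N D 0" using wy(1) by blast
qed (auto simp: Fl_def NN.ft_iff)

end

end

section \<open>Euler characteristics\<close>

definition sgnd :: "nat => 'g::ab_group_add => 'g" where
 "sgnd i x = (if even i then x else - x)"

lemma sgnd_add: "sgnd i (x + y) = sgnd i x + sgnd i y" and sgnd_diff: "sgnd i (x - y) = sgnd i x - sgnd i y"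
 and sgnd_Suc: "sgnd (Suc i) x = - sgnd i x" and sgnd_0 [simp]: "sgnd i 0 = 0" "sgnd 0 x = x"
 by (auto simp: sgnd_def)

lemma sgnd_sum: "sgnd i (sum f Y) = (\<Sum>y\<in>Y. sgnd i (f y))"
 by (simp add: sgnd_def sum_negf)

locale add_subgroup =
 fixes R :: "'g::ab_group_add set"
 assumes zero: "0 : R" and add: "x : R ==> y : R ==> x + y : R" and uminus: "x : R ==> - x : R"
begin

lemma diff: "x : R ==> y : R ==> x - y : R"
 using add[of x "-y"] uminus by simp

lemma sum: "(!!i. i : Y ==> f i : R) ==> sum f Y : R"
 by (induction Y rule: infinite_finite_induct) (auto intro: zero add)

lemma sgnd: "x : R ==> sgnd i x : R"
 by (simp add: sgnd_def uminus)

lemma trans: "x - y : R ==> y - z : R ==> x - z : R"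
 using add[of "x - y" "y - z"] by simp

lemma sym: "x - y : R ==> y - x : R"
 using uminus[of "x - y"] by simp

text \<open>Telescoping along the short exact sequences of cycles and boundaries. Congruence modulo
  an arbitrary subgroup \<open>R\<close> covers both applications: classes modulo the relations of
  the Grothendieck group, and dimensions with \<open>R\<close> zero.\<close>

lemma alternating_sum:
 assumes "v 0 - z 0 : R" "!!i. v (Suc i) - z (Suc i) - b i : R" "b n : R"
 shows "(\<Sum>i\<le>n. sgnd i (v i)) - (\<Sum>i\<le>n. sgnd i (z i - b i)) : R"
proof -
 have "(\<Sum>i\<le>n. sgnd i (v i)) - (\<Sum>i\<le>n. sgnd i (z i - b i)) - sgnd n (b n) : R"
 proof (induction n)
  case 0
  then show ?case using assms(1) by simp
 next
  case (Suc n)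
  have eq: "(\<Sum>i\<le>Suc n. sgnd i (v i)) - (\<Sum>i\<le>Suc n. sgnd i (z i - b i)) - sgnd (Suc n) (b (Suc n))
   = ((\<Sum>i\<le>n. sgnd i (v i)) - (\<Sum>i\<le>n. sgnd i (z i - b i)) - sgnd n (b n)) + sgnd (Suc n) (v (Suc n) - z (Suc n) - b n)"
   by (simp add: sgnd_diff sgnd_Suc[of n "b n"])
  show ?case unfolding eq by (rule add[OF Suc sgnd[OF assms(2)]])
 qed
 from add[OF this sgnd[OF assms(3), of n]] show ?thesis by simp
qed

end

context koszul_point
begin

abbreviation Vd where "Vd i j \<equiv> ftd N (kgens m i) wt j"

lemma Vd_cycles_0: "tcyc N KC 0 j = Vd 0 j"
 by (simp add: tor_cycles_def)

lemma Vd_cycles_Suc: "tcyc N KC (Suc i) j = {u : Vd (Suc i) j. d u = 0}"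
 by (simp add: tor_cycles_def)

lemma boundaries_eq: "tbnd N KC i j = d ` Vd (Suc i) j"
 by (simp add: tor_boundaries_def)

lemma Vd_empty: "m < i ==> Vd i j = {0}"
 using NN.ftd_ft[of _ "{}" wt j] by (auto simp: kgens_empty NN.ft_iff NN.N.zero)

lemma Fl_empty: "m < i ==> Fl N D i = {0}"
 by (auto simp: Fl_def kgens_empty NN.ft_iff NN.N.zero)

lemma Fl_Suc_ker: "{u : Fl N (Suc D) i. NN.tcomp wt D u = 0} = Fl N D i"
proof (intro equalityI subsetI)
 fix u assume u: "u : {u : Fl N (Suc D) i. NN.tcomp wt D u = 0}"
 have "NN.tcomp wt j u = 0" if "D \<le> j" for j
 proof (cases "j = D")
  case False
  with that have "Suc D \<le> j" by simp
  with u show ?thesis unfolding Fl_def by blast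
 qed (use u in blast)
 with u show "u : Fl N D i" unfolding Fl_def by blast
next
 fix u assume u: "u : Fl N D i"
 have "NN.tcomp wt j u = 0" if "Suc D \<le> j" for j
  using u Suc_leD[OF that] unfolding Fl_def by blast
 moreover have "NN.tcomp wt D u = 0" using u order_refl[of D] unfolding Fl_def by blast
 ultimately show "u : {u : Fl N (Suc D) i. NN.tcomp wt D u = 0}" using u unfolding Fl_def by blast
qed

lemma Fl_Suc_image: "NN.tcomp wt D ` Fl N (Suc D) i = Vd i D"
proof (intro equalityI subsetI)
 fix u assume "u : Vd i D"
 then have "u : Fl N (Suc D) i" "NN.tcomp wt D u = u"
  using NN.tcomp_eq[of u "kgens m i" wt D] NN.ftd_ft by (auto simp: Fl_def)
 then show "u : NN.tcomp wt D ` Fl N (Suc D) i" by force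
qed (auto simp: Fl_def intro: NN.tcomp_ftd)

lemma euler_homology:
 fixes lam :: "(('x,'k) fvec) set => 'g::ab_group_add"
 assumes R: "add_subgroup R" and zero: "lam {0} : R"
  and add_d: "!!i. lam (Vd (Suc i) j) - lam {u : Vd (Suc i) j. d u = 0} - lam (d ` Vd (Suc i) j) : R"
 shows "(\<Sum>i\<le>m. sgnd i (lam (Vd i j))) - (\<Sum>i\<le>m. sgnd i (lam (tcyc N KC i j) - lam (tbnd N KC i j))) : R"
proof -
 interpret R: add_subgroup R by fact
 show ?thesis
 proof (rule R.alternating_sum)
  show "lam (Vd 0 j) - lam (tcyc N KC 0 j) : R" by (simp add: Vd_cycles_0 R.zero)
  show "lam (Vd (Suc i) j) - lam (tcyc N KC (Suc i) j) - lam (tbnd N KC i j) : R" for i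
   using add_d by (simp add: Vd_cycles_Suc boundaries_eq)
  show "lam (tbnd N KC m j) : R" using zero by (simp add: boundaries_eq Vd_empty)
 qed
qed

text \<open>\<open>lam\<close> stands for a function that is additive, modulo \<open>R\<close>, on
  the maps that occur. The filtration assembles the graded pieces of degree below \<open>D\<close>
  into the truncated complex; there exactness of \<open>d'\<close> cancels everything except the
  cokernel at level 0.\<close>

lemma euler_filtration:
 fixes lam :: "(('x,'k) fvec) set => 'g::ab_group_add"
 assumes R: "add_subgroup R" and zero: "lam {0} : R"
  and add_t: "!!D i. lam (Fl N (Suc D) i) - lam {u : Fl N (Suc D) i. NN.tcomp wt D u = 0} - lam (NN.tcomp wt D ` Fl N (Suc D) i) : R"
  and add_d': "!!i. lam (Fl N D (Suc i)) - lam {u : Fl N D (Suc i). d' u = 0} - lam (d' ` Fl N D (Suc i)) : R"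
  and D: "!!i j. D \<le> j ==> tcyc N KC i j \<subseteq> tbnd N KC i j"
 shows "(\<Sum>i\<le>m. sgnd i (\<Sum>j<D. lam (Vd i j))) - (lam (Fl N D 0) - lam {u : Fl N D 0. \<Theta> (lk u 0) = 0}) : R"
proof -
 interpret R: add_subgroup R by fact
 have filt: "lam (Fl N D i) - (\<Sum>j<D. lam (Vd i j)) : R" for D i
 proof (induction D)
  case 0
  then show ?case using zero by (simp add: Fl_0[OF NN.graded_ring_axioms])
 next
  case (Suc D)
  have "lam (Fl N (Suc D) i) - lam (Fl N D i) - lam (Vd i D) : R"
   using add_t[of D i] by (simp only: Fl_Suc_ker Fl_Suc_image)
  from R.add[OF this Suc] show ?case by (simp add: algebra_simps)
 qed
 define z where "z i = lam (case i of 0 => Fl N D 0 | Suc l => d' ` Fl N D (Suc (Suc l)))" for i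
 define b where "b i = lam (d' ` Fl N D (Suc i))" for i
 have "(\<Sum>i\<le>m. sgnd i (lam (Fl N D i))) - (\<Sum>i\<le>m. sgnd i (z i - b i)) : R"
 proof (rule R.alternating_sum)
  show "lam (Fl N D 0) - z 0 : R" by (simp add: z_def R.zero)
  show "lam (Fl N D (Suc i)) - z (Suc i) - b i : R" for i
   using add_d'[of i] by (simp add: z_def b_def Fl_acyclic[OF D])
  show "b m : R" using zero by (simp add: b_def Fl_empty)
 qed
 moreover have "(\<Sum>i\<le>m. sgnd i (z i - b i)) = z 0 - b 0"
 proof -
  have "sgnd i (z i - b i) = 0" if "i ~= 0" for i using that by (cases i) (simp_all add: z_def b_def)
  then have "(\<Sum>i\<le>m. sgnd i (z i - b i)) = (\<Sum>i\<in>{0}. sgnd i (z i - b i))"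
   by (intro sum.mono_neutral_right) auto
  then show ?thesis by simp
 qed
 moreover have "z 0 - b 0 = lam (Fl N D 0) - lam {u : Fl N D 0. \<Theta> (lk u 0) = 0}"
  using Fl_Theta_ker[OF D] by (simp add: z_def b_def)
 ultimately have 1: "(\<Sum>i\<le>m. sgnd i (lam (Fl N D i))) - (lam (Fl N D 0) - lam {u : Fl N D 0. \<Theta> (lk u 0) = 0}) : R"
  by (simp only:)
 have "(\<Sum>i\<le>m. sgnd i (\<Sum>j<D. lam (Vd i j))) - (\<Sum>i\<le>m. sgnd i (lam (Fl N D i))) : R"
  unfolding sum_subtractf[symmetric] sgnd_diff[symmetric] by (intro R.sum R.sgnd R.sym[OF filt])
 then show ?thesis using 1 by (rule R.trans)
qed

end

section \<open>Dimensions and eigenspaces\<close>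

text \<open>The map has to be linear on \<open>Z\<close> only and may lead to a space over a
  different type. A basis of the kernel is extended to one of \<open>Z\<close>; the images of the
  added vectors form a basis of the image.\<close>

lemma rank_nullity:
 fixes sc :: "'k::field => 'm::ab_group_add => 'm" and sc2 :: "'k => 'n::ab_group_add => 'n"
 assumes v1: "vector_space sc" and v2: "vector_space sc2" and Z: "module.subspace sc Z" "fdim sc Z"
  and f: "!!x y. x : Z ==> y : Z ==> f (x + y) = f x + f y" "!!a x. x : Z ==> f (sc a x) = sc2 a (f x)"
 shows "vector_space.dim sc Z = vector_space.dim sc {z\<in>Z. f z = 0} + vector_space.dim sc2 (f ` Z)"
proof -
 interpret v1: vector_space sc by fact
 interpret v2: vector_space sc2 by fact
 let ?B = "{z\<in>Z. f z = 0}"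
 have f0: "f 0 = 0" using f(2)[of 0 0] v1.subspace_0[OF Z(1)] by simp
 have fsum: "f (\<Sum>x\<in>Y. sc (u x) x) = (\<Sum>x\<in>Y. sc2 (u x) (f x)) & (\<Sum>x\<in>Y. sc (u x) x) : Z" if "Y \<subseteq> Z" for Y u
  using that by (induction Y rule: infinite_finite_induct)
   (auto simp: f0 f v1.subspace_0[OF Z(1)] v1.subspace_add[OF Z(1)] v1.subspace_scale[OF Z(1)])
 have subB: "v1.subspace ?B"
  using Z(1) by (auto simp: v1.subspace_def f f0)
 obtain S where S: "finite S" "Z \<subseteq> v1.span S" using Z(2) by (auto simp: fdim_def)
 obtain B0 where B0: "B0 \<subseteq> ?B" "v1.independent B0" "?B \<subseteq> v1.span B0" using v1.maximal_independent_subset by blast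
 have "B0 \<subseteq> Z" using B0(1) by auto
 then obtain C where C: "B0 \<subseteq> C" "C \<subseteq> Z" "v1.independent C" "Z \<subseteq> v1.span C"
  using v1.maximal_independent_subset_extend[OF _ B0(2)] by blast
 have finC: "finite C" using v1.independent_span_bound[OF S(1) C(3)] C(2) S(2) by blast
 let ?E = "C - B0"
 have EZ: "?E \<subseteq> Z" using C(2) by auto
 have key: "u e = 0" if u: "f (\<Sum>x\<in>?E. sc (u x) x) = 0" and e: "e : ?E" for u e
 proof -
  have "(\<Sum>x\<in>?E. sc (u x) x) : v1.span B0" using u fsum[OF EZ, of u] B0(3) by auto
  then obtain w where w: "(\<Sum>x\<in>?E. sc (u x) x) = (\<Sum>x\<in>B0. sc (w x) x)"
   using v1.span_finite[of B0] finite_subset[OF C(1) finC] by auto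
  define g where "g x = (if x : B0 then - w x else u x)" for x
  have "(\<Sum>x\<in>C. sc (g x) x) = (\<Sum>x\<in>?E. sc (g x) x) + (\<Sum>x\<in>B0. sc (g x) x)"
   by (rule sum.subset_diff[OF C(1) finC])
  also have "(\<Sum>x\<in>?E. sc (g x) x) = (\<Sum>x\<in>?E. sc (u x) x)" by (intro sum.cong refl) (simp add: g_def)
  also have "(\<Sum>x\<in>B0. sc (g x) x) = - (\<Sum>x\<in>B0. sc (w x) x)"
   unfolding sum_negf[symmetric] by (intro sum.cong refl) (simp add: g_def v1.scale_minus_left)
  finally have "(\<Sum>x\<in>C. sc (g x) x) = 0" using w by simp
  from v1.independentD[OF C(3) finC order_refl this, of e] e show ?thesis by (auto simp: g_def)
 qed
 have inj: "inj_on f ?E"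
 proof (rule inj_onI, rule ccontr)
  fix x y assume *: "x : ?E" "y : ?E" "f x = f y" "x ~= y"
  define u where "u z = (if z = x then 1 else if z = y then - 1 else 0 :: 'k)" for z
  have "(\<Sum>z\<in>?E. sc2 (u z) (f z)) = (\<Sum>z\<in>{x, y}. sc2 (u z) (f z))"
   using finC * by (intro sum.mono_neutral_right) (auto simp: u_def)
  also have "... = 0" using * by (simp add: u_def v2.scale_minus_left)
  finally have "u x = 0" using key[of u x] fsum[OF EZ, of u] * by simp
  then show False by (simp add: u_def)
 qed
 have ind: "v2.independent (f ` ?E)"
 proof (rule v2.independent_if_scalars_zero)
  fix g y assume g: "(\<Sum>y\<in>f ` ?E. sc2 (g y) y) = 0" and y: "y : f ` ?E"
  obtain e where e: "e : ?E" "y = f e" using y by auto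
  have "(\<Sum>x\<in>?E. sc2 (g (f x)) (f x)) = 0" using g by (simp add: sum.reindex[OF inj])
  then show "g y = 0" using key[of "%x. g (f x)" e] fsum[OF EZ, of "%x. g (f x)"] e by simp
 qed (use finC in simp)
 have span: "f ` Z \<subseteq> v2.span (f ` ?E)"
 proof
  fix y assume "y : f ` Z"
  then obtain z where z: "z : Z" "y = f z" by auto
  then obtain u where u: "z = (\<Sum>x\<in>C. sc (u x) x)" using C(4) v1.span_finite[OF finC] by auto
  have "y = (\<Sum>x\<in>C. sc2 (u x) (f x))" using fsum[OF C(2), of u] u z(2) by simp
  also have "... = (\<Sum>x\<in>?E. sc2 (u x) (f x))"
   using finC B0(1) by (intro sum.mono_neutral_right) auto
  also have "... : v2.span (f ` ?E)" by (intro v2.span_sum v2.span_scale v2.span_base) auto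
  finally show "y : v2.span (f ` ?E)" .
 qed
 have d1: "v1.dim Z = card C" using v1.basis_card_eq_dim[OF C(2,4,3)] by simp
 have d2: "v1.dim ?B = card B0" using v1.basis_card_eq_dim[OF B0(1,3,2)] by simp
 have d3: "v2.dim (f ` Z) = card (f ` ?E)"
  using v2.basis_card_eq_dim[OF _ span ind] EZ by (simp add: image_mono)
 have "card (f ` ?E) = card C - card B0"
  using finC C(1) by (simp add: card_image[OF inj] card_Diff_subset finite_subset)
 moreover have "card B0 \<le> card C" using card_mono[OF finC C(1)] .
 ultimately show ?thesis using d1 d2 d3 by simp
qed

text \<open>If \<open>n\<close> were 0 in \<open>k\<close>, the polynomial
  \<open>1 + x + ... + x^(n-1)\<close> would vanish not only at the powers of \<open>\<zeta>\<close>
  other than 1 but at 1 as well, giving \<open>n\<close> roots in degree at most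
  \<open>n - 1\<close>.\<close>

lemma of_nat_order_nonzero:
 fixes \<zeta> :: "'k::field"
 assumes "inj_on (%i. \<zeta> ^ i) {..<n}" "\<zeta> ^ n = 1" "n > 0" shows "(of_nat n :: 'k) ~= 0"
proof
 assume n0: "(of_nat n :: 'k) = 0"
 define p where "p = (\<Sum>r<n. monom (1::'k) r)"
 have "poly p (\<zeta> ^ i) = 0" if "i < n" for i
 proof (cases "i = 0")
  case True
  then show ?thesis using n0 by (simp add: p_def poly_sum poly_monom)
 next
  case False
  have "\<zeta> ^ i ~= 1" using assms(1) that False inj_onD[OF assms(1), of i 0] by auto
  moreover have "(\<zeta> ^ i - 1) * (\<Sum>r<n. (\<zeta> ^ i) ^ r) = (\<zeta> ^ i) ^ n - 1"
   by (rule power_diff_1_eq[symmetric])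
  moreover have "(\<zeta> ^ i) ^ n = 1" by (metis assms(2) mult.commute power_mult power_one)
  ultimately show ?thesis by (simp add: p_def poly_sum poly_monom)
 qed
 then have "(%i. \<zeta> ^ i) ` {..<n} \<subseteq> {x. poly p x = 0}" by auto
 moreover have coeff: "coeff p r = (if r < n then 1 else 0)" for r
  by (auto simp: p_def coeff_sum)
 then have "p ~= 0" using assms(3) by (metis coeff_0 zero_neq_one)
 ultimately have "card ((%i. \<zeta> ^ i) ` {..<n}) \<le> card {x. poly p x = 0}" using poly_roots_finite[of p] by (intro card_mono)
 then have "n \<le> card {x. poly p x = 0}" using assms(1) by (simp add: card_image)
 also have "... \<le> degree p" using card_poly_roots_bound[OF \<open>p ~= 0\<close>] by simp
 also have "degree p \<le> n - 1" using coeff by (intro degree_le) auto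
 finally show False using assms(3) by simp
qed

text \<open>Averaging over the cyclic group shows that taking eigenspaces is exact.\<close>

lemma eigenspace_additive:
 fixes sc :: "'k::field => 'm::ab_group_add => 'm" and sc2 :: "'k => 'n::ab_group_add => 'n"
 assumes v1: "vector_space sc" and v2: "vector_space sc2" and Z: "module.subspace sc Z" "fdim sc Z"
  and f: "!!x y. x : Z ==> y : Z ==> f (x + y) = f x + f y" "!!a x. x : Z ==> f (sc a x) = sc2 a (f x)"
  and \<gamma>: "!!x. x : Z ==> \<gamma> x : Z" "!!x y. x : Z ==> y : Z ==> \<gamma> (x + y) = \<gamma> x + \<gamma> y" "!!a x. x : Z ==> \<gamma> (sc a x) = sc a (\<gamma> x)"
   "!!x. x : Z ==> (\<gamma> ^^ n) x = x" "!!x. x : Z ==> f (\<gamma> x) = \<gamma>2 (f x)"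
  and z: "inj_on (%i. \<zeta> ^ i) {..<n}" "\<zeta> ^ n = 1" "n > 0" "\<theta> = \<zeta> ^ a"
 shows "vector_space.dim sc {x\<in>Z. \<gamma> x = sc \<theta> x} =
  vector_space.dim sc {x\<in>{z\<in>Z. f z = 0}. \<gamma> x = sc \<theta> x} + vector_space.dim sc2 {y\<in>f ` Z. \<gamma>2 y = sc2 \<theta> y}"
proof -
 interpret v1: vector_space sc by fact
 interpret v2: vector_space sc2 by fact
 let ?Za = "{x\<in>Z. \<gamma> x = sc \<theta> x}"
 note Zs = v1.subspace_0[OF Z(1)] v1.subspace_add[OF Z(1)] v1.subspace_scale[OF Z(1)]
 have \<gamma>0: "\<gamma> 0 = 0" using \<gamma>(3)[of 0 0] Zs(1) by simp
 have subZa: "v1.subspace ?Za"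
  using Zs by (auto simp: v1.subspace_def \<gamma> \<gamma>0 v1.scale_right_distrib mult.commute)
 have f0: "f 0 = 0" using f(2)[of 0 0] Zs(1) by simp
 have pZ: "(\<gamma> ^^ r) x : Z" if "x : Z" for r x using that by (induction r) (auto simp: \<gamma>)
 have fp: "f ((\<gamma> ^^ r) x) = (\<gamma>2 ^^ r) (f x)" if "x : Z" for r x
  using that by (induction r) (auto simp: \<gamma> pZ)
 have th: "\<theta> ^ n = 1" unfolding z(4) using z(2) by (metis power_mult mult.commute power_one)
 have th0: "\<theta> ~= 0" using th z(3) by (auto simp: power_0_left)
 have "f ` ?Za = {y\<in>f ` Z. \<gamma>2 y = sc2 \<theta> y}"
 proof (intro equalityI subsetI)
  fix y assume "y : f ` ?Za"
  then obtain x where "x : Z" "\<gamma> x = sc \<theta> x" "y = f x" by auto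
  then show "y : {y\<in>f ` Z. \<gamma>2 y = sc2 \<theta> y}" using \<gamma>(5)[of x] f(2)[of x \<theta>] by auto
 next
  fix y assume "y : {y\<in>f ` Z. \<gamma>2 y = sc2 \<theta> y}"
  then obtain x where x: "x : Z" "y = f x" "\<gamma>2 y = sc2 \<theta> y" by auto
  \<comment> \<open>For \<open>k = n\<close> this is \<open>n\<close> times the projection of
    \<open>x\<close> to the eigenspace of \<open>\<theta>\<close>. Partial sums are used so that
    both its eigenvector property and its image under \<open>f\<close> follow by induction.\<close>
  define S where "S k = (\<Sum>r<k. sc (inverse \<theta> ^ r) ((\<gamma> ^^ r) x))" for k
  have SZ: "S k : Z" for k unfolding S_def by (rule v1.subspace_sum[OF Z(1)]) (intro Zs pZ x)
  have "\<gamma> (S k) = sc \<theta> (S k + sc (inverse \<theta> ^ k) ((\<gamma> ^^ k) x) - x)" for k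
  proof (induction k)
   case 0
   then show ?case by (simp add: S_def \<gamma>0)
  next
   case (Suc k)
   have "\<gamma> (S (Suc k)) = \<gamma> (S k + sc (inverse \<theta> ^ k) ((\<gamma> ^^ k) x))" by (simp add: S_def)
   also have "... = \<gamma> (S k) + sc (inverse \<theta> ^ k) ((\<gamma> ^^ Suc k) x)"
   using SZ pZ[OF x(1)] Zs by (simp add: \<gamma>)
   also have "sc (inverse \<theta> ^ k) ((\<gamma> ^^ Suc k) x) = sc \<theta> (sc (inverse \<theta> ^ Suc k) ((\<gamma> ^^ Suc k) x))"
   using th0 by (simp add: field_simps)
   finally show ?case unfolding Suc
   by (simp add: S_def v1.scale_right_distrib v1.scale_right_diff_distrib algebra_simps)
  qed
  from this[of n] have e: "\<gamma> (S n) = sc \<theta> (S n)"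
   using th \<gamma>(4)[OF x(1)] by (simp add: power_inverse)
  have gy: "(\<gamma>2 ^^ r) y = sc2 (\<theta> ^ r) y" for r
  proof (induction r)
   case (Suc r)
   have "(\<gamma>2 ^^ Suc r) y = \<gamma>2 (f (sc (\<theta> ^ r) x))" using Suc x f(2) by simp
   also have "... = f (sc (\<theta> ^ r) (\<gamma> x))" using \<gamma>(5)[of "sc (\<theta> ^ r) x"] x(1) Zs(3) \<gamma>(3) by simp
   also have "... = sc2 (\<theta> ^ r) (\<gamma>2 y)" using f(2) \<gamma>(1,5) x by simp
   finally show ?case using x(3) by (simp add: mult.commute)
  qed simp
  have "f (S k) = sc2 (of_nat k) y" for k
  proof (induction k)
   case 0
   then show ?case by (simp add: S_def f0)
  next
   case (Suc k)
   have "f (S (Suc k)) = f (S k) + sc2 (inverse \<theta> ^ k) ((\<gamma>2 ^^ k) y)"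
   using SZ[of k] pZ[OF x(1), of k] Zs(3) f fp[OF x(1)] x(2) by (simp add: S_def)
   also have "sc2 (inverse \<theta> ^ k) ((\<gamma>2 ^^ k) y) = y" using th0 by (simp add: gy flip: power_mult_distrib)
   finally show ?case using Suc by (simp add: v2.scale_left_distrib add.commute)
  qed
  then have "f (sc (inverse (of_nat n)) (S n)) = y"
   using of_nat_order_nonzero[OF z(1-3)] SZ f(2) by simp
  moreover have "sc (inverse (of_nat n)) (S n) : ?Za" using SZ e v1.subspace_scale[OF subZa] by blast
  ultimately show "y : f ` ?Za" by (metis imageI)
 qed
 moreover have "v1.dim ?Za = v1.dim {x\<in>?Za. f x = 0} + v2.dim (f ` ?Za)"
  by (rule rank_nullity[OF v1 v2 subZa]) (use f fdim_subset[OF v1 Z(2) subZa] in auto)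
 moreover have "{x\<in>?Za. f x = 0} = {x\<in>{z\<in>Z. f z = 0}. \<gamma> x = sc \<theta> x}" by auto
 ultimately show ?thesis by simp
qed

section \<open>Monic products of linear factors\<close>

definition lfac :: "('g => 'a::comm_ring_1) => 'g set => 'a poly" where
 "lfac y S = (\<Prod>g\<in>S. [:- y g, 1:])"

lemma coeff_linear_mult: "coeff ([:- (a::'a::comm_ring_1), 1:] * p) l = - a * coeff p l + coeff (pCons 0 p) l"
 by (cases l) (simp_all add: mult_pCons_left)

lemma coeff_lfac_monic: "finite S ==> card S \<le> l ==> coeff (lfac y S) l = (if l = card S then 1 else 0)"
proof (induction S arbitrary: l rule: finite_induct)
 case empty
 then show ?case by (cases l) (simp_all add: lfac_def coeff_1)
next
 case (insert g S)
 have e: "lfac y (insert g S) = [:- y g, 1:] * lfac y S" using insert by (simp add: lfac_def)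
 obtain l' where l: "l = Suc l'" using insert by (cases l) auto
 show ?case unfolding e coeff_linear_mult l using insert.IH[of l'] insert.IH[of "Suc l'"] insert.hyps insert.prems by (simp add: l)
qed

lemma coeff_lfac_hom:
 assumes "rhom F" "finite S" shows "F (coeff (lfac y S) l) = coeff (lfac (%g. F (y g)) S) l"
 using assms(2)
proof (induction S arbitrary: l rule: finite_induct)
 case empty
 then show ?case by (simp add: lfac_def rhomD[OF assms(1)] coeff_1 split: nat.splits)
next
 case (insert g S)
 have e: "lfac z (insert g S) = [:- z g, 1:] * lfac z S" for z :: "_ => 'z::comm_ring_1" using insert by (simp add: lfac_def)
 show ?case unfolding e coeff_linear_mult
  using insert by (cases l) (simp_all add: rhomD[OF assms(1)])
qed

lemma coeff_lfac_closed:
 assumes "subring R" "finite S" "!!g. g : S ==> y g : R" shows "coeff (lfac y S) l : R"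
 using assms(2,3)
proof (induction S arbitrary: l rule: finite_induct)
 case empty
 interpret subring R by fact
 show ?case by (cases l) (auto simp: lfac_def one zero)
next
 case (insert g S)
 interpret subring R by fact
 have e: "lfac y (insert g S) = [:- y g, 1:] * lfac y S" using insert by (simp add: lfac_def)
 show ?case unfolding e coeff_linear_mult
  using insert by (cases l) (auto intro!: diff mult uminus zero)
qed

lemma lfac_zero: "finite S ==> (!!g. g : S ==> y g = 0) ==> coeff (lfac y S) l = (if l = card S then 1 else 0)"
proof (induction S arbitrary: l rule: finite_induct)
 case (insert g S)
 have e: "lfac y (insert g S) = [:- y g, 1:] * lfac y S" using insert by (simp add: lfac_def)
 show ?case unfolding e coeff_linear_mult using insert by (cases l) auto
qed (auto simp: lfac_def coeff_eq_0 split: if_splits)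

lemma lfac_root:
 assumes "finite S" "g : S"
 shows "y g ^ card S = (\<Sum>l<card S. - coeff (lfac y S) l * y g ^ l)"
proof -
 have "poly (lfac y S) (y g) = 0"
  unfolding lfac_def poly_prod using assms by (intro prod_zero) auto
 moreover have "poly (lfac y S) (y g) = (\<Sum>l\<le>card S. coeff (lfac y S) l * y g ^ l)"
 proof -
  have "degree (lfac y S) \<le> card S" using coeff_lfac_monic[OF assms(1), of _ y] by (intro degree_le) auto
  then have "(\<Sum>l\<le>card S. coeff (lfac y S) l * y g ^ l) = (\<Sum>l\<le>degree (lfac y S). coeff (lfac y S) l * y g ^ l)"
   by (intro sum.mono_neutral_right) (auto simp: coeff_eq_0)
  then show ?thesis by (simp add: poly_altdef)
 qed
 ultimately have "(\<Sum>l<card S. coeff (lfac y S) l * y g ^ l) + y g ^ card S = 0"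
  using coeff_lfac_monic[OF assms(1) order_refl, of y] by (simp add: lessThan_Suc_atMost[symmetric])
 then show ?thesis by (simp add: sum_negf eq_neg_iff_add_eq_0 add.commute)
qed

section \<open>Invariants of finite linear groups\<close>

abbreviation finv :: "('a => 'b) => 'b => 'a" where "finv \<equiv> inv_into UNIV"

locale linear_action =
 fixes scale :: "'k::field => 'v::ab_group_add => 'v" and basis :: "'v set"
 assumes fdvs: "finite_dimensional_vector_space scale basis"
begin

sublocale V: finite_dimensional_vector_space scale basis by (rule fdvs)

definition lin where "lin g \<longleftrightarrow> Vector_Spaces.linear scale scale g & bij g"

lemma GL_simps: "carrier (GL scale) = {g. lin g}" "x \<otimes>\<^bsub>GL scale\<^esub> y = x o y" "\<one>\<^bsub>GL scale\<^esub> = id"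
 by (simp_all add: GL_def lin_def)

lemma lin_id: "lin id"
 unfolding lin_def id_def using V.linear_id bij_id by (simp add: id_def)

lemma lin_comp: "lin g ==> lin h ==> lin (g o h)"
 unfolding lin_def using Vector_Spaces.linear_compose bij_comp by blast

lemma lin_inv: "lin g ==> lin (finv g)"
proof -
 assume g: "lin g"
 then interpret g: Vector_Spaces.linear scale scale g by (simp add: lin_def)
 have b: "bij g" using g by (simp add: lin_def)
 have s: "g (finv g x) = x" and i: "finv g (g x) = x" for x
  using b by (simp_all add: bij_def surj_f_inv_f)
 have "finv g (x + y) = finv g x + finv g y" for x y
  using i[of "finv g x + finv g y"] by (simp add: g.add s)
 moreover have "finv g (scale a x) = scale a (finv g x)" for a x
  using i[of "scale a (finv g x)"] by (simp add: g.scale s)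
 ultimately have "Vector_Spaces.linear scale scale (finv g)" by unfold_locales
 then show ?thesis using b by (simp add: lin_def bij_imp_bij_inv)
qed

lemma lin_inv_eq: "lin g ==> g (finv g x) = x" "lin g ==> finv g (g x) = x" "lin g ==> finv g o g = id" "lin g ==> g o finv g = id"
 by (auto simp: lin_def bij_def surj_f_inv_f fun_eq_iff)

lemma lin_add: "lin g ==> g (x + y) = g x + g y" and lin_scale: "lin g ==> g (scale a x) = scale a (g x)"
 by (simp_all add: lin_def linear_iff module_hom_iff Vector_Spaces.linear_iff_module_hom)

lemma group_GL: "group (GL scale)"
proof (rule groupI)
 fix g assume "g : carrier (GL scale)"
 then show "\<exists>h\<in>carrier (GL scale). h \<otimes>\<^bsub>GL scale\<^esub> g = \<one>\<^bsub>GL scale\<^esub>"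
  using lin_inv lin_inv_eq(3) by (auto simp: GL_simps intro!: exI[of _ "finv g"])
qed (auto simp: GL_simps lin_id lin_comp comp_assoc)

lemma inv_GL: "lin g ==> inv\<^bsub>GL scale\<^esub> g = finv g"
 by (rule group.inv_equality[OF group_GL]) (auto simp: GL_simps lin_inv lin_inv_eq)

abbreviation coord where "coord w b \<equiv> V.representation basis w b"

lemma coord_add: "coord (x + y) b = coord x b + coord y b"
 using V.representation_add[OF V.independent_Basis] V.span_Basis by simp

lemma coord_scale: "coord (scale a x) b = a * coord x b"
 using V.representation_scale[OF V.independent_Basis] V.span_Basis by simp

lemma coord_sum: "coord (sum f Y) b = (\<Sum>y\<in>Y. coord (f y) b)"
proof (induction Y rule: infinite_finite_induct)
 case empty
 show ?case using coord_scale[of 0 0 b] by simp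
qed (use coord_scale[of 0 0 b] coord_add in simp_all)

lemma coord_basis: "b' : basis ==> coord b' b = (if b = b' then 1 else 0)"
 using V.representation_basis[OF V.independent_Basis] by simp

lemma coord_expand: "w = (\<Sum>b\<in>basis. scale (coord w b) b)"
 using V.sum_representation_eq[OF V.independent_Basis _ V.finite_Basis order_refl, of w] V.span_Basis by simp

lemma coord_lin: "lin g ==> coord (g w) b = (\<Sum>b'\<in>basis. coord w b' * coord (g b') b)"
proof -
 assume g: "lin g"
 have "g (sum f Y) = (\<Sum>y\<in>Y. g (f y))" for f :: "'v => 'v" and Y
 proof (induction Y rule: infinite_finite_induct)
  case empty
  show ?case using lin_scale[OF g, of 0 0] by simp
 qed (use lin_scale[OF g, of 0 0] lin_add[OF g] in simp_all)
 then have "g w = (\<Sum>b'\<in>basis. scale (coord w b') (g b'))"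
  by (subst coord_expand) (simp add: lin_scale[OF g])
 then show ?thesis by (simp add: coord_sum coord_scale)
qed

lemma coord_eqI: "(!!b. b : basis ==> coord x b = coord y b) ==> x = y"
 by (subst coord_expand[of x], subst coord_expand[of y]) simp

abbreviation kV :: "('v,'k) mpol set" where "kV \<equiv> mpol_ring basis"

definition pact :: "('v => 'v) => ('v,'k) mpol => ('v,'k) mpol" where "pact g = pol_act scale basis g"

text \<open>The image under \<open>g\<close> of the coordinate function \<open>b\<close>, with the
  plain inverse function in place of the inverse in \<open>GL\<close>.\<close>

definition lform :: "('v => 'v) => 'v => ('v,'k) mpol" where
 "lform g b = (\<Sum>b'\<in>basis. mconst (coord (finv g b') b) * mvar b')"

lemma pact_msubst: "lin g ==> pact g = msubst (lform g)"
 by (rule ext) (simp add: pact_def pol_act_def lform_def[abs_def] inv_GL)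

lemma rhom_pact: "rhom (pact g)"
 unfolding pact_def pol_act_def by (rule rhom_msubst)

lemmas pact_simps = rhomD[OF rhom_pact]

lemma pact_mconst [simp]: "pact g (mconst a) = mconst a"
 by (simp add: pact_def pol_act_def)

lemma pact_homogeneous: "hmg d p ==> hmg d (pact g p)"
 unfolding pact_def pol_act_def
 by (rule homogeneous_msubst) (auto intro!: homogeneous_sum homogeneous_mconst_mult homogeneous_mvar[simplified])

lemma pact_hcomp: "hcomp d (pact g p) = pact g (hcomp d p)"
 by (rule hcomp_linear) (auto simp: pact_simps pact_homogeneous)

lemma pact_kV: "p : kV ==> pact g p : kV"
 unfolding pact_def pol_act_def
 by (erule msubst_closed) (auto intro!: mpol_ring_sum mpol_ring_mult mpol_ring_add mpol_ring_mvar)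

lemma lform_comp: "lin g ==> lin h ==> msubst (lform g) (lform h b) = lform (g o h) b"
proof -
 assume g: "lin g" and h: "lin h"
 have e: "finv (g o h) x = finv h (finv g x)" for x
  using g h by (simp add: lin_def o_inv_distrib)
 have "msubst (lform g) (lform h b) = (\<Sum>t\<in>basis. mconst (\<Sum>i\<in>basis. coord (finv h i) b * coord (finv g t) i) * mvar t)"
  unfolding lform_def[of h] lform_def[of g, abs_def] by (rule msubst_linear)
 also have "... = lform (g o h) b"
  unfolding lform_def e by (intro sum.cong refl) (simp add: coord_lin[OF lin_inv[OF h], of "finv g _"] mult.commute)
 finally show ?thesis .
qed

lemma pact_comp: "lin g ==> lin h ==> pact (g o h) p = pact g (pact h p)"
 by (simp add: pact_msubst lin_comp msubst_msubst lform_comp)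

lemma pact_id: "p : kV ==> pact id p = p"
proof -
 assume p: "p : kV"
 have "lform id b = mvar b" if "b : basis" for b
  using that V.finite_Basis by (simp add: lform_def coord_basis mconst_simps if_distrib[of mconst] if_distrib[of "%x. x * _"] cong: if_cong)
 then have "ins mconst (lform id) p = ins mconst mvar p" by (intro ins_cong[OF p])
 then show ?thesis using pact_msubst[OF lin_id] msubst_mvar_id[of p] by (simp add: msubst_ins)
qed

definition eva :: "'v => ('v,'k) mpol => 'k" where "eva w = ins (%x. x) (%b. coord w b)"

lemma rhom_eva: "rhom (eva w)"
 unfolding eva_def by (rule rhom_ins) simp

lemmas eva_simps = rhomD[OF rhom_eva]

lemma eva_mconst [simp]: "eva w (mconst a) = a" and eva_mvar [simp]: "eva w (mvar b) = coord w b"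
 by (simp_all add: eva_def)

lemma eva_pact: "lin g ==> eva w (pact g p) = eva (finv g w) p"
proof -
 assume g: "lin g"
 have "eva w (pact g p) = ins (%x. x) (%b. eva w (lform g b)) p"
  unfolding pact_msubst[OF g] eva_def by (rule ins_msubst) simp
 also have "(%b. eva w (lform g b)) = (%b. coord (finv g w) b)"
  by (rule ext) (simp add: lform_def eva_simps coord_lin[OF lin_inv[OF g], of w] mult.commute)
 finally show ?thesis by (simp add: eva_def)
qed

definition subgrp :: "('v => 'v) set => bool" where
 "subgrp G \<longleftrightarrow> (\<forall>g\<in>G. lin g & finv g : G) & id : G & (\<forall>g\<in>G. \<forall>h\<in>G. g o h : G)"

lemma subgrp_subgroup: "subgroup G (GL scale) ==> subgrp G"
proof -
 assume "subgroup G (GL scale)"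
 then interpret subgroup G "GL scale" .
 have l: "lin g" if "g : G" for g using subset that by (auto simp: GL_simps)
 then show ?thesis unfolding subgrp_def
  using m_inv_closed one_closed m_closed inv_GL by (auto simp: GL_simps)
qed

lemma subgrpD: "subgrp G ==> g : G ==> lin g" "subgrp G ==> g : G ==> finv g : G" "subgrp G ==> id : G"
 "subgrp G ==> g : G ==> h : G ==> g o h : G"
 by (auto simp: subgrp_def)

lemma subgrp_translate: "subgrp G ==> u : G ==> bij_betw (%g. u o g) G G"
proof (rule bij_betwI[where g = "%g. finv u o g"])
 assume G: "subgrp G" "u : G"
 note l = subgrpD[OF G(1)]
 show "(%g. u o g) : G \<rightarrow> G" "(%g. finv u o g) : G \<rightarrow> G" using l G(2) by auto
 show "finv u o (u o g) = g" "u o (finv u o g) = g" for g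
  using lin_inv_eq(3,4)[OF l(1)[OF G(2)]] by (simp_all add: comp_assoc[symmetric])
qed

section \<open>Invariant rings, transfer and orbit polynomials\<close>

definition invs :: "('v => 'v) set => ('v,'k) mpol set" where
 "invs G = pol_invariants scale basis G"

lemma invs_iff: "p : invs G \<longleftrightarrow> p : kV & (\<forall>g\<in>G. pact g p = p)"
 by (simp add: invs_def pol_invariants_def pact_def)

lemma invs_graded_ring: "graded_ring (invs G)"
proof (rule graded_ring.intro)
 show "subring (invs G)"
  by unfold_locales (auto simp: invs_iff pact_simps intro: mpol_ring_add mpol_ring_mult mpol_ring_uminus)
 show "mconst a : invs G" for a by (simp add: invs_iff)
 show "hcomp d p : invs G" if "p : invs G" for d p
  using that by (auto simp: invs_iff mpol_ring_hcomp simp flip: pact_hcomp)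
qed

definition transfer :: "('v => 'v) set => ('v,'k) mpol => ('v,'k) mpol" where
 "transfer G p = (\<Sum>g\<in>G. pact g p)"

lemma transfer_add: "transfer G (p + q) = transfer G p + transfer G q"
 by (simp add: transfer_def pact_simps sum.distrib)

lemma transfer_mult: "a : invs G ==> transfer G (p * a) = transfer G p * a"
 by (simp add: transfer_def pact_simps sum_distrib_right invs_iff)

lemma transfer_invs: "subgrp G ==> p : kV ==> transfer G p : invs G"
proof -
 assume G: "subgrp G" and p: "p : kV"
 have "pact u (transfer G p) = transfer G p" if u: "u : G" for u
 proof -
  have "pact u (transfer G p) = (\<Sum>g\<in>G. pact (u o g) p)"
   unfolding transfer_def pact_simps by (intro sum.cong refl) (simp add: pact_comp subgrpD[OF G] u)
  also have "... = transfer G p"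
   unfolding transfer_def by (rule sum.reindex_bij_betw[OF subgrp_translate[OF G u]])
  finally show ?thesis .
 qed
 then show ?thesis unfolding invs_iff transfer_def using p by (auto intro: mpol_ring_sum pact_kV)
qed

text \<open>The coefficients are those of the orbit polynomial, the product of the factors
  \<open>X - g f\<close>, which has \<open>f\<close> itself as a root. If all translates of
  \<open>f\<close> vanish at \<open>w\<close>, the orbit polynomial specializes at \<open>w\<close>
  to a pure power of \<open>X\<close>; this second part drives the Nullstellensatz for the
  orbit.\<close>

lemma integral_equation:
 assumes G: "subgrp G" "finite G" and f: "f : kV"
 shows "EX a. (ALL l. a l : invs G) & f ^ card G = (\<Sum>l<card G. a l * f ^ l) \<and>
  ((\<forall>g\<in>G. eva w (pact g f) = 0) --> (\<forall>l<card G. eva w (a l) = 0))"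
proof -
 let ?y = "%g. pact g f"
 have inv: "coeff (lfac ?y G) l : invs G" for l
 proof -
  have "pact u (coeff (lfac ?y G) l) = coeff (lfac ?y G) l" if u: "u : G" for u
  proof -
   have "pact u (coeff (lfac ?y G) l) = coeff (lfac (%g. pact u (pact g f)) G) l"
   by (rule coeff_lfac_hom[OF rhom_pact G(2)])
   also have "lfac (%g. pact u (pact g f)) G = (\<Prod>g\<in>G. [:- pact (u o g) f, 1:])"
   unfolding lfac_def by (intro prod.cong refl) (simp add: pact_comp subgrpD[OF G(1)] u)
   also have "... = lfac ?y G"
   unfolding lfac_def by (rule prod.reindex_bij_betw[OF subgrp_translate[OF G(1) u]])
   finally show ?thesis .
  qed
  moreover have "coeff (lfac ?y G) l : kV"
   by (rule coeff_lfac_closed[OF subring_mpol_ring G(2)]) (simp add: pact_kV f)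
  ultimately show ?thesis by (simp add: invs_iff)
 qed
 interpret A: graded_ring "invs G" by (rule invs_graded_ring)
 show ?thesis
 proof (intro exI[of _ "%l. - coeff (lfac ?y G) l"] conjI allI impI)
  show "- coeff (lfac ?y G) l : invs G" for l by (rule A.N.uminus[OF inv])
  show "f ^ card G = (\<Sum>l<card G. - coeff (lfac ?y G) l * f ^ l)"
   using lfac_root[OF G(2) subgrpD(3)[OF G(1)], of ?y] by (simp only: pact_id[OF f])
  fix l assume "\<forall>g\<in>G. eva w (pact g f) = 0" "l < card G"
  then show "eva w (- coeff (lfac ?y G) l) = 0"
   using coeff_lfac_hom[OF rhom_eva G(2), of w ?y l] lfac_zero[OF G(2), of "%g. eva w (pact g f)" l]
   by (simp add: eva_simps)
 qed
qed

text \<open>Interpolation on a free orbit: for each \<open>g\<close> other than the identity some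
  coordinate distinguishes \<open>v\<close> from its image under the inverse of \<open>g\<close>,
  and the normalized linear factors are multiplied.\<close>

lemma separating_polynomial:
 assumes G: "subgrp G" "finite G" and reg: "!!g. g : G ==> g v = v ==> g = id"
 shows "\<exists>p\<in>kV. \<forall>g\<in>G. eva v (pact g p) = (if g = id then 1 else 0)"
proof -
 have "EX b. g : G & g ~= id --> b : basis & coord v b ~= coord (finv g v) b" for g
 proof (cases "g : G & g ~= id")
  case True
  have "finv g v ~= v"
  proof
   assume "finv g v = v"
   then have "g v = v" using lin_inv_eq(1)[OF subgrpD(1)[OF G(1)], of g v] True by simp
   then show False using reg True by blast
  qed
  then show ?thesis using coord_eqI by metis
 qed blast
 then obtain b where b: "!!g. g : G ==> g ~= id ==> b g : basis & coord v (b g) ~= coord (finv g v) (b g)" by metis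
 define q where "q g = mconst (inverse (coord v (b g) - coord (finv g v) (b g))) * (mvar (b g) - mconst (coord (finv g v) (b g)))" for g
 define p where "p = (\<Prod>g\<in>G - {id}. q g)"
 interpret S: subring kV by (rule subring_mpol_ring)
 have "p : kV" unfolding p_def q_def using b by (intro S.prod S.mult S.diff mpol_ring_mvar) auto
 moreover have "eva v (pact g p) = (if g = id then 1 else 0)" if g: "g : G" for g
 proof (cases "g = id")
  case True
  have "eva v (q g) = 1" if "g : G - {id}" for g using b[of g] that by (simp add: q_def eva_simps)
  then show ?thesis using True \<open>p : kV\<close> by (simp add: pact_id p_def eva_simps)
 next
  case False
  have "eva (finv g v) (q g) = 0" by (simp add: q_def eva_simps)
  then have "eva (finv g v) p = 0" unfolding p_def eva_simps using G(2) g False by (intro prod_zero) auto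
  then show ?thesis using False by (simp add: eva_pact subgrpD(1)[OF G(1) g])
 qed
 ultimately show ?thesis by blast
qed

end

section \<open>The fibre through a regular vector\<close>

locale regular_setting = linear_action scale basis +
 graded_subalgebra basis "linear_action.invs scale basis G" m h dg "card G"
 for scale :: "'k::field => 'v::ab_group_add => 'v" and basis and G :: "('v => 'v) set" and m h dg +
 fixes H :: "('v => 'v) set" and v :: 'v
 assumes G: "subgrp G" "finite G" and H: "subgrp H" "H \<subseteq> G"
  and reg: "g : G ==> g v = v ==> g = id"
begin

abbreviation "invs_G \<equiv> invs G"
abbreviation "invs_H \<equiv> invs H"

lemma finH: "finite H" using G(2) H(2) finite_subset by blast

lemma card_G_pos: "card G > 0" using G(2) subgrpD(3)[OF G(1)] card_gt_0_iff by blast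

definition pp :: "('v,'k) mpol" where
 "pp = (SOME p. p : kV & (\<forall>g\<in>G. eva v (pact g p) = (if g = id then 1 else 0)))"

lemma pp: "pp : kV" "g : G ==> eva v (pact g pp) = (if g = id then 1 else 0)"
proof -
 have "EX p. p : kV & (\<forall>g\<in>G. eva v (pact g p) = (if g = id then 1 else 0))"
  using separating_polynomial[OF G reg] by blast
 from someI_ex[OF this] show "pp : kV" "g : G ==> eva v (pact g pp) = (if g = id then 1 else 0)"
  unfolding pp_def[symmetric] by blast+
qed

section \<open>Cosets of \<open>H\<close> and functions on the orbit of \<open>v\<close>\<close>

definition hcos :: "('v => 'v) => ('v => 'v) set" where "hcos g = (%h. h o g) ` H"

definition RC :: "('v => 'v) set set" where "RC = hcos ` G"

lemma RC_eq: "right_cosets scale G H = RC"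
 unfolding right_cosets_def RCOSETS_def r_coset_def RC_def hcos_def by (auto simp: GL_def)

lemma finite_RC: "finite RC" using G(2) by (simp add: RC_def)

lemma cos_eqI: "g : G ==> u : H ==> hcos (u o g) = hcos g"
proof -
 assume g: "g : G" and u: "u : H"
 have "(%h. h o (u o g)) ` H = (%h. h o g) ` ((%h. h o u) ` H)" by (simp only: image_image comp_assoc)
 also have "(%h. h o u) ` H = H"
 proof
  show "(%h. h o u) ` H \<subseteq> H" using u subgrpD(4)[OF H(1)] by auto
  show "H \<subseteq> (%h. h o u) ` H"
  proof
   fix h assume h: "h : H"
   have "h = (h o finv u) o u" using lin_inv_eq(3)[OF subgrpD(1)[OF H(1) u]] by (simp add: comp_assoc)
   moreover have "h o finv u : H" using h u subgrpD(2,4)[OF H(1)] by blast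
   ultimately show "h : (%h. h o u) ` H" by blast
  qed
 qed
 finally show ?thesis by (simp only: hcos_def)
qed

lemma cos_self: "g : hcos g"
 unfolding hcos_def by (rule image_eqI[of _ _ id]) (simp_all add: subgrpD(3)[OF H(1)])

lemma cosE:
 assumes "g' : hcos g" obtains u where "u : H" "g' = u o g"
 using assms by (auto simp: hcos_def)

lemma cos_eq_iff: "g : G ==> hcos g' = hcos g \<longleftrightarrow> (\<exists>u\<in>H. g' = u o g)"
proof
 assume "hcos g' = hcos g"
 then have "g' : hcos g" using cos_self[of g'] by simp
 then show "\<exists>u\<in>H. g' = u o g" by (rule cosE) blast
qed (use cos_eqI[of g] in blast)

definition rp :: "('v => 'v) set => ('v => 'v)" where "rp Y = (SOME g. g : G & Y = hcos g)"

lemma rp: "Y : RC ==> rp Y : G & Y = hcos (rp Y)"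
proof -
 assume "Y : RC"
 then have "EX g. g : G & Y = hcos g" unfolding RC_def by blast
 from someI_ex[OF this] show ?thesis unfolding rp_def .
qed

lemma right_cancel: "lin g ==> a o g = b o g ==> a = b"
proof -
 assume g: "lin g" and e: "a o g = b o g"
 have "(a o g) o finv g = (b o g) o finv g" using e by simp
 then show "a = b" using lin_inv_eq(4)[OF g] by (simp add: comp_assoc)
qed

lemma coset_bij: "bij_betw (%(Y, u). u o rp Y) (RC \<times> H) G"
proof (rule bij_betw_imageI)
 show "inj_on (%(Y, u). u o rp Y) (RC \<times> H)"
 proof (rule inj_onI, clarsimp)
  fix Y u Y' u' assume *: "Y : RC" "u : H" "Y' : RC" "u' : H" and e: "u o rp Y = u' o rp Y'"
  have "hcos (rp Y) = hcos (rp Y')" using cos_eqI[of "rp Y" u] cos_eqI[of "rp Y'" u'] e rp * by metis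
  then have "Y = Y'" using rp * by metis
  then show "Y = Y' & u = u'" using e right_cancel[OF subgrpD(1)[OF G(1)], of "rp Y" u u'] rp[of Y] * by auto
 qed
 show "(%(Y, u). u o rp Y) ` (RC \<times> H) = G"
 proof
  show "(%(Y, u). u o rp Y) ` (RC \<times> H) \<subseteq> G" using rp H(2) subgrpD(4)[OF G(1)] by auto
  show "G \<subseteq> (%(Y, u). u o rp Y) ` (RC \<times> H)"
  proof
   fix g assume g: "g : G"
   then have Y: "hcos g : RC" by (simp add: RC_def)
   from rp[OF Y] obtain u where "u : H" "g = u o rp (hcos g)" using cos_self[of g] by (metis cosE)
   then show "g : (%(Y, u). u o rp Y) ` (RC \<times> H)" using Y by (intro image_eqI[of _ _ "(hcos g, u)"]) auto
  qed
 qed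
qed

text \<open>Built from one translate of \<open>pp\<close> for each coset, so that its transfer over
  \<open>H\<close> is the transfer of \<open>pp\<close> over \<open>G\<close>, an element of
  \<open>k[V]^G\<close> with value 1 at \<open>v\<close>.\<close>

definition ff :: "('v,'k) mpol" where "ff = (\<Sum>Y\<in>RC. pact (rp Y) pp)"

lemma ff_kV: "ff : kV" unfolding ff_def by (intro mpol_ring_sum pact_kV pp)

lemma transfer_ff: "transfer H ff = transfer G pp"
proof -
 have "transfer H ff = (\<Sum>u\<in>H. \<Sum>Y\<in>RC. pact (u o rp Y) pp)"
  unfolding transfer_def ff_def pact_simps
  by (intro sum.cong refl) (simp add: pact_comp subgrpD(1)[OF H(1)] subgrpD(1)[OF G(1)] rp)
 also have "... = (\<Sum>z\<in>RC \<times> H. pact (case z of (Y, u) => u o rp Y) pp)"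
  by (subst sum.swap) (simp add: sum.cartesian_product case_prod_unfold)
 also have "... = transfer G pp"
  unfolding transfer_def by (rule sum.reindex_bij_betw[OF coset_bij])
 finally show ?thesis .
qed

lemma eva_transfer: "eva w (transfer G p) = (\<Sum>g\<in>G. eva w (pact g p))"
 by (simp add: transfer_def eva_simps)

text \<open>Restriction of a polynomial to the points \<open>rp Y v\<close> of the orbit. For an
  \<open>H\<close>-invariant the values do not depend on the representatives, so these are functions
  on the \<open>H\<close>-orbits in the orbit of \<open>v\<close>, which correspond to cosets
  because \<open>v\<close> is regular.\<close>

definition Th :: "('v,'k) mpol => ('v => 'v) set \<Rightarrow>\<^sub>0 'k" where
 "Th n = (\<Sum>Y\<in>RC. sg Y (eva (rp Y v) n))"

lemma lookup_Th: "lk (Th n) Y = (if Y : RC then eva (rp Y v) n else 0)"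
 using finite_RC by (simp add: Th_def lookup_sum lookup_single when_def)

lemma keys_Th: "ky (Th n) \<subseteq> RC"
 using lookup_Th[of n] by (meson in_keys_iff subsetI)

lemma eva_invs: "n : invs U ==> subgrp U ==> u : U ==> eva (u w) n = eva w n"
proof -
 assume n: "n : invs U" and U: "subgrp U" and u: "u : U"
 have l: "lin u" using subgrpD(1)[OF U u] .
 have "eva (u w) n = eva (u w) (pact u n)" using n u by (simp add: invs_iff)
 also have "... = eva w n" unfolding eva_pact[OF l] by (simp add: lin_inv_eq[OF l])
 finally show ?thesis .
qed

lemma Th_cos: "n : invs_H ==> g : G ==> lk (Th n) (hcos g) = eva (g v) n"
proof -
 assume n: "n : invs_H" and g: "g : G"
 have Y: "hcos g : RC" using g by (simp add: RC_def)
 obtain u where u: "u : H" "g = u o rp (hcos g)" using cos_self[of g] rp[OF Y] by (metis cosE)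
 have "eva (g v) n = eva (u (rp (hcos g) v)) n" using u(2) by (metis comp_apply)
 also have "... = eva (rp (hcos g) v) n" by (rule eva_invs[OF n H(1) u(1)])
 finally show ?thesis using Y by (simp add: lookup_Th)
qed

lemma Th_eqI: "ky f \<subseteq> RC ==> (!!g. g : G ==> lk (Th n) (hcos g) = lk f (hcos g)) ==> Th n = f"
proof (rule poly_mapping_eqI)
 fix Y assume f: "ky f \<subseteq> RC" and e: "!!g. g : G ==> lk (Th n) (hcos g) = lk f (hcos g)"
 show "lk (Th n) Y = lk f Y"
 proof (cases "Y : RC")
  case True
  then show ?thesis using e by (auto simp: RC_def)
 next
  case False
  then have "Y \<notin> ky f" using f by blast
  then show ?thesis using False by (simp add: lookup_Th not_in_keys_iff_lookup_eq_zero)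
 qed
qed

abbreviation hs where "hs s \<equiv> h s - mconst (eva v (h s))"

lemma Th_ideal: "n : invs_H ==> s < m ==> Th (hs s * n) = 0"
proof (rule poly_mapping_eqI)
 fix Y assume n: "n : invs_H" and s: "s < m"
 have "eva (rp Y v) (h s) = eva v (h s)" if "Y : RC" using eva_invs[OF h_A[OF s] G(1)] rp that by blast
 then show "lk (Th (hs s * n)) Y = lk 0 Y" by (simp add: lookup_Th eva_simps)
qed

section \<open>The ideal of the fibre through \<open>v\<close>\<close>

definition J :: "('v,'k) mpol set" where
 "J = {x. EX c. (ALL s. c s : kV) & x = (\<Sum>s<m. c s * hs s)}"

lemma J_add: "x : J ==> y : J ==> x + y : J"
proof -
 assume "x : J" "y : J"
 then obtain a b where "ALL s. a s : kV" "x = (\<Sum>s<m. a s * hs s)" "ALL s. b s : kV" "y = (\<Sum>s<m. b s * hs s)"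
  unfolding J_def by blast
 then have "(ALL s. a s + b s : kV) & x + y = (\<Sum>s<m. (a s + b s) * hs s)"
  by (simp add: mpol_ring_add sum.distrib distrib_right)
 then show ?thesis unfolding J_def by (intro CollectI exI[of _ "%s. a s + b s"])
qed

lemma J_mult: "x : J ==> y : kV ==> y * x : J"
proof -
 assume "x : J" and y: "y : kV"
 then obtain a where "ALL s. a s : kV" "x = (\<Sum>s<m. a s * hs s)" unfolding J_def by blast
 then have "(ALL s. y * a s : kV) & y * x = (\<Sum>s<m. (y * a s) * hs s)"
  using y by (simp add: mpol_ring_mult sum_distrib_left mult.assoc)
 then show ?thesis unfolding J_def by (intro CollectI exI[of _ "%s. y * a s"])
qed

lemma J_0: "0 : J" unfolding J_def by (intro CollectI exI[of _ "%s. 0"]) simp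

lemma J_uminus: "x : J ==> - x : J"
 using J_mult[of x "- 1"] by (simp add: mpol_ring_uminus)

lemma J_diff: "x : J ==> y : J ==> x - y : J"
 using J_add[of x "- y"] J_uminus by simp

lemma J_sum: "(!!y. y : Y ==> f y : J) ==> sum f Y : J"
 by (induction Y rule: infinite_finite_induct) (auto intro: J_0 J_add)

lemma invs_kV: "a : invs U ==> a : kV" by (simp add: invs_iff)

lemma J_invs: "a : invs_G ==> eva v a = 0 ==> a : J"
proof -
 assume a: "a : invs_G" "eva v a = 0"
 have mc: "mconst (eva v a) = (0 :: ('v,'k) mpol)" by (simp add: a(2) mconst_simps)
 obtain c where c: "ALL s. c s : invs_G" "a - mconst (eva v a) = (\<Sum>s<m. c s * hs s)"
  using A_ideal[of "eva v", OF rhom_eva eva_mconst a(1)] by blast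
 then show ?thesis unfolding J_def using invs_kV mc by (intro CollectI exI[of _ c]) auto
qed

lemma pact_hs: "s < m ==> g : G ==> pact g (hs s) = hs s"
 using h_A by (simp add: pact_simps invs_iff)

lemma J_pact: "x : J ==> g : G ==> pact g x : J"
proof -
 assume "x : J" and g: "g : G"
 then obtain a where a: "ALL s. a s : kV" "x = (\<Sum>s<m. a s * hs s)" unfolding J_def by blast
 have "pact g x = (\<Sum>s<m. pact g (a s) * hs s)"
  unfolding a(2) pact_simps(8) pact_simps(3) using g by (intro sum.cong refl) (simp add: pact_hs del: pact_mconst)
 then show ?thesis unfolding J_def using a(1) by (intro CollectI exI[of _ "%s. pact g (a s)"]) (simp add: pact_kV)
qed

text \<open>In the integral equation of \<open>y\<close> all lower coefficients vanish at
  \<open>v\<close>, and invariants vanishing at \<open>v\<close> lie in \<open>J\<close>.\<close>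

lemma J_power: "y : kV ==> (!!g. g : G ==> eva v (pact g y) = 0) ==> y ^ card G : J"
proof -
 assume y: "y : kV" and 0: "!!g. g : G ==> eva v (pact g y) = 0"
 obtain a where a: "ALL l. a l : invs_G" "y ^ card G = (\<Sum>l<card G. a l * y ^ l)" "\<forall>l<card G. eva v (a l) = 0"
  using integral_equation[OF G y, of v] 0 by blast
 have "a l * y ^ l : J" if "l < card G" for l
  using J_mult[OF J_invs[of "a l"] mpol_ring_power[OF y, of l]] a that by (simp add: mult.commute)
 then show ?thesis unfolding a(2) by (intro J_sum) simp
qed

text \<open>The power \<open>e\<close> of the separating polynomial and its translates are orthogonal idempotents up to
 units modulo \<open>J\<close>, which reduces the Nullstellensatz for the orbit of \<open>v\<close> to invariants.\<close>

lemma orbit_ideal: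
 assumes f: "f : kV" and 0: "!!g. g : G ==> eva v (pact g f) = 0" shows "f : J"
proof -
 let ?r = "card G"
 \<comment> \<open>The exponent \<open>card G\<close> is the one with which \<open>J_power\<close>
   puts products of distinct translates into \<open>J\<close>; the values at \<open>v\<close> are
   still 0 and 1.\<close>
 define e where "e w = pact w (pp ^ ?r)" for w
 have ekV: "e w : kV" for w unfolding e_def by (intro pact_kV mpol_ring_power pp)
 have eu: "pact u (e w) = e (u o w)" if "u : G" "w : G" for u w
  using that by (simp add: e_def pact_comp subgrpD(1)[OF G(1)])
 have orth1: "e id * e g : J" if g: "g : G" "g ~= id" for g
 proof -
  have "eva v (pact u (pp * pact g pp)) = 0" if u: "u : G" for u
  proof (cases "u = id")
   case True
   then show ?thesis using pp(2)[of g] g by (simp add: pact_simps pact_id pact_kV pp eva_simps)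
  next
   case False
   then show ?thesis using pp(2)[OF u] by (simp add: pact_simps eva_simps)
  qed
  from J_power[OF mpol_ring_mult[OF pp(1) pact_kV[OF pp(1)]] this]
  show ?thesis by (simp add: e_def pact_simps power_mult_distrib pact_id pp(1))
 qed
 have orth: "e w * e (u o w) : J" if u: "u : G" "u ~= id" and w: "w : G" for u w
 proof -
  let ?g = "finv w o (u o w)"
  have l: "lin w" using subgrpD(1)[OF G(1) w] .
  have g: "?g : G" using u w by (intro subgrpD(2,4)[OF G(1)])
  have wg: "w o ?g = u o w" using lin_inv_eq(4)[OF l] by (metis comp_assoc id_comp)
  have "?g ~= id"
  proof
   assume "?g = id"
   then have "u o w = id o w" using wg by simp
   then show False using right_cancel[OF l] u by blast
  qed
  from J_pact[OF orth1[OF g this] w] show ?thesis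
   using eu[OF w subgrpD(3)[OF G(1)]] eu[OF w g] wg by (simp add: pact_simps)
 qed
 \<comment> \<open>The sum of the squares of all \<open>e w\<close>. It is an invariant of value 1
   at \<open>v\<close>, hence congruent to 1 modulo \<open>J\<close>.\<close>
 define t where "t = transfer G (e id ^ 2)"
 have t_inv: "t : invs_G" unfolding t_def by (intro transfer_invs[OF G(1)] mpol_ring_power ekV)
 have ev_e: "eva v (e w) = (if w = id then 1 else 0)" if "w : G" for w
  using pp(2)[OF that] card_G_pos by (simp add: e_def pact_simps eva_simps)
 have "eva v t = (\<Sum>g\<in>G. if g = id then 1 else 0)"
  unfolding t_def eva_transfer
  by (intro sum.cong refl) (simp add: pact_simps eva_simps eu[OF _ subgrpD(3)[OF G(1)]] ev_e)
 then have ev_t: "eva v t = 1" using G(2) subgrpD(3)[OF G(1)] by simp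
 have t1: "t - 1 : J"
  using J_invs[of "t - 1"] t_inv ev_t A.diff[OF t_inv A.one] by (simp add: eva_simps)
 have Tw: "transfer G (e w * f) : J" if w: "w : G" for w
 proof (rule J_invs)
  show "transfer G (e w * f) : invs_G" by (intro transfer_invs[OF G(1)] mpol_ring_mult ekV f)
  show "eva v (transfer G (e w * f)) = 0" unfolding eva_transfer using 0 by (simp add: pact_simps eva_simps)
 qed
 have "(\<Sum>w\<in>G. e w * transfer G (e w * f)) : J" by (intro J_sum J_mult Tw ekV)
 \<comment> \<open>Orthogonality leaves only the term of the identity in the transfer. Summed over
   \<open>w\<close> this puts \<open>t * f\<close> into \<open>J\<close>, because each
   \<open>transfer G (e w * f)\<close> is an invariant that vanishes at \<open>v\<close>.\<close>
 moreover have "e w * transfer G (e w * f) - e w ^ 2 * f : J" if w: "w : G" for w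
 proof -
  have "e w * transfer G (e w * f) = (\<Sum>u\<in>G. e w * e (u o w) * pact u f)"
   unfolding transfer_def sum_distrib_left
   by (intro sum.cong refl) (simp add: pact_simps eu w mult.assoc)
  also have "... = e w ^ 2 * f + (\<Sum>u\<in>G - {id}. e w * e (u o w) * pact u f)"
   using sum.remove[OF G(2) subgrpD(3)[OF G(1)], of "%u. e w * e (u o w) * pact u f"]
   by (simp add: pact_id f power2_eq_square)
  finally have "e w * transfer G (e w * f) - e w ^ 2 * f = (\<Sum>u\<in>G - {id}. pact u f * (e w * e (u o w)))"
   by (simp add: mult.commute)
  also have "... : J" by (intro J_sum J_mult orth pact_kV f) (use w in auto)
  finally show ?thesis .
 qed
 then have "(\<Sum>w\<in>G. e w * transfer G (e w * f) - e w ^ 2 * f) : J" by (intro J_sum)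
 ultimately have "(\<Sum>w\<in>G. e w ^ 2 * f) : J"
  using J_diff[of "\<Sum>w\<in>G. e w * transfer G (e w * f)" "\<Sum>w\<in>G. e w * transfer G (e w * f) - e w ^ 2 * f"]
  by (simp add: sum_subtractf)
 moreover have "(\<Sum>w\<in>G. e w ^ 2 * f) = t * f"
  unfolding t_def transfer_def sum_distrib_right
  by (intro sum.cong refl) (simp add: pact_simps eu[OF _ subgrpD(3)[OF G(1)]])
 ultimately have "t * f - f * (t - 1) : J" using J_diff[OF _ J_mult[OF t1 f]] by simp
 then show ?thesis by (simp add: algebra_simps)
qed

lemma invs_G_subset: "invs_G \<subseteq> invs_H"
 unfolding subset_iff invs_iff using H(2) by blast

lemma Th_add: "Th (p + q) = Th p + Th q"
 by (rule poly_mapping_eqI) (simp add: lookup_Th lookup_add eva_simps)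

lemma Th_ker: "n : invs_H ==> Th n = 0 ==> EX c. (ALL s. c s : kV) & ff * n = (\<Sum>s<m. c s * hs s)"
proof -
 assume n: "n : invs_H" and 0: "Th n = 0"
 have "eva v (pact g n) = 0" if g: "g : G" for g
  using Th_cos[OF n subgrpD(2)[OF G(1) g]] 0 by (simp add: eva_pact subgrpD(1)[OF G(1) g])
 then have "n : J" by (intro orbit_ideal invs_kV[OF n])
 from J_mult[OF this ff_kV] show ?thesis by (simp add: J_def)
qed

sublocale koszul_point basis invs_G m h dg "card G" invs_H "eva v" "transfer H" ff "transfer G pp" Th
proof (rule koszul_point.intro)
 show "graded_subalgebra basis invs_G m h dg (card G)" by (rule graded_subalgebra_axioms)
 show "graded_ring invs_H" by (rule invs_graded_ring)
 show "koszul_point_axioms basis invs_G m h invs_H (eva v) (transfer H) ff (transfer G pp) Th"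
 proof (rule koszul_point_axioms.intro)
  show "invs_G \<subseteq> invs_H" by (rule invs_G_subset)
  show "invs_H \<subseteq> kV" using invs_kV by blast
  show "transfer H (p * a) = transfer H p * a" if "a : invs_G" for a p
   by (rule transfer_mult) (use that invs_G_subset in blast)
  show "transfer G pp : invs_G" by (rule transfer_invs[OF G(1) pp(1)])
  show "eva v (transfer G pp) = 1"
   unfolding eva_transfer using G(2) subgrpD(3)[OF G(1)] by (simp add: pp(2))
  show "transfer H (ff * n) = transfer G pp * n" if "n : invs_H" for n
   using transfer_mult[OF that, of ff] by (simp add: transfer_ff)
  show "EX c. (ALL s. c s : kV) & ff * n = (\<Sum>s<m. c s * hs s)" if "n : invs_H" "Th n = 0" for n
   by (rule Th_ker[OF that])
 qed (auto simp: rhom_eva transfer_add ff_kV Th_add intro: transfer_invs[OF H(1)] Th_ideal)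
qed

text \<open>The transfer over \<open>H\<close> of a translate of \<open>pp\<close> restricts to the
  indicator function of a single coset.\<close>

lemma Th_onto: "Th ` invs_H = {f. ky f \<subseteq> RC}"
proof
 show "Th ` invs_H \<subseteq> {f. ky f \<subseteq> RC}" using keys_Th by blast
 show "{f. ky f \<subseteq> RC} \<subseteq> Th ` invs_H"
 proof
 fix f :: "('v => 'v) set \<Rightarrow>\<^sub>0 'k" assume "f : {f. ky f \<subseteq> RC}"
 then have f: "ky f \<subseteq> RC" by simp
 have delta: "lk (Th (transfer H (pact g pp))) (hcos g') = (if hcos g' = hcos g then 1 else 0)" if g: "g : G" "g' : G" for g g'
 proof -
  have l': "lin g'" and gi: "finv g' : G" using subgrpD[OF G(1)] g by auto
  have ii: "finv (finv g') = g'" using l' by (simp add: inv_inv_eq lin_def)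
  have "lk (Th (transfer H (pact g pp))) (hcos g') = eva (g' v) (transfer H (pact g pp))"
   by (rule Th_cos[OF transfer_invs[OF H(1) pact_kV[OF pp(1)]] g(2)])
  also have "... = (\<Sum>u\<in>H. eva (g' v) (pact u (pact g pp)))" by (simp add: transfer_def eva_simps)
  also have "... = (\<Sum>u\<in>H. if g' = u o g then 1 else 0)"
  proof (intro sum.cong refl)
   fix u assume u: "u : H"
   have ug: "u o g : G" using u g H(2) subgrpD(4)[OF G(1)] by blast
   have "eva (g' v) (pact u (pact g pp)) = eva (finv (finv g') v) (pact (u o g) pp)"
   unfolding ii pact_comp[OF subgrpD(1)[OF H(1) u] subgrpD(1)[OF G(1) g(1)]] ..
   also have "... = eva v (pact (finv g' o (u o g)) pp)"
   by (simp add: eva_pact[OF lin_inv[OF l'], symmetric] pact_comp[OF lin_inv[OF l'] subgrpD(1)[OF G(1) ug]])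
   also have "... = (if finv g' o (u o g) = id then 1 else 0)" by (rule pp(2)[OF subgrpD(4)[OF G(1) gi ug]])
   also have "finv g' o (u o g) = id \<longleftrightarrow> g' = u o g"
   proof
   assume "finv g' o (u o g) = id"
   then have "g' o (finv g' o (u o g)) = g'" by simp
   then show "g' = u o g" using lin_inv_eq(4)[OF l'] by (metis comp_assoc id_comp)
   next
   assume "g' = u o g" then show "finv g' o (u o g) = id" using lin_inv_eq(3)[OF l'] by simp
   qed
   finally show "eva (g' v) (pact u (pact g pp)) = (if g' = u o g then 1 else 0)" .
  qed
  also have "... = (if hcos g' = hcos g then 1 else 0)"
  proof (cases "hcos g' = hcos g")
   case True
   then obtain u0 where u0: "u0 : H" "g' = u0 o g" using cos_eq_iff[OF g(1)] by blast
   have "g' = u o g \<longleftrightarrow> u = u0" for u using right_cancel[OF subgrpD(1)[OF G(1) g(1)]] u0(2) by blast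
   then show ?thesis using True u0(1) finH by simp
  next
   case False
   then have "g' ~= u o g" if "u : H" for u using cos_eq_iff[OF g(1)] that by blast
   then show ?thesis using False by simp
  qed
  finally show ?thesis .
 qed
 define n where "n = (\<Sum>Y\<in>RC. mconst (lk f Y) * transfer H (pact (rp Y) pp))"
 have n: "n : invs_H" unfolding n_def
  by (intro NN.N.sum NN.N.mult NN.N_const transfer_invs[OF H(1)] pact_kV pp)
 have "Th n = f"
 proof (rule Th_eqI[OF f])
  fix g assume g: "g : G"
  have Y: "hcos g : RC" using g by (simp add: RC_def)
  have "lk (Th n) (hcos g) = (\<Sum>Y\<in>RC. lk f Y * lk (Th (transfer H (pact (rp Y) pp))) (hcos g))"
   using Y by (simp add: lookup_Th n_def eva_simps)
  also have "... = (\<Sum>Y\<in>RC. if Y = hcos g then lk f Y else 0)"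
  proof (intro sum.cong refl)
   fix Y assume "Y : RC"
   then have r: "rp Y : G" "hcos (rp Y) = Y" using rp[of Y] by auto
   show "lk f Y * lk (Th (transfer H (pact (rp Y) pp))) (hcos g) = (if Y = hcos g then lk f Y else 0)"
   unfolding delta[OF r(1) g] r(2) by simp
  qed
  also have "... = lk f (hcos g)" unfolding sum.delta[OF finite_RC] using Y by simp
  finally show "lk (Th n) (hcos g) = lk f (hcos g)" .
 qed
 then show "f : Th ` invs_H" using n by blast
 qed
qed

end

section \<open>Homology as an element of the Grothendieck group\<close>

lemma coset_eq_iff:
 assumes "vector_space sc" and B: "subrep Q sc ac B"
 shows "y : (%b. x + b) ` B \<longleftrightarrow> y - x : B"
  and "(%b. x + b) ` B = (%b. y + b) ` B \<longleftrightarrow> x - y : B"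
  and "(%b. x + b) ` B = B \<longleftrightarrow> x : B"
proof -
 interpret vector_space sc by fact
 note b = subrepD[OF B]
 have um: "- x : B" if "x : B" for x using b(3)[OF that, of "- 1"] by simp
 have mem: "y : (%b. x + b) ` B \<longleftrightarrow> y - x : B" for x y
 proof
  assume "y - x : B" then show "y : (%b. x + b) ` B" by (intro image_eqI[of _ _ "y - x"]) simp_all
 qed auto
 then show "y : (%b. x + b) ` B \<longleftrightarrow> y - x : B" .
 have sub: "(%b. x + b) ` B \<subseteq> (%b. y + b) ` B" if "x - y : B" for x y
 proof
  fix z assume "z : (%b. x + b) ` B"
  then have "z - x : B" using mem by blast
  from b(2)[OF this that] show "z : (%b. y + b) ` B" using mem[of z y] by simp
 qed
 have eq: "(%b. x + b) ` B = (%b. y + b) ` B \<longleftrightarrow> x - y : B" for x y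
 proof
  assume "(%b. x + b) ` B = (%b. y + b) ` B"
  moreover have "x : (%b. x + b) ` B" using mem[of x x] b(1) by simp
  ultimately show "x - y : B" using mem by blast
 next
  assume "x - y : B"
  then show "(%b. x + b) ` B = (%b. y + b) ` B" using sub[of x y] sub[of y x] um[of "x - y"] by auto
 qed
 then show "(%b. x + b) ` B = (%b. y + b) ` B \<longleftrightarrow> x - y : B" .
 show "(%b. x + b) ` B = B \<longleftrightarrow> x : B" using eq[of x 0] by simp
qed

text \<open>The presenting space \<open>Z'\<close> may differ from \<open>Z\<close>: it is enough
  that \<open>g\<close> reaches every class modulo \<open>B\<close>. In the application
  \<open>Z'\<close> consists of Koszul cycles and \<open>Z\<close> of cycles of an arbitrary
  resolution.\<close>

lemma quotient_presents:
 fixes sc :: "'k::field => 'm::ab_group_add => 'm" and sc' :: "'k => 'l::ab_group_add => 'l"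
 assumes vs: "vector_space sc" and B: "subrep Q sc ac B"
  and ac: "!!q x y. q : carrier Q ==> ac q (x + y) = ac q x + ac q y"
  and g: "!!z. z : Z' ==> g z : Z" "!!x y. g (x + y) = g x + g y" "!!a x. g (sc' a x) = sc a (g x)" "g 0 = 0"
   "!!q x. q : carrier Q ==> x : Z' ==> g (ac' q x) = ac q (g x)"
  and onto: "!!z. z : Z ==> \<exists>z'\<in>Z'. z - g z' : B"
 shows "presents Q sc' ac' Z' (quotient_rep sc ac Z B) (%z. (%b. g z + b) ` B)"
proof -
 interpret vector_space sc by fact
 note b = subrepD[OF B] and mem = coset_eq_iff(1)[OF vs B] and eq = coset_eq_iff(2)[OF vs B]
 let ?cs = "%x. (%b. x + b) ` B"
 have self: "x : ?cs x" for x using mem[of x x] b(1) by simp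
 have carr: "(%z. ?cs (g z)) ` Z' = ?cs ` Z"
 proof
  show "(%z. ?cs (g z)) ` Z' \<subseteq> ?cs ` Z" using g(1) by blast
  show "?cs ` Z \<subseteq> (%z. ?cs (g z)) ` Z'"
  proof
   fix y assume "y : ?cs ` Z"
   then obtain z where z: "z : Z" "y = ?cs z" by blast
   obtain z' where z': "z' : Z'" "z - g z' : B" using onto[OF z(1)] by blast
   have "?cs z = ?cs (g z')" unfolding eq by (rule z'(2))
   then show "y : (%z. ?cs (g z)) ` Z'" unfolding z(2) using z'(1) by (intro image_eqI[of _ _ z'])
  qed
 qed
 have add: "{a + b | a b. a : ?cs x & b : ?cs y} = ?cs (x + y)" for x y
 proof (intro equalityI subsetI)
  fix z assume "z : {a + b | a b. a : ?cs x & b : ?cs y}"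
  then obtain a c where z: "z = a + c" "a - x : B" "c - y : B" using mem by blast
  from b(2)[OF z(2,3)] show "z : ?cs (x + y)" unfolding mem z(1) by (simp add: algebra_simps)
 next
  fix z assume "z : ?cs (x + y)"
  then have "z - x : ?cs y" unfolding mem by (simp add: algebra_simps)
  then have "z = x + (z - x) & x : ?cs x & z - x : ?cs y" using self by simp
  then show "z : {a + b | a b. a : ?cs x & b : ?cs y}" by blast
 qed
 have op: "{F x' + b | x' b. x' : ?cs x & b : B} = ?cs (F x)"
  if F: "!!x y. F (x + y) = F x + F y" "!!y. y : B ==> F y : B" for F :: "'m => 'm" and x
 proof (intro equalityI subsetI)
  fix z assume "z : {F x' + b | x' b. x' : ?cs x & b : B}"
  then obtain x' c where z: "z = F x' + c" "x' - x : B" "c : B" using mem by blast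
  have "F x' = F x + F (x' - x)" using F(1)[of x "x' - x"] by simp
  then have "z - F x = F (x' - x) + c" using z(1) by simp
  then show "z : ?cs (F x)" unfolding mem using b(2)[OF F(2)[OF z(2)] z(3)] by simp
 next
  fix z assume "z : ?cs (F x)"
  then have "z = F x + (z - F x) & x : ?cs x & z - F x : B" using self mem[of z "F x"] by simp
  then show "z : {F x' + b | x' b. x' : ?cs x & b : B}" by blast
 qed
 show ?thesis unfolding presents_def
 proof (intro conjI ballI allI)
  show "(%z. ?cs (g z)) ` Z' = carrier (quotient_rep sc ac Z B)" using carr by (simp add: quotient_rep_def)
  show "?cs (g (x + y)) = ?cs (g x) \<oplus>\<^bsub>quotient_rep sc ac Z B\<^esub> ?cs (g y)" for x y
   using add[of "g x" "g y"] by (simp add: quotient_rep_def g(2))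
  show "?cs (g (sc' a x)) = a \<odot>\<^bsub>quotient_rep sc ac Z B\<^esub> ?cs (g x)" for a x
   using op[of "sc a" "g x"] b(3) by (simp add: quotient_rep_def g(3) scale_right_distrib)
  show "?cs (g 0) = \<zero>\<^bsub>quotient_rep sc ac Z B\<^esub>" by (simp add: quotient_rep_def g(4))
  show "?cs (g (ac' q x)) = act (quotient_rep sc ac Z B) q (?cs (g x))" if "q : carrier Q" "x : Z'" for q x
   using op[of "ac q" "g x"] b(4)[OF that(1)] ac[OF that(1)] by (simp add: quotient_rep_def g(5)[OF that])
 qed
qed

lemma ses_relations_subset: "ses_relations Q \<subseteq> relation_group Q"
 unfolding relation_group_def by (auto intro: generate.incl)

lemma presented_relation:
 assumes "presented_rep Q sc ac Z M \<pi>"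
 shows "cls Q (srep sc ac Z) - cls Q (srep sc ac {z\<in>Z. \<pi> z = \<zero>\<^bsub>M\<^esub>}) - cls Q M : relation_group Q"
proof -
 interpret presented_rep Q sc ac Z M \<pi> by fact
 show ?thesis using cls_relation ses_relations_subset by (auto simp: ker_def)
qed

lemma class_additive:
 assumes Q: "group Q" "vector_space sc" and Z: "subrep Q sc ac Z" "fdim sc Z"
  and f: "!!x y. x : Z ==> y : Z ==> f (x + y) = f x + f y" "!!a x. x : Z ==> f (sc a x) = sc a (f x)" "f 0 = 0"
   "!!q x. q : carrier Q ==> x : Z ==> f (ac q x) = ac q (f x)"
 shows "cls Q (srep sc ac Z) - cls Q (srep sc ac {z\<in>Z. f z = 0}) - cls Q (srep sc ac (f ` Z)) : relation_group Q"
proof -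
 have "presents Q sc ac Z (srep sc ac (f ` Z)) f"
  unfolding presents_def srep_def using f by simp
 then have "presented_rep Q sc ac Z (srep sc ac (f ` Z)) f"
  using Q Z by (simp add: presented_rep_def)
 from presented_relation[OF this] show ?thesis by (simp add: srep_def)
qed

text \<open>The identity of the zero space yields \<open>[0] - [0] - [0]\<close> as a
  relation.\<close>

lemma class_zero:
 assumes "group Q" "vector_space sc" "subrep Q sc ac {0}"
 shows "cls Q (srep sc ac {0}) : relation_group Q"
proof -
 have fd: "fdim sc {0}"
 proof -
  interpret vector_space sc by fact
  show ?thesis unfolding fdim_def using span_base[of 0 "{0}"] by (intro exI[of _ "{0}"]) auto
 qed
 have "cls Q (srep sc ac {0}) - cls Q (srep sc ac {z\<in>{0}. z = 0}) - cls Q (srep sc ac ((%x. x) ` {0})) : relation_group Q"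
  by (rule class_additive[OF assms fd]) auto
 then have "- cls Q (srep sc ac {0}) : relation_group Q" by (simp add: Collect_conv_if)
 then show ?thesis using relation_group_closed(3)[of "- cls Q (srep sc ac {0})" Q] by simp
qed

section \<open>The group action on the complexes and its finite-dimensional pieces\<close>

abbreviation sclm :: "'k::field => (('x,'k) fvec) => (('x,'k) fvec)" where "sclm a \<equiv> smul (mconst a)"

lemma finite_bounded_monomials:
 assumes "finite I" shows "finite {\<mu> :: 'x \<Rightarrow>\<^sub>0 nat. ky \<mu> \<subseteq> I & mdeg \<mu> < D}"
proof (rule finite_subset)
 show "{\<mu> :: 'x \<Rightarrow>\<^sub>0 nat. ky \<mu> \<subseteq> I & mdeg \<mu> < D} \<subseteq> {\<mu>. ky \<mu> \<subseteq> I & (ALL x. lk \<mu> x \<le> D)}"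
 proof clarify
  fix \<mu> :: "'x \<Rightarrow>\<^sub>0 nat" and x assume "mdeg \<mu> < D"
  show "lk \<mu> x \<le> D"
  proof (cases "x : ky \<mu>")
   case True
   have "lk \<mu> x \<le> mdeg \<mu>" unfolding wdeg_def using member_le_sum[of x "ky \<mu>" "%x. lk \<mu> x * Suc 0"] True by simp
   then show ?thesis using \<open>mdeg \<mu> < D\<close> by simp
  qed (simp add: not_in_keys_iff_lookup_eq_zero)
 qed
qed (rule card_bounded_monomials(2)[OF assms])

lemma single_sum: "sg b (sum f Y) = (\<Sum>y\<in>Y. sg b (f y))"
 by (induction Y rule: infinite_finite_induct) (simp_all add: single_add)

lemma fdim_bounded:
 fixes B :: "nat set" and I :: "'x set"
 assumes fin: "finite B" "finite I"
 shows "fdim sclm {u :: ('x,'k::field) fvec. ky u \<subseteq> B & (ALL b. \<forall>\<mu>\<in>ky (lk u b). ky \<mu> \<subseteq> I & mdeg \<mu> < D)}" (is "fdim _ ?W")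
proof -
 let ?Mon = "{\<mu> :: 'x \<Rightarrow>\<^sub>0 nat. ky \<mu> \<subseteq> I & mdeg \<mu> < D}"
 let ?S = "(%(b, \<mu>). sg b (sg \<mu> (1::'k))) ` (B \<times> ?Mon)"
 have "finite ?S" using fin finite_bounded_monomials by blast
 moreover have "?S \<subseteq> ?W"
 proof clarify
  fix b \<mu> assume b: "b : B" and \<mu>: "ky \<mu> \<subseteq> I" "mdeg (\<mu> :: 'x \<Rightarrow>\<^sub>0 nat) < D"
  have "ky (lk (sg b (sg \<mu> (1::'k))) b') \<subseteq> {\<mu>}" for b' by (simp add: lookup_single when_def)
  then show "ky (sg b (sg \<mu> (1::'k))) \<subseteq> B & (\<forall>b'. \<forall>\<mu>'\<in>ky (lk (sg b (sg \<mu> (1::'k))) b'). ky \<mu>' \<subseteq> I & mdeg \<mu>' < D)"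
   using b \<mu> by (auto split: if_splits)
 qed
 moreover have "?W \<subseteq> svs.span ?S"
 proof
  fix u :: "('x,'k) fvec" assume u: "u : ?W"
  have e: "u = (\<Sum>b\<in>ky u. \<Sum>\<mu>\<in>ky (lk u b). sclm (lk (lk u b) \<mu>) (sg b (sg \<mu> (1::'k))))"
  proof -
   have "sg b (lk u b) = (\<Sum>\<mu>\<in>ky (lk u b). sclm (lk (lk u b) \<mu>) (sg b (sg \<mu> (1::'k))))" for b
   proof -
   have "sg b (lk u b) = sg b (\<Sum>\<mu>\<in>ky (lk u b). sg \<mu> (lk (lk u b) \<mu>))" by (subst sum_monomials[of "lk u b"]) simp
   also have "... = (\<Sum>\<mu>\<in>ky (lk u b). sg b (sg \<mu> (lk (lk u b) \<mu>)))"
   by (rule single_sum)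
   also have "... = (\<Sum>\<mu>\<in>ky (lk u b). sclm (lk (lk u b) \<mu>) (sg b (sg \<mu> (1::'k))))"
   by (intro sum.cong refl) (simp add: smul_single sg_eq[symmetric])
   finally show ?thesis .
   qed
   then show ?thesis using sum_monomials[of u] by simp
  qed
  have sp: "sclm a (sg b (sg \<mu> (1::'k))) : svs.span ?S" if "b : ky u" "\<mu> : ky (lk u b)" for a b \<mu>
  proof -
   have "(b, \<mu>) : B \<times> ?Mon" using u that by blast
   then have "sg b (sg \<mu> (1::'k)) : ?S" by (rule rev_image_eqI) simp
   then show ?thesis by (intro svs.span_scale svs.span_base)
  qed
  show "u : svs.span ?S" by (subst e) (intro svs.span_sum sp)
 qed
 ultimately show ?thesis unfolding fdim_def by blast
qed

lemma ksgn_cases: "ksgn s T = 1 \<or> ksgn s T = - 1"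
 unfolding ksgn_def using neg_one_even_power neg_one_odd_power by blast

text \<open>The group \<open>Q\<close> acts on \<open>N\<close> semilinearly over \<open>A\<close>:
  a factor of degree \<open>e\<close> from \<open>A\<close> is multiplied by the \<open>e\<close>-th
  power of \<open>\<chi> q\<close>. In the application \<open>Q\<close> is the product of
  \<open>\<Gamma>\<close> and \<open>C\<close>, and \<open>chi_ev\<close> holds because
  \<open>v\<close> is an eigenvector of \<open>C\<close>.\<close>

locale equivariant_point = koszul_point I A m h dg r N ev Tr ff Ff \<Theta>
 for I :: "'x set" and A :: "('x,'k::field) mpol set" and m h dg r N ev Tr ff Ff
  and \<Theta> :: "('x,'k) mpol => 'y::ab_group_add" +
 fixes Q :: "'q monoid" and \<chi> :: "'q => 'k" and \<alpha> :: "'q => ('x,'k) mpol => ('x,'k) mpol"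
  and M :: "('q,'k,'y) rep"
 assumes Q: "group Q"
  and al_add: "q : carrier Q ==> \<alpha> q (p + p') = \<alpha> q p + \<alpha> q p'"
  and al_sc: "q : carrier Q ==> \<alpha> q (mconst a * p) = mconst a * \<alpha> q p"
  and al_hom: "q : carrier Q ==> hmg e p ==> hmg e (\<alpha> q p)"
  and al_N: "q : carrier Q ==> p : N ==> \<alpha> q p : N"
  and al_mult: "q : carrier Q ==> p : N ==> f : A ==> hmg e f ==> \<alpha> q (p * f) = mconst (\<chi> q ^ e) * (\<alpha> q p * f)"
  and al_one: "p : N ==> \<alpha> \<one>\<^bsub>Q\<^esub> p = p"
  and al_comp: "q : carrier Q ==> q' : carrier Q ==> p : N ==> \<alpha> (q \<otimes>\<^bsub>Q\<^esub> q') p = \<alpha> q (\<alpha> q' p)"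
  and chi_one: "\<chi> \<one>\<^bsub>Q\<^esub> = 1" and chi_mult: "q : carrier Q ==> q' : carrier Q ==> \<chi> (q \<otimes>\<^bsub>Q\<^esub> q') = \<chi> q * \<chi> q'"
  and chi_ev: "q : carrier Q ==> s < m ==> ev (h s) ~= 0 ==> \<chi> q ^ dg s = 1"
  and M: "presents Q (%a p. mconst a * p) \<alpha> N M \<Theta>" and M_zero: "\<zero>\<^bsub>M\<^esub> = 0"
begin

definition ac :: "(nat => nat) => 'q => (('x,'k) fvec) => (('x,'k) fvec)" where
 "ac w q = Poly_Mapping.mapp (%b p. mconst (\<chi> q ^ w b) * \<alpha> q p)"

lemma al_0: "q : carrier Q ==> \<alpha> q 0 = 0"
 using al_add[of q 0 0] by simp

lemma al_uminus: "q : carrier Q ==> \<alpha> q (- p) = - \<alpha> q p"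
 using al_add[of q p "- p"] al_0[of q] by (simp add: eq_neg_iff_add_eq_0 add.commute)

lemma al_sum: "q : carrier Q ==> \<alpha> q (sum f Y) = (\<Sum>y\<in>Y. \<alpha> q (f y))"
 by (induction Y rule: infinite_finite_induct) (simp_all add: al_0 al_add)

lemma lookup_ac: "q : carrier Q ==> lk (ac w q u) b = mconst (\<chi> q ^ w b) * \<alpha> q (lk u b)"
 by (cases "b : ky u") (auto simp: ac_def lookup_mapp when_def in_keys_iff al_0)

lemma keys_ac: "q : carrier Q ==> ky (ac w q u) \<subseteq> ky u"
 by (rule subsetI) (metis in_keys_iff lookup_ac al_0 mult_zero_right)

lemma ac_add: "q : carrier Q ==> ac w q (u + u') = ac w q u + ac w q u'"
 by (rule poly_mapping_eqI) (simp add: lookup_ac lookup_add al_add distrib_left)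

lemma ac_sc: "q : carrier Q ==> ac w q (sclm a u) = sclm a (ac w q u)"
 by (rule poly_mapping_eqI) (simp add: lookup_ac lookup_smul al_sc mult.left_commute)

lemma ac_ft: "q : carrier Q ==> u : ft N B ==> ac w q u : ft N B"
 unfolding NN.ft_iff using keys_ac[of q w u]
 by (auto simp: lookup_ac intro: NN.N.mult[OF NN.N_const al_N])

lemma ac_ftd: "q : carrier Q ==> u : ftd N B w j ==> ac w q u : ftd N B w j"
 unfolding NN.ftd_iff using keys_ac[of q w u] ac_ft[of q u B w]
 by (auto simp: lookup_ac intro!: homogeneous_mconst_mult al_hom)

lemma ac_one: "u : ft N B ==> ac w \<one>\<^bsub>Q\<^esub> u = u"
proof -
 assume u: "u : ft N B"
 have 1: "\<one>\<^bsub>Q\<^esub> : carrier Q" using Q by (simp add: group.is_monoid)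
 show ?thesis
  by (rule poly_mapping_eqI) (simp add: lookup_ac[OF 1] chi_one mconst_simps al_one[OF NN.ft_lookup[OF u]])
qed

lemma ac_comp: "q : carrier Q ==> q' : carrier Q ==> u : ft N B ==> ac w (q \<otimes>\<^bsub>Q\<^esub> q') u = ac w q (ac w q' u)"
proof -
 assume q: "q : carrier Q" "q' : carrier Q" and u: "u : ft N B"
 have qq: "q \<otimes>\<^bsub>Q\<^esub> q' : carrier Q" using Q q by (simp add: group.is_monoid monoid.m_closed)
 show ?thesis
  by (rule poly_mapping_eqI)
   (simp only: lookup_ac[OF qq] lookup_ac[OF q(1)] lookup_ac[OF q(2)] chi_mult[OF q] al_comp[OF q NN.ft_lookup[OF u]]
   al_sc[OF q(1)] mconst_simps(3) power_mult_distrib mult.assoc)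
qed

lemma ft_subrep:
 assumes "Z \<subseteq> ft N B" "0 : Z" "!!x y. x : Z ==> y : Z ==> x + y : Z" "!!a x. x : Z ==> sclm a x : Z"
  "!!q x. q : carrier Q ==> x : Z ==> ac w q x : Z"
 shows "subrep Q sclm (ac w) Z"
 unfolding subrep_def using assms by (auto simp: ac_add ac_sc subset_iff intro: ac_one ac_comp)

text \<open>Equivariance is a condition on the single matrix entries of the differential. The form
  is general enough for \<open>d'\<close>, whose entries need not be homogeneous.\<close>

lemma ac_bd_map:
 assumes q: "q : carrier Q" and u: "u : ft N B"
  and entry: "!!b b' n. b : B ==> n : N ==>
   mconst (\<chi> q ^ w' b') * \<alpha> q (n * lk (D b) b') = mconst (\<chi> q ^ w b) * (\<alpha> q n * lk (D b) b')"
 shows "ac w' q (bd_map D u) = bd_map D (ac w q u)"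
proof (rule poly_mapping_eqI)
 fix b'
 have uB: "ky u \<subseteq> B" using u by (simp add: NN.ft_iff)
 have "lk (ac w' q (bd_map D u)) b' = (\<Sum>b\<in>ky u. mconst (\<chi> q ^ w' b') * \<alpha> q (lk u b * lk (D b) b'))"
  by (simp add: lookup_ac q bd_map_alt lookup_sum lookup_smul al_sum sum_distrib_left)
 also have "... = (\<Sum>b\<in>ky u. lk (ac w q u) b * lk (D b) b')"
  using uB by (intro sum.cong refl) (auto simp: entry[OF _ NN.ft_lookup[OF u]] lookup_ac q mult.assoc)
 also have "... = lk (bd_map D (ac w q u)) b'"
  by (simp add: bd_map_superset[OF _ keys_ac[OF q]] lookup_sum lookup_smul)
 finally show "lk (ac w' q (bd_map D u)) b' = lk (bd_map D (ac w q u)) b'" .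
qed

lemma graded_entry:
 assumes q: "q : carrier Q" and n: "n : N" and D: "x : ftd A B' w' j"
 shows "mconst (\<chi> q ^ w' b') * \<alpha> q (n * lk x b') = mconst (\<chi> q ^ j) * (\<alpha> q n * lk x b')"
proof (cases "b' : ky x")
 case True
 then have *: "w' b' \<le> j" "hmg (j - w' b') (lk x b')" "lk x b' : A" using D AA.ft_lookup by (auto simp: AA.ftd_iff)
 have "mconst (\<chi> q ^ w' b') * \<alpha> q (n * lk x b') = mconst (\<chi> q ^ w' b' * \<chi> q ^ (j - w' b')) * (\<alpha> q n * lk x b')"
  by (simp add: al_mult[OF q n *(3,2)] mconst_simps mult.assoc)
 then show ?thesis using *(1) by (simp add: power_add[symmetric])
next
 case False
 then show ?thesis by (simp add: not_in_keys_iff_lookup_eq_zero al_0 q)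
qed

lemma ac_bd_map_graded:
 assumes "q : carrier Q" "u : ft N B" "!!b. b : B ==> D b : ftd A B' w' (w b)"
 shows "ac w' q (bd_map D u) = bd_map D (ac w q u)"
 by (rule ac_bd_map[OF assms(1,2)]) (rule graded_entry[OF assms(1) _ assms(3)])

lemma ac_d: "q : carrier Q ==> u : ft N (kgens m (Suc i)) ==> ac wt q (d u) = d (ac wt q u)"
 by (rule ac_bd_map_graded[OF _ _ AA.kbd_ftd]) (auto intro: h_A h_hom)

text \<open>The inhomogeneous \<open>h' s\<close> is still an eigenvector of \<open>\<chi>\<close>, since \<open>\<chi> q\<close> to the power \<open>dg s\<close> is \<open>1\<close>
 unless \<open>h s\<close> vanishes at the point.\<close>

lemma al_h': "q : carrier Q ==> n : N ==> s < m ==> \<alpha> q (n * h' s) = mconst (\<chi> q ^ dg s) * (\<alpha> q n * h' s)"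
proof -
 assume q: "q : carrier Q" and n: "n : N" and s: "s < m"
 have c: "\<alpha> q (mconst (ev (h s)) * n) = mconst (\<chi> q ^ dg s) * (mconst (ev (h s)) * \<alpha> q n)"
  using chi_ev[OF q s] by (cases "ev (h s) = 0") (simp_all add: al_sc al_0 q mconst_simps)
 have "\<alpha> q (n * h' s) = \<alpha> q (n * h s) - \<alpha> q (mconst (ev (h s)) * n)"
  using al_add[OF q, of "n * h s" "- (mconst (ev (h s)) * n)"] by (simp add: algebra_simps al_uminus q)
 also have "... = mconst (\<chi> q ^ dg s) * (\<alpha> q n * h' s)"
  unfolding al_mult[OF q n h_A[OF s] h_hom[OF s]] c by (simp add: algebra_simps)
 finally show ?thesis .
qed

lemma ac_d': "q : carrier Q ==> u : ft N (kgens m (Suc i)) ==> ac wt q (d' u) = d' (ac wt q u)"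
proof (rule ac_bd_map)
 fix b b' n assume q: "q : carrier Q" and b: "b : kgens m (Suc i)" and n: "n : N"
 let ?T = "set_decode b"
 have T: "?T \<subseteq> {..<m}" "finite ?T" using b by (auto simp: kgens_def ksub_def finite_subset)
 define c where "c s = (if set_encode (?T - {s}) = b' then ksgn s (?T - {s}) * h' s else 0)" for s
 have lkc: "lk (kbd h' b) b' = (\<Sum>s\<in>?T. c s)"
  by (simp add: kbd_def lookup_sum lookup_single when_def c_def)
 \<comment> \<open>Removing \<open>s\<close> from the subset lowers the weight by
   \<open>dg s\<close>, and \<open>al_h'\<close> supplies the matching power of
   \<open>\<chi> q\<close> even where \<open>h' s\<close> is inhomogeneous.\<close>
 have "mconst (\<chi> q ^ wt b') * \<alpha> q (n * c s) = mconst (\<chi> q ^ wt b) * (\<alpha> q n * c s)" if s: "s : ?T" for s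
 proof (cases "set_encode (?T - {s}) = b'")
  case True
  have "finite (?T - {s})" using T(2) by simp
  from set_encode_inverse[OF this] have "set_decode b' = ?T - {s}" unfolding True .
  then have w: "wt b = dg s + wt b'" unfolding kwt_def using sum.remove[OF T(2) s, of dg] by simp
  have sm: "s < m" using T(1) s by blast
  have "\<alpha> q (n * c s) = mconst (\<chi> q ^ dg s) * (\<alpha> q n * c s)"
   using ksgn_cases[of s "?T - {s}", where 'a = "('x,'k) mpol"]
  proof
   assume e: "ksgn s (?T - {s}) = (1 :: ('x,'k) mpol)"
   show ?thesis unfolding c_def e using True al_h'[OF q n sm] by simp
  next
   assume e: "ksgn s (?T - {s}) = (- 1 :: ('x,'k) mpol)"
   have cs: "y * c s = - (y * h' s)" for y unfolding c_def e using True by (simp del: minus_diff_eq)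
   show ?thesis unfolding cs al_uminus[OF q] al_h'[OF q n sm] by (simp del: minus_diff_eq)
  qed
  then show ?thesis by (simp add: w power_add mconst_simps mult.assoc mult.left_commute)
 qed (simp add: c_def al_0 q)
 then show "mconst (\<chi> q ^ wt b') * \<alpha> q (n * lk (kbd h' b) b') = mconst (\<chi> q ^ wt b) * (\<alpha> q n * lk (kbd h' b) b')"
  unfolding lkc sum_distrib_left al_sum[OF q] by (intro sum.cong refl)
qed

lemma ac_tcomp: "q : carrier Q ==> NN.tcomp w j (ac w q u) = ac w q (NN.tcomp w j u)"
proof (rule poly_mapping_eqI)
 fix b assume q: "q : carrier Q"
 have "hcomp e (\<alpha> q p) = \<alpha> q (hcomp e p)" for e p by (rule hcomp_linear) (simp_all add: al_add q al_hom)
 then show "lk (NN.tcomp w j (ac w q u)) b = lk (ac w q (NN.tcomp w j u)) b"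
  by (simp add: NN.lookup_tcomp lookup_ac q hcomp_mconst_mult al_0)
qed

abbreviation lam where "lam Z \<equiv> cls Q (srep sclm (ac wt) Z)"

lemma Vd_ft: "Vd i j \<subseteq> ft N (kgens m i)" and Fl_ft: "Fl N D i \<subseteq> ft N (kgens m i)"
 using NN.ftd_ft by (auto simp: Fl_def)

lemma Vd_subrep: "subrep Q sclm (ac wt) (Vd i j)"
 by (rule ft_subrep[OF Vd_ft]) (auto intro: NN.ftd_add NN.ftd_sc ac_ftd)

lemma Fl_subrep: "subrep Q sclm (ac wt) (Fl N D i)"
proof (rule ft_subrep[OF Fl_ft])
 show "0 : Fl N D i" by (simp add: Fl_def)
 show "x + y : Fl N D i" if "x : Fl N D i" "y : Fl N D i" for x y
  using that by (simp add: Fl_def NN.ft_add NN.tcomp_add)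
 show "sclm a x : Fl N D i" if "x : Fl N D i" for a x
  using that by (simp add: Fl_def NN.ft_smul NN.N_const NN.tcomp_smul)
 show "ac wt q x : Fl N D i" if "q : carrier Q" "x : Fl N D i" for q x
 proof -
  have "ac wt q 0 = 0" using ac_add[OF that(1), of wt 0 0] by simp
  then show ?thesis using that by (simp add: Fl_def ac_ft ac_tcomp)
 qed
qed

lemma fdim_bounded_subrep:
 assumes "subrep Q sclm (ac wt) Z" "!!u. u : Z ==> ky u \<subseteq> kgens m i"
  "!!u b \<mu>. u : Z ==> \<mu> : ky (lk u b) ==> ky \<mu> \<subseteq> I & mdeg \<mu> < D"
 shows "fdim sclm Z"
 by (rule fdim_subset[OF vector_space_smul fdim_bounded[OF finite_kgens finI, of m i D]
  subrep_subspace[OF vector_space_smul assms(1)]]) (use assms(2,3) in blast)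

lemma ft_monomials: "u : ft N B ==> \<mu> : ky (lk u b) ==> ky \<mu> \<subseteq> I"
 using NN.ft_lookup[of u B b] NS unfolding mpol_ring_def by blast

lemma Vd_fdim: "fdim sclm (Vd i j)"
proof (rule fdim_bounded_subrep[OF Vd_subrep, of _ _ i "Suc j"])
 fix u b \<mu> assume u: "u : Vd i j" and \<mu>: "\<mu> : ky (lk u b)"
 then have "b : ky u" by (auto simp: in_keys_iff)
 then have "hmg (j - wt b) (lk u b)" using u by (simp add: NN.ftd_iff)
 then show "ky \<mu> \<subseteq> I & mdeg \<mu> < Suc j" using \<mu> ft_monomials[OF NN.ftd_ft[OF u] \<mu>] by (auto simp: homogeneous_iff)
qed (use NN.ftd_ft NN.ft_iff in blast)

lemma Fl_fdim: "fdim sclm (Fl N D i)"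
proof (rule fdim_bounded_subrep[OF Fl_subrep, of _ _ i D])
 fix u b \<mu> assume u: "u : Fl N D i" and \<mu>: "\<mu> : ky (lk u b)"
 have "mdeg \<mu> < D"
 proof (rule ccontr)
  assume "\<not> mdeg \<mu> < D"
  then have "D \<le> mdeg \<mu> + wt b" by simp
  then have "NN.tcomp wt (mdeg \<mu> + wt b) u = 0" using u unfolding Fl_def by blast
  then have "lk (lk (NN.tcomp wt (mdeg \<mu> + wt b) u) b) \<mu> = 0" by simp
  then have "lk (lk u b) \<mu> = 0" by (simp add: NN.lookup_tcomp lookup_hcomp)
  then show False using \<mu> by (simp add: in_keys_iff)
 qed
 then show "ky \<mu> \<subseteq> I & mdeg \<mu> < D" using ft_monomials[OF subsetD[OF Fl_ft u] \<mu>] by simp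
qed (use Fl_ft NN.ft_iff in blast)

end

lemma image_iff_singleton: "z : f ` Y ==> f ` Y = {z} \<longleftrightarrow> (\<forall>y\<in>Y. f y = z)"
proof
 assume e: "f ` Y = {z}"
 show "\<forall>y\<in>Y. f y = z"
 proof
  fix y assume "y : Y"
  then have "f y : f ` Y" by (rule imageI)
  then show "f y = z" unfolding e by simp
 qed
next
 assume z: "z : f ` Y" and "\<forall>y\<in>Y. f y = z"
 then have "f ` Y \<subseteq> {z}" by (intro image_subsetI) simp
 with z show "f ` Y = {z}" by (intro equalityI) simp_all
qed

section \<open>Classes of the graded pieces and of the homology\<close>

context equivariant_point
begin

lemma relation_add_subgroup: "add_subgroup (relation_group Q :: (('q,'k) urep \<Rightarrow>\<^sub>0 int) set)"
 by unfold_locales (auto intro: relation_group_closed)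

lemma ac_0: "q : carrier Q ==> ac w q 0 = 0"
 using ac_add[of q w 0 0] by simp

lemma class_trivial: "lam {0} : relation_group Q"
proof -
 have "subrep Q sclm (ac wt) {0}" by (rule ft_subrep[of "{0}" "{}"]) (auto simp: ac_0)
 then show ?thesis by (rule class_zero[OF Q vector_space_smul])
qed

lemma class_d: "lam (Vd (Suc i) j) - lam {u : Vd (Suc i) j. d u = 0} - lam (d ` Vd (Suc i) j) : relation_group Q"
proof (rule class_additive[OF Q vector_space_smul Vd_subrep Vd_fdim])
 fix q x assume q: "q : carrier Q" and x: "x : Vd (Suc i) j"
 show "d (ac wt q x) = ac wt q (d x)" by (rule ac_d[OF q subsetD[OF Vd_ft x], symmetric])
qed (auto simp: bd_map_add bd_map_smul)

lemma class_d': "lam (Fl N D (Suc i)) - lam {u : Fl N D (Suc i). d' u = 0} - lam (d' ` Fl N D (Suc i)) : relation_group Q"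
proof (rule class_additive[OF Q vector_space_smul Fl_subrep Fl_fdim])
 fix q x assume q: "q : carrier Q" and x: "x : Fl N D (Suc i)"
 show "d' (ac wt q x) = ac wt q (d' x)" by (rule ac_d'[OF q subsetD[OF Fl_ft x], symmetric])
qed (auto simp: bd_map_add bd_map_smul)

lemma class_tcomp: "lam (Fl N (Suc D) i) - lam {u : Fl N (Suc D) i. NN.tcomp wt D u = 0} - lam (NN.tcomp wt D ` Fl N (Suc D) i) : relation_group Q"
 by (rule class_additive[OF Q vector_space_smul Fl_subrep Fl_fdim]) (auto simp: NN.tcomp_add NN.tcomp_smul ac_tcomp)

text \<open>Every element of \<open>M\<close> already comes from degrees below \<open>D\<close>, so
  \<open>M\<close> is a quotient of a finite-dimensional piece of the filtration. The only Koszul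
  generator at level 0 has weight 0, so the action is not twisted there.\<close>

lemma point_presented:
 assumes D: "!!i j. D \<le> j ==> tcyc N KC i j \<subseteq> tbnd N KC i j"
 shows "presented_rep Q sclm (ac wt) (Fl N D 0) M (%u. \<Theta> (lk u 0))"
proof -
 have n: "lk u 0 : N" if "u : Fl N D 0" for u using NN.ft_lookup[OF subsetD[OF Fl_ft that]] .
 have w0: "wt 0 = 0" by (simp add: kwt_def)
 have "presents Q sclm (ac wt) (Fl N D 0) M (%u. \<Theta> (lk u 0))"
  unfolding presents_def
 proof (intro conjI ballI allI)
  show "(%u. \<Theta> (lk u 0)) ` Fl N D 0 = carrier M" using Fl_Theta_onto[OF D] M by (simp add: presents_def)
  show "\<Theta> (lk (x + y) 0) = \<Theta> (lk x 0) \<oplus>\<^bsub>M\<^esub> \<Theta> (lk y 0)" if "x : Fl N D 0" "y : Fl N D 0" for x y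
   using M n[OF that(1)] n[OF that(2)] by (simp add: presents_def lookup_add)
  show "\<Theta> (lk (sclm a x) 0) = a \<odot>\<^bsub>M\<^esub> \<Theta> (lk x 0)" if "x : Fl N D 0" for a x
   using M n[OF that] by (simp add: presents_def lookup_smul)
  show "\<Theta> (lk 0 0) = \<zero>\<^bsub>M\<^esub>" using M by (simp add: presents_def)
  show "\<Theta> (lk (ac wt q x) 0) = act M q (\<Theta> (lk x 0))" if "q : carrier Q" "x : Fl N D 0" for q x
   using M n[OF that(2)] that(1) by (simp add: presents_def lookup_ac w0 mconst_simps)
 qed
 then show ?thesis unfolding presented_rep_def using Q vector_space_smul Fl_subrep Fl_fdim by blast
qed

lemma point_class:
 assumes D: "!!i j. D \<le> j ==> tcyc N KC i j \<subseteq> tbnd N KC i j"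
 shows "(\<Sum>i\<le>m. sgnd i (\<Sum>j<D. lam (Vd i j))) - cls Q M : relation_group Q"
proof -
 interpret R: add_subgroup "relation_group Q :: (('q,'k) urep \<Rightarrow>\<^sub>0 int) set" by (rule relation_add_subgroup)
 have "(\<Sum>i\<le>m. sgnd i (\<Sum>j<D. lam (Vd i j))) - (lam (Fl N D 0) - lam {u : Fl N D 0. \<Theta> (lk u 0) = 0}) : relation_group Q"
  by (rule euler_filtration[OF relation_add_subgroup class_trivial class_tcomp class_d' D])
 moreover have "(lam (Fl N D 0) - lam {u : Fl N D 0. \<Theta> (lk u 0) = 0}) - cls Q M : relation_group Q"
  using presented_relation[OF point_presented[OF D]] by (simp add: M_zero)
 ultimately show ?thesis by (rule R.trans)
qed

definition graded_cplx :: "('x,'k) fcplx => bool" where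
 "graded_cplx P \<longleftrightarrow> (ALL i. \<forall>b\<in>gens P (Suc i). bd P i b : ftd A (gens P i) (gdeg P i) (gdeg P (Suc i) b))"

lemma graded_cplx_KC: "graded_cplx KC"
 unfolding graded_cplx_def KC_simps using AA.kbd_ftd[of m h dg] h_A h_hom by blast

lemma ftd_A_N: "x : ftd A B w j ==> x : ftd N B w j"
 using AN by (auto simp: AA.ftd_iff NN.ftd_iff AA.ft_iff NN.ft_iff)

lemma boundaries_subrep:
 assumes P: "graded_cplx P" shows "subrep Q sclm (ac (gdeg P i)) (tbnd N P i j)"
proof -
 let ?V = "ftd N (gens P (Suc i)) (gdeg P (Suc i)) j"
 have D: "bd P i b : ftd A (gens P i) (gdeg P i) (gdeg P (Suc i) b)" if "b : gens P (Suc i)" for b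
  using P that by (simp add: graded_cplx_def)
 show ?thesis unfolding tor_boundaries_def
 proof (rule ft_subrep[of _ "gens P i"])
  show "bd_map (bd P i) ` ?V \<subseteq> ft N (gens P i)"
  proof (rule image_subsetI)
   fix u assume u: "u : ?V"
   show "bd_map (bd P i) u : ft N (gens P i)"
   by (rule NN.ftd_ft, rule NN.ftd_bd_map[OF u], rule ftd_A_N, rule D)
  qed
  show "0 : bd_map (bd P i) ` ?V" by (rule image_eqI[of _ _ 0]) simp_all
  show "x + y : bd_map (bd P i) ` ?V" if x: "x : bd_map (bd P i) ` ?V" and y: "y : bd_map (bd P i) ` ?V" for x y
  proof -
   obtain u u' where "u : ?V" "x = bd_map (bd P i) u" "u' : ?V" "y = bd_map (bd P i) u'" using x y by blast
   then show ?thesis by (intro image_eqI[of _ _ "u + u'"]) (simp_all add: bd_map_add NN.ftd_add)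
  qed
  show "sclm a x : bd_map (bd P i) ` ?V" if x: "x : bd_map (bd P i) ` ?V" for a x
  proof -
   obtain u where "u : ?V" "x = bd_map (bd P i) u" using x by blast
   then show ?thesis by (intro image_eqI[of _ _ "sclm a u"]) (simp_all add: bd_map_smul NN.ftd_sc)
  qed
  show "ac (gdeg P i) q x : bd_map (bd P i) ` ?V" if q: "q : carrier Q" and x: "x : bd_map (bd P i) ` ?V" for q x
  proof -
   obtain u where u: "u : ?V" "x = bd_map (bd P i) u" using x by blast
   have "ac (gdeg P i) q x = bd_map (bd P i) (ac (gdeg P (Suc i)) q u)"
   unfolding u(2) by (rule ac_bd_map_graded[OF q NN.ftd_ft[OF u(1)] D])
   then show ?thesis using ac_ftd[OF q u(1)] by (intro image_eqI[of _ _ "ac (gdeg P (Suc i)) q u"])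
  qed
 qed
qed

lemma cycles_subrep:
 assumes P: "graded_cplx P" shows "subrep Q sclm (ac (gdeg P i)) (tcyc N P i j)"
proof (rule ft_subrep[of _ "gens P i"])
 show "tcyc N P i j \<subseteq> ft N (gens P i)" using NN.ftd_ft by (auto simp: tor_cycles_def)
 show "0 : tcyc N P i j" by (simp add: tor_cycles_def split: nat.split)
 show "x + y : tcyc N P i j" if "x : tcyc N P i j" "y : tcyc N P i j" for x y
  using that by (auto simp: tor_cycles_def NN.ftd_add bd_map_add split: nat.splits)
 show "sclm a x : tcyc N P i j" if "x : tcyc N P i j" for a x
  using that by (auto simp: tor_cycles_def NN.ftd_sc bd_map_smul split: nat.splits)
 show "ac (gdeg P i) q x : tcyc N P i j" if q: "q : carrier Q" and x: "x : tcyc N P i j" for q x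
 proof (cases i)
  case 0
  then show ?thesis using x ac_ftd[OF q] by (simp add: tor_cycles_def)
 next
  case (Suc l)
  have x': "x : ftd N (gens P i) (gdeg P i) j" "bd_map (bd P l) x = 0" using x Suc by (simp_all add: tor_cycles_def)
  have "bd_map (bd P l) (ac (gdeg P (Suc l)) q x) = ac (gdeg P l) q (bd_map (bd P l) x)"
   by (rule ac_bd_map_graded[OF q, symmetric, where B = "gens P (Suc l)" and B' = "gens P l"])
   (use x'(1) Suc NN.ftd_ft P in \<open>auto simp: graded_cplx_def\<close>)
  then show ?thesis using x' Suc ac_ftd[OF q x'(1)] by (simp add: tor_cycles_def ac_0 q)
 qed
qed

text \<open>The chain equivalence lets Koszul cycles represent the homology computed from any
  resolution \<open>P\<close>, and it is equivariant because its entries lie in \<open>A\<close> in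
  the right degrees. The classes can therefore be computed from Koszul cycles and
  boundaries.\<close>

lemma tor_presented:
 assumes P: "graded_free_resolution A P"
 shows "\<exists>\<pi>. presented_rep Q sclm (ac wt) (tcyc N KC i j) (tor_rep \<chi> \<alpha> N P i j) \<pi> \<and>
  (\<forall>z\<in>tcyc N KC i j. \<pi> z = \<zero>\<^bsub>tor_rep \<chi> \<alpha> N P i j\<^esub> \<longleftrightarrow> z : tbnd N KC i j)"
proof -
 let ?Z = "tcyc N P i j" and ?B = "tbnd N P i j" and ?ZK = "tcyc N KC i j" and ?BK = "tbnd N KC i j"
 have gP: "graded_cplx P" using P by (simp add: graded_free_resolution_def graded_cplx_def)
 obtain F G where FG: "ALL i. \<forall>b\<in>gens KC i. G i b : ftd A (gens P i) (gdeg P i) (gdeg KC i b)"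
  "ALL i j. \<forall>z\<in>tcyc N P i j. bd_map (F i) z : tcyc N KC i j & bd_map (G i) (bd_map (F i) z) - z : tbnd N P i j"
  "ALL i j. \<forall>z\<in>tcyc N KC i j. bd_map (G i) z : tcyc N P i j & bd_map (F i) (bd_map (G i) z) - z : tbnd N KC i j"
  "ALL i j. \<forall>z\<in>tbnd N P i j. bd_map (F i) z : tbnd N KC i j"
  "ALL i j. \<forall>z\<in>tbnd N KC i j. bd_map (G i) z : tbnd N P i j"
  using tor_comparison[OF AA.graded_ring_axioms NN.graded_ring_axioms AN P kos_resolution] by (elim exE conjE) blast
 have T: "tor_rep \<chi> \<alpha> N P i j = quotient_rep sclm (ac (gdeg P i)) ?Z ?B"
  by (simp add: tor_rep_def ac_def[abs_def] smul_def[abs_def])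
 let ?\<pi> = "%z. (%b. bd_map (G i) z + b) ` ?B"
 have BK: "subrep Q sclm (ac wt) ?BK" and B: "subrep Q sclm (ac (gdeg P i)) ?B"
  using boundaries_subrep[OF graded_cplx_KC, of i j] boundaries_subrep[OF gP] by simp_all
 have ZK: "subrep Q sclm (ac wt) ?ZK" using cycles_subrep[OF graded_cplx_KC, of i j] by simp
 have subK: "x - y : ?BK" if "x : ?BK" "y : ?BK" for x y
  using svs.subspace_diff[OF subrep_subspace[OF vector_space_smul BK] that] .
 have pres: "presents Q sclm (ac wt) ?ZK (tor_rep \<chi> \<alpha> N P i j) ?\<pi>"
  unfolding T
 proof (rule quotient_presents[OF vector_space_smul B ac_add])
  show "bd_map (G i) z : ?Z" if "z : ?ZK" for z using FG(3) that by blast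
  show "bd_map (G i) (ac wt q x) = ac (gdeg P i) q (bd_map (G i) x)" if q: "q : carrier Q" and x: "x : ?ZK" for q x
   by (rule ac_bd_map_graded[OF q, symmetric, where B = "kgens m i" and B' = "gens P i"])
   (use x NN.ftd_ft FG(1) in \<open>auto simp: tor_cycles_def\<close>)
  show "\<exists>z'\<in>?ZK. z - bd_map (G i) z' : ?B" if z: "z : ?Z" for z
  proof (rule bexI[of _ "bd_map (F i) z"])
   have "bd_map (G i) (bd_map (F i) z) - z : ?B" using FG(2) z by blast
   from svs.subspace_neg[OF subrep_subspace[OF vector_space_smul B] this]
   show "z - bd_map (G i) (bd_map (F i) z) : ?B" by simp
  qed (use FG(2) z in blast)
 qed (simp_all add: bd_map_add bd_map_smul)
 have "presented_rep Q sclm (ac wt) ?ZK (tor_rep \<chi> \<alpha> N P i j) ?\<pi>"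
  unfolding presented_rep_def
 proof (intro conjI Q vector_space_smul ZK pres)
  show "fdim sclm ?ZK"
   by (rule fdim_subset[OF vector_space_smul Vd_fdim subrep_subspace[OF vector_space_smul ZK]]) (auto simp: tor_cycles_def)
 qed
 moreover have "?\<pi> z = \<zero>\<^bsub>tor_rep \<chi> \<alpha> N P i j\<^esub> \<longleftrightarrow> z : ?BK" if z: "z : ?ZK" for z
 proof -
  have "?\<pi> z = \<zero>\<^bsub>tor_rep \<chi> \<alpha> N P i j\<^esub> \<longleftrightarrow> bd_map (G i) z : ?B"
   using coset_eq_iff(3)[OF vector_space_smul B] by (simp add: T quotient_rep_def)
  also have "... \<longleftrightarrow> z : ?BK"
  proof
   assume "bd_map (G i) z : ?B"
   then have "bd_map (F i) (bd_map (G i) z) : ?BK" using FG(4) by blast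
   moreover have "bd_map (F i) (bd_map (G i) z) - z : ?BK" using FG(3) z by blast
   ultimately show "z : ?BK" using subK[of "bd_map (F i) (bd_map (G i) z)" "bd_map (F i) (bd_map (G i) z) - z"] by simp
  qed (use FG(5) in blast)
  finally show ?thesis .
 qed
 ultimately show ?thesis by blast
qed

text \<open>A chain of congruences: the class of each homology module is that of cycles minus
  boundaries; the alternating sum of these is that of the graded pieces of the Koszul complex; and
  the pieces of degree below \<open>D\<close> together have the class of the deformed complex
  truncated at \<open>D\<close>, which resolves \<open>M\<close>.\<close>

lemma grothendieck_identity:
 fixes P
 defines "T \<equiv> tor_rep \<chi> \<alpha> N P"
 defines "S \<equiv> {(i, j). carrier (T i j) ~= {\<zero>\<^bsub>T i j\<^esub>}}"
 assumes P: "graded_free_resolution A P"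
 shows "fin_dim_rep Q (T i j)" and "finite S"
  and "finprod (grothendieck_group Q) (%(i, j). rep_class Q (T i j) [^]\<^bsub>grothendieck_group Q\<^esub> ((-1) ^ i :: int)) S = rep_class Q M"
proof -
 interpret R: add_subgroup "relation_group Q :: (('q,'k) urep \<Rightarrow>\<^sub>0 int) set" by (rule relation_add_subgroup)
 have "ALL i j. \<exists>\<pi>. presented_rep Q sclm (ac wt) (tcyc N KC i j) (T i j) \<pi> \<and>
  (\<forall>z\<in>tcyc N KC i j. \<pi> z = \<zero>\<^bsub>T i j\<^esub> \<longleftrightarrow> z : tbnd N KC i j)"
  unfolding T_def using tor_presented[OF P] by blast
 then obtain \<pi> where pr: "!!i j. presented_rep Q sclm (ac wt) (tcyc N KC i j) (T i j) (\<pi> i j)"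
  and ker: "!!i j z. z : tcyc N KC i j ==> \<pi> i j z = \<zero>\<^bsub>T i j\<^esub> \<longleftrightarrow> z : tbnd N KC i j" by metis
 show "fin_dim_rep Q (T i j)" by (rule presented_rep.fin_dim_rep[OF pr])
 obtain D where D: "!!i j. D \<le> j ==> tcyc N KC i j \<subseteq> tbnd N KC i j" using homology_bounded by blast
 define c where "c i j = lam (tcyc N KC i j) - lam (tbnd N KC i j)" for i j
 have rel: "cls Q (T i j) - c i j : relation_group Q" for i j
 proof -
  have "{z : tcyc N KC i j. \<pi> i j z = \<zero>\<^bsub>T i j\<^esub>} = tbnd N KC i j"
   using ker boundaries_cycles by blast
  then have "c i j - cls Q (T i j) : relation_group Q" using presented_relation[OF pr[of i j]] by (simp add: c_def)
  then show ?thesis by (rule R.sym)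
 qed
 \<comment> \<open>Nonvanishing of the homology is expressed through the Koszul complex, where the
   bounds \<open>m\<close> and \<open>D\<close> are available.\<close>
 have notS: "tcyc N KC i j \<subseteq> tbnd N KC i j \<longleftrightarrow> (i, j) \<notin> S" for i j
 proof -
  interpret p: presented_rep Q sclm "ac wt" "tcyc N KC i j" "T i j" "\<pi> i j" by (rule pr)
  have "carrier (T i j) = \<pi> i j ` tcyc N KC i j" by (simp add: p.pi(1))
  moreover have "\<zero>\<^bsub>T i j\<^esub> : carrier (T i j)" using p.pi(4) p.pi(6)[OF p.sub(1)] by simp
  ultimately have "carrier (T i j) = {\<zero>\<^bsub>T i j\<^esub>} \<longleftrightarrow> (\<forall>z\<in>tcyc N KC i j. \<pi> i j z = \<zero>\<^bsub>T i j\<^esub>)"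
   by (simp only: image_iff_singleton)
  moreover have "(i, j) \<notin> S \<longleftrightarrow> carrier (T i j) = {\<zero>\<^bsub>T i j\<^esub>}" by (simp add: S_def)
  moreover have "tcyc N KC i j \<subseteq> tbnd N KC i j \<longleftrightarrow> (\<forall>z\<in>tcyc N KC i j. \<pi> i j z = \<zero>\<^bsub>T i j\<^esub>)"
   unfolding subset_iff using ker[of _ i j] by (metis (no_types))
  ultimately show ?thesis by (simp only:)
 qed
 have SD: "S \<subseteq> {..m} \<times> {..<D}"
 proof clarify
  fix i j assume s: "(i, j) : S"
  have "i \<le> m"
  proof (rule ccontr)
   assume "\<not> i \<le> m"
   then have "tcyc N KC i j = {0}" using cycles_empty by simp
   moreover have "0 : tbnd N KC i j" using subrepD(1)[OF boundaries_subrep[OF graded_cplx_KC]] .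
   ultimately show False using notS[of i j] s by simp
  qed
  moreover have "j < D" using D[of j i] notS[of i j] s by (meson not_le)
  ultimately show "i : {..m} & j : {..<D}" by simp
 qed
 then show finS: "finite S" by (rule finite_subset) simp
 have c0: "c i j = 0" if "(i, j) \<notin> S" for i j
 proof -
  have "tcyc N KC i j = tbnd N KC i j" using notS that boundaries_cycles by blast
  then show ?thesis by (simp add: c_def)
 qed
 have 1: "(\<Sum>s\<in>S. sgnd (fst s) (cls Q (T (fst s) (snd s)))) - (\<Sum>s\<in>S. sgnd (fst s) (c (fst s) (snd s))) : relation_group Q"
  unfolding sum_subtractf[symmetric] sgnd_diff[symmetric] by (intro R.sum R.sgnd rel)
 have 2: "(\<Sum>s\<in>S. sgnd (fst s) (c (fst s) (snd s))) = (\<Sum>j<D. \<Sum>i\<le>m. sgnd i (c i j))"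
 proof -
  have "(\<Sum>s\<in>S. sgnd (fst s) (c (fst s) (snd s))) = (\<Sum>s\<in>{..m} \<times> {..<D}. sgnd (fst s) (c (fst s) (snd s)))"
   using SD c0 by (intro sum.mono_neutral_left) auto
  also have "... = (\<Sum>i\<le>m. \<Sum>j<D. sgnd i (c i j))" by (simp add: sum.cartesian_product case_prod_unfold)
  finally show ?thesis by (simp add: sum.swap[of _ "{..m}"])
 qed
 have 3: "(\<Sum>j<D. \<Sum>i\<le>m. sgnd i (lam (Vd i j))) - (\<Sum>j<D. \<Sum>i\<le>m. sgnd i (c i j)) : relation_group Q"
  unfolding sum_subtractf[of _ _ "{..<D}", symmetric]
  by (intro R.sum) (unfold c_def, rule euler_homology[OF relation_add_subgroup class_trivial class_d])
 have 4: "(\<Sum>j<D. \<Sum>i\<le>m. sgnd i (lam (Vd i j))) = (\<Sum>i\<le>m. sgnd i (\<Sum>j<D. lam (Vd i j)))"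
  unfolding sgnd_sum by (rule sum.swap)
 have 5: "(\<Sum>j<D. \<Sum>i\<le>m. sgnd i (lam (Vd i j))) - cls Q M : relation_group Q"
  unfolding 4 by (rule point_class) (rule D)
 have "(\<Sum>s\<in>S. sgnd (fst s) (cls Q (T (fst s) (snd s)))) - cls Q M : relation_group Q"
  by (rule R.trans[OF 1[unfolded 2] R.trans[OF R.sym[OF 3] 5]])
 then have eq: "relation_group Q #>\<^bsub>free_Abelian_group (fd_reps Q)\<^esub> (\<Sum>s\<in>S. sgnd (fst s) (cls Q (T (fst s) (snd s)))) = rep_class Q M"
  unfolding rep_class_cls by (rule grothendieck_coset_eq)
 have sg: "(if (-1) ^ i = (1::int) then x else - x) = sgnd i x" for i and x :: "('q,'k) urep \<Rightarrow>\<^sub>0 int"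
  by (cases "even i") (simp_all add: sgnd_def)
 have "finprod (grothendieck_group Q) (%s. rep_class Q (T (fst s) (snd s)) [^]\<^bsub>grothendieck_group Q\<^esub> ((-1) ^ fst s :: int)) S
  = relation_group Q #>\<^bsub>free_Abelian_group (fd_reps Q)\<^esub> (\<Sum>s\<in>S. if (-1) ^ fst s = (1::int) then cls Q (T (fst s) (snd s)) else - cls Q (T (fst s) (snd s)))"
 proof (rule grothendieck_finprod[OF finS])
  show "(-1) ^ fst s = (1::int) \<or> (-1) ^ fst s = (-1::int)" for s :: "nat \<times> nat" by (cases "even (fst s)") simp_all
  show "ky (cls Q (T (fst s) (snd s))) \<subseteq> fd_reps Q" for s
  proof -
   obtain U where "U : fd_reps Q" "cls Q (T (fst s) (snd s)) = frag_of U" using presented_rep.cls_ex[OF pr] by blast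
   then show ?thesis by simp
  qed
 qed
 then show "finprod (grothendieck_group Q) (%(i, j). rep_class Q (T i j) [^]\<^bsub>grothendieck_group Q\<^esub> ((-1) ^ i :: int)) S = rep_class Q M"
  unfolding sg eq case_prod_unfold .
qed

end

section \<open>The action of \<open>\<Gamma> \<times> C\<close>\<close>

abbreviation scf :: "'k::field => ('y \<Rightarrow>\<^sub>0 'k) => ('y \<Rightarrow>\<^sub>0 'k)" where "scf a \<equiv> Poly_Mapping.map (%x. a * x)"

lemma lookup_scf: "lk (scf a f) Y = a * lk f Y"
 by (simp add: Poly_Mapping.map.rep_eq when_def)

lemma mult_order_props:
 fixes x :: "'a::field"
 assumes "\<exists>d>0. x ^ d = 1"
 shows "mult_order x > 0" "x ^ mult_order x = 1" "x ^ a = 1 \<longleftrightarrow> mult_order x dvd a"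
  "x ^ a = x ^ b \<longleftrightarrow> a mod mult_order x = b mod mult_order x"
  "inj_on (%i. x ^ i) {..<mult_order x}"
proof -
 let ?n = "mult_order x"
 have L: "0 < ?n & x ^ ?n = 1" unfolding mult_order_def by (rule LeastI_ex) (use assms in blast)
 then show n: "?n > 0" "x ^ ?n = 1" by auto
 have x0: "x ~= 0" using n by (metis power_0_left zero_neq_one less_not_refl)
 have md: "x ^ a = x ^ (a mod ?n)" for a
  by (metis div_mult_mod_eq mult.commute mult_1 n(2) power_add power_mult power_one)
 have low: "i = j" if "i \<le> j" "j < ?n" "x ^ i = x ^ j" for i j
 proof (rule ccontr)
  assume "i ~= j"
  have "x ^ j = x ^ i * x ^ (j - i)" using that(1) by (simp add: power_add[symmetric])
  then have "x ^ (j - i) = 1" using that(3) x0 by simp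
  then have "?n \<le> j - i" unfolding mult_order_def using that(1) \<open>i ~= j\<close> by (intro Least_le) simp
  then show False using that(2) n(1) by linarith
 qed
 show inj: "inj_on (%i. x ^ i) {..<?n}"
  by (rule inj_onI) (metis lessThan_iff low nat_le_linear)
 show eq: "x ^ a = x ^ b \<longleftrightarrow> a mod ?n = b mod ?n" for a b
 proof
  assume "x ^ a = x ^ b"
  then have "x ^ (a mod ?n) = x ^ (b mod ?n)" using md by metis
  then show "a mod ?n = b mod ?n" using inj_onD[OF inj] n(1) by simp
 next
  assume "a mod ?n = b mod ?n" then show "x ^ a = x ^ b" using md by metis
 qed
 show "x ^ a = 1 \<longleftrightarrow> ?n dvd a" using eq[of a 0] by (simp add: dvd_eq_mod_eq_0)
qed

definition scl :: "'k::field => ('x,'k) mpol => ('x,'k) mpol" where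
 "scl a = msubst (%b. mconst a * mvar b)"

lemma rhom_scl: "rhom (scl a)" unfolding scl_def by (rule rhom_msubst)

lemma scl_mconst [simp]: "scl a (mconst b) = mconst b" by (simp add: scl_def)

lemma scl_homogeneous:
 assumes "hmg e p" shows "scl a p = mconst (a ^ e) * p"
proof -
 have mon: "mon (%b. mconst a * mvar b) \<mu> = mconst (a ^ mdeg \<mu>) * mon mvar \<mu>" for \<mu> :: "'a \<Rightarrow>\<^sub>0 nat"
  by (simp add: mon_def wdeg_def power_mult_distrib prod.distrib mconst_simps(7,9) power_sum)
 have "scl a p = (\<Sum>\<mu>\<in>ky p. mconst (lk p \<mu>) * (mconst (a ^ e) * mon mvar \<mu>))"
  unfolding scl_def msubst_ins ins_def mon using assms by (intro sum.cong refl) (simp add: homogeneous_iff)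
 also have "... = mconst (a ^ e) * (\<Sum>\<mu>\<in>ky p. sg \<mu> (lk p \<mu>))"
  unfolding sum_distrib_left by (intro sum.cong refl) (simp add: sg_mon mult.left_commute)
 finally show ?thesis using sum_monomials[of p] by simp
qed

lemma scl_scl: "scl a (scl b p) = scl (a * b) p"
proof -
 have "msubst (%b. mconst a * mvar b) (mconst b * mvar x) = mconst (a * b) * mvar x" for x :: 'a
  by (simp only: msubst_mconst_mult msubst_mvar mconst_simps(3) mult.assoc) (rule mult.left_commute)
 then show ?thesis unfolding scl_def msubst_msubst by (simp only:)
qed

lemma scl_1: "scl 1 p = p"
 by (simp add: scl_def mconst_simps(1) msubst_mvar_id)

context linear_action
begin

lemma pact_scl: "lin g ==> pact g (scl a p) = scl a (pact g p)"
proof -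
 assume g: "lin g"
 have "msubst (%b. mconst a * mvar b) (lform g b) = mconst a * lform g b" for b
  by (simp add: lform_def msubst_simps sum_distrib_left mult.left_commute)
 then show ?thesis unfolding pact_msubst[OF g] scl_def msubst_msubst by simp
qed

lemma eva_scl: "eva w (scl a p) = eva (scale a w) p"
proof -
 have "eva w (scl a p) = ins (%x. x) (%b. eva w (mconst a * mvar b)) p"
  unfolding scl_def eva_def by (rule ins_msubst) simp
 also have "(%b. eva w (mconst a * mvar b)) = coord (scale a w)"
  by (rule ext) (simp add: eva_simps coord_scale)
 also have "ins (%x. x) (coord (scale a w)) p = eva (scale a w) p" by (simp add: eva_def)
 finally show ?thesis .
qed

lemma scl_kV: "p : kV ==> scl a p : kV"
 unfolding scl_def by (erule msubst_closed) (auto intro!: mpol_ring_mult mpol_ring_add mpol_ring_mvar)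

lemma scl_invs: "subgrp U ==> p : invs U ==> scl a p : invs U"
 using subgrpD(1)[of U] by (simp add: invs_iff scl_kV pact_scl)

lemma subgroup_subgrp: "subgrp G ==> subgroup G (GL scale)"
proof (rule subgroup.intro)
 assume G: "subgrp G"
 show "G \<subseteq> carrier (GL scale)" using subgrpD(1)[OF G] by (auto simp: GL_simps)
 show "inv\<^bsub>GL scale\<^esub> x : G" if "x : G" for x using subgrpD(1,2)[OF G that] by (simp add: inv_GL)
qed (use subgrpD in \<open>auto simp: GL_simps\<close>)

lemma pow_GL: "lin g ==> g [^]\<^bsub>GL scale\<^esub> (a::nat) = g ^^ a"
proof (induction a)
 case 0
 then show ?case by (simp add: GL_simps monoid.nat_pow_0[OF group.is_monoid[OF group_GL]])
next
 case (Suc a)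
 then show ?case
  by (simp add: GL_simps monoid.nat_pow_Suc[OF group.is_monoid[OF group_GL]] funpow_Suc_right del: funpow.simps)
qed

lemma funpow_subgrp: "subgrp U ==> g : U ==> g ^^ a : U"
 by (induction a) (auto simp: subgrpD)

end

section \<open>The cyclic group generated by \<open>c\<close> and its character\<close>

locale cyclic_setting = regular_setting scale basis G m h dg H v
 for scale :: "'k::field => 'v::ab_group_add => 'v" and basis G m h dg H v +
 fixes c :: "'v => 'v" and \<zeta> :: 'k
 assumes cG: "c : G" and cv: "c v = scale \<zeta> v" and v0: "v ~= 0" and z0: "\<zeta> ~= 0"
begin

lemma c_pow_G: "c ^^ a : G" by (rule funpow_subgrp[OF G(1) cG])

lemma c_pow_v: "(c ^^ a) v = scale (\<zeta> ^ a) v"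
 by (induction a) (simp_all add: lin_scale[OF subgrpD(1)[OF G(1) cG]] cv mult.commute)

lemma scale_v: "scale a v = scale b v \<longleftrightarrow> a = b"
 using v0 V.scale_right_imp_eq by blast

text \<open>An element of \<open>G\<close> that fixes the regular vector is the identity, and powers
  of \<open>c\<close> act on that vector through powers of the eigenvalue. Hence \<open>c\<close>
  and \<open>\<zeta>\<close> have the same order.\<close>

lemma c_pow_eq: "c ^^ a = c ^^ b \<longleftrightarrow> \<zeta> ^ a = \<zeta> ^ b"
proof
 assume "c ^^ a = c ^^ b" then show "\<zeta> ^ a = \<zeta> ^ b" using c_pow_v scale_v by metis
next
 assume "\<zeta> ^ a = \<zeta> ^ b"
 then have e: "(c ^^ a) v = (c ^^ b) v" by (simp add: c_pow_v)
 have la: "lin (c ^^ a)" by (rule subgrpD(1)[OF G(1) c_pow_G])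
 have g: "finv (c ^^ a) o c ^^ b : G" by (intro subgrpD(2,4)[OF G(1)] c_pow_G)
 have "(finv (c ^^ a) o c ^^ b) v = v" using e lin_inv_eq(2)[OF la, of v] by (metis comp_apply)
 then have "finv (c ^^ a) o c ^^ b = id" by (rule reg[OF g])
 then have "c ^^ a o (finv (c ^^ a) o c ^^ b) = c ^^ a" by simp
 then show "c ^^ a = c ^^ b" using lin_inv_eq(4)[OF la] by (metis comp_assoc id_comp)
qed

lemma zeta_torsion: "\<exists>e>0. \<zeta> ^ e = 1"
proof -
 have "finite (range (%a. c ^^ a))" using c_pow_G G(2) by (meson finite_subset image_subsetI)
 then have "\<not> inj (%a::nat. c ^^ a)" using finite_imageD infinite_UNIV_nat by blast
 then obtain a b where "a ~= b" "c ^^ a = c ^^ b" unfolding inj_def by blast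
 then obtain a b where ab: "a < b" "c ^^ a = c ^^ b" by (metis linorder_neqE_nat)
 have "\<zeta> ^ b = \<zeta> ^ a * \<zeta> ^ (b - a)" using ab(1) by (simp add: power_add[symmetric])
 then have "\<zeta> ^ (b - a) = 1" using ab(2) c_pow_eq z0 by auto
 then show ?thesis using ab(1) by (intro exI[of _ "b - a"]) simp
qed

abbreviation "nn \<equiv> mult_order \<zeta>"

lemmas zeta = mult_order_props[OF zeta_torsion]

lemma c_pow_id: "c ^^ a = id \<longleftrightarrow> nn dvd a"
 using c_pow_eq[of a 0] zeta(3) by simp

abbreviation "CC \<equiv> generate (GL scale) {c}"

lemma c_inv: "finv c = c ^^ (nn - 1)"
proof -
 have "c o c ^^ (nn - 1) = id" using c_pow_id[of nn] zeta(1) by (metis Suc_diff_1 dvd_refl funpow.simps(2))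
 then have "finv c o (c o c ^^ (nn - 1)) = finv c" by simp
 then have "(finv c o c) o c ^^ (nn - 1) = finv c" by (simp only: comp_assoc)
 then show ?thesis by (simp only: lin_inv_eq(3)[OF subgrpD(1)[OF G(1) cG]] id_comp)
qed

lemma CC_eq: "CC = range (%a. c ^^ a)"
proof
 show "CC \<subseteq> range (%a. c ^^ a)"
 proof
  fix x assume "x : CC"
  then show "x : range (%a. c ^^ a)"
  proof (induction rule: generate.induct)
   case one
   show ?case by (rule image_eqI[of _ _ 0]) (simp_all add: GL_simps)
  next
   case (incl x)
   then show ?case by (intro image_eqI[of _ _ 1]) simp_all
  next
   case (inv x)
   then show ?case using c_inv inv_GL[OF subgrpD(1)[OF G(1) cG]] by auto
  next
   case (eng x y)
   then obtain a b where "x = c ^^ a" "y = c ^^ b" by blast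
   then show ?case by (intro image_eqI[of _ _ "a + b"]) (simp_all add: GL_simps funpow_add)
  qed
 qed
 show "range (%a. c ^^ a) \<subseteq> CC"
 proof clarify
  fix a :: nat
  show "c ^^ a : CC"
  proof (induction a)
   case 0
   show ?case using generate.one[of "GL scale" "{c}"] by (simp only: GL_simps funpow.simps(1))
  next
   case (Suc a)
   from generate.eng[OF generate.incl[OF singletonI] Suc] show ?case by (simp only: GL_simps funpow.simps(2))
  qed
 qed
qed

text \<open>Identifies the character, given by a least exponent, with the eigenvalue on
  \<open>v\<close>; multiplicativity then follows from composition of maps instead of arithmetic of
  exponents.\<close>

lemma chi_v: "hc : CC ==> hc v = scale (cyc_char scale c \<zeta> hc) v"
proof -
 assume "hc : CC"
 then obtain a where a: "hc = c ^^ a" using CC_eq by blast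
 let ?L = "LEAST a::nat. c [^]\<^bsub>GL scale\<^esub> a = hc"
 have "c [^]\<^bsub>GL scale\<^esub> ?L = hc" by (rule LeastI[of _ a]) (simp add: a pow_GL subgrpD(1)[OF G(1) cG])
 then have "hc = c ^^ ?L" by (simp add: pow_GL subgrpD(1)[OF G(1) cG])
 then have "hc v = scale (\<zeta> ^ ?L) v" by (metis c_pow_v)
 then show ?thesis by (simp add: cyc_char_def)
qed

lemma CC_G: "hc : CC ==> hc : G" unfolding CC_eq using c_pow_G by blast

section \<open>The normalizer, its quotient by \<open>H\<close>, and the action on
  invariants\<close>

definition NG where "NG = normalizer ((GL scale)\<lparr>carrier := G\<rparr>) H"

lemma inv_G: "g : G ==> inv\<^bsub>(GL scale)\<lparr>carrier := G\<rparr>\<^esub> g = finv g"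
 using group.m_inv_consistent[OF group_GL subgroup_subgrp[OF G(1)]] inv_GL subgrpD(1)[OF G(1)] by simp

lemma NG_iff: "\<gamma> : NG \<longleftrightarrow> \<gamma> : G & (%u. \<gamma> o u o finv \<gamma>) ` H = H"
proof -
 have "\<gamma> <#\<^bsub>(GL scale)\<lparr>carrier := G\<rparr>\<^esub> H #>\<^bsub>(GL scale)\<lparr>carrier := G\<rparr>\<^esub> (inv\<^bsub>(GL scale)\<lparr>carrier := G\<rparr>\<^esub> \<gamma>)
  = (%u. \<gamma> o u o finv \<gamma>) ` H" if "\<gamma> : G"
  unfolding inv_G[OF that] by (auto simp: l_coset_def r_coset_def GL_def)
 then show ?thesis using H(2) by (auto simp: NG_def normalizer_def stabilizer_def)
qed

lemma conj_mem: "\<gamma> : NG ==> u : H ==> \<gamma> o u o finv \<gamma> : H"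
 using NG_iff by blast

lemma NG_G: "\<gamma> : NG ==> \<gamma> : G" by (simp add: NG_iff)

lemma conj_ex: "\<gamma> : NG ==> u : H ==> \<exists>w\<in>H. u o \<gamma> = \<gamma> o w"
proof -
 assume g: "\<gamma> : NG" and u: "u : H"
 then obtain w where w: "w : H" "u = \<gamma> o w o finv \<gamma>" using NG_iff by blast
 then have "u o \<gamma> = \<gamma> o w" using lin_inv_eq(3)[OF subgrpD(1)[OF G(1) NG_G[OF g]]] by (simp add: comp_assoc)
 then show ?thesis using w(1) by blast
qed

lemma conj_left: "\<gamma> : NG ==> u : H ==> \<exists>w\<in>H. \<gamma> o u = w o \<gamma>"
proof -
 assume g: "\<gamma> : NG" and u: "u : H"
 have "(\<gamma> o u o finv \<gamma>) o \<gamma> = \<gamma> o u" using lin_inv_eq(3)[OF subgrpD(1)[OF G(1) NG_G[OF g]]] by (simp add: comp_assoc)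
 then show ?thesis using conj_mem[OF g u] by metis
qed

lemma H_NG: "H \<subseteq> NG"
proof
 fix u assume u: "u : H"
 note s = subgrpD[OF H(1)]
 have "(%w. u o w o finv u) ` H = H"
 proof
  show "(%w. u o w o finv u) ` H \<subseteq> H" by (rule image_subsetI) (rule s(4)[OF s(4)[OF u] s(2)[OF u]])
  show "H \<subseteq> (%w. u o w o finv u) ` H"
  proof
   fix w assume w: "w : H"
   have "u o (finv u o w o u) o finv u = (u o finv u) o w o (u o finv u)" by (simp only: comp_assoc)
   then have "u o (finv u o w o u) o finv u = w" by (simp only: lin_inv_eq(4)[OF s(1)[OF u]] id_comp comp_id)
   moreover have "finv u o w o u : H" by (rule s(4)[OF s(4)[OF s(2)[OF u] w] u])
   ultimately show "w : (%w. u o w o finv u) ` H" by (metis image_eqI)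
  qed
 qed
 then show "u : NG" using u H(2) NG_iff by blast
qed

lemma NG_subgroup: "subgroup NG (GL scale)"
proof -
 have gG: "group ((GL scale)\<lparr>carrier := G\<rparr>)" by (rule subgroup.subgroup_is_group[OF subgroup_subgrp[OF G(1)] group_GL])
 have "subgroup NG ((GL scale)\<lparr>carrier := G\<rparr>)"
  unfolding NG_def by (rule group.normalizer_imp_subgroup[OF gG]) (use H(2) in simp)
 then show ?thesis by (rule group.incl_subgroup[OF group_GL subgroup_subgrp[OF G(1)]])
qed

abbreviation "GN \<equiv> (GL scale)\<lparr>carrier := NG\<rparr>"

lemma GN_group: "group GN" by (rule subgroup.subgroup_is_group[OF NG_subgroup group_GL])

lemma H_normal: "H \<lhd> GN"
 unfolding group.normal_inv_iff[OF GN_group]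
proof
 show "subgroup H GN" by (rule group.subgroup_incl[OF group_GL subgroup_subgrp[OF H(1)] NG_subgroup H_NG])
 have "inv\<^bsub>GN\<^esub> x = finv x" if "x : NG" for x
  using group.m_inv_consistent[OF group_GL NG_subgroup that] inv_GL subgrpD(1)[OF G(1) NG_G[OF that]] by simp
 then show "\<forall>x\<in>carrier GN. \<forall>h\<in>H. x \<otimes>\<^bsub>GN\<^esub> h \<otimes>\<^bsub>GN\<^esub> inv\<^bsub>GN\<^esub> x : H"
  using conj_mem by (simp add: GL_simps)
qed

abbreviation "QQ \<equiv> Gamma_C scale G H c"

lemma quot_simps:
 "carrier (quot_normalizer scale G H) = hcos ` NG" "\<one>\<^bsub>quot_normalizer scale G H\<^esub> = H"
 "\<gamma> : NG ==> \<gamma>' : NG ==> hcos \<gamma> \<otimes>\<^bsub>quot_normalizer scale G H\<^esub> hcos \<gamma>' = hcos (\<gamma> o \<gamma>')"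
proof -
 have q: "quot_normalizer scale G H = GN Mod H" by (simp add: quot_normalizer_def NG_def)
 have rc: "H #>\<^bsub>GN\<^esub> x = hcos x" for x by (auto simp: r_coset_def hcos_def GL_def)
 show "carrier (quot_normalizer scale G H) = hcos ` NG" unfolding q FactGroup_def RCOSETS_def rc by auto
 show "\<one>\<^bsub>quot_normalizer scale G H\<^esub> = H" unfolding q by (simp add: FactGroup_def)
 show "hcos \<gamma> \<otimes>\<^bsub>quot_normalizer scale G H\<^esub> hcos \<gamma>' = hcos (\<gamma> o \<gamma>')" if "\<gamma> : NG" "\<gamma>' : NG"
  using normal.rcos_sum[OF H_normal, of \<gamma> \<gamma>'] that unfolding q rc by (simp add: FactGroup_def GL_simps)
qed

lemma QQ_simps:
 "carrier QQ = hcos ` NG \<times> CC" "\<one>\<^bsub>QQ\<^esub> = (H, id)"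
 "q \<otimes>\<^bsub>QQ\<^esub> q' = (fst q \<otimes>\<^bsub>quot_normalizer scale G H\<^esub> fst q', snd q o snd q')"
 by (simp_all add: Gamma_C_def DirProd_def quot_simps(1,2) cyclic_group_def GL_def case_prod_unfold)

lemma QQ_group: "group QQ"
 unfolding Gamma_C_def
proof (rule DirProd_group)
 show "group (quot_normalizer scale G H)"
  using normal.factorgroup_is_group[OF H_normal] by (simp add: quot_normalizer_def NG_def)
 have "subgroup CC (GL scale)"
  by (rule group.generate_is_subgroup[OF group_GL]) (use subgrpD(1)[OF G(1) cG] in \<open>simp add: GL_simps\<close>)
 then show "group (cyclic_group scale c)"
  unfolding cyclic_group_def by (rule subgroup.subgroup_is_group[OF _ group_GL])
qed

abbreviation "chi \<equiv> %(K :: ('v => 'v) set, h). cyc_char scale c \<zeta> h"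
abbreviation "iact \<equiv> inv_act scale basis c \<zeta>"

lemma iact_alt: "iact q p = scl (chi q) (pact (SOME \<gamma>. \<gamma> : fst q) p)"
 by (simp add: inv_act_def scl_def pact_def case_prod_unfold)

lemma pact_invs: "\<gamma> : NG ==> n : invs_H ==> pact \<gamma> n : invs_H"
proof -
 assume g: "\<gamma> : NG" and n: "n : invs_H"
 have lg: "lin \<gamma>" by (rule subgrpD(1)[OF G(1) NG_G[OF g]])
 have "pact u (pact \<gamma> n) = pact \<gamma> n" if u: "u : H" for u
 proof -
  obtain w where w: "w : H" "u o \<gamma> = \<gamma> o w" using conj_ex[OF g u] by blast
  have "pact u (pact \<gamma> n) = pact \<gamma> (pact w n)"
   using pact_comp[OF subgrpD(1)[OF H(1) u] lg, of n] pact_comp[OF lg subgrpD(1)[OF H(1) w(1)], of n] w(2) by simp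
  then show ?thesis using n w(1) by (simp add: invs_iff)
 qed
 then show ?thesis using n by (simp add: invs_iff pact_kV)
qed

text \<open>Representatives of the coset differ by elements of \<open>H\<close> on the left, and
  these act trivially because \<open>\<gamma>\<close> preserves the \<open>H\<close>-invariants; so
  the choice operator in the action is harmless.\<close>

lemma iact_coset: "\<gamma> : NG ==> n : invs_H ==> iact (hcos \<gamma>, hc) n = scl (cyc_char scale c \<zeta> hc) (pact \<gamma> n)"
proof -
 assume g: "\<gamma> : NG" and n: "n : invs_H"
 have "(SOME \<delta>. \<delta> : hcos \<gamma>) : hcos \<gamma>" by (rule someI[of "%\<delta>. \<delta> : hcos \<gamma>", OF cos_self])
 then obtain u where u: "u : H" "(SOME \<delta>. \<delta> : hcos \<gamma>) = u o \<gamma>" by (rule cosE)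
 have "pact (u o \<gamma>) n = pact \<gamma> n"
  using pact_comp[OF subgrpD(1)[OF H(1) u(1)] subgrpD(1)[OF G(1) NG_G[OF g]], of n] pact_invs[OF g n] u(1) by (simp add: invs_iff)
 then show ?thesis by (simp add: iact_alt u(2))
qed

lemma QQ_cases:
 assumes "q : carrier QQ" obtains \<gamma> hc where "\<gamma> : NG" "hc : CC" "q = (hcos \<gamma>, hc)"
 using assms by (auto simp: QQ_simps)

lemma chi_comp: "hc : CC ==> he : CC ==> cyc_char scale c \<zeta> (hc o he) = cyc_char scale c \<zeta> hc * cyc_char scale c \<zeta> he"
proof -
 assume h: "hc : CC" "he : CC"
 have hh: "hc o he : CC" using generate.eng[OF h] by (simp add: GL_simps)
 have "scale (cyc_char scale c \<zeta> (hc o he)) v = hc (he v)" using chi_v[OF hh] by simp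
 also have "... = scale (cyc_char scale c \<zeta> hc * cyc_char scale c \<zeta> he) v"
  by (simp add: chi_v[OF h(1)] chi_v[OF h(2)] lin_scale[OF subgrpD(1)[OF G(1) CC_G[OF h(1)]]] mult.commute)
 finally show ?thesis using scale_v by blast
qed

lemma hcos_mult: "\<gamma> : NG ==> hcos \<gamma> <#>\<^bsub>GL scale\<^esub> hcos g = hcos (\<gamma> o g)"
proof
 assume g: "\<gamma> : NG"
 show "hcos \<gamma> <#>\<^bsub>GL scale\<^esub> hcos g \<subseteq> hcos (\<gamma> o g)"
 proof
  fix x assume "x : hcos \<gamma> <#>\<^bsub>GL scale\<^esub> hcos g"
  then obtain u w where x: "u : H" "w : H" "x = (u o \<gamma>) o (w o g)"
   by (auto simp: set_mult_def GL_simps hcos_def)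
  obtain w' where w': "w' : H" "\<gamma> o w = w' o \<gamma>" using conj_left[OF g x(2)] by blast
  have "x = u o (\<gamma> o w) o g" by (simp add: x(3) comp_assoc)
  then have "x = (u o w') o (\<gamma> o g)" unfolding w'(2) by (simp add: comp_assoc)
  then show "x : hcos (\<gamma> o g)" unfolding hcos_def using subgrpD(4)[OF H(1) x(1) w'(1)] by blast
 qed
 show "hcos (\<gamma> o g) \<subseteq> hcos \<gamma> <#>\<^bsub>GL scale\<^esub> hcos g"
 proof
  fix x assume "x : hcos (\<gamma> o g)"
  then obtain u where "u : H" "x = u o (\<gamma> o g)" by (rule cosE)
  then have "x = (u o \<gamma>) o g" "u o \<gamma> : hcos \<gamma>" by (auto simp: comp_assoc hcos_def)
  then show "x : hcos \<gamma> <#>\<^bsub>GL scale\<^esub> hcos g" using cos_self[of g] by (auto simp: set_mult_def GL_simps)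
 qed
qed

lemma hcos_right: "hcos g #>\<^bsub>GL scale\<^esub> x = hcos (g o x)"
 by (auto simp: r_coset_def GL_simps hcos_def comp_assoc)

text \<open>Scaling the point \<open>g v\<close> by the eigenvalue of \<open>hc\<close> gives
  \<open>g (hc v)\<close>, so the scalar action of \<open>C\<close> on polynomials becomes right
  translation on cosets. Both sides at the coset of \<open>g\<close> are the value of
  \<open>Th n\<close> at the coset of \<open>finv \<gamma> o g o hc\<close>.\<close>

lemma Th_equivariant:
 assumes q: "q : carrier QQ" and n: "n : invs_H"
 shows "Th (iact q n) = act (coset_rep scale G H) q (Th n)"
proof -
 obtain \<gamma> hc where q': "\<gamma> : NG" "hc : CC" "q = (hcos \<gamma>, hc)" using QQ_cases[OF q] .
 have lg: "lin \<gamma>" "\<gamma> : G" and lh: "lin hc" "hc : G" using subgrpD(1)[OF G(1)] NG_G[OF q'(1)] CC_G[OF q'(2)] by auto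
 note s = subgrpD[OF G(1)]
 let ?\<sigma> = "%Y. (hcos \<gamma> <#>\<^bsub>GL scale\<^esub> Y) #>\<^bsub>GL scale\<^esub> (inv\<^bsub>GL scale\<^esub> hc)"
 have \<sigma>: "?\<sigma> (hcos g) = hcos (\<gamma> o g o finv hc)" for g
  by (simp add: hcos_mult[OF q'(1)] hcos_right inv_GL[OF lh(1)])
 have act: "act (coset_rep scale G H) q (Th n) = (\<Sum>Y\<in>ky (Th n). sg (?\<sigma> Y) (lk (Th n) Y))"
  by (simp add: coset_rep_def q'(3))
 have \<sigma>_RC: "?\<sigma> Y : RC" if Y: "Y : RC" for Y
 proof -
  obtain g where "g : G" "Y = hcos g" using Y by (auto simp: RC_def)
  then show ?thesis unfolding RC_def using \<sigma> s(2,4) lg lh by (intro image_eqI[of _ _ "\<gamma> o g o finv hc"]) auto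
 qed
 show ?thesis unfolding act
 proof (rule Th_eqI)
  show "ky (\<Sum>Y\<in>ky (Th n). sg (?\<sigma> Y) (lk (Th n) Y)) \<subseteq> RC"
  proof (rule subset_trans[OF keys_sum], rule UN_least)
   fix Y assume "Y : ky (Th n)"
   then have "?\<sigma> Y : RC" using \<sigma>_RC keys_Th by blast
   then show "ky (sg (?\<sigma> Y) (lk (Th n) Y)) \<subseteq> RC" by simp
  qed
  fix g assume g: "g : G"
  let ?g = "finv \<gamma> o g o hc"
  have gG: "?g : G" using s(2,4) lg lh g by auto
  have "lk (Th (iact q n)) (hcos g) = eva (g v) (scl (cyc_char scale c \<zeta> hc) (pact \<gamma> n))"
   unfolding q'(3) iact_coset[OF q'(1) n] by (rule Th_cos[OF scl_invs[OF H(1) pact_invs[OF q'(1) n]] g])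
  also have "... = eva (finv \<gamma> (scale (cyc_char scale c \<zeta> hc) (g v))) n"
   by (simp add: eva_scl eva_pact[OF lg(1)])
  also have "scale (cyc_char scale c \<zeta> hc) (g v) = g (hc v)"
   by (simp add: chi_v[OF q'(2)] lin_scale[OF s(1)[OF g]])
  also have "eva (finv \<gamma> (g (hc v))) n = lk (Th n) (hcos ?g)" using Th_cos[OF n gG] by simp
  finally have lhs: "lk (Th (iact q n)) (hcos g) = lk (Th n) (hcos ?g)" .
  have \<sigma>_iff: "?\<sigma> Y = hcos g \<longleftrightarrow> Y = hcos ?g" if Y: "Y : RC" for Y
  proof
   have c1: "\<gamma> o ?g o finv hc = g"
   proof -
   have "\<gamma> o ?g o finv hc = (\<gamma> o finv \<gamma>) o g o (hc o finv hc)" by (simp only: comp_assoc)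
   then show ?thesis by (simp only: lin_inv_eq(4)[OF lg(1)] lin_inv_eq(4)[OF lh(1)] id_comp comp_id)
   qed
   { assume "Y = hcos ?g"
   then show "?\<sigma> Y = hcos g" using \<sigma>[of ?g] unfolding c1 by simp }
   obtain g' where g': "g' : G" "Y = hcos g'" using Y by (auto simp: RC_def)
   { assume "?\<sigma> Y = hcos g"
   then have "hcos (\<gamma> o g' o finv hc) = hcos g" unfolding g'(2) \<sigma> .
   then obtain u where u: "u : H" "\<gamma> o g' o finv hc = u o g" using cos_eq_iff[OF g] by blast
   have fN: "finv \<gamma> : NG" using subgroup.m_inv_closed[OF NG_subgroup q'(1)] inv_GL[OF lg(1)] by simp
   obtain w where w: "w : H" "finv \<gamma> o u = w o finv \<gamma>" using conj_left[OF fN u(1)] by blast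
   have "(finv \<gamma> o \<gamma>) o g' o (finv hc o hc) = finv \<gamma> o (\<gamma> o g' o finv hc) o hc" by (simp only: comp_assoc)
   then have "g' = finv \<gamma> o (u o g) o hc"
   unfolding u(2) by (simp only: lin_inv_eq(3)[OF lg(1)] lin_inv_eq(3)[OF lh(1)] id_comp comp_id)
   also have "... = (finv \<gamma> o u) o g o hc" by (simp only: comp_assoc)
   also have "... = w o ?g" unfolding w(2) by (simp only: comp_assoc)
   finally show "Y = hcos ?g" unfolding g'(2) using cos_eqI[OF gG w(1)] by simp }
  qed
  have Y0: "hcos ?g : RC" using gG by (simp add: RC_def)
  have "lk (\<Sum>Y\<in>ky (Th n). sg (?\<sigma> Y) (lk (Th n) Y)) (hcos g) = (\<Sum>Y\<in>ky (Th n). if Y = hcos ?g then lk (Th n) Y else 0)"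
   unfolding lookup_sum lookup_single
  proof (intro sum.cong refl)
   fix Y assume "Y : ky (Th n)"
   then have "Y : RC" using keys_Th by blast
   from \<sigma>_iff[OF this] show "(lk (Th n) Y when ?\<sigma> Y = hcos g) = (if Y = hcos ?g then lk (Th n) Y else 0)"
   by (simp add: when_def)
  qed
  also have "... = lk (Th n) (hcos ?g)"
   unfolding sum.delta[OF finite_keys] by (simp add: in_keys_iff)
  finally show "lk (Th (iact q n)) (hcos g) = lk (\<Sum>Y\<in>ky (Th n). sg (?\<sigma> Y) (lk (Th n) Y)) (hcos g)"
   using lhs by simp
 qed
qed

text \<open>The invariant has the same value at \<open>v\<close> and at \<open>hc v\<close>, a
  scalar multiple of \<open>v\<close>, and homogeneity compares the two. A nonzero value thus forces
  the power of the character to be 1.\<close>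

lemma eva_CC: "hmg e p ==> p : invs_G ==> hc : CC ==> eva v p = cyc_char scale c \<zeta> hc ^ e * eva v p"
proof -
 assume p: "hmg e p" "p : invs_G" and hc: "hc : CC"
 have "eva v p = eva (hc v) p" using eva_invs[OF p(2) G(1) CC_G[OF hc]] by simp
 also have "... = eva v (scl (cyc_char scale c \<zeta> hc) p)" by (simp add: chi_v[OF hc] eva_scl)
 finally show ?thesis by (simp add: scl_homogeneous[OF p(1)] eva_simps)
qed

sublocale equivariant_point basis invs_G m h dg "card G" invs_H "eva v" "transfer H" ff "transfer G pp" Th
 QQ chi iact "coset_rep scale G H"
proof (rule equivariant_point.intro[OF koszul_point_axioms], rule equivariant_point_axioms.intro)
 note ps = pact_simps(2,3) rhomD(2,3)[OF rhom_scl]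
 show "group QQ" by (rule QQ_group)
 show "iact q (p + p') = iact q p + iact q p'" for q p p' by (simp add: iact_alt ps)
 show "iact q (mconst a * p) = mconst a * iact q p" for q a p by (simp add: iact_alt ps)
 show "hmg e (iact q p)" if "hmg e p" for q e p
  unfolding iact_alt scl_homogeneous[OF pact_homogeneous[OF that]] by (rule homogeneous_mconst_mult[OF pact_homogeneous[OF that]])
 show "iact q p : invs_H" if "q : carrier QQ" "p : invs_H" for q p
  using QQ_cases[OF that(1)] iact_coset[OF _ that(2)] scl_invs[OF H(1) pact_invs[OF _ that(2)]] by metis
 show "iact q (p * f) = mconst (chi q ^ e) * (iact q p * f)"
  if q: "q : carrier QQ" and p: "p : invs_H" and f: "f : invs_G" "hmg e f" for q p f e
 proof -
  obtain \<gamma> hc where q': "\<gamma> : NG" "hc : CC" "q = (hcos \<gamma>, hc)" using QQ_cases[OF q] .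
  have pf: "p * f : invs_H" using NN.N.mult[OF p] f(1) invs_G_subset by blast
  have "pact \<gamma> f = f" using f(1) NG_G[OF q'(1)] by (simp add: invs_iff)
  then show ?thesis unfolding q'(3) iact_coset[OF q'(1) pf] iact_coset[OF q'(1) p]
   by (simp add: ps scl_homogeneous[OF f(2)] mult_ac)
 qed
 have hid: "H = hcos id" unfolding hcos_def by (simp add: comp_id)
 have idN: "id : NG" using H_NG subgrpD(3)[OF H(1)] by blast
 have idC: "id : CC" using generate.one[of "GL scale" "{c}"] by (simp add: GL_simps)
 have chi1: "cyc_char scale c \<zeta> id = 1"
 proof -
  have "scale (cyc_char scale c \<zeta> id) v = scale 1 v" using chi_v[OF idC, symmetric] by simp
  then show ?thesis using scale_v by blast
 qed
 show "iact \<one>\<^bsub>QQ\<^esub> p = p" if p: "p : invs_H" for p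
  unfolding QQ_simps(2) using iact_coset[OF idN p, of id, folded hid] chi1 p by (simp add: scl_1 pact_id invs_kV)
 show "iact (q \<otimes>\<^bsub>QQ\<^esub> q') p = iact q (iact q' p)"
  if q: "q : carrier QQ" "q' : carrier QQ" and p: "p : invs_H" for q q' p
 proof -
  obtain \<gamma> hc where q1: "\<gamma> : NG" "hc : CC" "q = (hcos \<gamma>, hc)" using QQ_cases[OF q(1)] .
  obtain \<gamma>' he where q2: "\<gamma>' : NG" "he : CC" "q' = (hcos \<gamma>', he)" using QQ_cases[OF q(2)] .
  have l: "lin \<gamma>" "lin \<gamma>'" using subgrpD(1)[OF G(1)] NG_G q1 q2 by auto
  have gg: "\<gamma> o \<gamma>' : NG" using subgroup.m_closed[OF NG_subgroup q1(1) q2(1)] by (simp add: GL_simps)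
  have i2: "iact q' p : invs_H" unfolding q2(3) iact_coset[OF q2(1) p] by (rule scl_invs[OF H(1) pact_invs[OF q2(1) p]])
  have "iact (q \<otimes>\<^bsub>QQ\<^esub> q') p = scl (cyc_char scale c \<zeta> (hc o he)) (pact (\<gamma> o \<gamma>') p)"
   unfolding QQ_simps(3) q1(3) q2(3) using quot_simps(3)[OF q1(1) q2(1)] iact_coset[OF gg p] by simp
  also have "... = scl (cyc_char scale c \<zeta> hc) (pact \<gamma> (scl (cyc_char scale c \<zeta> he) (pact \<gamma>' p)))"
   by (simp add: chi_comp[OF q1(2) q2(2)] pact_comp[OF l] pact_scl[OF l(1)] scl_scl)
  also have "... = iact q (iact q' p)"
   using iact_coset[OF q1(1) i2, of hc] unfolding q1(3) q2(3) iact_coset[OF q2(1) p] by simp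
  finally show ?thesis .
 qed
 show "chi \<one>\<^bsub>QQ\<^esub> = 1" by (simp add: QQ_simps(2) chi1)
 show "chi (q \<otimes>\<^bsub>QQ\<^esub> q') = chi q * chi q'" if q: "q : carrier QQ" "q' : carrier QQ" for q q'
 proof -
  obtain \<gamma> hc where q1: "\<gamma> : NG" "hc : CC" "q = (hcos \<gamma>, hc)" using QQ_cases[OF q(1)] .
  obtain \<gamma>' he where q2: "\<gamma>' : NG" "he : CC" "q' = (hcos \<gamma>', he)" using QQ_cases[OF q(2)] .
  show ?thesis unfolding QQ_simps(3) q1(3) q2(3) by (simp add: chi_comp[OF q1(2) q2(2)])
 qed
 show "chi q ^ dg s = 1" if q: "q : carrier QQ" and s: "s < m" "eva v (h s) ~= 0" for q s
 proof -
  obtain \<gamma> hc where "\<gamma> : NG" "hc : CC" "q = (hcos \<gamma>, hc)" using QQ_cases[OF q] .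
  then show ?thesis using eva_CC[OF h_hom[OF s(1)] h_A[OF s(1)], of hc] s(2) by simp
 qed
 show "presents QQ (%a p. mconst a * p) iact invs_H (coset_rep scale G H) Th"
  unfolding presents_def
 proof (intro conjI ballI allI)
  show "Th ` invs_H = carrier (coset_rep scale G H)" by (simp add: Th_onto coset_rep_def RC_eq)
  show "Th (x + y) = Th x \<oplus>\<^bsub>coset_rep scale G H\<^esub> Th y" for x y by (simp add: Th_add coset_rep_def)
  show "Th (mconst a * x) = a \<odot>\<^bsub>coset_rep scale G H\<^esub> Th x" for a x
   by (rule poly_mapping_eqI) (simp add: coset_rep_def lookup_Th lookup_scf eva_simps)
  show "Th 0 = \<zero>\<^bsub>coset_rep scale G H\<^esub>" by (simp add: coset_rep_def Theta_0)
  show "Th (iact q x) = act (coset_rep scale G H) q (Th x)" if "q : carrier QQ" "x : invs_H" for q x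
   by (rule Th_equivariant[OF that])
 qed
 show "\<zero>\<^bsub>coset_rep scale G H :: (_, 'k, _) rep\<^esub> = 0" by (simp add: coset_rep_def)
qed

end

section \<open>Hilbert series\<close>

lemma dim_zero: "vector_space sc ==> vector_space.dim sc {0} = 0"
proof -
 assume "vector_space sc"
 then interpret vector_space sc .
 show ?thesis by (rule dim_unique[of "{}"]) (simp_all add: independent_empty)
qed

lemma zero_add_subgroup: "add_subgroup {0}"
 by unfold_locales auto

lemma kwt_eq_0: "b : kgens m i ==> (!!s. s < m ==> 0 < dg s) ==> kwt dg b = 0 ==> i = 0"
proof -
 assume b: "b : kgens m i" and dg: "!!s. s < m ==> 0 < dg s" and w: "kwt dg b = 0"
 obtain T where T: "T \<subseteq> {..<m}" "card T = i" "b = set_encode T" using b by (auto simp: kgens_def ksub_def)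
 have finT: "finite T" using T(1) finite_subset by blast
 have "sum dg T = 0" using w finT unfolding T(3) kwt_def by simp
 then have "\<forall>s\<in>T. dg s = 0" using finT by simp
 then have "T = {}" using dg T(1) by (metis all_not_in_conv lessThan_iff less_irrefl subsetD)
 then show ?thesis using T(2) by simp
qed

context koszul_point
begin

definition hN :: "nat => nat" where
 "hN e = vector_space.dim (%a p. mconst a * p) {p : N. hmg e p}"

lemma ftd_subspace: "svs.subspace (ftd N B w j)"
 by (simp add: svs.subspace_def NN.ftd_add NN.ftd_sc)

lemma ftd_fdim: "finite B ==> fdim sclm (ftd N B w j)"
proof (rule fdim_subset[OF vector_space_smul fdim_bounded[OF _ finI] ftd_subspace])
 show "ftd N B w j \<subseteq> {u. ky u \<subseteq> B & (ALL b. \<forall>\<mu>\<in>ky (lk u b). ky \<mu> \<subseteq> I & mdeg \<mu> < Suc j)}"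
 proof clarify
  fix u assume u: "u : ftd N B w j"
  have "ky \<mu> \<subseteq> I & mdeg \<mu> < Suc j" if \<mu>: "\<mu> : ky (lk u b)" for b \<mu>
  proof -
   have "b : ky u" using \<mu> by (auto simp: in_keys_iff)
   then have "hmg (j - w b) (lk u b)" using u by (simp add: NN.ftd_iff)
   then show ?thesis using \<mu> NN.ft_lookup[OF NN.ftd_ft[OF u], of b] NS
   unfolding mpol_ring_def homogeneous_iff by fastforce
  qed
  then show "ky u \<subseteq> B & (ALL b. \<forall>\<mu>\<in>ky (lk u b). ky \<mu> \<subseteq> I & mdeg \<mu> < Suc j)"
   using NN.ftd_ft[OF u] by (simp add: NN.ft_iff)
 qed
qed

text \<open>Generators are split off one at a time, by rank and nullity of the coefficient map at a
  generator.\<close>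

lemma dim_ftd: "finite B ==> svs.dim (ftd N B w j) = (\<Sum>b\<in>B. if w b \<le> j then hN (j - w b) else 0)"
proof (induction B rule: finite_induct)
 case empty
 have "x = 0" if "x : ftd N {} w j" for x
  using NN.ftd_ft[OF that] by (simp add: NN.ft_iff)
 then have "ftd N {} w j = {0}" using NN.ftd_0 by blast
 then show ?case by (simp add: dim_zero[OF vector_space_smul])
next
 case (insert b B)
 let ?Z = "ftd N (insert b B) w j"
 have "svs.dim ?Z = svs.dim {u\<in>?Z. lk u b = 0} + vector_space.dim (%a p. mconst a * p) ((%u. lk u b) ` ?Z)"
  by (rule rank_nullity[OF vector_space_smul vector_space_mpol ftd_subspace ftd_fdim])
   (use insert.hyps in \<open>simp_all add: lookup_add lookup_smul\<close>)
 moreover have "{u\<in>?Z. lk u b = 0} = ftd N B w j"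
 proof (intro equalityI subsetI)
  fix u assume u: "u : {u\<in>?Z. lk u b = 0}"
  then have "b \<notin> ky u" by (simp add: not_in_keys_iff_lookup_eq_zero)
  then show "u : ftd N B w j" using u by (auto simp: NN.ftd_iff NN.ft_iff)
 next
  fix u assume u: "u : ftd N B w j"
  then have "b \<notin> ky u" using insert.hyps(2) by (auto simp: NN.ftd_iff NN.ft_iff)
  then show "u : {u\<in>?Z. lk u b = 0}" using u by (auto simp: NN.ftd_iff NN.ft_iff not_in_keys_iff_lookup_eq_zero)
 qed
 moreover have "vector_space.dim (%a p. mconst a * p) ((%u. lk u b) ` ?Z) = (if w b \<le> j then hN (j - w b) else 0)"
 proof (cases "w b \<le> j")
  case True
  have "(%u. lk u b) ` ?Z = {p : N. hmg (j - w b) p}"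
  proof (intro equalityI subsetI)
   fix p assume "p : (%u. lk u b) ` ?Z"
   then obtain u where u: "u : ?Z" "p = lk u b" by blast
   have "hmg (j - w b) p"
   proof (cases "b : ky u")
   case True
   then show ?thesis using u by (simp add: NN.ftd_iff)
   qed (simp add: u(2) not_in_keys_iff_lookup_eq_zero)
   then show "p : {p : N. hmg (j - w b) p}" using u NN.ft_lookup[OF NN.ftd_ft[OF u(1)]] by simp
  next
   fix p assume p: "p : {p : N. hmg (j - w b) p}"
   have "sg b p : ftd N (insert b B) w ((j - w b) + w b)" by (rule NN.ftd_single) (use p in auto)
   then have "sg b p : ?Z" using True by simp
   then show "p : (%u. lk u b) ` ?Z" by (rule rev_image_eqI) simp
  qed
  then show ?thesis using True by (simp add: hN_def)
 next
  case False
  have "lk u b = 0" if "u : ?Z" for u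
  proof -
   have "b \<notin> ky u" using that False by (auto simp: NN.ftd_iff)
   then show ?thesis by (simp add: not_in_keys_iff_lookup_eq_zero)
  qed
  moreover have "0 : ?Z" by simp
  ultimately have "(%u. lk u b) ` ?Z = {0}" by (auto intro!: image_eqI[of _ _ 0])
  then show ?thesis using False by (simp add: dim_zero[OF vector_space_mpol])
 qed
 ultimately show ?case using insert by simp
qed

definition euler :: "nat => int" where
 "euler j = (\<Sum>i\<le>m. sgnd i (int (svs.dim (Vd i j))))"

lemma euler_homology_dim:
 "euler j = (\<Sum>i\<le>m. sgnd i (int (svs.dim (tcyc N KC i j)) - int (svs.dim (tbnd N KC i j))))"
proof -
 have "(\<Sum>i\<le>m. sgnd i (int (svs.dim (Vd i j)))) -
  (\<Sum>i\<le>m. sgnd i (int (svs.dim (tcyc N KC i j)) - int (svs.dim (tbnd N KC i j)))) : {0}"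
 proof (rule euler_homology[OF zero_add_subgroup])
  show "int (svs.dim (Vd (Suc i) j)) - int (svs.dim {u : Vd (Suc i) j. d u = 0}) - int (svs.dim (d ` Vd (Suc i) j)) : {0}" for i
   using rank_nullity[OF vector_space_smul vector_space_smul ftd_subspace[of "kgens m (Suc i)" wt j] ftd_fdim[OF finite_kgens],
   where f = "bd_map (kbd h)"]
   by (simp add: bd_map_add bd_map_smul)
 qed (simp add: dim_zero[OF vector_space_smul])
 then show ?thesis by (simp add: euler_def)
qed

lemma euler_vanish: "(!!i. tcyc N KC i j \<subseteq> tbnd N KC i j) ==> euler j = 0"
proof -
 assume "!!i. tcyc N KC i j \<subseteq> tbnd N KC i j"
 then have "tcyc N KC i j = tbnd N KC i j" for i using boundaries_cycles by blast
 then show ?thesis unfolding euler_homology_dim by simp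
qed

text \<open>Expansion of the product of the factors \<open>1 - t ^ dg s\<close> over
  \<open>s < m\<close>, as a signed count of Koszul generators by weight.\<close>

definition koszul_fps :: "complex fps" where
 "koszul_fps = (\<Sum>i\<le>m. \<Sum>b\<in>kgens m i. fps_const (sgnd i 1) * fps_X ^ kwt dg b)"

lemma hilbert_koszul: "hilbert_series N * koszul_fps = Abs_fps (%j. of_int (euler j))"
proof (rule fps_ext)
 fix j
 have sgo: "of_int (sgnd i x) = sgnd i (of_int x :: complex)" for i x by (simp add: sgnd_def)
 have "fps_nth (hilbert_series N * (fps_const (sgnd i 1) * fps_X ^ w)) j = sgnd i (if w \<le> j then of_nat (hN (j - w)) else 0)" for i w
 proof -
  have eq: "hilbert_series N * (fps_const (sgnd i 1) * fps_X ^ w) = fps_const (sgnd i 1) * (hilbert_series N * fps_X ^ w)"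
   by (simp add: mult.left_commute)
  show ?thesis unfolding eq fps_mult_left_const_nth fps_X_power_mult_right_nth
   by (simp add: hilbert_series_def hN_def sgnd_def)
 qed
 then have "fps_nth (hilbert_series N * koszul_fps) j = (\<Sum>i\<le>m. \<Sum>b\<in>kgens m i. sgnd i (if wt b \<le> j then of_nat (hN (j - wt b)) else 0))"
  by (simp add: koszul_fps_def sum_distrib_left fps_sum_nth)
 also have "... = of_int (euler j)"
  unfolding euler_def of_int_sum sgo dim_ftd[OF finite_kgens] sgnd_sum[symmetric]
  by (intro sum.cong refl arg_cong2[of _ _ _ _ sgnd]) (auto intro!: sum.cong)
 finally show "fps_nth (hilbert_series N * koszul_fps) j = fps_nth (Abs_fps (%j. of_int (euler j))) j" by simp
qed

lemma hN_0: "hN 0 = 1"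
proof -
 have e: "{p : N. hmg 0 p} = range mconst"
  using homogeneous_0_mconst NN.N_const by auto
 have ind: "mvs.independent {1 :: ('x,'k) mpol}" by (rule mvs.independent_insertI) (simp_all add: mvs.independent_empty)
 have "mvs.dim (range mconst :: ('x,'k) mpol set) = 1"
 proof (rule mvs.dim_unique[OF _ _ ind])
  show "{1 :: ('x,'k) mpol} \<subseteq> range mconst" using mconst_simps(1)[symmetric] by auto
  show "range mconst \<subseteq> mvs.span {1 :: ('x,'k) mpol}"
  proof clarify
   fix a show "mconst a : mvs.span {1 :: ('x,'k) mpol}"
   using mvs.span_scale[OF mvs.span_base[of "1 :: ('x,'k) mpol" "{1}"], of a] by simp
  qed
 qed simp
 then show ?thesis by (simp add: hN_def e)
qed

lemma euler_0: "euler 0 = 1"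
proof -
 have "svs.dim (Vd i 0) = (if i = 0 then 1 else 0)" for i
 proof (cases "i = 0")
  case True
  then show ?thesis by (simp add: dim_ftd finite_kgens kgens_0 kwt_def hN_0)
 next
  case False
  then have nw: "\<not> wt b \<le> 0" if "b : kgens m i" for b using kwt_eq_0[OF that, of dg] dg_pos by auto
  have "svs.dim (Vd i 0) = 0" unfolding dim_ftd[OF finite_kgens] by (rule sum.neutral, rule ballI, drule nw, simp)
  then show ?thesis using False by simp
 qed
 then have "euler 0 = (\<Sum>i\<le>m. if i = 0 then 1 else 0)"
  unfolding euler_def by (intro sum.cong refl) simp
 then show ?thesis by simp
qed

text \<open>For \<open>N = A\<close> the Koszul homology is that of the resolution itself, which is
  \<open>k\<close> in degree 0.\<close>

lemma cycles_boundaries_self: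
 assumes "N = A" "0 < j" shows "tcyc N KC i j \<subseteq> tbnd N KC i j"
proof
 fix u assume u: "u : tcyc N KC i j"
 have uf: "u : ftd A (gens KC i) (gdeg KC i) j" using u assms(1) by (simp add: tor_cycles_def)
 have "u : AA.res_cycles KC i"
 proof (cases i)
  case 0
  have "lk (lk u b) 0 = 0" if "b : ky u" for b
  proof -
   have "ky u \<subseteq> {0}" using uf 0 by (simp add: AA.ftd_iff AA.ft_iff kgens_0)
   then have "b = 0" using that by auto
   moreover have "wt 0 = 0" by (simp add: kwt_def)
   moreover have "hmg (j - wt b) (lk u b)" using uf that 0 by (simp add: AA.ftd_iff)
   ultimately have "hmg j (lk u b)" by simp
   then show ?thesis using lookup_0_homogeneous assms(2) by blast
  qed
  then show ?thesis using 0 AA.ftd_ft[OF uf] unfolding AA.res_cycles_def aug_map_def by simp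
 next
  case (Suc l)
  then show ?thesis using u AA.ftd_ft[OF uf] unfolding AA.res_cycles_def tor_cycles_def by simp
 qed
 from AA.res_graded_exact[OF kos_resolution this uf]
 obtain w where "w : ftd A (gens KC (Suc i)) (gdeg KC (Suc i)) j" "u = bd_map (bd KC i) w" by blast
 then show "u : tbnd N KC i j" using assms(1) unfolding tor_boundaries_def by blast
qed

text \<open>Makes multiplication by \<open>koszul_fps\<close> the same as division by the Hilbert
  series of \<open>A\<close>, without computing the latter.\<close>

lemma hilbert_koszul_self: "N = A ==> hilbert_series N * koszul_fps = 1"
proof -
 assume NA: "N = A"
 have "euler j = (if j = 0 then 1 else 0)" for j
  using euler_0 euler_vanish[of j] cycles_boundaries_self[OF NA] by auto
 then show ?thesis unfolding hilbert_koszul by (intro fps_ext) simp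
qed

end

section \<open>Eigenspaces of permutations\<close>

definition period :: "('y => 'y) => 'y => nat" where
 "period \<sigma> Y = (LEAST e. 0 < e & (\<sigma> ^^ e) Y = Y)"

lemma period:
 assumes "inj \<sigma>" "0 < n" "(\<sigma> ^^ n) Y = Y"
 shows "0 < period \<sigma> Y" "(\<sigma> ^^ k) Y = Y \<longleftrightarrow> period \<sigma> Y dvd k"
  "inj_on (%i. (\<sigma> ^^ i) Y) {..<period \<sigma> Y}" "period \<sigma> ((\<sigma> ^^ i) Y) = period \<sigma> Y"
proof -
 let ?e = "period \<sigma> Y"
 have L: "0 < ?e & (\<sigma> ^^ ?e) Y = Y" unfolding period_def by (rule LeastI_ex) (use assms in blast)
 then show e: "0 < ?e" by simp
 have inj: "inj (\<sigma> ^^ i)" for i by (rule inj_fn[OF assms(1)])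
 have mult: "(\<sigma> ^^ (?e * q)) Y = Y" for q
 proof (induction q)
  case (Suc q)
  then show ?case using L by (simp add: funpow_add)
 qed simp
 have md: "(\<sigma> ^^ k) Y = (\<sigma> ^^ (k mod ?e)) Y" for k
 proof -
  have "\<sigma> ^^ k = \<sigma> ^^ (k mod ?e) o \<sigma> ^^ (?e * (k div ?e))" by (simp add: funpow_add[symmetric])
  then show ?thesis using mult by simp
 qed
 have least: "k = 0" if "(\<sigma> ^^ k) Y = Y" "k < ?e" for k
  using that not_less_Least[of k "%e. 0 < e & (\<sigma> ^^ e) Y = Y"] by (auto simp: period_def)
 show dv: "(\<sigma> ^^ k) Y = Y \<longleftrightarrow> ?e dvd k" for k
 proof
  assume "(\<sigma> ^^ k) Y = Y"
  then have "(\<sigma> ^^ (k mod ?e)) Y = Y" using md[of k] by (rule trans[OF sym, rotated])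
  then have "k mod ?e = 0" by (rule least) (simp add: e)
  then show "?e dvd k" by (rule mod_0_imp_dvd)
 next
  assume "?e dvd k"
  then obtain q where "k = ?e * q" by (rule dvdE)
  then show "(\<sigma> ^^ k) Y = Y" using mult[of q] by (simp only:)
 qed
 show "inj_on (%i. (\<sigma> ^^ i) Y) {..<?e}"
 proof -
  have "i = j" if "i \<le> j" "j < ?e" "(\<sigma> ^^ i) Y = (\<sigma> ^^ j) Y" for i j
  proof -
   have "\<sigma> ^^ j = \<sigma> ^^ i o \<sigma> ^^ (j - i)" using that(1) by (simp add: funpow_add[symmetric])
   then have "(\<sigma> ^^ i) ((\<sigma> ^^ (j - i)) Y) = (\<sigma> ^^ i) Y" using that(3) by simp
   then have "(\<sigma> ^^ (j - i)) Y = Y" using injD[OF inj] by blast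
   moreover have "j - i < ?e" using that(2) by simp
   ultimately have "j - i = 0" by (rule least)
   then show ?thesis using that(1) by simp
  qed
  then show ?thesis by (intro inj_onI) (metis lessThan_iff nat_le_linear)
 qed
 have "(\<sigma> ^^ k) ((\<sigma> ^^ i) Y) = (\<sigma> ^^ i) Y \<longleftrightarrow> (\<sigma> ^^ k) Y = Y" for k
 proof -
  have "(\<sigma> ^^ k) ((\<sigma> ^^ i) Y) = (\<sigma> ^^ i) ((\<sigma> ^^ k) Y)" by (metis add.commute comp_apply funpow_add)
  then show ?thesis using inj_eq[OF inj[of i]] by simp
 qed
 then show "period \<sigma> ((\<sigma> ^^ i) Y) = ?e" by (simp add: period_def)
qed

lemma vector_space_scf: "vector_space (scf :: 'k::field => ('y \<Rightarrow>\<^sub>0 'k) => _)"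
 by unfold_locales (rule poly_mapping_eqI, simp only: lookup_scf lookup_add, simp add: algebra_simps)+

lemma vector_space_field: "vector_space ((*) :: 'k::field => 'k => 'k)"
 by unfold_locales (simp_all add: algebra_simps)

lemma fdim_functions:
 assumes "finite S" shows "fdim scf {f :: 'y \<Rightarrow>\<^sub>0 'k::field. ky f \<subseteq> S}"
proof -
 interpret vector_space "scf :: 'k => ('y \<Rightarrow>\<^sub>0 'k) => _" by (rule vector_space_scf)
 let ?S = "(%Y. sg Y (1::'k)) ` S"
 have "f : span ?S" if f: "ky f \<subseteq> S" for f
 proof -
  have "sg Y (lk f Y) = scf (lk f Y) (sg Y 1)" for Y by (rule poly_mapping_eqI) (simp add: lookup_scf lookup_single when_def)
  then have e: "f = (\<Sum>Y\<in>ky f. scf (lk f Y) (sg Y 1))" using sum_monomials[of f] by simp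
  show ?thesis by (subst e) (intro span_sum span_scale span_base, use f in blast)
 qed
 then show ?thesis unfolding fdim_def using assms by (intro exI[of _ ?S]) auto
qed

text \<open>The eigenvectors for \<open>\<theta>\<close> of the operator that moves the basis vector
  \<open>Y\<close> to \<open>\<sigma> Y\<close>, written in coordinates.\<close>

definition eigf :: "('y => 'y) => 'k::field => 'y set => ('y \<Rightarrow>\<^sub>0 'k) set" where
 "eigf \<sigma> \<theta> S = {f. ky f \<subseteq> S & (ALL Y. lk f Y = \<theta> * lk f (\<sigma> Y))}"

lemma eigfI: "ky f \<subseteq> S ==> (!!Y. lk f Y = \<theta> * lk f (\<sigma> Y)) ==> f : eigf \<sigma> \<theta> S"
 unfolding eigf_def by blast

lemma eigfD: "f : eigf \<sigma> \<theta> S ==> ky f \<subseteq> S" "f : eigf \<sigma> \<theta> S ==> lk f Y = \<theta> * lk f (\<sigma> Y)"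
 unfolding eigf_def by blast+

text \<open>Each orbit of length \<open>e\<close> contributes one dimension if \<open>\<theta>\<close> has order dividing \<open>e\<close>; the sum
 distributes this contribution equally over the points of the orbit.\<close>

lemma dim_eigf:
 fixes \<theta> :: "'k::field"
 assumes \<sigma>: "inj \<sigma>" and n: "0 < n" and \<theta>: "\<theta> ~= 0"
  and S: "finite S" "\<sigma> ` S \<subseteq> S" "!!Y. Y : S ==> (\<sigma> ^^ n) Y = Y"
 shows "of_nat (vector_space.dim scf (eigf \<sigma> \<theta> S)) = (\<Sum>Y\<in>S. if \<theta> ^ period \<sigma> Y = 1 then 1 / of_nat (period \<sigma> Y) else (0::complex))"
 using S
proof (induction "card S" arbitrary: S rule: less_induct)
 case less
 interpret vector_space "scf :: 'k => ('a \<Rightarrow>\<^sub>0 'k) => _" by (rule vector_space_scf)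
 show ?case
 proof (cases "S = {}")
  case True
  have "eigf \<sigma> \<theta> {} = {0}" by (auto simp: eigf_def)
  then show ?thesis using True dim_zero[OF vector_space_scf] by simp
 next
  case False
  then obtain Y where Y: "Y : S" by blast
  let ?e = "period \<sigma> Y"
  note pd = period[OF \<sigma> n less.prems(3)[OF Y]]
  define Ob where "Ob = (%i. (\<sigma> ^^ i) Y) ` {..<?e}"
  have itS: "(\<sigma> ^^ i) Z : S" if "Z : S" for i Z using that less.prems(2) by (induction i) auto
  have per: "(\<sigma> ^^ ?e) Y = Y" using pd(2) by simp
  have itO: "(\<sigma> ^^ i) Y : Ob" for i
  proof -
   have "(\<sigma> ^^ ?e) ((\<sigma> ^^ i) Y) = (\<sigma> ^^ i) Y" by (metis add.commute comp_apply funpow_add per)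
   have "(\<sigma> ^^ (?e * q)) Y = Y" for q using pd(2) by simp
   then have "(\<sigma> ^^ (i mod ?e)) Y = (\<sigma> ^^ (i mod ?e)) ((\<sigma> ^^ (?e * (i div ?e))) Y)" by simp
   also have "... = (\<sigma> ^^ (i mod ?e + ?e * (i div ?e))) Y" by (simp only: funpow_add comp_apply)
   also have "i mod ?e + ?e * (i div ?e) = i" by simp
   finally have "(\<sigma> ^^ i) Y = (\<sigma> ^^ (i mod ?e)) Y" by simp
   then show ?thesis unfolding Ob_def using pd(1) by (intro image_eqI[of _ _ "i mod ?e"]) simp_all
  qed
  have ObS: "Ob \<subseteq> S" "finite Ob" using itS[OF Y] by (auto simp: Ob_def)
  have YO: "Y : Ob" using itO[of 0] by simp
  have \<sigma>O: "\<sigma> Z : Ob \<longleftrightarrow> Z : Ob" if "Z : S" for Z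
  proof
   assume "Z : Ob"
   then obtain i where "Z = (\<sigma> ^^ i) Y" by (auto simp: Ob_def)
   then show "\<sigma> Z : Ob" using itO[of "Suc i"] by simp
  next
   assume "\<sigma> Z : Ob"
   then obtain i where i: "\<sigma> Z = (\<sigma> ^^ i) Y" by (auto simp: Ob_def)
   have "(\<sigma> ^^ i) Y = (\<sigma> ^^ (i + n)) Y" using less.prems(3)[OF Y] by (simp add: funpow_add)
   then have "\<sigma> Z = \<sigma> ((\<sigma> ^^ (i + n - 1)) Y)" using i n by (cases "i + n") auto
   then show "Z : Ob" using injD[OF \<sigma>] itO by metis
  qed
  have sub: "subspace (eigf \<sigma> \<theta> S)"
  proof (rule subspaceI)
   show "0 : eigf \<sigma> \<theta> S" by (simp add: eigf_def)
   show "f + g : eigf \<sigma> \<theta> S" if f: "f : eigf \<sigma> \<theta> S" and g: "g : eigf \<sigma> \<theta> S" for f g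
   proof (rule eigfI)
   show "ky (f + g) \<subseteq> S" using keys_add[of f g] eigfD(1)[OF f] eigfD(1)[OF g] by blast
   show "lk (f + g) Y = \<theta> * lk (f + g) (\<sigma> Y)" for Y
   unfolding lookup_add distrib_left eigfD(2)[OF f, symmetric] eigfD(2)[OF g, symmetric] ..
   qed
   show "scf a f : eigf \<sigma> \<theta> S" if f: "f : eigf \<sigma> \<theta> S" for a f
   proof (rule eigfI)
   have "ky (scf a f) \<subseteq> ky f" by (rule subsetI) (metis in_keys_iff lookup_scf mult_zero_right)
   then show "ky (scf a f) \<subseteq> S" using eigfD(1)[OF f] by blast
   show "lk (scf a f) Y = \<theta> * lk (scf a f) (\<sigma> Y)" for Y
   unfolding lookup_scf mult.left_commute[of \<theta>] eigfD(2)[OF f, symmetric] ..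
   qed
  qed
  have fd: "fdim scf (eigf \<sigma> \<theta> S)"
   by (rule fdim_subset[OF vector_space_scf fdim_functions[OF less.prems(1)] sub]) (use eigfD(1) in blast)
  \<comment> \<open>Evaluation at \<open>Y\<close> separates the orbit of \<open>Y\<close> from the
    rest: its kernel consists of the eigenvectors supported off the orbit, and its image is the
    whole field or zero.\<close>
  have rn: "dim (eigf \<sigma> \<theta> S) = dim {f : eigf \<sigma> \<theta> S. lk f Y = 0} + vector_space.dim (*) ((%f. lk f Y) ` eigf \<sigma> \<theta> S)"
   by (rule rank_nullity[OF vector_space_scf vector_space_field sub fd]) (simp_all add: lookup_add lookup_scf)
  have iter: "lk f Z = \<theta> ^ i * lk f ((\<sigma> ^^ i) Z)" if "f : eigf \<sigma> \<theta> S" for f Z i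
  proof (induction i)
   case (Suc i)
   have "\<theta> ^ i * lk f ((\<sigma> ^^ i) Z) = \<theta> ^ i * (\<theta> * lk f (\<sigma> ((\<sigma> ^^ i) Z)))"
   unfolding eigfD(2)[OF that, symmetric] ..
   then show ?case unfolding Suc by (simp add: mult_ac)
  qed simp
  have ker: "{f : eigf \<sigma> \<theta> S. lk f Y = 0} = eigf \<sigma> \<theta> (S - Ob)"
  proof (intro equalityI subsetI)
   fix f assume "f : {f : eigf \<sigma> \<theta> S. lk f Y = 0}"
   then have f: "f : eigf \<sigma> \<theta> S" and fY: "lk f Y = 0" by simp_all
   have z: "lk f ((\<sigma> ^^ i) Y) = 0" for i
   proof -
   have "\<theta> ^ i * lk f ((\<sigma> ^^ i) Y) = 0" using iter[OF f, of Y i] fY by metis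
   then show ?thesis using \<theta> by simp
   qed
   have "lk f Z = 0" if "Z : Ob" for Z using that z unfolding Ob_def by blast
   then have "ky f \<inter> Ob = {}" by (auto simp: in_keys_iff)
   then show "f : eigf \<sigma> \<theta> (S - Ob)" using eigfD[OF f] by (intro eigfI) blast+
  next
   fix f assume f: "f : eigf \<sigma> \<theta> (S - Ob)"
   then have "Y \<notin> ky f" using YO eigfD(1)[OF f] by blast
   then have "lk f Y = 0" by (simp add: not_in_keys_iff_lookup_eq_zero)
   moreover have "f : eigf \<sigma> \<theta> S" using eigfD[OF f] by (intro eigfI) blast+
   ultimately show "f : {f : eigf \<sigma> \<theta> S. lk f Y = 0}" by simp
  qed
  have im: "vector_space.dim (*) ((%f. lk f Y) ` eigf \<sigma> \<theta> S) = (if \<theta> ^ ?e = 1 then 1 else 0)"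
  proof (cases "\<theta> ^ ?e = 1")
   case True
   define x where "x = inverse \<theta>"
   have x: "\<theta> * x = 1" "x ^ ?e = 1" using \<theta> True by (simp_all add: x_def power_inverse)
   \<comment> \<open>The eigenvector supported on the orbit of \<open>Y\<close> and normalized at
     \<open>Y\<close>; the condition that \<open>\<theta>\<close> to the power \<open>?e\<close> is
     1 makes it consistent around the cycle.\<close>
   define b where "b = (\<Sum>i<?e. sg ((\<sigma> ^^ i) Y) (x ^ i))"
   have kb: "ky b \<subseteq> S"
   proof (unfold b_def, rule subset_trans[OF keys_sum], rule UN_least)
   fix i show "ky (sg ((\<sigma> ^^ i) Y) (x ^ i)) \<subseteq> S" using itS[OF Y, of i] by auto
   qed
   have shift: "b = (\<Sum>i<?e. sg ((\<sigma> ^^ Suc i) Y) (x ^ Suc i))"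
   proof -
   have "b + sg ((\<sigma> ^^ ?e) Y) (x ^ ?e) = sg ((\<sigma> ^^ 0) Y) (x ^ 0) + (\<Sum>i<?e. sg ((\<sigma> ^^ Suc i) Y) (x ^ Suc i))"
   unfolding b_def by (rule trans[OF sum.lessThan_Suc[symmetric] sum.lessThan_Suc_shift])
   then show ?thesis using per x(2) by simp
   qed
   have bE: "lk b Z = \<theta> * lk b (\<sigma> Z)" for Z
   proof -
   have "lk b (\<sigma> Z) = (\<Sum>i<?e. x ^ Suc i when \<sigma> ((\<sigma> ^^ i) Y) = \<sigma> Z)"
   by (subst shift) (simp add: lookup_sum lookup_single)
   also have "... = (\<Sum>i<?e. x * (x ^ i when (\<sigma> ^^ i) Y = Z))"
   by (intro sum.cong refl) (simp add: when_def inj_eq[OF \<sigma>])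
   also have "... = x * lk b Z" by (simp add: b_def lookup_sum lookup_single sum_distrib_left)
   finally show ?thesis using x(1) by (simp add: mult.assoc[symmetric])
   qed
   have bY: "lk b Y = 1"
   proof -
   have "lk b Y = (\<Sum>i<?e. if i = 0 then 1 else 0)"
   unfolding b_def lookup_sum lookup_single
   proof (intro sum.cong refl)
   fix i assume "i : {..<?e}"
   then show "(x ^ i when (\<sigma> ^^ i) Y = Y) = (if i = 0 then 1 else 0)"
   using pd(2)[of i] by (auto simp: when_def dest: dvd_imp_le)
   qed
   then show ?thesis using pd(1) by simp
   qed
   have "(%f. lk f Y) ` eigf \<sigma> \<theta> S = UNIV"
   proof -
   have "a : (%f. lk f Y) ` eigf \<sigma> \<theta> S" for a
   proof -
   have "scf a b : eigf \<sigma> \<theta> S" by (rule subspace_scale[OF sub eigfI[OF kb bE]])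
   then show ?thesis by (rule rev_image_eqI) (simp add: lookup_scf bY)
   qed
   then show ?thesis by blast
   qed
   moreover have "vector_space.dim (*) (UNIV :: 'k set) = 1"
   proof -
   interpret F: vector_space "(*) :: 'k => 'k => 'k" by (rule vector_space_field)
   have ind: "F.independent {1::'k}" by (rule F.independent_insertI) (simp_all add: F.independent_empty)
   show ?thesis
   proof (rule F.dim_unique[OF _ _ ind])
   show "UNIV \<subseteq> F.span {1::'k}"
   proof
   fix a :: 'k show "a : F.span {1}" using F.span_scale[OF F.span_base[of "1::'k" "{1}"], of a] by simp
   qed
   qed simp_all
   qed
   ultimately show ?thesis using True by simp
  next
   case False
   have "lk f Y = 0" if f: "f : eigf \<sigma> \<theta> S" for f
   proof -
   have "lk f Y = \<theta> ^ ?e * lk f Y" using iter[OF f, of Y ?e] unfolding per .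
   then have "(1 - \<theta> ^ ?e) * lk f Y = 0" by (simp add: algebra_simps)
   then show ?thesis using False by simp
   qed
   moreover have "0 : eigf \<sigma> \<theta> S" by (rule subspace_0[OF sub])
   ultimately have "(%f. lk f Y) ` eigf \<sigma> \<theta> S = {0}" by (auto intro!: image_eqI[of _ _ 0])
   then show ?thesis using False dim_zero[OF vector_space_field] by simp
  qed
  have IH: "of_nat (dim (eigf \<sigma> \<theta> (S - Ob))) = (\<Sum>Y\<in>S - Ob. if \<theta> ^ period \<sigma> Y = 1 then 1 / of_nat (period \<sigma> Y) else (0::complex))"
  proof (rule less.hyps)
   show "card (S - Ob) < card S" using Y YO less.prems(1) by (intro psubset_card_mono) auto
   show "\<sigma> ` (S - Ob) \<subseteq> S - Ob" using less.prems(2) \<sigma>O by auto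
  qed (use less.prems in auto)
  \<comment> \<open>All points of the orbit have the same period, so when the orbit contributes at
    all, its \<open>?e\<close> shares of size \<open>1 / ?e\<close> add up to one dimension.\<close>
  have orb: "(\<Sum>Z\<in>Ob. if \<theta> ^ period \<sigma> Z = 1 then 1 / of_nat (period \<sigma> Z) else (0::complex)) = (if \<theta> ^ ?e = 1 then 1 else 0)"
   unfolding Ob_def sum.reindex[OF pd(3)] comp_def pd(4) using pd(1) by simp
  have "(\<Sum>Z\<in>S. if \<theta> ^ period \<sigma> Z = 1 then 1 / of_nat (period \<sigma> Z) else (0::complex))
   = (\<Sum>Z\<in>S - Ob. if \<theta> ^ period \<sigma> Z = 1 then 1 / of_nat (period \<sigma> Z) else 0) + (if \<theta> ^ ?e = 1 then 1 else 0)"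
   unfolding orb[symmetric] by (rule sum.subset_diff[OF ObS(1) less.prems(1)])
  then show ?thesis using rn unfolding ker im IH[symmetric] by simp
 qed
qed

text \<open>The exponents \<open>a\<close> that count are the multiples of \<open>n / e\<close>, so
  the sum is geometric over the powers of an \<open>e\<close>-th root of unity, and this root is 1
  exactly if \<open>e\<close> divides \<open>j\<close>.\<close>

lemma root_of_unity_sum:
 fixes \<omega> :: complex
 assumes \<omega>: "!!a. \<omega> ^ a = 1 \<longleftrightarrow> n dvd a" and n: "0 < n" and e: "e dvd n"
 shows "(\<Sum>a<n. if n dvd a * e then (\<omega> ^ j) ^ a else 0) = (if e dvd j then of_nat e else 0)"
proof -
 obtain l where l: "n = e * l" using e by blast
 have pos: "e > 0" "l > 0" using n l by auto
 have dv: "n dvd a * e \<longleftrightarrow> l dvd a" for a using pos by (simp add: l mult.commute[of a])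
 have "{a : {..<n}. l dvd a} = (%b. l * b) ` {..<e}" using pos by (auto simp: l mult.commute[of e])
 moreover have "inj_on (%b. l * b) {..<e}" using pos by (auto intro: inj_onI)
 moreover have "(\<Sum>a<n. if n dvd a * e then (\<omega> ^ j) ^ a else 0) = (\<Sum>a\<in>{a : {..<n}. l dvd a}. (\<omega> ^ j) ^ a)"
  unfolding dv by (rule sum.inter_filter[symmetric]) simp
 ultimately have s: "(\<Sum>a<n. if n dvd a * e then (\<omega> ^ j) ^ a else 0) = (\<Sum>b<e. ((\<omega> ^ j) ^ l) ^ b)"
  by (simp add: sum.reindex power_mult)
 let ?y = "(\<omega> ^ j) ^ l"
 have y1: "?y = 1 \<longleftrightarrow> e dvd j"
  using \<omega>[of "j * l"] pos by (simp add: power_mult[symmetric] l)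
 show ?thesis
 proof (cases "e dvd j")
  case True
  then show ?thesis unfolding s using y1 by simp
 next
  case False
  have "?y ^ e = 1" using \<omega>[of "j * l * e"] by (simp add: power_mult[symmetric] l mult_ac)
  moreover have "(?y - 1) * (\<Sum>b<e. ?y ^ b) = ?y ^ e - 1" by (rule power_diff_1_eq[symmetric])
  ultimately show ?thesis unfolding s using False y1 by simp
 qed
qed

section \<open>Cyclic sieving\<close>

lemma (in equivariant_point) eigenspace_exact:
 fixes f :: "(('x,'k) fvec) => 'n::ab_group_add"
 assumes q: "q : carrier Q" and v2: "vector_space sc2" and Z: "subrep Q sclm (ac wt) Z" "fdim sclm Z"
  and f: "!!x y. x : Z ==> y : Z ==> f (x + y) = f x + f y" "!!a x. x : Z ==> f (sclm a x) = sc2 a (f x)"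
   "!!x. x : Z ==> f (ac wt q x) = \<gamma>2 (f x)"
  and n: "!!x. x : Z ==> (ac wt q ^^ n) x = x"
  and z: "inj_on (%i. \<zeta> ^ i) {..<n}" "\<zeta> ^ n = 1" "0 < n"
 shows "svs.dim {x\<in>Z. ac wt q x = sclm (\<zeta> ^ a) x} =
  svs.dim {x\<in>{z\<in>Z. f z = 0}. ac wt q x = sclm (\<zeta> ^ a) x} + vector_space.dim sc2 {y\<in>f ` Z. \<gamma>2 y = sc2 (\<zeta> ^ a) y}"
proof -
 have sub: "svs.subspace Z" by (rule subrep_subspace[OF vector_space_smul Z(1)])
 have c1: "ac wt q x : Z" if "x : Z" for x by (rule subrepD(4)[OF Z(1) q that])
 have c2: "ac wt q (x + y) = ac wt q x + ac wt q y" if "x : Z" "y : Z" for x y by (rule ac_add[OF q])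
 have c3: "ac wt q (sclm b x) = sclm b (ac wt q x)" if "x : Z" for b x by (rule ac_sc[OF q])
 show ?thesis
  by (rule eigenspace_additive[where n = n and \<zeta> = \<zeta> and a = a and f = f and Z = Z], rule vector_space_smul, rule v2,
   rule sub, rule Z(2), erule (1) f(1), erule f(2), erule c1, erule (1) c2, erule c3, erule n, erule f(3),
   rule z(1), rule z(2), rule z(3), rule refl)
qed

context cyclic_setting
begin

section \<open>The generator \<open>c\<close> acting on cosets and on the complex\<close>

abbreviation "qc \<equiv> (H, c)"

lemma H_hcos: "hcos id = H" by (simp add: hcos_def)

lemma id_NG: "id : NG" using H_NG subgrpD(3)[OF H(1)] by blast

lemma c_CC: "c : CC" by (rule generate.incl) simp

lemma qc: "qc : carrier QQ"
 unfolding QQ_simps(1) using c_CC imageI[OF id_NG, of hcos] by (simp add: H_hcos)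

lemma chi_c: "cyc_char scale c \<zeta> c = \<zeta>"
 using chi_v[OF c_CC] cv scale_v by simp

lemma iact_c: "n : invs_H ==> iact qc n = scl \<zeta> n"
 using iact_coset[OF id_NG, of n c] by (simp add: H_hcos chi_c pact_id invs_kV)

definition rot :: "('v => 'v) set => ('v => 'v) set" where "rot Y = (%k. k o finv c) ` Y"

lemma lin_c: "lin c" by (rule subgrpD(1)[OF G(1) cG])

lemma rot_bij: "inj rot" "surj rot"
proof -
 have "inj (%k :: 'v => 'v. k o finv c)" by (rule injI) (rule right_cancel[OF lin_inv[OF lin_c]])
 then show "inj rot" unfolding rot_def[abs_def] by (simp add: inj_on_def inj_image_eq_iff)
 show "surj rot"
 proof (rule surjI)
  fix Y show "rot ((%k. k o c) ` Y) = Y"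
   unfolding rot_def image_image by (simp only: comp_assoc lin_inv_eq(4)[OF lin_c] comp_id image_ident)
 qed
qed

lemma rot_pow: "(rot ^^ j) Y = (%k. k o (finv c ^^ j)) ` Y"
proof (induction j)
 case (Suc j)
 have "(rot ^^ Suc j) Y = rot ((%k. k o (finv c ^^ j)) ` Y)" by (simp only: funpow.simps(2) comp_apply[of rot "rot ^^ j"] Suc)
 also have "... = (%k. (k o (finv c ^^ j)) o finv c) ` Y" by (simp only: rot_def image_image)
 also have "(%k. (k o (finv c ^^ j)) o finv c) = (%k :: 'v => 'v. k o (finv c ^^ Suc j))"
  by (rule ext) (simp only: comp_assoc funpow_Suc_right)
 finally show ?case .
qed simp

lemma pow_inv: "(f :: 'v => 'v) o g = id ==> f ^^ j o g ^^ j = id"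
proof (induction j)
 case (Suc j)
 have 1: "f ^^ Suc j = f ^^ j o f" by (rule funpow_Suc_right)
 have 2: "g ^^ Suc j = g o g ^^ j" by (rule funpow.simps(2))
 have "f ^^ Suc j o g ^^ Suc j = f ^^ j o (f o g) o g ^^ j" unfolding 1 2 by (simp only: comp_assoc)
 then show ?case by (simp only: Suc.prems comp_id Suc.IH[OF Suc.prems])
qed simp

lemma c_pow_inv: "c ^^ j o finv c ^^ j = id" "finv c ^^ j o c ^^ j = id"
 using pow_inv[OF lin_inv_eq(4)[OF lin_c]] pow_inv[OF lin_inv_eq(3)[OF lin_c]] by blast+

text \<open>The left action of \<open>c\<close> is right multiplication by its inverse; a coset
  fixed by a power of one is fixed by the same power of the other.\<close>

lemma rot_fixed: "Y #>\<^bsub>GL scale\<^esub> (c [^]\<^bsub>GL scale\<^esub> (j::nat)) = Y \<longleftrightarrow> (rot ^^ j) Y = Y"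
proof -
 have t: "Y #>\<^bsub>GL scale\<^esub> (c [^]\<^bsub>GL scale\<^esub> j) = (%k. k o c ^^ j) ` Y"
  unfolding pow_GL[OF lin_c] by (auto simp: r_coset_def GL_simps)
 have 1: "(rot ^^ j) ((%k. k o c ^^ j) ` Y) = Y"
  unfolding rot_pow image_image by (simp only: comp_assoc c_pow_inv comp_id image_ident)
 have 2: "(%k. k o c ^^ j) ` ((rot ^^ j) Y) = Y"
  unfolding rot_pow image_image by (simp only: comp_assoc c_pow_inv comp_id image_ident)
 show ?thesis unfolding t using 1 2 by metis
qed

lemma rot_RC: "rot ` RC \<subseteq> RC"
proof clarify
 fix Y assume "Y : RC"
 then obtain g where g: "g : G" "Y = hcos g" by (auto simp: RC_def)
 have "rot Y = hcos (g o finv c)" by (simp only: g(2) rot_def hcos_def image_image comp_assoc)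
 then show "rot Y : RC" unfolding RC_def using g(1) subgrpD(2,4)[OF G(1)] cG by blast
qed

lemma rot_order: "(rot ^^ nn) Y = Y"
proof -
 have "c ^^ nn = id" using c_pow_id by simp
 then have "finv c ^^ nn = id" using c_pow_inv(1)[of nn] by simp
 then show ?thesis by (simp add: rot_pow)
qed

lemma act_c:
 assumes "ky f \<subseteq> RC" shows "lk (act (coset_rep scale G H) qc f) (rot Y) = lk f Y"
proof -
 have "act (coset_rep scale G H) qc f = (\<Sum>Y\<in>ky f. sg (rot Y) (lk f Y))"
 proof -
  have "(H <#>\<^bsub>GL scale\<^esub> Y) #>\<^bsub>GL scale\<^esub> (inv\<^bsub>GL scale\<^esub> c) = rot Y" if Y: "Y : ky f" for Y
  proof -
   obtain g where g: "Y = hcos g" using assms Y by (auto simp: RC_def)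
   have "(H <#>\<^bsub>GL scale\<^esub> Y) #>\<^bsub>GL scale\<^esub> (inv\<^bsub>GL scale\<^esub> c) = hcos (g o finv c)"
   using hcos_mult[OF id_NG, of g] by (simp add: g H_hcos hcos_right inv_GL[OF lin_c])
   then show ?thesis by (simp only: g rot_def hcos_def image_image comp_assoc)
  qed
  then show ?thesis by (simp add: coset_rep_def)
 qed
 then have "lk (act (coset_rep scale G H) qc f) (rot Y) = (\<Sum>Z\<in>ky f. if Z = Y then lk f Z else 0)"
  by (simp add: lookup_sum lookup_single when_def inj_eq[OF rot_bij(1)])
 also have "... = lk f Y" unfolding sum.delta[OF finite_keys] by (simp add: in_keys_iff)
 finally show ?thesis .
qed

lemma eigenspace_cosets: "{f : {f. ky f \<subseteq> RC}. act (coset_rep scale G H) qc f = scf \<theta> f} = eigf rot \<theta> RC"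
proof (intro equalityI subsetI)
 fix f assume "f : {f : {f. ky f \<subseteq> RC}. act (coset_rep scale G H) qc f = scf \<theta> f}"
 then have f: "ky f \<subseteq> RC" "act (coset_rep scale G H) qc f = scf \<theta> f" by auto
 have "lk f Y = \<theta> * lk f (rot Y)" for Y using act_c[OF f(1), of Y] unfolding f(2) lookup_scf by simp
 then show "f : eigf rot \<theta> RC" by (rule eigfI[OF f(1)])
next
 fix f assume "f : eigf rot \<theta> RC"
 then have f: "ky f \<subseteq> RC" "!!Y. lk f Y = \<theta> * lk f (rot Y)" by (rule eigfD)+
 have "act (coset_rep scale G H) qc f = scf \<theta> f"
 proof (rule poly_mapping_eqI)
  fix Z
  obtain Y where Z: "Z = rot Y" using surjD[OF rot_bij(2)] by blast
  show "lk (act (coset_rep scale G H) qc f) Z = lk (scf \<theta> f) Z" unfolding Z act_c[OF f(1)] lookup_scf by (rule f(2))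
 qed
 then show "f : {f : {f. ky f \<subseteq> RC}. act (coset_rep scale G H) qc f = scf \<theta> f}" using f(1) by simp
qed

lemma lookup_ac_c: "u : ft invs_H B ==> lk (ac w qc u) b = mconst (\<zeta> ^ w b) * scl \<zeta> (lk u b)"
 by (simp add: lookup_ac[OF qc] chi_c iact_c[OF NN.ft_lookup])

lemma ac_pow:
 assumes "u : ft invs_H B"
 shows "(ac wt qc ^^ k) u : ft invs_H B & (ALL b. lk ((ac wt qc ^^ k) u) b = mconst ((\<zeta> ^ k) ^ wt b) * scl (\<zeta> ^ k) (lk u b))"
proof (induction k)
 case 0
 then show ?case using assms by (simp add: scl_1 mconst_simps(1))
next
 case (Suc k)
 let ?w = "(ac wt qc ^^ k) u"
 have w: "?w : ft invs_H B"
  and l: "lk ?w b = mconst ((\<zeta> ^ k) ^ wt b) * scl (\<zeta> ^ k) (lk u b)" for b using Suc by blast+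
 have s: "(ac wt qc ^^ Suc k) u = ac wt qc ?w" by (simp only: funpow.simps(2) comp_apply)
 show ?case unfolding s
 proof (intro conjI allI)
  show "ac wt qc ?w : ft invs_H B" by (rule ac_ft[OF qc w])
  fix b
  have "lk (ac wt qc ?w) b = mconst (\<zeta> ^ wt b) * scl \<zeta> (mconst ((\<zeta> ^ k) ^ wt b) * scl (\<zeta> ^ k) (lk u b))"
   by (simp only: lookup_ac_c[OF w] l)
  also have "... = mconst (\<zeta> ^ wt b) * (mconst ((\<zeta> ^ k) ^ wt b) * scl (\<zeta> * \<zeta> ^ k) (lk u b))"
   by (simp only: rhomD(3)[OF rhom_scl] scl_mconst scl_scl)
  also have "... = mconst (\<zeta> ^ wt b * (\<zeta> ^ k) ^ wt b) * scl (\<zeta> * \<zeta> ^ k) (lk u b)"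
   by (simp only: mconst_simps(3) mult.assoc)
  also have "... = mconst ((\<zeta> ^ Suc k) ^ wt b) * scl (\<zeta> ^ Suc k) (lk u b)"
   by (simp only: power_Suc power_mult_distrib)
  finally show "lk (ac wt qc ?w) b = mconst ((\<zeta> ^ Suc k) ^ wt b) * scl (\<zeta> ^ Suc k) (lk u b)" .
 qed
qed

lemma ac_order:
 assumes u: "u : ft invs_H B" shows "(ac wt qc ^^ nn) u = u"
 by (rule poly_mapping_eqI)
  (simp only: conjunct2[OF ac_pow[OF u, of nn], rule_format] zeta(2) power_one scl_1 mconst_simps(1) mult_1_left)

lemma eig_additive:
 assumes v2: "vector_space sc2" and Z: "subrep QQ sclm (ac wt) Z" "fdim sclm Z" "Z \<subseteq> ft invs_H B"
  and f: "!!x y. x : Z ==> y : Z ==> f (x + y) = f x + f y" "!!a x. x : Z ==> f (sclm a x) = sc2 a (f x)"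
   "!!x. x : Z ==> f (ac wt qc x) = \<gamma>2 (f x)"
 shows "svs.dim {x\<in>Z. ac wt qc x = sclm (\<zeta> ^ a) x} =
  svs.dim {x\<in>{z\<in>Z. f z = 0}. ac wt qc x = sclm (\<zeta> ^ a) x} + vector_space.dim sc2 {y\<in>f ` Z. \<gamma>2 y = sc2 (\<zeta> ^ a) y}"
 by (rule eigenspace_exact, rule qc, rule v2, rule Z(1), rule Z(2), erule (1) f(1), erule f(2), erule f(3),
  rule ac_order, erule subsetD[OF Z(3)], rule zeta(5), rule zeta(2), rule zeta(1))

text \<open>\<open>c\<close> scales polynomials and Koszul generators according to their degrees, so
  on total degree \<open>j\<close> it is the \<open>j\<close>-th power of \<open>\<zeta>\<close>; an
  eigenspace is everything or zero.\<close>

lemma eig_Vd: "svs.dim {x\<in>Vd i j. ac wt qc x = sclm (\<zeta> ^ a) x} = (if j mod nn = a mod nn then svs.dim (Vd i j) else 0)"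
proof -
 have e: "ac wt qc x = sclm (\<zeta> ^ j) x" if x: "x : Vd i j" for x
 proof (rule poly_mapping_eqI)
  fix b
  show "lk (ac wt qc x) b = lk (sclm (\<zeta> ^ j) x) b"
  proof (cases "b : ky x")
   case True
   then have *: "wt b \<le> j" "hmg (j - wt b) (lk x b)" using x by (simp_all add: NN.ftd_iff)
   have "mconst (\<zeta> ^ wt b) * (mconst (\<zeta> ^ (j - wt b)) * lk x b) = mconst (\<zeta> ^ wt b * \<zeta> ^ (j - wt b)) * lk x b"
   by (simp only: mconst_simps(3) mult.assoc)
   also have "\<zeta> ^ wt b * \<zeta> ^ (j - wt b) = \<zeta> ^ j" using *(1) by (simp add: power_add[symmetric])
   finally show ?thesis by (simp only: lookup_ac_c[OF NN.ftd_ft[OF x]] scl_homogeneous[OF *(2)] lookup_smul)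
  next
   case False
   then show ?thesis
   by (simp add: lookup_ac_c[OF NN.ftd_ft[OF x]] lookup_smul not_in_keys_iff_lookup_eq_zero rhomD(4)[OF rhom_scl])
  qed
 qed
 have "ac wt qc x = sclm (\<zeta> ^ a) x \<longleftrightarrow> j mod nn = a mod nn \<or> x = 0" if "x : Vd i j" for x
  unfolding e[OF that] svs.scale_cancel_right zeta(4) ..
 then have "{x\<in>Vd i j. ac wt qc x = sclm (\<zeta> ^ a) x} = (if j mod nn = a mod nn then Vd i j else {0})"
  by (auto simp: ac_0[OF qc])
 then show ?thesis by (simp add: dim_zero[OF vector_space_smul])
qed

text \<open>The filtration argument again, with the dimension of an eigenspace of \<open>c\<close>
  as additive function. Eigenspaces of the graded pieces select a residue class of degrees, and
  those of the coset module are described by \<open>eigf\<close>.\<close>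

lemma euler_mod:
 assumes D: "!!i j. D \<le> j ==> tcyc invs_H KC i j \<subseteq> tbnd invs_H KC i j"
 shows "(\<Sum>j<D. if j mod nn = a mod nn then euler j else 0) = int (vector_space.dim scf (eigf rot (\<zeta> ^ a) RC))"
proof -
 define L where "L Z = int (svs.dim {x\<in>Z. ac wt qc x = sclm (\<zeta> ^ a) x})" for Z
 have add: "L Z - L {z\<in>Z. f z = 0} - L (f ` Z) : {0}"
  if "subrep QQ sclm (ac wt) Z" "fdim sclm Z" "Z \<subseteq> ft invs_H B"
   "!!x y. f (x + y) = f x + f y" "!!a x. f (sclm a x) = sclm a (f x)" "!!x. x : Z ==> f (ac wt qc x) = ac wt qc (f x)" for Z B f
  using eig_additive[OF vector_space_smul that(1,2,3), of f "ac wt qc" a] that(4-6) by (simp add: L_def)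
 have "(\<Sum>i\<le>m. sgnd i (\<Sum>j<D. L (Vd i j))) - (L (Fl invs_H D 0) - L {u : Fl invs_H D 0. Th (lk u 0) = 0}) : {0}"
 proof (rule euler_filtration[OF zero_add_subgroup])
  have "{x\<in>{0}. ac wt qc x = sclm (\<zeta> ^ a) x} = {0}" by (auto simp: ac_0 qc)
  then show "L {0} : {0}" by (simp add: L_def dim_zero[OF vector_space_smul])
  show "L (Fl invs_H (Suc D) i) - L {u : Fl invs_H (Suc D) i. NN.tcomp wt D u = 0} - L (NN.tcomp wt D ` Fl invs_H (Suc D) i) : {0}" for D i
   by (rule add[OF Fl_subrep Fl_fdim Fl_ft]) (simp_all add: NN.tcomp_add NN.tcomp_smul ac_tcomp[OF qc])
  show "L (Fl invs_H D (Suc i)) - L {u : Fl invs_H D (Suc i). d' u = 0} - L (d' ` Fl invs_H D (Suc i)) : {0}" for i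
  proof (rule add[OF Fl_subrep Fl_fdim Fl_ft])
   show "d' (ac wt qc x) = ac wt qc (d' x)" if "x : Fl invs_H D (Suc i)" for x
   by (rule ac_d'[OF qc subsetD[OF Fl_ft that], symmetric])
  qed (simp_all only: bd_map_add bd_map_smul)
 qed (rule D)
 then have 1: "(\<Sum>i\<le>m. sgnd i (\<Sum>j<D. L (Vd i j))) = L (Fl invs_H D 0) - L {u : Fl invs_H D 0. Th (lk u 0) = 0}" by simp
 have 2: "svs.dim {x\<in>Fl invs_H D 0. ac wt qc x = sclm (\<zeta> ^ a) x} =
  svs.dim {x\<in>{z\<in>Fl invs_H D 0. Th (lk z 0) = 0}. ac wt qc x = sclm (\<zeta> ^ a) x} +
  vector_space.dim scf {y\<in>(%u. Th (lk u 0)) ` Fl invs_H D 0. act (coset_rep scale G H) qc y = scf (\<zeta> ^ a) y}"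
 proof (rule eig_additive[OF vector_space_scf Fl_subrep Fl_fdim Fl_ft])
  show "Th (lk (x + y) 0) = Th (lk x 0) + Th (lk y 0)" for x y by (simp add: lookup_add Th_add)
  show "Th (lk (sclm a x) 0) = scf a (Th (lk x 0))" for a x
   by (rule poly_mapping_eqI) (simp add: lookup_Th lookup_scf lookup_smul eva_simps)
  show "Th (lk (ac wt qc x) 0) = act (coset_rep scale G H) qc (Th (lk x 0))" if "x : Fl invs_H D 0" for x
  proof -
   have n: "lk x 0 : invs_H" using NN.ft_lookup[OF subsetD[OF Fl_ft that]] .
   have "lk (ac wt qc x) 0 = iact qc (lk x 0)" by (simp add: lookup_ac[OF qc] kwt_def mconst_simps(1))
   then show ?thesis using Th_equivariant[OF qc n] by simp
  qed
 qed
 have onto: "(%u. Th (lk u 0)) ` Fl invs_H D 0 = {f. ky f \<subseteq> RC}"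
  unfolding Th_onto[symmetric] by (rule Fl_Theta_onto) (rule D)
 have "(\<Sum>i\<le>m. sgnd i (\<Sum>j<D. L (Vd i j))) = int (vector_space.dim scf (eigf rot (\<zeta> ^ a) RC))"
  unfolding 1 unfolding L_def 2 onto eigenspace_cosets by simp
 moreover have "(\<Sum>i\<le>m. sgnd i (\<Sum>j<D. L (Vd i j))) = (\<Sum>j<D. if j mod nn = a mod nn then euler j else 0)"
 proof -
  have "(\<Sum>i\<le>m. sgnd i (\<Sum>j<D. L (Vd i j))) = (\<Sum>j<D. \<Sum>i\<le>m. sgnd i (L (Vd i j)))"
   unfolding sgnd_sum by (rule sum.swap)
  also have "... = (\<Sum>j<D. if j mod nn = a mod nn then euler j else 0)"
  proof (intro sum.cong refl)
   fix j show "(\<Sum>i\<le>m. sgnd i (L (Vd i j))) = (if j mod nn = a mod nn then euler j else 0)"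
   unfolding L_def eig_Vd by (cases "j mod nn = a mod nn") (simp_all add: euler_def)
  qed
  finally show ?thesis .
 qed
 ultimately show ?thesis by simp
qed

text \<open>The coefficients of the product are Euler characteristics, which vanish from degree
  \<open>D\<close> on. At a power of the root of unity only their sums over residue classes of
  degrees matter; these are dimensions of eigenspaces on \<open>k(X)\<close>, counted orbit by
  orbit. Exchanging sums leaves for each coset a Fourier sum that is 1 or 0 according to whether the
  coset is fixed.\<close>

lemma cyclic_sieving:
 assumes \<omega>: "!!a. \<omega> ^ a = 1 \<longleftrightarrow> nn dvd a"
 shows "\<exists>p :: int poly. hilbert_series invs_H * koszul_fps = fps_of_poly (map_poly of_int p) \<and>
  (ALL j. of_nat (card {Y : RC. Y #>\<^bsub>GL scale\<^esub> (c [^]\<^bsub>GL scale\<^esub> (j::nat)) = Y}) = poly (map_poly of_int p) ((\<omega>::complex) ^ j))"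
proof -
 obtain D where D: "!!i j. D \<le> j ==> tcyc invs_H KC i j \<subseteq> tbnd invs_H KC i j" using homology_bounded by blast
 define p :: "int poly" where "p = (\<Sum>j<D. monom (euler j) j)"
 have cp: "coeff p j = euler j" for j
 proof -
  have "coeff p j = (\<Sum>i<D. if i = j then euler i else 0)" by (simp add: p_def coeff_sum)
  then show ?thesis using euler_vanish[OF D, of j] by (cases "j < D") simp_all
 qed
 have 1: "hilbert_series invs_H * koszul_fps = fps_of_poly (map_poly of_int p)"
  unfolding hilbert_koszul by (rule fps_ext) (simp add: coeff_map_poly cp)
 have mp: "map_poly of_int p = (\<Sum>j<D. monom (of_int (euler j)) j :: complex poly)"
 proof (rule poly_eqI)
  fix i show "coeff (map_poly of_int p) i = coeff (\<Sum>j<D. monom (of_int (euler j)) j :: complex poly) i"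
  proof -
   have "coeff (\<Sum>j<D. monom (of_int (euler j)) j :: complex poly) i = (\<Sum>j<D. if j = i then of_int (euler j) else 0)"
   by (simp add: coeff_sum)
   then show ?thesis using euler_vanish[OF D, of i] by (cases "i < D") (simp_all add: coeff_map_poly cp)
  qed
 qed
 have "of_nat (card {Y : RC. Y #>\<^bsub>GL scale\<^esub> (c [^]\<^bsub>GL scale\<^esub> j) = Y}) = poly (map_poly of_int p) (\<omega> ^ j)" for j
 proof -
  let ?y = "\<omega> ^ j"
  have pd: "0 < period rot Y" "(rot ^^ k) Y = Y \<longleftrightarrow> period rot Y dvd k" for Y k
   using period[OF rot_bij(1) zeta(1) rot_order] by blast+
  have yn: "?y ^ nn = 1" using \<omega>[of "j * nn"] by (simp add: power_mult[symmetric])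
  have ymod: "?y ^ i = ?y ^ (i mod nn)" for i
  proof -
   have "?y ^ i = ?y ^ (i mod nn + nn * (i div nn))" by simp
   also have "... = ?y ^ (i mod nn)" by (simp only: power_add power_mult yn power_one mult_1_right)
   finally show ?thesis .
  qed
  have "poly (map_poly of_int p) ?y = (\<Sum>i<D. of_int (euler i) * ?y ^ i)" by (simp add: mp poly_sum poly_monom)
  also have "... = (\<Sum>i<D. \<Sum>a<nn. if a = i mod nn then of_int (euler i) * ?y ^ a else 0)"
  proof (intro sum.cong refl)
   fix i
   have "i mod nn : {..<nn}" using zeta(1) by simp
   then have "(\<Sum>a<nn. if a = i mod nn then of_int (euler i) * ?y ^ a else 0) = of_int (euler i) * ?y ^ (i mod nn)"
   unfolding sum.delta[OF finite_lessThan] by simp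
   then show "of_int (euler i) * ?y ^ i = (\<Sum>a<nn. if a = i mod nn then of_int (euler i) * ?y ^ a else 0)"
   using ymod[of i] by simp
  qed
  also have "... = (\<Sum>a<nn. \<Sum>i<D. if a = i mod nn then of_int (euler i) * ?y ^ a else 0)" by (rule sum.swap)
  also have "... = (\<Sum>a<nn. ?y ^ a * of_int (\<Sum>i<D. if i mod nn = a mod nn then euler i else 0))"
   unfolding of_int_sum sum_distrib_left by (intro sum.cong refl) auto
  also have "... = (\<Sum>a<nn. ?y ^ a * (\<Sum>Y\<in>RC. if nn dvd a * period rot Y then 1 / of_nat (period rot Y) else 0))"
  proof (intro sum.cong refl arg_cong2[of _ _ _ _ "(*)"])
   fix a
   have "of_nat (vector_space.dim scf (eigf rot (\<zeta> ^ a) RC))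
   = (\<Sum>Y\<in>RC. if (\<zeta> ^ a) ^ period rot Y = 1 then 1 / of_nat (period rot Y) else (0::complex))"
   by (rule dim_eigf[OF rot_bij(1) zeta(1) _ finite_RC rot_RC rot_order]) (simp add: z0)
   moreover have "(\<zeta> ^ a) ^ e = 1 \<longleftrightarrow> nn dvd a * e" for e by (simp only: power_mult[symmetric] zeta(3))
   moreover have "(\<Sum>i<D. if i mod nn = a mod nn then euler i else 0) = int (vector_space.dim scf (eigf rot (\<zeta> ^ a) RC))"
   by (rule euler_mod) (rule D)
   ultimately show "of_int (\<Sum>i<D. if i mod nn = a mod nn then euler i else 0)
   = (\<Sum>Y\<in>RC. if nn dvd a * period rot Y then 1 / of_nat (period rot Y) else (0::complex))"
   by (simp only: of_int_of_nat_eq)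
  qed
  also have "... = (\<Sum>Y\<in>RC. (1 / of_nat (period rot Y)) * (\<Sum>a<nn. if nn dvd a * period rot Y then ?y ^ a else 0))"
   unfolding sum_distrib_left by (subst sum.swap) (intro sum.cong refl, simp)
  also have "... = (\<Sum>Y\<in>RC. if period rot Y dvd j then 1 else 0)"
  proof (intro sum.cong refl)
   fix Y
   have dv: "period rot Y dvd nn" by (rule period(2)[OF rot_bij(1) zeta(1) rot_order, THEN iffD1, OF rot_order])
   show "(1 / of_nat (period rot Y)) * (\<Sum>a<nn. if nn dvd a * period rot Y then ?y ^ a else 0) = (if period rot Y dvd j then 1 else 0)"
   unfolding root_of_unity_sum[OF \<omega> zeta(1) dv] using pd(1)[of Y] by simp
  qed
  also have "... = of_nat (card {Y : RC. period rot Y dvd j})"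
   unfolding sum.inter_filter[OF finite_RC, symmetric] by simp
  also have "{Y : RC. period rot Y dvd j} = {Y : RC. Y #>\<^bsub>GL scale\<^esub> (c [^]\<^bsub>GL scale\<^esub> j) = Y}"
   unfolding rot_fixed using pd(2) by simp
  finally show ?thesis by simp
 qed
 with 1 show ?thesis by blast
qed

end

lemma hilbert_series_quotient:
 assumes "hilbert_series N * K = p" "hilbert_series A * K = 1"
 shows "hilbert_series N / hilbert_series A = p"
proof -
 have A: "hilbert_series A ~= 0" using assms(2) by auto
 have "hilbert_series N = hilbert_series N * (hilbert_series A * K)" unfolding assms(2) by simp
 also have "... = p * hilbert_series A" unfolding assms(1)[symmetric] by (simp only: mult_ac)
 finally show ?thesis using A by simp
qed

theorem corollary1p2p2:
 fixes scale :: "'k::field \<Rightarrow> 'v::ab_group_add \<Rightarrow> 'v"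
  and basis :: "'v set"
  and G H :: "('v \<Rightarrow> 'v) set"
  and c :: "'v \<Rightarrow> 'v" and v :: 'v
  and \<zeta> :: 'k and \<zeta>h :: complex
 assumes "finite_dimensional_vector_space scale basis"
  and "subgroup G (GL scale)" and "finite G"
  and "subgroup H (GL scale)" and "H \<subseteq> G"
  and "polynomial_algebra (pol_invariants scale basis G)"
  and "c \<in> G"
  and "regular_vector G v" and "v \<noteq> 0" and "c v = scale \<zeta> v" and "\<zeta> \<noteq> 0"
  and "complex_lift \<zeta> \<zeta>h"
 shows
  "(\<exists>P. graded_free_resolution (pol_invariants scale basis G) P) \<and>
  (\<forall>P. graded_free_resolution (pol_invariants scale basis G) P \<longrightarrow>
   (let Q = Gamma_C scale G H c;
      R = grothendieck_group Q;
      T = Tor_inv scale basis H c \<zeta> P;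
      S = {(i, j). carrier (T i j) \<noteq> {\<zero>\<^bsub>T i j\<^esub>}}
    in (\<forall>i j. fin_dim_rep Q (T i j)) \<and> finite S \<and>
     finprod R (\<lambda>(i, j). rep_class Q (T i j) [^]\<^bsub>R\<^esub> ((-1) ^ i :: int)) S =
     rep_class Q (coset_rep scale G H :: (_, 'k, _) rep))) \<and>
  (\<exists>p :: int poly.
    hilbert_series (pol_invariants scale basis H) / hilbert_series (pol_invariants scale basis G) =
     fps_of_poly (map_poly of_int p) \<and>
    (\<forall>j::nat.
     mult_order (\<zeta>h ^ j) = group.ord (GL scale) (c [^]\<^bsub>GL scale\<^esub> j) \<and>
     of_nat (card {Y \<in> right_cosets scale G H.
      Y #>\<^bsub>GL scale\<^esub> (c [^]\<^bsub>GL scale\<^esub> j) = Y}) =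
     poly (map_poly of_int p) (\<zeta>h ^ j)))"
proof -
 interpret L: linear_action scale basis by (rule linear_action.intro) (rule assms(1))
 have G: "L.subgrp G" and H: "L.subgrp H" using L.subgrp_subgroup assms(2,4) by auto
 have reg: "g = id" if "g \<in> G" "g v = v" for g
  using assms(8) that unfolding regular_vector_def by blast
 interpret AG: graded_ring "L.invs G" by (rule L.invs_graded_ring)
 obtain m h dg where gen: "\<And>s. s < m \<Longrightarrow> h s \<in> L.invs G" "\<And>s. s < m \<Longrightarrow> homogeneous (dg s) (h s)"
  "\<And>s. s < m \<Longrightarrow> 0 < dg s" "bij_betw (msubst h) (mpol_ring {..<m :: nat}) (L.invs G)"
  using homogeneous_generators[OF AG.N_sub AG.N_const AG.N_hcomp assms(6)[folded L.invs_def]] by metis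
 have sub: "graded_subalgebra basis (L.invs G) m h dg (card G)"
 proof (rule graded_subalgebra.intro)
  show "finite basis" by (rule L.V.finite_Basis)
  show "L.invs G \<subseteq> mpol_ring basis" by (auto simp: L.invs_iff)
  show "\<exists>a. (\<forall>l<card G. a l \<in> L.invs G) \<and> mvar x ^ card G = (\<Sum>l<card G. a l * mvar x ^ l)" if "x \<in> basis" for x
   using L.integral_equation[OF G assms(3) mpol_ring_mvar[OF that]] by blast
 qed (rule AG.N_sub AG.N_const AG.N_hcomp gen; assumption)+
 have rs: "regular_setting scale basis G m h dg U v" if "L.subgrp U" "U \<subseteq> G" for U
  by (intro regular_setting.intro regular_setting_axioms.intro L.linear_action_axioms sub G assms(3) that reg)
 \<comment> \<open>The case \<open>H = G\<close> of the same construction, which supplies the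
   Hilbert series of \<open>k[V]^G\<close>. Both interpretations share \<open>koszul_fps\<close>,
   which depends on \<open>m\<close> and \<open>dg\<close> only.\<close>
 interpret CG: regular_setting scale basis G m h dg G v by (rule rs[OF G order_refl])
 interpret CH: cyclic_setting scale basis G m h dg H v c \<zeta>
  by (intro cyclic_setting.intro cyclic_setting_axioms.intro rs H assms(5,7,9,10,11))
 have lift: "\<exists>e>0. \<zeta>h ^ e = 1" "mult_order \<zeta>h = CH.nn" using assms(12) by (auto simp: complex_lift_def)
 have \<omega>: "\<zeta>h ^ a = 1 \<longleftrightarrow> CH.nn dvd a" for a using mult_order_props(3)[OF lift(1)] lift(2) by simp
 \<comment> \<open>Powers of \<open>c\<close> and of the lift become trivial at the same exponents;
   uniqueness of the order then settles all \<open>j\<close> at once.\<close>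
 have ord: "mult_order (\<zeta>h ^ j) = group.ord (GL scale) (c [^]\<^bsub>GL scale\<^esub> j)" for j
 proof -
  have cG: "c \<in> carrier (GL scale)" using CH.lin_c by (simp add: L.GL_simps)
  have ex: "\<exists>e>0. (\<zeta>h ^ j) ^ e = 1"
   using \<omega>[of "j * CH.nn"] CH.zeta(1) by (intro exI[of _ CH.nn]) (simp add: power_mult)
  have "(c [^]\<^bsub>GL scale\<^esub> j) [^]\<^bsub>GL scale\<^esub> k = \<one>\<^bsub>GL scale\<^esub> \<longleftrightarrow> mult_order (\<zeta>h ^ j) dvd k" for k :: nat
  proof -
   have "(c [^]\<^bsub>GL scale\<^esub> j) [^]\<^bsub>GL scale\<^esub> k = c ^^ (j * k)"
    using monoid.nat_pow_pow[OF group.is_monoid[OF L.group_GL] cG, of j k] L.pow_GL[OF CH.lin_c] by simp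
   then show ?thesis unfolding mult_order_props(3)[OF ex, symmetric] power_mult[symmetric] \<omega>
    using CH.c_pow_id[of "j * k"] by (simp add: L.GL_simps)
  qed
  then have "group.ord (GL scale) (c [^]\<^bsub>GL scale\<^esub> j) = mult_order (\<zeta>h ^ j)"
   unfolding group.ord_unique[OF L.group_GL monoid.nat_pow_closed[OF group.is_monoid[OF L.group_GL] cG]] by blast
  then show ?thesis by simp
 qed
 obtain p where p: "hilbert_series (L.invs H) * CH.koszul_fps = fps_of_poly (map_poly of_int p)"
  "\<And>j. of_nat (card {Y \<in> CH.RC. Y #>\<^bsub>GL scale\<^esub> (c [^]\<^bsub>GL scale\<^esub> (j::nat)) = Y}) = poly (map_poly of_int p) (\<zeta>h ^ j)"
  using CH.cyclic_sieving[OF \<omega>] by blast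
 have quot: "hilbert_series (L.invs H) / hilbert_series (L.invs G) = fps_of_poly (map_poly of_int p)"
  by (rule hilbert_series_quotient[OF p(1) CG.hilbert_koszul_self[OF refl]])
 have T: "Tor_inv scale basis H c \<zeta> P i j = tor_rep CH.chi CH.iact (L.invs H) P i j" for P i j
  by (simp add: Tor_inv_def L.invs_def)
 show ?thesis unfolding L.invs_def[symmetric] Let_def T CH.RC_eq
 proof (intro conjI allI impI)
  show "\<exists>P. graded_free_resolution (L.invs G) P" using CG.kos_resolution by blast
 next
  fix P :: "('v, 'k) free_complex" assume P: "graded_free_resolution (L.invs G) P"
  show "fin_dim_rep CH.QQ (tor_rep CH.chi CH.iact (L.invs H) P i j)" for i j
   by (rule CH.grothendieck_identity(1)[OF P])
  show "finite {(i, j). carrier (tor_rep CH.chi CH.iact (L.invs H) P i j) \<noteq> {\<zero>\<^bsub>tor_rep CH.chi CH.iact (L.invs H) P i j\<^esub>}}"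
   by (rule CH.grothendieck_identity(2)[OF P])
  show "finprod (grothendieck_group CH.QQ) (\<lambda>(i, j). rep_class CH.QQ (tor_rep CH.chi CH.iact (L.invs H) P i j) [^]\<^bsub>grothendieck_group CH.QQ\<^esub> ((-1) ^ i :: int))
    {(i, j). carrier (tor_rep CH.chi CH.iact (L.invs H) P i j) \<noteq> {\<zero>\<^bsub>tor_rep CH.chi CH.iact (L.invs H) P i j\<^esub>}}
   = rep_class CH.QQ (coset_rep scale G H :: (_, 'k, _) rep)"
   by (rule CH.grothendieck_identity(3)[OF P])
 next
  show "\<exists>p :: int poly. hilbert_series (L.invs H) / hilbert_series (L.invs G) = fps_of_poly (map_poly of_int p) \<and>
    (\<forall>j::nat. mult_order (\<zeta>h ^ j) = group.ord (GL scale) (c [^]\<^bsub>GL scale\<^esub> j) \<and>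
     of_nat (card {Y \<in> CH.RC. Y #>\<^bsub>GL scale\<^esub> (c [^]\<^bsub>GL scale\<^esub> j) = Y}) = poly (map_poly of_int p) (\<zeta>h ^ j))"
   using quot ord p(2) by blast
 qed
qed

end
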